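(* Let $A$ and $B$ be separable simple unital $C^*$-algebras and assume that there exists a tracially sequentially-split $*$-homomorphism $\phi:A\to B$. Let $\mathcal{C}$ be a class of unital separable semiprojective or weakly semiprojective $C^*$-algebras such that: every quotient of an algebra in $\mathcal{C}$ is locally approximated unitarily by $C^*$-algebras in $\mathcal{C}$; if $D\in\mathcal{C}$ then $M_n(D)\in\mathcal{C}$ for all $n$; and if $D\in\mathcal{C}$ then every hereditary $C^*$-subalgebra of $D$ is in $\mathcal{C}$. Assume moreover that $\mathcal{C}$ satisfies the strict comparison property (i.e. every algebra in $\mathcal{C}$ has strict comparison). If $B$ belongs to $\mathrm{TA}\,\mathcal{C}$, then so does $A$.
   Context: For a $C^*$-algebra $A$, let $A^+$ be its cone of positive elements (including $0$), $c_0(\mathbb{N},A)=\{(a_n)_n: \lim_n\|a_n\|=0\}$, $l^\infty(\mathbb{N},A)=\{(a_n)_n: (\|a_n\|)_n \text{ bounded}\}$, and $A_\infty=l^\infty(\mathbb{N},A)/c_0(\mathbb{N},A)$. $A$ is embedded in $A_\infty$ as constant sequences, and $A_\infty\cap A'$ is the central sequence algebra. Let $A_\infty^{++}$ be the set of $x\in A_\infty^+$, $x=[(x_n)_n]$, for which there is no strictly increasing sequence $(k_n)$ of natural numbers with $\lim_n x_{k_n}=0$. Definition. Let $A,B$ be separable $C^*$-algebras with $A$ unital. A $*$-homomorphism $\phi:A\to B$ is tracially sequentially-split if for every nonzero $z\in A_\infty^{++}$ there exist a $*$-homomorphism $\psi:B\to A_\infty$ and a nonzero projection $g\in A_\infty\cap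 A'$ such that (1) $\psi(\phi(a))=ag$ for each $a\in A$, and (2) $1_{A_\infty}-g$ is Murray-von Neumann equivalent in $A_\infty$ to a projection in the hereditary $C^*$-subalgebra $\overline{zA_\infty z}$. Definition. A simple unital $C^*$-algebra $A$ belongs to $\mathrm{TA}\,\mathcal{C}$ if for every finite set $\mathcal{F}\subset A$, every $\epsilon>0$ and every nonzero $a\in A^+$ there exist a projection $p\in A$ and a $C^*$-subalgebra $C\subset A$ in $\mathcal{C}$ with $1_C=p$ such that for all $x\in\mathcal{F}$: (1) $\|px-xp\|\le\epsilon$; (2) $\mathrm{dist}(pxp,C)\le\epsilon$; (3) $1-p$ is Murray-von Neumann equivalent to a projection in $\overline{aAa}$. A unital $C^*$-algebra $D$ is locally approximated unitarily by $C^*$-algebras in $\mathcal{C}$ if for every finite $\mathcal{F}\subset D$ and $\epsilon>0$ there is a $C^*$-subalgebra $C\subset D$ in $\mathcal{C}$ with $1_C=1_D$ and $\mathrm{dist}(x,C)\le\epsilon$ for all $x\in\mathcal{F}$. A $C^*$-algebra $D$ is weakly semiprojective if every $*$-homomorphism $D\to \prod_n E_n/\bigoplus_n E_n$ (for any sequence of $C^*$-algebras $E_n$, with $\bigoplus$ denoting the $c_0$-sum) lifts to a $*$-homomorphism $D\to\prod_n E_n$. Strict comparison: for a unital $C^*$-algebra $A$, let $T(A)$ be the set of tracial states, $M_\infty(A)=\bigcup_n M_n(A)$ (embeddings $a\mapsto a\oplus 0$), and for $\tau\in T(A)$ (extended to matrices) and $a\in M_\infty(A)_+$ set $d_\tau(a)=\lim_n\tau(a^{1/n})$.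 For positive $a,b$, write $a\lesssim b$ (Cuntz subequivalence) if there are sequences $(r_n),(s_n)$ with $r_nbs_n\to a$ in norm. $A$ has strict comparison if $a\lesssim b$ whenever $d_\tau(a)<d_\tau(b)$ for every $\tau\in T(A)$ (the paper introduces this definition for unital nuclear $A$). *)

theory Defs
  imports "HOL-Analysis.Analysis"
begin

text \<open>
  There is no field for a unit, since hereditary subalgebras, ideals and the algebras in lifting
  problems need not be unital.
\<close>

record 'a calg =
  carrier :: "'a set"
  zero :: 'a ("\<zero>\<index>")
  add :: "'a \<Rightarrow> 'a \<Rightarrow> 'a" (infixl "\<oplus>\<index>" 65)
  scale :: "complex \<Rightarrow> 'a \<Rightarrow> 'a" (infixr "\<odot>\<index>" 75)
  mult :: "'a \<Rightarrow> 'a \<Rightarrow> 'a" (infixl "\<otimes>\<index>" 70)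
  adj :: "'a \<Rightarrow> 'a"
  nrm :: "'a \<Rightarrow> real"

definition diff :: "'a calg \<Rightarrow> 'a \<Rightarrow> 'a \<Rightarrow> 'a" (infixl "\<ominus>\<index>" 65) where
  "x \<ominus>\<^bsub>A\<^esub> y = x \<oplus>\<^bsub>A\<^esub> ((- 1) \<odot>\<^bsub>A\<^esub> y)"

text \<open>
  The value off the carrier is irrelevant, but \<^locale>\<open>Metric_space\<close> asks for nonnegativity and
  symmetry on the whole type.
\<close>

definition cdist :: "'a calg \<Rightarrow> 'a \<Rightarrow> 'a \<Rightarrow> real" where
  "cdist A x y = (if x \<in> carrier A \<and> y \<in> carrier A then nrm A (x \<ominus>\<^bsub>A\<^esub> y) else 0)"

definition norm_topology :: "'a calg \<Rightarrow> 'a topology" where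
  "norm_topology A = Metric_space.mtopology (carrier A) (cdist A)"

locale cstar_algebra =
  fixes A :: "'a calg" (structure)
  assumes zero_closed: "\<zero> \<in> carrier A"
    and add_closed: "\<lbrakk>x \<in> carrier A; y \<in> carrier A\<rbrakk> \<Longrightarrow> x \<oplus> y \<in> carrier A"
    and scale_closed: "x \<in> carrier A \<Longrightarrow> c \<odot> x \<in> carrier A"
    and mult_closed: "\<lbrakk>x \<in> carrier A; y \<in> carrier A\<rbrakk> \<Longrightarrow> x \<otimes> y \<in> carrier A"
    and adj_closed: "x \<in> carrier A \<Longrightarrow> adj A x \<in> carrier A"
    and add_assoc: "\<lbrakk>x \<in> carrier A; y \<in> carrier A; z \<in> carrier A\<rbrakk>
      \<Longrightarrow> (x \<oplus> y) \<oplus> z = x \<oplus> (y \<oplus> z)"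
    and add_commute: "\<lbrakk>x \<in> carrier A; y \<in> carrier A\<rbrakk> \<Longrightarrow> x \<oplus> y = y \<oplus> x"
    and add_zero: "x \<in> carrier A \<Longrightarrow> x \<oplus> \<zero> = x"
    and add_minus: "x \<in> carrier A \<Longrightarrow> x \<oplus> ((- 1) \<odot> x) = \<zero>"
    and scale_one: "x \<in> carrier A \<Longrightarrow> 1 \<odot> x = x"
    and scale_scale: "x \<in> carrier A \<Longrightarrow> c \<odot> (d \<odot> x) = (c * d) \<odot> x"
    and scale_add_left: "x \<in> carrier A \<Longrightarrow> (c + d) \<odot> x = (c \<odot> x) \<oplus> (d \<odot> x)"
    and scale_add_right: "\<lbrakk>x \<in> carrier A; y \<in> carrier A\<rbrakk>
      \<Longrightarrow> c \<odot> (x \<oplus> y) = (c \<odot> x) \<oplus> (c \<odot> y)"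
    and mult_assoc: "\<lbrakk>x \<in> carrier A; y \<in> carrier A; z \<in> carrier A\<rbrakk>
      \<Longrightarrow> (x \<otimes> y) \<otimes> z = x \<otimes> (y \<otimes> z)"
    and mult_add_left: "\<lbrakk>x \<in> carrier A; y \<in> carrier A; z \<in> carrier A\<rbrakk>
      \<Longrightarrow> (x \<oplus> y) \<otimes> z = (x \<otimes> z) \<oplus> (y \<otimes> z)"
    and mult_add_right: "\<lbrakk>x \<in> carrier A; y \<in> carrier A; z \<in> carrier A\<rbrakk>
      \<Longrightarrow> x \<otimes> (y \<oplus> z) = (x \<otimes> y) \<oplus> (x \<otimes> z)"
    and mult_scale_left: "\<lbrakk>x \<in> carrier A; y \<in> carrier A\<rbrakk> \<Longrightarrow> (c \<odot> x) \<otimes> y = c \<odot> (x \<otimes> y)"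
    and mult_scale_right: "\<lbrakk>x \<in> carrier A; y \<in> carrier A\<rbrakk> \<Longrightarrow> x \<otimes> (c \<odot> y) = c \<odot> (x \<otimes> y)"
    and adj_adj: "x \<in> carrier A \<Longrightarrow> adj A (adj A x) = x"
    and adj_add: "\<lbrakk>x \<in> carrier A; y \<in> carrier A\<rbrakk> \<Longrightarrow> adj A (x \<oplus> y) = adj A x \<oplus> adj A y"
    and adj_scale: "x \<in> carrier A \<Longrightarrow> adj A (c \<odot> x) = cnj c \<odot> adj A x"
    and adj_mult: "\<lbrakk>x \<in> carrier A; y \<in> carrier A\<rbrakk> \<Longrightarrow> adj A (x \<otimes> y) = adj A y \<otimes> adj A x"
    and nrm_nonneg: "x \<in> carrier A \<Longrightarrow> 0 \<le> nrm A x"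
    and nrm_eq_zero: "x \<in> carrier A \<Longrightarrow> nrm A x = 0 \<longleftrightarrow> x = \<zero>"
    and nrm_triangle: "\<lbrakk>x \<in> carrier A; y \<in> carrier A\<rbrakk> \<Longrightarrow> nrm A (x \<oplus> y) \<le> nrm A x + nrm A y"
    and nrm_scale: "x \<in> carrier A \<Longrightarrow> nrm A (c \<odot> x) = cmod c * nrm A x"
    and nrm_mult: "\<lbrakk>x \<in> carrier A; y \<in> carrier A\<rbrakk> \<Longrightarrow> nrm A (x \<otimes> y) \<le> nrm A x * nrm A y"
    and nrm_cstar: "x \<in> carrier A \<Longrightarrow> nrm A (adj A x \<otimes> x) = (nrm A x)\<^sup>2"
    and complete: "Metric_space.mcomplete (carrier A) (cdist A)"

lemma (in cstar_algebra) Metric_space_cdist: "Metric_space (carrier A) (cdist A)"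
proof
  have neg: "(-1) \<odot> x \<in> carrier A" if "x \<in> carrier A" for x
    using that scale_closed by simp
  have diff: "x \<ominus> y \<in> carrier A" if "x \<in> carrier A" "y \<in> carrier A" for x y
    using that by (simp add: diff_def add_closed neg)
  have zero_add: "\<zero> \<oplus> x = x" if "x \<in> carrier A" for x
    using that add_commute add_zero zero_closed by metis
  have minus_add: "((-1) \<odot> y) \<oplus> y = \<zero>" if "y \<in> carrier A" for y
    using that add_commute add_minus neg by metis
  have flip: "y \<ominus> x = (-1) \<odot> (x \<ominus> y)" if "x \<in> carrier A" "y \<in> carrier A" for x y
    using that by (simp add: diff_def scale_add_right neg scale_scale scale_one add_commute)
  show "0 \<le> cdist A x y" for x y
    by (simp add: cdist_def nrm_nonneg diff)
  show "cdist A x y = cdist A y x" for x y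
    using nrm_scale[of "x \<ominus> y" "-1"] flip[of x y] diff[of x y] by (auto simp: cdist_def)
  show "cdist A x y = 0 \<longleftrightarrow> x = y" if "x \<in> carrier A" "y \<in> carrier A" for x y
  proof -
    have "x = y" if "x \<ominus> y = \<zero>"
    proof -
      have "(x \<ominus> y) \<oplus> y = x \<oplus> (((-1) \<odot> y) \<oplus> y)"
        using \<open>x \<in> carrier A\<close> \<open>y \<in> carrier A\<close> by (simp add: diff_def add_assoc neg)
      then show ?thesis
        using \<open>x \<in> carrier A\<close> \<open>y \<in> carrier A\<close> that by (simp add: minus_add zero_add add_zero)
    qed
    moreover have "x \<ominus> x = \<zero>"
      using that by (simp add: diff_def add_minus)
    ultimately show ?thesis
      using that nrm_eq_zero[OF diff[of x y]] by (auto simp: cdist_def)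
  qed
  show "cdist A x z \<le> cdist A x y + cdist A y z"
    if "x \<in> carrier A" "y \<in> carrier A" "z \<in> carrier A" for x y z
  proof -
    have "(x \<ominus> y) \<oplus> (y \<ominus> z) = x \<oplus> ((((-1) \<odot> y) \<oplus> y) \<oplus> ((-1) \<odot> z))"
      using that by (simp add: diff_def add_assoc neg add_closed)
    also have "\<dots> = x \<ominus> z"
      using that by (simp add: diff_def minus_add zero_add neg)
    finally show ?thesis
      using that nrm_triangle[OF diff[of x y] diff[of y z]] by (simp add: cdist_def)
  qed
qed

definition separable :: "'a calg \<Rightarrow> bool" where
  "separable A \<longleftrightarrow> separable_space (norm_topology A)"

definition is_unit :: "'a calg \<Rightarrow> 'a \<Rightarrow> bool" where
  "is_unit A e \<longleftrightarrow> e \<in> carrier A \<and> (\<forall>x\<in>carrier A. e \<otimes>\<^bsub>A\<^esub> x = x \<and> x \<otimes>\<^bsub>A\<^esub> e = x)"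

definition unital :: "'a calg \<Rightarrow> bool" where
  "unital A \<longleftrightarrow> (\<exists>e. is_unit A e)"

definition one :: "'a calg \<Rightarrow> 'a" ("\<one>\<index>") where
  "\<one>\<^bsub>A\<^esub> = (THE e. is_unit A e)"

definition positives :: "'a calg \<Rightarrow> 'a set" where
  "positives A = {adj A x \<otimes>\<^bsub>A\<^esub> x | x. x \<in> carrier A}"

definition projections :: "'a calg \<Rightarrow> 'a set" where
  "projections A = {p \<in> carrier A. p \<otimes>\<^bsub>A\<^esub> p = p \<and> adj A p = p}"

definition mvn_equiv :: "'a calg \<Rightarrow> 'a \<Rightarrow> 'a \<Rightarrow> bool" where
  "mvn_equiv A p q \<longleftrightarrow> (\<exists>v\<in>carrier A. adj A v \<otimes>\<^bsub>A\<^esub> v = p \<and> v \<otimes>\<^bsub>A\<^esub> adj A v = q)"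

definition cstar_hom :: "'a calg \<Rightarrow> 'b calg \<Rightarrow> ('a \<Rightarrow> 'b) \<Rightarrow> bool" where
  "cstar_hom A B f \<longleftrightarrow>
     f \<in> carrier A \<rightarrow> carrier B \<and>
     (\<forall>x\<in>carrier A. \<forall>y\<in>carrier A. f (x \<oplus>\<^bsub>A\<^esub> y) = f x \<oplus>\<^bsub>B\<^esub> f y) \<and>
     (\<forall>c. \<forall>x\<in>carrier A. f (c \<odot>\<^bsub>A\<^esub> x) = c \<odot>\<^bsub>B\<^esub> f x) \<and>
     (\<forall>x\<in>carrier A. \<forall>y\<in>carrier A. f (x \<otimes>\<^bsub>A\<^esub> y) = f x \<otimes>\<^bsub>B\<^esub> f y) \<and>
     (\<forall>x\<in>carrier A. f (adj A x) = adj B (f x))"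

definition cstar_iso :: "'a calg \<Rightarrow> 'b calg \<Rightarrow> bool" where
  "cstar_iso A B \<longleftrightarrow> (\<exists>f. cstar_hom A B f \<and> bij_betw f (carrier A) (carrier B))"

definition restrict_to :: "'a calg \<Rightarrow> 'a set \<Rightarrow> 'a calg" where
  "restrict_to A S = A\<lparr>carrier := S\<rparr>"

definition cstar_subalgebra :: "'a set \<Rightarrow> 'a calg \<Rightarrow> bool" where
  "cstar_subalgebra S A \<longleftrightarrow>
     closedin (norm_topology A) S \<and> \<zero>\<^bsub>A\<^esub> \<in> S \<and>
     (\<forall>x\<in>S. \<forall>y\<in>S. x \<oplus>\<^bsub>A\<^esub> y \<in> S \<and> x \<otimes>\<^bsub>A\<^esub> y \<in> S) \<and>
     (\<forall>x\<in>S. adj A x \<in> S \<and> (\<forall>c. c \<odot>\<^bsub>A\<^esub> x \<in> S))"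

definition hereditary :: "'a set \<Rightarrow> 'a calg \<Rightarrow> bool" where
  "hereditary H A \<longleftrightarrow>
     cstar_subalgebra H A \<and>
     (\<forall>a\<in>positives A. \<forall>b\<in>positives A \<inter> H. b \<ominus>\<^bsub>A\<^esub> a \<in> positives A \<longrightarrow> a \<in> H)"

definition hereditary_gen :: "'a calg \<Rightarrow> 'a \<Rightarrow> 'a set" where
  "hereditary_gen A z =
     norm_topology A closure_of {z \<otimes>\<^bsub>A\<^esub> x \<otimes>\<^bsub>A\<^esub> z | x. x \<in> carrier A}"

definition closed_ideal :: "'a set \<Rightarrow> 'a calg \<Rightarrow> bool" where
  "closed_ideal J A \<longleftrightarrow>
     closedin (norm_topology A) J \<and> \<zero>\<^bsub>A\<^esub> \<in> J \<and>
     (\<forall>x\<in>J. \<forall>y\<in>J. x \<oplus>\<^bsub>A\<^esub> y \<in> J) \<and>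
     (\<forall>x\<in>J. \<forall>c. c \<odot>\<^bsub>A\<^esub> x \<in> J) \<and>
     (\<forall>x\<in>J. \<forall>a\<in>carrier A. a \<otimes>\<^bsub>A\<^esub> x \<in> J \<and> x \<otimes>\<^bsub>A\<^esub> a \<in> J)"

definition simple :: "'a calg \<Rightarrow> bool" where
  "simple A \<longleftrightarrow>
     carrier A \<noteq> {\<zero>\<^bsub>A\<^esub>} \<and> (\<forall>J. closed_ideal J A \<longrightarrow> J = {\<zero>\<^bsub>A\<^esub>} \<or> J = carrier A)"

definition coset :: "'a calg \<Rightarrow> 'a set \<Rightarrow> 'a \<Rightarrow> 'a set" where
  "coset A J x = {x \<oplus>\<^bsub>A\<^esub> j | j. j \<in> J}"

definition quot_algebra :: "'a calg \<Rightarrow> 'a set \<Rightarrow> 'a set calg" where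
  "quot_algebra A J =
     \<lparr>carrier = coset A J ` carrier A,
      zero = J,
      add = \<lambda>X Y. \<Union>x\<in>X. \<Union>y\<in>Y. coset A J (x \<oplus>\<^bsub>A\<^esub> y),
      scale = \<lambda>c X. \<Union>x\<in>X. coset A J (c \<odot>\<^bsub>A\<^esub> x),
      mult = \<lambda>X Y. \<Union>x\<in>X. \<Union>y\<in>Y. coset A J (x \<otimes>\<^bsub>A\<^esub> y),
      adj = \<lambda>X. \<Union>x\<in>X. coset A J (adj A x),
      nrm = \<lambda>X. INF x\<in>X. nrm A x\<rparr>"

definition dist_to :: "'a calg \<Rightarrow> 'a \<Rightarrow> 'a set \<Rightarrow> real" where
  "dist_to A x S = (INF s\<in>S. nrm A (x \<ominus>\<^bsub>A\<^esub> s))"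

definition bounded_product :: "(nat \<Rightarrow> 'a calg) \<Rightarrow> (nat \<Rightarrow> 'a) calg" where
  "bounded_product E =
     \<lparr>carrier = {x. (\<forall>n. x n \<in> carrier (E n)) \<and> bdd_above (range (\<lambda>n. nrm (E n) (x n)))},
      zero = \<lambda>n. \<zero>\<^bsub>E n\<^esub>,
      add = \<lambda>x y n. x n \<oplus>\<^bsub>E n\<^esub> y n,
      scale = \<lambda>c x n. c \<odot>\<^bsub>E n\<^esub> x n,
      mult = \<lambda>x y n. x n \<otimes>\<^bsub>E n\<^esub> y n,
      adj = \<lambda>x n. adj (E n) (x n),
      nrm = \<lambda>x. SUP n. nrm (E n) (x n)\<rparr>"

definition c0_sum :: "(nat \<Rightarrow> 'a calg) \<Rightarrow> (nat \<Rightarrow> 'a) set" where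
  "c0_sum E = {x \<in> carrier (bounded_product E). (\<lambda>n. nrm (E n) (x n)) \<longlonglongrightarrow> 0}"

definition seq_algebra :: "'a calg \<Rightarrow> (nat \<Rightarrow> 'a) set calg" where
  "seq_algebra A = quot_algebra (bounded_product (\<lambda>_. A)) (c0_sum (\<lambda>_. A))"

definition seq_const :: "'a calg \<Rightarrow> 'a \<Rightarrow> (nat \<Rightarrow> 'a) set" where
  "seq_const A a = coset (bounded_product (\<lambda>_. A)) (c0_sum (\<lambda>_. A)) (\<lambda>_. a)"

definition central_sequences :: "'a calg \<Rightarrow> (nat \<Rightarrow> 'a) set set" where
  "central_sequences A =
     {g \<in> carrier (seq_algebra A). \<forall>a\<in>carrier A.
        g \<otimes>\<^bsub>seq_algebra A\<^esub> seq_const A a = seq_const A a \<otimes>\<^bsub>seq_algebra A\<^esub> g}"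

text \<open>
  An element of \<^term>\<open>seq_algebra A\<close> is the set of all its representing sequences, and the
  condition below does not depend on the representative.
\<close>

definition seq_strictly_positives :: "'a calg \<Rightarrow> (nat \<Rightarrow> 'a) set set" where
  "seq_strictly_positives A =
     {X \<in> positives (seq_algebra A).
        \<forall>x\<in>X. \<not> (\<exists>k :: nat \<Rightarrow> nat. strict_mono k \<and>
                    limitin (norm_topology A) (x \<circ> k) \<zero>\<^bsub>A\<^esub> sequentially)}"

definition tracially_sequentially_split :: "'a calg \<Rightarrow> 'b calg \<Rightarrow> ('a \<Rightarrow> 'b) \<Rightarrow> bool" where
  "tracially_sequentially_split A B \<phi> \<longleftrightarrow>
     cstar_hom A B \<phi> \<and>
     (\<forall>z\<in>seq_strictly_positives A. z \<noteq> \<zero>\<^bsub>seq_algebra A\<^esub> \<longrightarrow>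
       (\<exists>\<psi> g. cstar_hom B (seq_algebra A) \<psi> \<and>
              g \<in> projections (seq_algebra A) \<and> g \<in> central_sequences A \<and>
              g \<noteq> \<zero>\<^bsub>seq_algebra A\<^esub> \<and>
              (\<forall>a\<in>carrier A. \<psi> (\<phi> a) = seq_const A a \<otimes>\<^bsub>seq_algebra A\<^esub> g) \<and>
              (\<exists>r\<in>projections (seq_algebra A). r \<in> hereditary_gen (seq_algebra A) z \<and>
                 mvn_equiv (seq_algebra A) (\<one>\<^bsub>seq_algebra A\<^esub> \<ominus>\<^bsub>seq_algebra A\<^esub> g) r)))"

text \<open>
  A class of C*-algebras is given by a set of structures carried by one type; an arbitrary
  C*-algebra, on whatever type, belongs to it if it is isomorphic to one of them.  As classes are
  closed under isomorphism and only separable algebras are involved, a type of the cardinality of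
  the continuum is enough to represent every class.
\<close>

definition in_class :: "'u calg set \<Rightarrow> 'a calg \<Rightarrow> bool" where
  "in_class \<C> A \<longleftrightarrow> (\<exists>D\<in>\<C>. cstar_iso D A)"

definition locally_approx_unitarily :: "'u calg set \<Rightarrow> 'a calg \<Rightarrow> bool" where
  "locally_approx_unitarily \<C> D \<longleftrightarrow>
     (\<forall>F \<epsilon>. finite F \<and> F \<subseteq> carrier D \<and> (0::real) < \<epsilon> \<longrightarrow>
       (\<exists>S. cstar_subalgebra S D \<and> in_class \<C> (restrict_to D S) \<and>
            is_unit (restrict_to D S) \<one>\<^bsub>D\<^esub> \<and> (\<forall>x\<in>F. dist_to D x S \<le> \<epsilon>)))"

definition TA :: "'u calg set \<Rightarrow> 'a calg \<Rightarrow> bool" where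
  "TA \<C> A \<longleftrightarrow>
     cstar_algebra A \<and> simple A \<and> unital A \<and>
     (\<forall>F \<epsilon> a. finite F \<and> F \<subseteq> carrier A \<and> (0::real) < \<epsilon> \<and> a \<in> positives A \<and> a \<noteq> \<zero>\<^bsub>A\<^esub> \<longrightarrow>
       (\<exists>p\<in>projections A. \<exists>S.
          cstar_subalgebra S A \<and> in_class \<C> (restrict_to A S) \<and> is_unit (restrict_to A S) p \<and>
          (\<forall>x\<in>F. nrm A (p \<otimes>\<^bsub>A\<^esub> x \<ominus>\<^bsub>A\<^esub> x \<otimes>\<^bsub>A\<^esub> p) \<le> \<epsilon> \<and>
                 dist_to A (p \<otimes>\<^bsub>A\<^esub> x \<otimes>\<^bsub>A\<^esub> p) S \<le> \<epsilon>) \<and>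
          (\<exists>r\<in>projections A. r \<in> hereditary_gen A a \<and> mvn_equiv A (\<one>\<^bsub>A\<^esub> \<ominus>\<^bsub>A\<^esub> p) r)))"

text \<open>
  The target algebras range over all C*-algebras carried by the type of the algebra D itself.  For
  separable D this is no restriction: a lifting problem for D can be solved inside separable
  subalgebras of the targets; these have at most the cardinality of the continuum, and hence copies
  on the type of D as soon as D is nonzero.  In any case the predicates are implied by the versions
  for targets on arbitrary types.
\<close>

definition weakly_semiprojective :: "'u calg \<Rightarrow> bool" where
  "weakly_semiprojective D \<longleftrightarrow>
     (\<forall>(E :: nat \<Rightarrow> 'u calg) \<phi>.
        (\<forall>n. cstar_algebra (E n)) \<and>
        cstar_hom D (quot_algebra (bounded_product E) (c0_sum E)) \<phi> \<longrightarrow>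
        (\<exists>\<psi>. cstar_hom D (bounded_product E) \<psi> \<and>
             (\<forall>d\<in>carrier D. coset (bounded_product E) (c0_sum E) (\<psi> d) = \<phi> d)))"

text \<open>
  In the next definition a representative x of an element of the quotient by \<open>J n\<close> is pushed
  forward to the quotient by the closure of the union of the ideals.
\<close>

definition semiprojective :: "'u calg \<Rightarrow> bool" where
  "semiprojective D \<longleftrightarrow>
     (\<forall>(E :: 'u calg) J K \<phi>.
        cstar_algebra E \<and> (\<forall>n::nat. closed_ideal (J n) E) \<and> mono J \<and>
        K = norm_topology E closure_of (\<Union>n. J n) \<and>
        cstar_hom D (quot_algebra E K) \<phi> \<longrightarrow>
        (\<exists>n \<psi>. cstar_hom D (quot_algebra E (J n)) \<psi> \<and>
               (\<forall>d\<in>carrier D. \<forall>x\<in>\<psi> d. coset E K x = \<phi> d)))"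

text \<open>
  A matrix over D is an infinite array with only finitely many nonzero entries, so that the
  embedding of \<open>M\<^sub>n(D)\<close> into \<open>M\<^sub>n\<^sub>+\<^sub>1(D)\<close> by \<open>a \<oplus> 0\<close> is an inclusion.  The norm is the operator norm
  on the Hilbert D-module of finitely supported columns.
\<close>

primrec partial_sum :: "'a calg \<Rightarrow> (nat \<Rightarrow> 'a) \<Rightarrow> nat \<Rightarrow> 'a" where
  "partial_sum D f 0 = \<zero>\<^bsub>D\<^esub>"
| "partial_sum D f (Suc n) = partial_sum D f n \<oplus>\<^bsub>D\<^esub> f n"

definition finite_sum :: "'a calg \<Rightarrow> (nat \<Rightarrow> 'a) \<Rightarrow> 'a" where
  "finite_sum D f = partial_sum D f (LEAST N. \<forall>k\<ge>N. f k = \<zero>\<^bsub>D\<^esub>)"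

definition columns :: "'a calg \<Rightarrow> (nat \<Rightarrow> 'a) set" where
  "columns D = {x. (\<forall>i. x i \<in> carrier D) \<and> (\<exists>N. \<forall>k\<ge>N. x k = \<zero>\<^bsub>D\<^esub>)}"

definition column_norm :: "'a calg \<Rightarrow> (nat \<Rightarrow> 'a) \<Rightarrow> real" where
  "column_norm D x = sqrt (nrm D (finite_sum D (\<lambda>i. adj D (x i) \<otimes>\<^bsub>D\<^esub> x i)))"

definition matrix_infty :: "'a calg \<Rightarrow> (nat \<Rightarrow> nat \<Rightarrow> 'a) calg" where
  "matrix_infty D =
     \<lparr>carrier = {a. (\<forall>i j. a i j \<in> carrier D) \<and> (\<exists>n. \<forall>i j. n \<le> i \<or> n \<le> j \<longrightarrow> a i j = \<zero>\<^bsub>D\<^esub>)},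
      zero = \<lambda>i j. \<zero>\<^bsub>D\<^esub>,
      add = \<lambda>a b i j. a i j \<oplus>\<^bsub>D\<^esub> b i j,
      scale = \<lambda>c a i j. c \<odot>\<^bsub>D\<^esub> a i j,
      mult = \<lambda>a b i j. finite_sum D (\<lambda>k. a i k \<otimes>\<^bsub>D\<^esub> b k j),
      adj = \<lambda>a i j. adj D (a j i),
      nrm = \<lambda>a. SUP x \<in> {x \<in> columns D. column_norm D x \<le> 1}.
                  column_norm D (\<lambda>i. finite_sum D (\<lambda>k. a i k \<otimes>\<^bsub>D\<^esub> x k))\<rparr>"

definition matrix_algebra :: "nat \<Rightarrow> 'a calg \<Rightarrow> (nat \<Rightarrow> nat \<Rightarrow> 'a) calg" where
  "matrix_algebra n D = restrict_to (matrix_infty D)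
     {a \<in> carrier (matrix_infty D). \<forall>i j. n \<le> i \<or> n \<le> j \<longrightarrow> a i j = \<zero>\<^bsub>D\<^esub>}"

definition tracial_state :: "'a calg \<Rightarrow> ('a \<Rightarrow> complex) \<Rightarrow> bool" where
  "tracial_state D \<tau> \<longleftrightarrow>
     (\<forall>x\<in>carrier D. \<forall>y\<in>carrier D. \<tau> (x \<oplus>\<^bsub>D\<^esub> y) = \<tau> x + \<tau> y) \<and>
     (\<forall>c. \<forall>x\<in>carrier D. \<tau> (c \<odot>\<^bsub>D\<^esub> x) = c * \<tau> x) \<and>
     (\<forall>a\<in>positives D. \<tau> a \<in> \<real> \<and> 0 \<le> Re (\<tau> a)) \<and>
     \<tau> \<one>\<^bsub>D\<^esub> = 1 \<and>
     (\<forall>x\<in>carrier D. \<forall>y\<in>carrier D. \<tau> (x \<otimes>\<^bsub>D\<^esub> y) = \<tau> (y \<otimes>\<^bsub>D\<^esub> x))"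

definition matrix_trace :: "'a calg \<Rightarrow> ('a \<Rightarrow> complex) \<Rightarrow> (nat \<Rightarrow> nat \<Rightarrow> 'a) \<Rightarrow> complex" where
  "matrix_trace D \<tau> a = (\<Sum>i | a i i \<noteq> \<zero>\<^bsub>D\<^esub>. \<tau> (a i i))"

text \<open>
  Powers with a successor exponent, since \<open>M\<^sub>\<infinity>(D)\<close> has no unit: \<^term>\<open>power_Suc A a n\<close> is the
  product of n + 1 factors, and \<^term>\<open>root_Suc A a n\<close> is the positive root of order n + 1.
\<close>

primrec power_Suc :: "'a calg \<Rightarrow> 'a \<Rightarrow> nat \<Rightarrow> 'a" where
  "power_Suc A a 0 = a"
| "power_Suc A a (Suc n) = power_Suc A a n \<otimes>\<^bsub>A\<^esub> a"

definition root_Suc :: "'a calg \<Rightarrow> 'a \<Rightarrow> nat \<Rightarrow> 'a" where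
  "root_Suc A a n = (THE b. b \<in> positives A \<and> power_Suc A b n = a)"

definition dimension_function ::
    "'a calg \<Rightarrow> ('a \<Rightarrow> complex) \<Rightarrow> (nat \<Rightarrow> nat \<Rightarrow> 'a) \<Rightarrow> real" where
  "dimension_function D \<tau> a =
     lim (\<lambda>n. Re (matrix_trace D \<tau> (root_Suc (matrix_infty D) a n)))"

definition cuntz_subequiv :: "'a calg \<Rightarrow> 'a \<Rightarrow> 'a \<Rightarrow> bool" where
  "cuntz_subequiv A a b \<longleftrightarrow>
     (\<exists>r s. range r \<subseteq> carrier A \<and> range s \<subseteq> carrier A \<and>
        limitin (norm_topology A) (\<lambda>n. r n \<otimes>\<^bsub>A\<^esub> b \<otimes>\<^bsub>A\<^esub> s n) a sequentially)"

definition strict_comparison :: "'a calg \<Rightarrow> bool" where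
  "strict_comparison D \<longleftrightarrow>
     (\<forall>a\<in>positives (matrix_infty D). \<forall>b\<in>positives (matrix_infty D).
        (\<forall>\<tau>. tracial_state D \<tau> \<longrightarrow> dimension_function D \<tau> a < dimension_function D \<tau> b) \<longrightarrow>
        cuntz_subequiv (matrix_infty D) a b)"

end

theory Submission
  imports Defs
begin

text \<open>
  Given \<open>a \<ge> 0\<close> in \<open>A\<close>, choose orthogonal nonzero positive elements \<open>a\<^sub>1, a\<^sub>2\<close> of \<open>aA\<close> and take
  \<open>\<psi>\<close> and \<open>g\<close> for the constant sequence \<open>a\<^sub>1\<close>, so that \<open>1 - g\<close> is small with respect to \<open>a\<^sub>1\<close>.  Apply
  the tracial approximation of \<open>B\<close> to \<open>\<phi>(F)\<close>, the projection \<open>q = \<phi>(1)\<close> and \<open>\<phi>(a\<^sub>2)\<close>, and perturb the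
  resulting algebra to a hereditary subalgebra \<open>D\<close> whose unit \<open>\<sigma>\<close> is almost below \<open>q\<close>; then \<open>q - \<sigma>\<close> is
  small with respect to \<open>\<phi>(a\<^sub>2)\<close>.  Semiprojectivity lifts \<open>\<psi>\<close> restricted to \<open>D\<close> to homomorphisms
  \<open>\<pi>\<^sub>n : D \<rightarrow> A\<close>.  For large \<open>n\<close> the projection \<open>p = \<pi>\<^sub>n(\<sigma>)\<close> and a subalgebra in the class that
  approximates the quotient \<open>\<pi>\<^sub>n(D)\<close> witness the claim: \<open>1 - p\<close> lies over \<open>1 - g\<close> plus \<open>g - \<psi>(\<sigma>)\<close>, and both
  are approximately of the form \<open>(ac)\<^sup>*(ac)\<close>, with orthogonal ranges.  If \<open>a\<^sub>1, a\<^sub>2\<close> do not exist, then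
  \<open>a\<^sup>2\<close> is a multiple of a minimal projection \<open>e\<close>.  If \<open>e = 1\<close> then \<open>a\<close> is invertible and \<open>p = 0\<close>
  works; otherwise already \<open>g = 1\<close>, because a projection in \<open>eA\<^sub>\<infinity>e\<close> cannot be equivalent to a nonzero
  central one.
\<close>

section \<open>Unital C*-algebras as a type class\<close>

text \<open>The split controls \<open>\<psi>\<close> only on the image of \<open>\<phi>\<close>, and
  \<open>\<phi>\<close> need not be unital. A projection of \<open>B\<close> is therefore useful
  only if it lies almost below \<open>q\<close>: then \<open>\<psi>(q) = g\<close> turns smallness
  of \<open>q - \<sigma>\<close> relative to the image of the second piece of \<open>a\<close> into
  smallness of \<open>g - \<psi>(\<sigma>)\<close> relative to that piece. As \<open>1 - g\<close>
  has to be small too, and both defects must fit under the same \<open>a\<close>, it is cut into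
  orthogonal pieces beforehand. A coordinate inherits from the sequence algebra only strict norm
  inequalities, because the quotient norm is a limes superior. So the comparison of
  \<open>1 - p\<close> with \<open>a\<close> is carried as a norm estimate with bound
  \<open>1\<close>, and only inside \<open>A\<close> is it turned into an exact partial isometry by
  a polar decomposition. The algebras involved live on different types and have different units.
  They are embedded as corners into Banach algebra types, in which order and functional calculus are
  derived from one tool, the square root of \<open>1 - x\<close> for a selfadjoint contraction
  \<open>x\<close>.\<close>

text \<open>Complex scalars are encoded by the central element \<open>iu\<close>, which plays the role of \<open>\<i>\<close>.\<close>

class cstar = real_normed_algebra_1 + banach +
  fixes star :: "'a \<Rightarrow> 'a" and iu :: 'a
  assumes star_star [simp]: "star (star x) = x"
    and star_add: "star (x + y) = star x + star y"
    and star_mult: "star (x * y) = star y * star x"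
    and star_scaleR: "star (r *\<^sub>R x) = r *\<^sub>R star x"
    and cstar_norm: "norm (star x * x) = (norm x)\<^sup>2"
    and iu_sq: "iu * iu = - 1"
    and star_iu: "star iu = - iu"
    and iu_commute: "iu * x = x * iu"

lemma star_zero [simp]: "star 0 = (0 :: 'a::cstar)"
  using star_scaleR[of 0 "0 :: 'a"] by simp

lemma star_minus: "star (- x) = - star (x :: 'a::cstar)"
  using star_scaleR[of "-1" x] by simp

lemma star_diff: "star (x - y) = star x - star (y :: 'a::cstar)"
  by (simp only: diff_conv_add_uminus star_add star_minus)

lemma star_one [simp]: "star 1 = (1 :: 'a::cstar)"
  by (metis mult_1_left mult_1_right star_mult star_star)

lemma norm_star [simp]: "norm (star x) = norm (x :: 'a::cstar)"
proof -
  have le: "norm y \<le> norm (star y)" for y :: 'a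
  proof (cases "norm y = 0")
    case False
    have "norm y * norm y \<le> norm (star y) * norm y"
      using cstar_norm[of y] norm_mult_ineq[of "star y" y] by (simp add: power2_eq_square)
    then show ?thesis using False by (simp add: mult_le_cancel_right)
  qed simp
  show ?thesis using le[of x] le[of "star x"] by simp
qed

lemma star_eq_zero: "star x * x = 0 \<longleftrightarrow> x = (0 :: 'a::cstar)"
  using cstar_norm[of x] by (metis mult_zero_right norm_eq_zero zero_eq_power2)

lemmas star_simps = star_add star_mult star_scaleR star_minus star_diff star_iu

lemma iu_iu: "iu * (iu * x) = - (x :: 'a::cstar)"
  by (simp add: iu_sq flip: mult.assoc)

lemma mult_iu: "x * (iu * y) = iu * (x * y :: 'a::cstar)"
  by (metis iu_commute mult.assoc)

section \<open>Square roots and the positive cone, by norm estimates\<close>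

lemma sa_sq_eq_zero: "star x = x \<Longrightarrow> x * x = 0 \<Longrightarrow> x = (0 :: 'a::cstar)"
  using star_eq_zero[of x] by simp


lemma norm_sa_sq: "star x = x \<Longrightarrow> norm (x * x) = (norm x)\<^sup>2" for x :: "'a::cstar"
  using cstar_norm[of x] by simp

lemma bounded_linear_star: "bounded_linear (star :: 'a::cstar \<Rightarrow> 'a)"
  by (rule bounded_linear_intro[where K=1]) (auto simp: star_simps)

lemmas tendsto_star = bounded_linear.tendsto[OF bounded_linear_star]

text \<open>The iteration \<open>y \<mapsto> (x + y\<^sup>2) / 2\<close> is dominated by the same iteration applied to the
  number \<open>\<parallel>x\<parallel>\<close>, which is monotone and bounded by \<open>\<parallel>x\<parallel>\<close>; this gives convergence even for \<open>\<parallel>x\<parallel> = 1\<close>.\<close>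

lemma sqrt_one_minus:
  fixes x :: "'a::cstar"
  assumes sa: "star x = x" and n: "norm x \<le> 1"
  obtains s where "star s = s" "s * s = 1 - x" "norm (1 - s) \<le> norm x"
    "\<And>c. c * x = x * c \<Longrightarrow> c * s = s * c"
proof -
  define r where "r = norm x"
  have r: "0 \<le> r" "r \<le> 1" using n by (auto simp: r_def)
  define t where "t = rec_nat (0::real) (\<lambda>_ u. (r + u * u) / 2)"
  define y where "y = rec_nat (0::'a) (\<lambda>_ u. (1/2) *\<^sub>R (x + u * u))"
  have t0 [simp]: "t 0 = 0" and tS: "t (Suc k) = (r + t k * t k) / 2" for k by (auto simp: t_def)
  have y0 [simp]: "y 0 = 0" and yS: "y (Suc k) = (1/2) *\<^sub>R (x + y k * y k)" for k by (auto simp: y_def)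
  have t_bd: "0 \<le> t k \<and> t k \<le> r" for k
  proof (induction k)
    case (Suc k)
    have "t k * t k \<le> r * 1" using Suc r by (intro mult_mono) auto
    then show ?case using Suc r by (auto simp: tS)
  qed (use r in auto)
  have t_mono: "t k \<le> t (Suc k)" for k
  proof (induction k)
    case (Suc k)
    have "t k * t k \<le> t (Suc k) * t (Suc k)" using Suc t_bd by (intro mult_mono) auto
    then show ?case by (simp add: tS[of "Suc k"] tS[of k])
  qed (use t_bd in simp)
  have y_bd: "norm (y k) \<le> t k" for k
  proof (induction k)
    case (Suc k)
    have "norm (y k * y k) \<le> t k * t k"
      by (rule order_trans[OF norm_mult_ineq]) (use Suc in \<open>auto intro!: mult_mono order_trans[OF norm_ge_zero]\<close>)
    then have "norm (x + y k * y k) \<le> r + t k * t k"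
      using norm_triangle_ineq[of x "y k * y k"] by (simp add: r_def)
    then show ?case by (simp add: yS tS)
  qed simp
  \<comment> \<open>The increments of \<open>y\<close> are bounded by those of \<open>t\<close>, not
    merely \<open>y\<close> by \<open>t\<close>. This transfers the Cauchy property even when
    \<open>norm x = 1\<close>, where \<open>t\<close> converges without a geometric rate.\<close>
  have y_step: "norm (y (Suc k) - y k) \<le> t (Suc k) - t k" for k
  proof (induction k)
    case 0
    then show ?case by (simp add: yS tS r_def)
  next
    case (Suc k)
    have eq: "y (Suc (Suc k)) - y (Suc k)
      = (1/2) *\<^sub>R (y (Suc k) * (y (Suc k) - y k) + (y (Suc k) - y k) * y k)"
      unfolding yS[of "Suc k"] yS[of k, symmetric]
      by (subst (2) yS) (simp add: algebra_simps)
    have "norm (y (Suc k) * (y (Suc k) - y k)) \<le> t (Suc k) * (t (Suc k) - t k)"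
      by (rule order_trans[OF norm_mult_ineq]) (use Suc y_bd t_bd in \<open>auto intro!: mult_mono\<close>)
    moreover have "norm ((y (Suc k) - y k) * y k) \<le> (t (Suc k) - t k) * t k"
      by (rule order_trans[OF norm_mult_ineq]) (use Suc y_bd t_bd t_mono in \<open>auto intro!: mult_mono\<close>)
    ultimately have "norm (y (Suc k) * (y (Suc k) - y k) + (y (Suc k) - y k) * y k)
      \<le> t (Suc k) * (t (Suc k) - t k) + (t (Suc k) - t k) * t k"
      by (meson add_mono norm_triangle_ineq order_trans)
    also have "\<dots> = 2 * (t (Suc (Suc k)) - t (Suc k))"
      by (simp add: tS[of "Suc k"] tS[of k, symmetric])
        (subst (5) tS, simp add: algebra_simps)
    finally show ?case unfolding eq by simp
  qed
  have "convergent t"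
  proof (rule Bseq_monoseq_convergent)
    show "Bseq t" by (rule BseqI'[where K=r]) (use t_bd in simp)
    show "monoseq t" using t_mono by (intro incseq_imp_monoseq incseq_SucI)
  qed
  then have "Cauchy t" by (rule convergent_Cauchy)
  have diff: "norm (y (k + m) - y k) \<le> t (k + m) - t k" for k m
  proof (induction m)
    case (Suc m)
    have "norm (y (k + Suc m) - y k) \<le> norm (y (k + Suc m) - y (k + m)) + norm (y (k + m) - y k)"
      using norm_triangle_ineq[of "y (k + Suc m) - y (k + m)" "y (k + m) - y k"] by simp
    then show ?case using y_step[of "k + m"] Suc by auto
  qed simp
  have "Cauchy y"
  proof (rule CauchyI')
    fix e :: real assume "0 < e"
    then obtain M where M: "\<And>m n. m \<ge> M \<Longrightarrow> n \<ge> M \<Longrightarrow> norm (t m - t n) < e"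
      using CauchyD[OF \<open>Cauchy t\<close>] by metis
    have "norm (y m - y n) < e" if "m \<ge> M" "m < n" for m n
    proof -
      have "norm (y n - y m) \<le> t n - t m" using diff[of m "n - m"] that by simp
      also have "\<dots> < e" using M[of n m] that by simp
      finally show ?thesis by (simp add: norm_minus_commute)
    qed
    then show "\<exists>M. \<forall>m\<ge>M. \<forall>n>m. dist (y m) (y n) < e" unfolding dist_norm by blast
  qed
  then obtain z where z: "y \<longlonglongrightarrow> z" by (metis Cauchy_convergent convergent_def)
  have "(\<lambda>k. (1/2) *\<^sub>R (x + y k * y k)) \<longlonglongrightarrow> (1/2) *\<^sub>R (x + z * z)"
    by (intro tendsto_scaleR tendsto_add tendsto_mult tendsto_const z)
  then have zz: "z = (1/2) *\<^sub>R (x + z * z)"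
    using LIMSEQ_unique[OF LIMSEQ_Suc[OF z], unfolded yS] by metis
  have ys: "star (y k) = y k" for k
    by (induction k) (auto simp: yS star_simps sa)
  have zs: "star z = z"
    using LIMSEQ_unique[OF tendsto_star[OF z]] z by (simp add: ys)
  have yc: "c * x = x * c \<Longrightarrow> c * y k = y k * c" for c k
  proof (induction k)
    case (Suc k)
    then have "c * (y k * y k) = y k * y k * c" by (metis mult.assoc)
    then show ?case using Suc.prems by (simp add: yS distrib_left distrib_right)
  qed simp
  have zc: "c * z = z * c" if "c * x = x * c" for c
  proof (rule LIMSEQ_unique)
    show "(\<lambda>k. c * y k) \<longlonglongrightarrow> c * z" by (intro tendsto_intros z)
    show "(\<lambda>k. c * y k) \<longlonglongrightarrow> z * c" unfolding yc[OF that] by (intro tendsto_intros z)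
  qed
  have zn: "norm z \<le> r"
    using Lim_bounded[OF tendsto_norm[OF z], of 0 r] y_bd t_bd by (meson order_trans)
  \<comment> \<open>Completing the square in the fixed point equation shows that the root is
    \<open>1 - z\<close>; the bound on \<open>norm z\<close> then controls its distance from
    \<open>1\<close>.\<close>
  have "2 *\<^sub>R z = x + z * z" by (subst zz) simp
  then have eq: "(1 - z) * (1 - z) = 1 - x"
    by (simp add: algebra_simps scaleR_2)
  show ?thesis
  proof (rule that[OF _ eq])
    show "star (1 - z) = 1 - z" by (simp add: star_simps zs)
    show "norm (1 - (1 - z)) \<le> norm x" using zn by (simp add: r_def)
    show "c * (1 - z) = (1 - z) * c" if "c * x = x * c" for c
      using zc[OF that] by (simp add: algebra_simps)
  qed
qed

text \<open>For \<open>u = w + iu * v\<close> commutation gives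
  \<open>star u * u = w * w + v * v\<close>, while \<open>w\<close> is the real part of
  \<open>u\<close> and hence no larger in norm. This stands in for monotonicity of the norm on
  commuting squares before any order is available.\<close>

lemma commuting_sq_norm:
  fixes w v :: "'a::cstar"
  assumes w: "star w = w" and v: "star v = v" and c: "w * v = v * w"
  shows "(norm w)\<^sup>2 \<le> norm (w * w + v * v)"
proof -
  define u where "u = w + iu * v"
  have u: "star u = w - iu * v"
    by (simp add: u_def star_simps w v iu_commute)
  have "(w - iu * v) * (w + iu * v) = w * w + iu * (w * v) - iu * (v * w) - iu * (iu * (v * v))"
    by (simp add: algebra_simps mult_iu[of w] mult_iu[of v])
  also have "\<dots> = w * w + v * v" by (simp add: c iu_iu)
  finally have "star u * u = w * w + v * v" by (simp add: u) (simp add: u_def)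
  then have nu: "norm (w * w + v * v) = (norm u)\<^sup>2" using cstar_norm[of u] by simp
  have "2 *\<^sub>R w = u + star u" by (simp add: u) (simp add: u_def scaleR_2)
  then have "2 * norm w \<le> 2 * norm u"
    using norm_triangle_ineq[of u "star u"] by (metis norm_scaleR norm_star mult_2 abs_numeral real_norm_def)
  then show ?thesis unfolding nu by (simp add: power_mono)
qed

text \<open>The root \<open>s\<close> of \<open>1 - w * w\<close> commutes with \<open>w\<close> and
  \<open>s * s + w * w = 1\<close>, so \<open>commuting_sq_norm\<close> bounds \<open>s\<close>.
  This is the core of the metric description of positivity.\<close>

lemma norm_one_minus_sq:
  fixes w :: "'a::cstar"
  assumes w: "star w = w" "norm w \<le> 1"
  shows "norm (1 - w * w) \<le> 1"
proof -
  have sa: "star (w * w) = w * w" by (simp add: star_simps w)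
  have "norm (w * w) \<le> 1" using w by (simp add: norm_sa_sq power_le_one)
  then obtain s where s: "star s = s" "s * s = 1 - w * w" "\<And>c. c * (w * w) = w * w * c \<Longrightarrow> c * s = s * c"
    using sqrt_one_minus[OF sa] by metis
  have c: "s * w = w * s" using s(3)[of w] by (simp add: mult.assoc)
  show ?thesis
    using commuting_sq_norm[OF s(1) w(1) c] by (simp add: s(2) flip: norm_sa_sq[OF s(1)])
qed

text \<open>Being a selfadjoint square makes roots available at once. The usual form
  \<open>star x * x\<close> is linked to it only in \<open>Pos_star_mult\<close>, and the
  description by norms in \<open>Pos_norm\<close> and \<open>PosI\<close> is the one that handles
  sums and limits.\<close>

definition Pos :: "'a::cstar \<Rightarrow> bool" where
  "Pos x \<longleftrightarrow> (\<exists>s. star s = s \<and> x = s * s)"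

lemma Pos_sa: "Pos x \<Longrightarrow> star x = x"
  by (auto simp: Pos_def star_mult)

lemma Pos_square: "star s = s \<Longrightarrow> Pos (s * s)"
  by (auto simp: Pos_def)

text \<open>Dividing by \<open>t\<close> reduces to \<open>norm_one_minus_sq\<close>. With
  \<open>PosI\<close> it follows that a selfadjoint element is positive exactly when it lies in the
  ball of radius \<open>t\<close> around \<open>t *\<^sub>R 1\<close> for some
  \<open>t\<close>.\<close>

lemma Pos_norm:
  assumes "Pos x" "norm x \<le> t"
  shows "norm (t *\<^sub>R 1 - x) \<le> t"
proof (cases "t = 0")
  case True
  then show ?thesis using assms by simp
next
  case False
  then have t: "t > 0" using assms(2) norm_ge_zero[of x] by linarith
  obtain s where s: "star s = s" "x = s * s" using assms(1) by (auto simp: Pos_def)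
  define w where "w = (1 / sqrt t) *\<^sub>R s"
  have ww: "w * w = (1 / t) *\<^sub>R x" using t by (simp add: w_def s(2))
  have ws: "star w = w" by (simp add: w_def star_simps s)
  have "(norm w)\<^sup>2 \<le> 1"
    using assms(2) t by (simp add: ww flip: norm_sa_sq[OF ws])
  then have "norm w \<le> 1" by (simp add: power_le_one_iff)
  then have "norm (1 - w * w) \<le> 1" by (rule norm_one_minus_sq[OF ws])
  moreover have "t *\<^sub>R 1 - x = t *\<^sub>R (1 - w * w)" using t by (simp add: ww scaleR_diff_right)
  ultimately show ?thesis using t by simp
qed

text \<open>Rescaled version of \<open>sqrt_one_minus\<close> for \<open>x = t (1 - y)\<close>.
  Carrying along the distance of the root to \<open>sqrt t\<close> is essential: by
  \<open>PosI\<close> it makes the root itself positive in \<open>Pos_root\<close>.\<close>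

lemma sqrt_near_scalar:
  fixes x :: "'a::cstar"
  assumes x: "star x = x" "norm (t *\<^sub>R 1 - x) \<le> t"
  obtains s where "star s = s" "s * s = x" "norm (sqrt t *\<^sub>R 1 - s) \<le> sqrt t"
    "\<And>c. c * x = x * c \<Longrightarrow> c * s = s * c"
proof (cases "t = 0")
  case True
  then show ?thesis using x by (intro that[of 0]) auto
next
  case False
  then have t: "t > 0" using x(2) norm_ge_zero[of "t *\<^sub>R 1 - x"] by linarith
  define y where "y = 1 - (1 / t) *\<^sub>R x"
  have y: "t *\<^sub>R 1 - x = t *\<^sub>R y" using t by (simp add: y_def scaleR_diff_right)
  have "norm y \<le> 1" using x(2) t unfolding y by simp
  moreover have "star y = y" by (simp add: y_def star_simps x)
  ultimately obtain s where s: "star s = s" "s * s = 1 - y" "norm (1 - s) \<le> norm y"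
    "\<And>c. c * y = y * c \<Longrightarrow> c * s = s * c"
    using sqrt_one_minus[of y] by metis
  show ?thesis
  proof
    show "star (sqrt t *\<^sub>R s) = sqrt t *\<^sub>R s" by (simp add: star_simps s)
    show "sqrt t *\<^sub>R s * sqrt t *\<^sub>R s = x" using t by (simp add: s(2) y_def)
    have "sqrt t *\<^sub>R 1 - sqrt t *\<^sub>R s = sqrt t *\<^sub>R (1 - s)" by (simp add: scaleR_diff_right)
    then show "norm (sqrt t *\<^sub>R 1 - sqrt t *\<^sub>R s) \<le> sqrt t"
      using t s(3) \<open>norm y \<le> 1\<close> by simp
    show "c * sqrt t *\<^sub>R s = sqrt t *\<^sub>R s * c" if "c * x = x * c" for c
      using s(4)[of c] that by (simp add: y_def algebra_simps)
  qed
qed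

lemma PosI: "star x = x \<Longrightarrow> norm (t *\<^sub>R 1 - x) \<le> t \<Longrightarrow> Pos x"
  by (metis sqrt_near_scalar Pos_def)

lemma Pos_root:
  fixes x :: "'a::cstar"
  assumes "Pos x"
  obtains s where "Pos s" "s * s = x" "\<And>c. c * x = x * c \<Longrightarrow> c * s = s * c"
proof -
  obtain s where s: "star s = s" "s * s = x" "norm (sqrt (norm x) *\<^sub>R 1 - s) \<le> sqrt (norm x)"
    "\<And>c. c * x = x * c \<Longrightarrow> c * s = s * c"
    using sqrt_near_scalar[OF Pos_sa[OF assms] Pos_norm[OF assms order_refl]] by metis
  show thesis by (rule that[OF PosI[OF s(1,3)] s(2,4)])
qed

lemma Pos_scalar: "0 \<le> t \<Longrightarrow> Pos (t *\<^sub>R 1 :: 'a::cstar)"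
  using Pos_square[of "sqrt t *\<^sub>R 1 :: 'a"] by (simp add: star_simps)

lemma Pos_zero [simp]: "Pos 0"
  using Pos_scalar[of 0] by simp

lemma Pos_scaleR: "0 \<le> t \<Longrightarrow> Pos x \<Longrightarrow> Pos (t *\<^sub>R x)"
  unfolding Pos_def
proof (elim exE conjE)
  fix s assume "0 \<le> t" "star s = s" "x = s * s"
  then show "\<exists>r. star r = r \<and> t *\<^sub>R x = r * r"
    by (intro exI[of _ "sqrt t *\<^sub>R s"]) (simp add: star_simps)
qed

text \<open>The ball criterion adds up by the triangle inequality, with the radii
  \<open>norm x\<close> and \<open>norm y\<close>; no commutation of the summands is
  involved.\<close>

lemma Pos_add:
  assumes "Pos x" "Pos y"
  shows "Pos (x + y)"
proof (rule PosI)
  show "star (x + y) = x + y" using assms by (simp add: star_add Pos_sa)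
  have "(norm x *\<^sub>R 1 - x) + (norm y *\<^sub>R 1 - y) = (norm x + norm y) *\<^sub>R 1 - (x + y)"
    by (simp add: algebra_simps)
  then show "norm ((norm x + norm y) *\<^sub>R 1 - (x + y)) \<le> norm x + norm y"
    using norm_triangle_mono[OF Pos_norm[OF assms(1) order_refl] Pos_norm[OF assms(2) order_refl]]
    by metis
qed

text \<open>Roots \<open>w\<close> of \<open>x\<close> and \<open>v\<close> of \<open>- x\<close>
  commute and their squares cancel, so \<open>commuting_sq_norm\<close> gives
  \<open>w = 0\<close>.\<close>

lemma Pos_antisym:
  assumes "Pos x" "Pos (- x)"
  shows "x = 0"
proof -
  obtain w where w: "star w = w" "x = w * w" using assms(1) by (auto simp: Pos_def)
  obtain v where v: "Pos v" "v * v = - x" "\<And>c. c * (- x) = (- x) * c \<Longrightarrow> c * v = v * c"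
    using Pos_root[OF assms(2)] by metis
  have "w * v = v * w" by (rule v(3)) (simp add: w(2) mult.assoc)
  then have "(norm w)\<^sup>2 \<le> 0"
    using commuting_sq_norm[OF w(1) Pos_sa[OF v(1)]] by (simp add: v(2) flip: w(2))
  then show ?thesis by (simp add: w(2))
qed

lemma Pos_le_norm:
  assumes "Pos x" "Pos (t *\<^sub>R 1 - x)" "0 \<le> t"
  shows "norm x \<le> t"
proof -
  obtain w where w: "star w = w" "x = w * w" using assms(1) by (auto simp: Pos_def)
  obtain v where v: "Pos v" "v * v = t *\<^sub>R 1 - x"
    "\<And>c. c * (t *\<^sub>R 1 - x) = (t *\<^sub>R 1 - x) * c \<Longrightarrow> c * v = v * c"
    using Pos_root[OF assms(2)] by metis
  have "w * v = v * w" by (rule v(3)) (simp add: w(2) mult.assoc algebra_simps)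
  then have "(norm w)\<^sup>2 \<le> t"
    using commuting_sq_norm[OF w(1) Pos_sa[OF v(1)]] assms(3) by (simp add: v(2) flip: w(2))
  then show ?thesis by (simp add: w(2) norm_sa_sq[OF w(1)])
qed

lemma Pos_norm_minus:
  assumes "Pos x" "norm x \<le> t"
  shows "Pos (t *\<^sub>R 1 - x)"
  by (rule PosI[where t=t]) (use assms in \<open>auto simp: star_simps Pos_sa\<close>)

lemma Pos_mono:
  assumes "Pos a" "Pos b"
  shows "norm a \<le> norm (a + b)"
proof (rule Pos_le_norm)
  have "Pos ((norm (a + b) *\<^sub>R 1 - (a + b)) + b)"
    by (intro Pos_add Pos_norm_minus assms order_refl)
  then show "Pos (norm (a + b) *\<^sub>R 1 - a)" by (simp add: algebra_simps)
qed (use assms in auto)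

text \<open>With the norm of the element as radius, the ball criterion is an inequality between
  continuous functions, hence a closed condition.\<close>

lemma Pos_limit:
  assumes "\<And>n. Pos (f n)" "f \<longlonglongrightarrow> x"
  shows "Pos x"
proof (rule PosI)
  have "(\<lambda>n. star (f n)) \<longlonglongrightarrow> star x" by (intro tendsto_star assms)
  then show "star x = x"
    unfolding Pos_sa[OF assms(1)] using assms(2) by (rule LIMSEQ_unique)
  have "(\<lambda>n. norm (norm (f n) *\<^sub>R 1 - f n)) \<longlonglongrightarrow> norm (norm x *\<^sub>R 1 - x)"
    by (intro tendsto_intros assms)
  moreover have "(\<lambda>n. norm (f n)) \<longlonglongrightarrow> norm x" by (intro tendsto_intros assms)
  ultimately show "norm (norm x *\<^sub>R 1 - x) \<le> norm x"
    by (rule LIMSEQ_le) (use Pos_norm[OF assms(1) order_refl] in blast)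
qed

lemma sa_cube_eq_zero:
  fixes d :: "'a::cstar"
  assumes "star d = d" "d * d * d = 0"
  shows "d = 0"
proof -
  have "(d * d) * (d * d) = 0" using assms(2) by (simp flip: mult.assoc)
  then show ?thesis using sa_sq_eq_zero assms(1) by (metis star_mult)
qed

text \<open>For \<open>d = a - b\<close> one has \<open>d * (a + b) = 0\<close>, so the positive
  elements \<open>d * a * d\<close> and \<open>d * b * d\<close> are negatives of each other and
  vanish by antisymmetry; their difference is \<open>d * d * d\<close>.\<close>

lemma Pos_root_unique:
  assumes a: "Pos a" and b: "Pos b" and eq: "a * a = b * b" and c: "a * b = b * a"
  shows "a = b"
proof -
  obtain \<alpha> where \<alpha>: "Pos \<alpha>" "\<alpha> * \<alpha> = a" "\<And>c. c * a = a * c \<Longrightarrow> c * \<alpha> = \<alpha> * c" using Pos_root[OF a] by metis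
  obtain \<beta> where \<beta>: "Pos \<beta>" "\<beta> * \<beta> = b" "\<And>c. c * b = b * c \<Longrightarrow> c * \<beta> = \<beta> * c" using Pos_root[OF b] by metis
  define d where "d = a - b"
  have d: "star d = d" by (simp add: d_def star_simps Pos_sa a b)
  have pos: "Pos (d * (\<gamma> * \<gamma>) * d)" if "Pos \<gamma>" "d * \<gamma> = \<gamma> * d" for \<gamma>
  proof -
    have "star (d * \<gamma>) = d * \<gamma>" using that d by (simp add: star_simps Pos_sa)
    from Pos_square[OF this] show ?thesis using that(2) by (metis mult.assoc)
  qed
  have "d * a = a * d" "d * b = b * d" by (simp_all add: d_def algebra_simps c)
  then have p: "Pos (d * a * d)" "Pos (d * b * d)"
    using pos[OF \<alpha>(1) \<alpha>(3)] pos[OF \<beta>(1) \<beta>(3)] by (simp_all add: \<alpha>(2) \<beta>(2))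
  have "d * (a + b) = 0" by (simp add: d_def algebra_simps c eq)
  then have z: "d * a * d + d * b * d = 0" by (metis distrib_left distrib_right mult_zero_left)
  then have "d * a * d = - (d * b * d)" by (simp add: eq_neg_iff_add_eq_0)
  then have "d * b * d = 0" using Pos_antisym p by metis
  moreover have "d * a * d = 0" using z calculation by simp
  ultimately have "d * (a - b) * d = 0" by (simp add: algebra_simps)
  then have "d = 0" using sa_cube_eq_zero[OF d] by (simp add: d_def)
  then show ?thesis by (simp add: d_def)
qed

text \<open>Let \<open>q\<close> and \<open>r\<close> be the roots of \<open>p * p\<close> and
  \<open>n * n\<close>, that is, the absolute values. They are orthogonal, so \<open>q + r\<close>
  and \<open>p + n\<close> are two positive roots of the same element and agree by
  \<open>Pos_root_unique\<close>; multiplying by \<open>p\<close> leaves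
  \<open>p * q = p * p\<close>, which forces \<open>q = p\<close>.\<close>

lemma Pos_orth:
  assumes p: "star p = p" and n: "star n = n" and pn: "p * n = 0" and m: "Pos (p + n)"
  shows "Pos p"
proof -
  have np: "n * p = 0" using arg_cong[OF pn, of star] by (simp add: star_simps p n)
  obtain q where q: "Pos q" "q * q = p * p" "\<And>c. c * (p * p) = (p * p) * c \<Longrightarrow> c * q = q * c"
    using Pos_root[OF Pos_square[OF p]] by metis
  obtain r where r: "Pos r" "r * r = n * n" "\<And>c. c * (n * n) = (n * n) * c \<Longrightarrow> c * r = r * c"
    using Pos_root[OF Pos_square[OF n]] by metis
  have nq: "n * q = q * n" by (rule q(3)) (metis mult.assoc np pn mult_zero_left mult_zero_right)
  have pq: "p * q = q * p" by (rule q(3)) (simp add: mult.assoc)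
  have pr: "p * r = r * p" by (rule r(3)) (metis mult.assoc np pn mult_zero_left mult_zero_right)
  have nr: "n * r = r * n" by (rule r(3)) (simp add: mult.assoc)
  have qr: "q * r = r * q" by (rule r(3)) (metis mult.assoc nq)
  have "(q * r) * (q * r) = (q * q) * (r * r)" by (metis mult.assoc qr)
  also have "\<dots> = 0" unfolding q(2) r(2) by (metis mult.assoc pn mult_zero_left mult_zero_right)
  finally have "(q * r) * (q * r) = 0" .
  moreover have "star (q * r) = q * r" by (simp only: star_mult Pos_sa[OF q(1)] Pos_sa[OF r(1)] qr)
  ultimately have qr0: "q * r = 0" by (rule sa_sq_eq_zero[rotated])
  have "(p * r) * (p * r) = p * (r * p) * r" by (simp add: mult.assoc)
  also have "\<dots> = p * (p * n) * n" unfolding pr[symmetric] by (simp add: mult.assoc r(2))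
  also have "\<dots> = 0" by (simp add: pn)
  finally have "(p * r) * (p * r) = 0" .
  moreover have "star (p * r) = p * r" by (simp only: star_mult p Pos_sa[OF r(1)] pr)
  ultimately have pr0: "p * r = 0" by (rule sa_sq_eq_zero[rotated])
  have "q + r = p + n"
  proof (rule Pos_root_unique)
    show "Pos (q + r)" by (intro Pos_add q(1) r(1))
    show "(q + r) * (q + r) = (p + n) * (p + n)"
      using qr0 qr by (simp add: algebra_simps q(2) r(2) pn np)
    show "(q + r) * (p + n) = (p + n) * (q + r)"
      by (simp add: algebra_simps nq nr pq pr)
  qed (rule m)
  then have "p * q + p * r = p * p + p * n" by (metis distrib_left)
  then have "p * q = p * p" using pr0 pn by simp
  then have "(q - p) * (q - p) = 0" using pq q(2) by (simp add: algebra_simps)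
  then have "q = p" using sa_sq_eq_zero[of "q - p"] by (simp add: star_simps Pos_sa q(1) p)
  then show ?thesis using q(1) by simp
qed

text \<open>With \<open>m\<close> the absolute value of \<open>h\<close>, the parts are
  \<open>(m + h) / 2\<close> and \<open>(m - h) / 2\<close>. They are visibly orthogonal, and since
  their sum \<open>m\<close> is positive, \<open>Pos_orth\<close> makes each of them
  positive.\<close>

lemma Pos_parts:
  fixes h :: "'a::cstar"
  assumes h: "star h = h"
  obtains p n where "Pos p" "Pos n" "h = p - n" "p * n = 0" "n * p = 0"
proof -
  obtain m where m: "Pos m" "m * m = h * h" "\<And>c. c * (h * h) = (h * h) * c \<Longrightarrow> c * m = m * c"
    using Pos_root[OF Pos_square[OF h]] by metis
  have hm: "h * m = m * h" by (rule m(3)) (simp add: mult.assoc)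
  define p where "p = (1/2) *\<^sub>R (m + h)"
  define n where "n = (1/2) *\<^sub>R (m - h)"
  have s: "star p = p" "star n = n" by (simp_all add: p_def n_def star_simps Pos_sa m h)
  have pn: "p * n = 0" "n * p = 0" by (simp_all add: p_def n_def algebra_simps hm m(2))
  have "p + n = (1/2) *\<^sub>R (m + m)" "p - n = (1/2) *\<^sub>R (h + h)"
    by (simp_all add: p_def n_def algebra_simps)
  then have sum: "p + n = m" "p - n = h" by (simp_all flip: scaleR_2)
  show ?thesis
  proof
    show "Pos p" by (rule Pos_orth[OF s pn(1)]) (simp add: sum m(1))
    show "Pos n" by (rule Pos_orth[OF s(2,1) pn(2)]) (use sum(1) m(1) in \<open>simp add: add.commute\<close>)
  qed (use sum pn in auto)
qed

text \<open>Put \<open>K = (norm k)\<^sup>2\<close> and \<open>m = k * k\<close>. Real and imaginary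
  parts of \<open>y\<close> show that \<open>y * star y\<close> is positive, so
  \<open>K - y * star y\<close> has norm at most \<open>K\<close>, and
  \<open>z = (K - y * star y) * y\<close> satisfies \<open>(norm z)\<^sup>2 \<le> K ^ 3\<close>. But
  also \<open>z = y * (K + m)\<close>, and \<open>star z * z\<close> is minus a sum of positive
  terms, one of which is \<open>2 K m\<^sup>2\<close> of norm \<open>2 * K ^ 3\<close>.\<close>

lemma star_mult_neg_square:
  fixes y :: "'a::cstar"
  assumes k: "star k = k" and eq: "star y * y = - (k * k)"
  shows "k = 0"
proof (rule ccontr)
  assume "k \<noteq> 0"
  define K where "K = (norm k)\<^sup>2"
  have K: "K > 0" using \<open>k \<noteq> 0\<close> by (simp add: K_def)
  define a where "a = y + star y"
  define b where "b = iu * (star y - y)"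
  have ab: "star a = a" "star b = b" by (simp_all add: a_def b_def star_simps iu_commute algebra_simps)
  have "b * b = iu * (iu * ((star y - y) * (star y - y)))"
    unfolding b_def by (metis mult_iu mult.assoc)
  then have "a * a + b * b = 2 *\<^sub>R (y * star y + star y * y)"
    unfolding iu_iu by (simp add: a_def scaleR_2 algebra_simps)
  then have "y * star y = (1/2) *\<^sub>R (a * a + b * b) + k * k"
    by (simp add: eq)
  moreover have "Pos ((1/2) *\<^sub>R (a * a + b * b) + k * k)"
    by (intro Pos_add Pos_scaleR Pos_square ab k) simp
  ultimately have Py: "Pos (y * star y)" by simp
  have ny: "(norm y)\<^sup>2 = K"
    using cstar_norm[of y] by (simp add: eq norm_sa_sq[OF k] K_def)
  have "norm (y * star y) = K" using cstar_norm[of "star y"] ny by simp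
  then have n1: "norm (K *\<^sub>R 1 - y * star y) \<le> K" using Pos_norm[OF Py] by simp
  define z where "z = K *\<^sub>R y + y * (k * k)"
  have "z = (K *\<^sub>R 1 - y * star y) * y"
    unfolding z_def by (simp add: algebra_simps eq)
  then have "norm z \<le> K * norm y"
    using norm_mult_ineq[of "K *\<^sub>R 1 - y * star y" y] n1
    by (metis mult_right_mono norm_ge_zero order_trans)
  then have nz: "(norm z)\<^sup>2 \<le> K ^ 3"
    using power_mono[of "norm z" "K * norm y" 2] ny by (simp add: power_mult_distrib) (simp add: power3_eq_cube power2_eq_square)
  define m where "m = k * k"
  have m: "star m = m" by (simp add: m_def star_simps k)
  have zm: "z = y * (K *\<^sub>R 1 + m)" by (simp add: z_def m_def algebra_simps)
  have "star z * z = (K *\<^sub>R 1 + m) * (star y * y) * (K *\<^sub>R 1 + m)"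
    by (simp add: zm star_simps m mult.assoc)
  also have "\<dots> = - ((2 * K) *\<^sub>R (m * m) + (K\<^sup>2 *\<^sub>R m + m * m * m))"
    unfolding eq m_def[symmetric]
    by (simp add: algebra_simps power2_eq_square) (simp flip: scaleR_add_left)
  finally have "(norm z)\<^sup>2 = norm ((2 * K) *\<^sub>R (m * m) + (K\<^sup>2 *\<^sub>R m + m * m * m))"
    unfolding cstar_norm[of z, symmetric] by (metis norm_minus_cancel)
  moreover have "norm ((2 * K) *\<^sub>R (m * m)) \<le> norm ((2 * K) *\<^sub>R (m * m) + (K\<^sup>2 *\<^sub>R m + m * m * m))"
  proof (intro Pos_mono Pos_add Pos_scaleR)
    show "Pos (m * m)" by (rule Pos_square[OF m])
    show "Pos m" unfolding m_def by (rule Pos_square[OF k])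
    have "Pos ((k * m) * (k * m))" by (rule Pos_square) (simp add: m_def star_simps k mult.assoc)
    then show "Pos (m * m * m)" by (simp add: m_def mult.assoc)
  qed (use K in auto)
  moreover have "norm ((2 * K) *\<^sub>R (m * m)) = 2 * K ^ 3"
  proof -
    have "norm (m * m) = K\<^sup>2" unfolding norm_sa_sq[OF m] by (simp add: m_def norm_sa_sq[OF k] K_def)
    then show ?thesis using K by (simp add: power3_eq_cube power2_eq_square)
  qed
  ultimately show False using nz K zero_less_power[OF K, of 3] by linarith
qed

text \<open>Kaplansky's argument, with the spectral comparison of \<open>y\<^sup>*y\<close> and \<open>yy\<^sup>*\<close> replaced by a norm
  estimate.\<close>

lemma Pos_star_mult: "Pos (star x * x)"
proof -
  have "star (star x * x) = star x * x" by (simp add: star_simps)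
  then obtain p n where pn: "Pos p" "Pos n" "star x * x = p - n" "p * n = 0" "n * p = 0"
    using Pos_parts by metis
  obtain b where b: "Pos b" "b * b = n" "\<And>c. c * n = n * c \<Longrightarrow> c * b = b * c" using Pos_root[OF pn(2)] by metis
  have bn: "n * b = b * n" by (rule b(3)) simp
  \<comment> \<open>Cutting \<open>x\<close> by the negative part \<open>n\<close> of
    \<open>star x * x\<close> leaves \<open>- n ^ 3\<close>, which is minus the square of the
    selfadjoint \<open>n * b\<close> with \<open>b\<close> the root of \<open>n\<close>; then
    \<open>star_mult_neg_square\<close> applies.\<close>
  have "star (x * n) * (x * n) = n * (star x * x) * n"
    by (simp add: star_simps Pos_sa pn(2) mult.assoc)
  also have "\<dots> = - (n * n * n)" unfolding pn(3) by (simp add: algebra_simps pn(4,5))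
  also have "n * n * n = (n * b) * (n * b)" by (metis b(2) bn mult.assoc)
  finally have eq: "star (x * n) * (x * n) = - ((n * b) * (n * b))" .
  have "n * b = 0" by (rule star_mult_neg_square[OF _ eq]) (simp add: star_simps Pos_sa pn b bn)
  then have "n * n = 0" by (metis b(2) mult.assoc mult_zero_left)
  then have "n = 0" using sa_sq_eq_zero[OF Pos_sa[OF pn(2)]] by simp
  then show ?thesis using pn by simp
qed

lemma star_mult_sum_eq_zero:
  assumes "star x * x + star y * y = 0"
  shows "x = (0::'a::cstar)"
proof -
  have "star x * x = - (star y * y)" using assms by (simp add: eq_neg_iff_add_eq_0)
  moreover have "Pos (star x * x)" "Pos (star y * y)" by (rule Pos_star_mult)+
  ultimately have "star x * x = 0" using Pos_antisym[of "star x * x"] by simp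
  then show ?thesis by (simp add: star_eq_zero)
qed

section \<open>Inverses, polar parts and nearby projections\<close>

lemma neumann:
  fixes y :: "'a::cstar"
  assumes "norm y < 1"
  obtains z where "z * (1 - y) = 1" "(1 - y) * z = 1"
proof -
  have "summable (\<lambda>n. norm (y ^ n))"
    by (rule summable_comparison_test[OF _ summable_geometric[of "norm y"]]) (use assms norm_power_ineq in auto)
  then have s: "(\<lambda>n. y ^ n) sums (\<Sum>n. y ^ n)" by (metis summable_norm_cancel summable_sums)
  have "(\<lambda>n. y ^ Suc n) sums ((\<Sum>n. y ^ n) - 1)" using sums_Suc_iff[of "\<lambda>n. y ^ n"] s by simp
  moreover have "(\<lambda>n. y ^ Suc n) sums (y * (\<Sum>n. y ^ n))" using sums_mult[OF s, of y] by simp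
  moreover have "(\<lambda>n. y ^ Suc n) sums ((\<Sum>n. y ^ n) * y)" using sums_mult2[OF s, of y] by (simp add: power_commutes)
  ultimately have "y * (\<Sum>n. y ^ n) = (\<Sum>n. y ^ n) - 1" "(\<Sum>n. y ^ n) * y = (\<Sum>n. y ^ n) - 1"
    using sums_unique2 by blast+
  then show ?thesis by (intro that[of "\<Sum>n. y ^ n"]) (simp_all add: algebra_simps)
qed

text \<open>Since \<open>norm (1 - s) \<le> norm x < 1\<close>, the root \<open>s\<close> is
  invertible by a Neumann series; the inverse inherits selfadjointness and the commutation
  properties of \<open>s\<close>.\<close>

lemma inv_sqrt_one_minus:
  fixes x :: "'a::cstar"
  assumes x: "star x = x" "norm x < 1"
  obtains k s where "star k = k" "star s = s" "k * s = 1" "s * k = 1" "s * s = 1 - x" "norm (1 - s) \<le> norm x"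
    "\<And>c. c * x = x * c \<Longrightarrow> c * k = k * c" "\<And>c. c * x = x * c \<Longrightarrow> c * s = s * c"
proof -
  obtain s where s: "star s = s" "s * s = 1 - x" "norm (1 - s) \<le> norm x"
    "\<And>c. c * x = x * c \<Longrightarrow> c * s = s * c"
    using sqrt_one_minus[OF x(1)] x(2) by (metis less_imp_le)
  obtain k where k: "k * s = 1" "s * k = 1"
    using neumann[of "1 - s"] s(3) x(2) by auto
  have "star k * s = 1" using arg_cong[OF k(2), of star] by (simp add: star_simps s(1))
  then have "star k = k" using k by (metis mult.assoc mult_1_left mult_1_right)
  moreover have "c * k = k * c" if "c * x = x * c" for c
    using s(4)[OF that] k by (metis mult.assoc mult_1_left mult_1_right)
  ultimately show ?thesis using that k s by blast
qed

text \<open>The defect \<open>x = f - star w * w\<close> lies in the corner of \<open>f\<close>, so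
  \<open>k\<close>, the inverse root of \<open>1 - x\<close> formed in the whole algebra, commutes
  with \<open>f\<close> and normalises \<open>star w * w = f * (1 - x)\<close> to \<open>f\<close>.
  No inverse inside the corner has to be formed.\<close>

lemma polar:
  fixes w :: "'a::cstar"
  assumes f: "star f = f" "f * f = f" and w: "w * f = w" and n: "norm (f - star w * w) < 1"
  obtains k where "star k = k" "star (w * k) * (w * k) = f"
proof -
  define x where "x = f - star w * w"
  have fw: "f * star w = star w" using arg_cong[OF w, of star] by (simp add: star_simps f)
  have fx: "f * x = x" "x * f = x"
    by (simp_all add: x_def algebra_simps f w) (simp_all add: fw flip: mult.assoc)
  have "star x = x" by (simp add: x_def star_simps f)
  then obtain k s where k: "star k = k" "k * s = 1" "s * k = 1" "s * s = 1 - x"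
    "\<And>c. c * x = x * c \<Longrightarrow> c * k = k * c"
    using inv_sqrt_one_minus[of x] n unfolding x_def by metis
  have kf: "f * k = k * f" by (rule k(5)) (simp add: fx)
  have "star (w * k) * (w * k) = k * (star w * w) * k" by (simp add: star_simps k mult.assoc)
  also have "star w * w = f * (1 - x)" by (simp add: algebra_simps fx) (simp add: x_def)
  also have "k * (f * (1 - x)) * k = f * (k * s) * (s * k)" unfolding k(4)[symmetric] by (metis kf mult.assoc)
  finally show ?thesis using that k by simp
qed

text \<open>The element \<open>y = 2 x - 1\<close> satisfies \<open>y * y = 1 - z\<close> with
  \<open>z = 4 (x - x\<^sup>2)\<close>, and \<open>1/4\<close> is exactly the bound that gives
  \<open>norm z < 1\<close>. Dividing \<open>y\<close> by the root \<open>t\<close> of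
  \<open>1 - z\<close> yields its sign, a selfadjoint unitary \<open>\<sigma>\<close>. The
  projection is \<open>(1 + \<sigma>) / 2\<close>, and it differs from \<open>x\<close> by
  \<open>\<sigma> * (1 - t) / 2\<close>.\<close>

lemma projection_near:
  fixes x :: "'a::cstar"
  assumes x: "star x = x" and n: "norm (x * x - x) < 1/4"
  obtains s where "star s = s" "s * s = s" "norm (s - x) \<le> 2 * norm (x * x - x)"
proof -
  define z where "z = 4 *\<^sub>R (x - x * x)"
  define y where "y = 2 *\<^sub>R x - 1"
  have z: "star z = z" "norm z < 1" using n
    by (simp_all add: z_def star_simps x norm_minus_commute)
  have yy: "y * y = 1 - z"
    by (simp add: y_def z_def algebra_simps) (simp flip: scaleR_add_left)
  obtain k t where k: "star k = k" "star t = t" "k * t = 1" "t * k = 1" "t * t = 1 - z" "norm (1 - t) \<le> norm z"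
    "\<And>c. c * z = z * c \<Longrightarrow> c * k = k * c"
    using inv_sqrt_one_minus[OF z] by metis
  have ky: "y * k = k * y" by (rule k(7)) (simp add: y_def z_def algebra_simps)
  define \<sigma> where "\<sigma> = y * k"
  have \<sigma>: "star \<sigma> = \<sigma>" by (simp add: \<sigma>_def star_simps k y_def x) (use ky in \<open>simp add: y_def\<close>)
  have "\<sigma> * \<sigma> = y * y * (k * k)" unfolding \<sigma>_def by (metis ky mult.assoc)
  also have "\<dots> = t * (t * k) * k" by (simp add: yy k(5)[symmetric] mult.assoc)
  finally have \<sigma>2: "\<sigma> * \<sigma> = 1" using k by simp
  then have n\<sigma>: "norm \<sigma> = 1" using norm_sa_sq[OF \<sigma>] by (simp add: power2_eq_1_iff) (use norm_ge_zero[of \<sigma>] in linarith)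
  define s where "s = (1/2) *\<^sub>R (1 + \<sigma>)"
  have "\<sigma> * t = y" using k by (simp add: \<sigma>_def mult.assoc)
  then have "(1/2) *\<^sub>R (\<sigma> * (1 - t)) = (1/2) *\<^sub>R (1 + \<sigma>) - (1/2) *\<^sub>R (y + 1)" by (simp add: algebra_simps)
  then have "s - x = (1/2) *\<^sub>R (\<sigma> * (1 - t))" by (simp add: s_def y_def)
  then have "norm (s - x) \<le> 1/2 * norm z"
    using norm_mult_ineq[of \<sigma> "1 - t"] k(6) n\<sigma> by simp
  also have "\<dots> = 2 * norm (x * x - x)" by (simp add: z_def norm_minus_commute)
  finally show ?thesis
    by (intro that[of s]) (simp_all add: s_def star_simps \<sigma> algebra_simps \<sigma>2 flip: scaleR_2)
qed

section \<open>Two orthogonal pieces, or a minimal projection\<close>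

lemma Pos_conj: "Pos p \<Longrightarrow> Pos (star x * p * x)"
  using Pos_star_mult[of "_ * x"] unfolding Pos_def
proof (elim exE conjE)
  fix s assume "star s = s" "p = s * s"
  then have "star x * p * x = star (s * x) * (s * x)" by (simp add: star_mult mult.assoc)
  then show "\<exists>s. star s = s \<and> star x * p * x = s * s" using Pos_star_mult[of "s * x"] by (simp add: Pos_def)
qed

text \<open>Either two orthogonal nonzero positive elements exist in the right ideal generated by \<open>a\<close>,
  or \<open>a\<^sup>2\<close> is a multiple of a minimal projection.  In the second case the order on the selfadjoint
  part of \<open>aUa\<close> is total, and the constants are found as suprema.\<close>

lemma Pos_total_scalar:
  fixes e y :: "'a::cstar"
  assumes e: "Pos e" and y: "star y = y"
    and tot: "\<And>t. Pos (y - t *\<^sub>R e) \<or> Pos (t *\<^sub>R e - y)"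
    and lo: "Pos (y - l *\<^sub>R e)" and hi: "Pos (u *\<^sub>R e - y)"
  shows "\<exists>t. y = t *\<^sub>R e"
\<comment> \<open>The upper end is treated apart: if it is attained, antisymmetry already gives the
  equality; otherwise \<open>u\<close> bounds the set \<open>T\<close>, because \<open>T\<close> is
  closed downwards.\<close>
proof (cases "Pos (y - u *\<^sub>R e)")
  case True
  then have "y - u *\<^sub>R e = 0" using hi by (intro Pos_antisym) auto
  then show ?thesis by auto
next
  case False
  define T where "T = {t. Pos (y - t *\<^sub>R e)}"
  have down: "s \<in> T" if "t \<in> T" "s \<le> t" for s t
  proof -
    have "Pos ((y - t *\<^sub>R e) + (t - s) *\<^sub>R e)"
      using that by (intro Pos_add Pos_scaleR e) (auto simp: T_def)
    then show ?thesis by (simp add: T_def algebra_simps)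
  qed
  have bdd: "bdd_above T"
  proof (rule bdd_aboveI)
    show "t \<le> u" if "t \<in> T" for t
      using False down[OF that, of u] by (cases "u \<le> t") (auto simp: T_def)
  qed
  have l: "l \<in> T" using lo by (simp add: T_def)
  define t where "t = Sup T"
  have lim: "(\<lambda>n. c / real (Suc n)) \<longlonglongrightarrow> 0" for c :: real
    using tendsto_mult[OF tendsto_const LIMSEQ_inverse_real_of_nat, of c] by (simp add: divide_inverse)
  have "Pos (y - t *\<^sub>R e)"
  proof (rule Pos_limit)
    show "Pos (y - (t - 1 / real (Suc n)) *\<^sub>R e)" for n
    proof -
      obtain s where "s \<in> T" "t - 1 / real (Suc n) < s"
        using less_cSup_iff[of T "t - 1 / real (Suc n)"] l bdd by (auto simp: t_def)
      then show ?thesis using down[of s] by (auto simp: T_def)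
    qed
    have "(\<lambda>n. y - (t - 1 / real (Suc n)) *\<^sub>R e) \<longlonglongrightarrow> y - (t - 0) *\<^sub>R e"
      by (intro tendsto_diff tendsto_scaleR tendsto_const lim)
    then show "(\<lambda>n. y - (t - 1 / real (Suc n)) *\<^sub>R e) \<longlonglongrightarrow> y - t *\<^sub>R e" by simp
  qed
  moreover have "Pos (t *\<^sub>R e - y)"
  proof (rule Pos_limit)
    show "Pos ((t + 1 / real (Suc n)) *\<^sub>R e - y)" for n
    proof -
      have "t + 1 / real (Suc n) \<notin> T"
        using cSup_upper[OF _ bdd, of "t + 1 / real (Suc n)"] unfolding t_def[symmetric] by (force simp: divide_le_0_iff)
      then show ?thesis using tot by (auto simp: T_def)
    qed
    have "(\<lambda>n. (t + 1 / real (Suc n)) *\<^sub>R e - y) \<longlonglongrightarrow> (t + 0) *\<^sub>R e - y"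
      by (intro tendsto_diff tendsto_scaleR tendsto_add tendsto_const lim)
    then show "(\<lambda>n. (t + 1 / real (Suc n)) *\<^sub>R e - y) \<longlonglongrightarrow> t *\<^sub>R e - y" by simp
  qed
  ultimately have "y - t *\<^sub>R e = 0" by (intro Pos_antisym) auto
  then show ?thesis by auto
qed

lemma orthogonal_or_minimal:
  fixes a :: "'a::cstar"
  assumes a: "star a = a" "a \<noteq> 0"
  obtains c d p q where "star p = p" "star q = q" "a * c = p * p" "a * d = q * q"
      "p \<noteq> 0" "q \<noteq> 0" "p * q = 0" "q * p = 0"
  | e t where "e = t *\<^sub>R (a * a)" "star e = e" "e * e = e" "e \<noteq> 0"
      "\<And>y. \<exists>\<alpha> \<beta>. e * y * e = \<alpha> *\<^sub>R e + \<beta> *\<^sub>R (iu * e)"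
\<comment> \<open>The dichotomy is whether some \<open>a * y * a\<close> is indefinite. If so, its
  positive and negative parts are the two pieces, and multiplying \<open>a * y * a\<close> by one of
  them exhibits the square of that part, up to sign, as a right multiple of
  \<open>a\<close>.\<close>
proof (cases "\<exists>y. star y = y \<and> \<not> Pos (a * y * a) \<and> \<not> Pos (- (a * y * a))")
  case True
  then obtain y where y: "star y = y" "\<not> Pos (a * y * a)" "\<not> Pos (- (a * y * a))" by blast
  have "star (a * y * a) = a * y * a" by (simp add: star_simps a y mult.assoc)
  then obtain p n where pn: "Pos p" "Pos n" "a * y * a = p - n" "p * n = 0" "n * p = 0"
    using Pos_parts by metis
  show ?thesis
  proof (rule that(1))
    show "a * (y * a * p) = p * p"
      using arg_cong[OF pn(3), of "\<lambda>z. z * p"] by (simp add: algebra_simps pn(5))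
    show "a * (- (y * a * n)) = n * n"
      using arg_cong[OF pn(3), of "\<lambda>z. - (z * n)"] by (simp add: algebra_simps pn(4))
    show "p \<noteq> 0" using y(3) pn(2,3) by auto
    show "n \<noteq> 0" using y(2) pn(1,3) by auto
  qed (use pn in \<open>simp_all add: Pos_sa\<close>)
next
  case False
  \<comment> \<open>Now every selfadjoint element of the form \<open>a * y * a\<close> is comparable
    with zero, so all of them can be compared with the multiples of \<open>b\<close> and, later, of
    \<open>e\<close>.\<close>
  then have tot: "Pos (a * y * a) \<or> Pos (- (a * y * a))" if "star y = y" for y using that by blast
  define b where "b = a * a"
  have b: "Pos b" "star b = b" by (simp_all add: b_def Pos_square a star_simps)
  have nb: "norm b > 0" using a sa_sq_eq_zero by (auto simp: b_def)
  have up: "Pos (norm b *\<^sub>R b - b * b)"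
    using Pos_conj[OF Pos_norm_minus[OF b(1) order_refl], of a]
    by (simp add: a algebra_simps) (simp add: b_def mult.assoc)
  \<comment> \<open>Totality is applied to \<open>a * (b - t) * a = b * b - t b\<close>, and
    \<open>up\<close> supplies the upper end \<open>norm b\<close> of the interval. Dividing
    \<open>b\<close> by the resulting scalar gives the projection.\<close>
  have "\<exists>t. b * b = t *\<^sub>R b"
  proof (rule Pos_total_scalar[where l=0 and u="norm b"])
    fix t
    have "a * (b - t *\<^sub>R 1) * a = b * b - t *\<^sub>R b" by (simp add: algebra_simps) (simp add: b_def mult.assoc)
    then show "Pos (b * b - t *\<^sub>R b) \<or> Pos (t *\<^sub>R b - b * b)"
      using tot[of "b - t *\<^sub>R 1"] by (simp add: star_simps b)
  qed (use b up in \<open>simp_all add: Pos_square star_simps\<close>)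
  then obtain t where t: "b * b = t *\<^sub>R b" by blast
  have "b * b \<noteq> 0" using sa_sq_eq_zero[OF b(2)] nb by auto
  then have t0: "t \<noteq> 0" using t by auto
  define e where "e = (1 / t) *\<^sub>R b"
  have e: "star e = e" "e * e = e" "e \<noteq> 0" using nb t0 by (auto simp: e_def star_simps b t)
  have Pe: "Pos e" using Pos_square[OF e(1)] by (simp add: e(2))
  have sa: "\<exists>\<alpha>. e * y * e = \<alpha> *\<^sub>R e" if y: "star y = y" for y
  proof (rule Pos_total_scalar[where l="- norm y" and u="norm y"])
    show "star (e * y * e) = e * y * e" by (simp add: star_simps e y mult.assoc)
    have pos: "Pos (norm y *\<^sub>R 1 + y)" "Pos (norm y *\<^sub>R 1 - y)"
      by (rule PosI[where t="norm y"]; simp add: star_simps y)+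
    show "Pos (e * y * e - - norm y *\<^sub>R e)" "Pos (norm y *\<^sub>R e - e * y * e)"
      using Pos_conj[OF pos(1), of e] Pos_conj[OF pos(2), of e] by (simp_all add: e algebra_simps)
    fix s
    \<comment> \<open>Both factors \<open>e\<close> are multiples of \<open>a * a\<close>, so the
      compressed element again has the form \<open>a * _ * a\<close> and totality applies to
      it.\<close>
    have "a * ((1 / t * (1 / t)) *\<^sub>R (a * (y - s *\<^sub>R 1) * a)) * a = e * (y - s *\<^sub>R 1) * e"
      by (simp add: e_def b_def mult.assoc)
    also have "\<dots> = e * y * e - s *\<^sub>R e" by (simp add: algebra_simps e)
    finally show "Pos (e * y * e - s *\<^sub>R e) \<or> Pos (s *\<^sub>R e - e * y * e)"
      using tot[of "(1 / t * (1 / t)) *\<^sub>R (a * (y - s *\<^sub>R 1) * a)"] by (simp add: star_simps a y mult.assoc)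
  qed (rule Pe)
  have "\<exists>\<alpha> \<beta>. e * y * e = \<alpha> *\<^sub>R e + \<beta> *\<^sub>R (iu * e)" for y
  proof -
    define u v where "u = y + star y" and "v = iu * (star y - y)"
    have "star u = u" "star v = v" by (simp_all add: u_def v_def star_simps iu_commute algebra_simps)
    then obtain \<alpha> \<beta> where "e * u * e = \<alpha> *\<^sub>R e" "e * v * e = \<beta> *\<^sub>R e" using sa by metis
    moreover have "2 *\<^sub>R (e * y * e) = e * u * e + iu * (e * v * e)"
    proof -
      have "iu * (e * v * e) = e * (iu * v) * e" by (metis iu_commute mult.assoc)
      also have "iu * v = y - star y" by (simp add: v_def iu_iu)
      finally show ?thesis by (simp add: u_def algebra_simps scaleR_2)
    qed
    ultimately have "2 *\<^sub>R (e * y * e) = 2 *\<^sub>R ((\<alpha> / 2) *\<^sub>R e + (\<beta> / 2) *\<^sub>R (iu * e))"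
      by (simp add: algebra_simps)
    then have "e * y * e = (\<alpha> / 2) *\<^sub>R e + (\<beta> / 2) *\<^sub>R (iu * e)" by (simp only: scaleR_cancel_left) simp
    then show ?thesis by blast
  qed
  then show ?thesis using that(2)[OF _ e, of "1 / t"] by (simp add: e_def b_def)
qed

section \<open>Embedding carrier-based algebras into one type\<close>

context cstar_algebra begin

lemma zero_add: "x \<in> carrier A \<Longrightarrow> \<zero> \<oplus> x = x"
  using add_commute add_zero zero_closed by metis

lemma zero_scale: "x \<in> carrier A \<Longrightarrow> 0 \<odot> x = \<zero>"
  using scale_add_left[of x 1 "-1"] add_minus scale_one by simp

lemma scale_zero: "c \<odot> \<zero> = \<zero>"
  using scale_scale[OF zero_closed, of c 0] zero_scale[OF zero_closed] by simp

lemma zero_mult: "x \<in> carrier A \<Longrightarrow> \<zero> \<otimes> x = \<zero>"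
  using mult_scale_left[OF zero_closed, of x 0] zero_scale mult_closed zero_closed by metis

lemma mult_zero: "x \<in> carrier A \<Longrightarrow> x \<otimes> \<zero> = \<zero>"
  using mult_scale_right[OF _ zero_closed, of x 0] zero_scale mult_closed zero_closed by metis

lemma adj_zero: "adj A \<zero> = \<zero>"
  using adj_scale[OF zero_closed, of 0] zero_scale adj_closed zero_closed by simp

lemma nrm_zero: "nrm A \<zero> = 0"
  using nrm_eq_zero zero_closed by blast

lemma nrm_adj: assumes "x \<in> carrier A" shows "nrm A (adj A x) = nrm A x"
proof -
  have le: "nrm A y \<le> nrm A (adj A y)" if y: "y \<in> carrier A" for y
  proof (cases "nrm A y = 0")
    case True
    then show ?thesis using nrm_nonneg adj_closed y by simp
  next
    case False
    then have "nrm A y > 0" using nrm_nonneg[OF y] by simp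
    moreover have "nrm A y * nrm A y \<le> nrm A (adj A y) * nrm A y"
      using nrm_cstar[OF y] nrm_mult[of "adj A y" y] y adj_closed by (simp add: power2_eq_square)
    ultimately show ?thesis by simp
  qed
  show ?thesis using le[OF assms] le[OF adj_closed[OF assms]] adj_adj[OF assms] by simp
qed

lemma diff_closed: "x \<in> carrier A \<Longrightarrow> y \<in> carrier A \<Longrightarrow> x \<ominus> y \<in> carrier A"
  by (simp add: diff_def add_closed scale_closed)

lemma is_unit_unique: "is_unit A e \<Longrightarrow> is_unit A f \<Longrightarrow> e = f"
  unfolding is_unit_def by metis

lemma one_eq: "is_unit A e \<Longrightarrow> \<one> = e"
  unfolding one_def using is_unit_unique by blast

lemma is_unit_one: "unital A \<Longrightarrow> is_unit A \<one>"
  unfolding unital_def using one_eq by auto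

lemma adj_unit: assumes e: "is_unit A e" shows "adj A e = e"
proof -
  have c: "e \<in> carrier A" "adj A e \<in> carrier A" using e adj_closed by (auto simp: is_unit_def)
  have "adj A e \<otimes> e = adj A e" using e c by (simp add: is_unit_def)
  moreover have "adj A (adj A e \<otimes> e) = adj A e \<otimes> e" using c by (simp add: adj_mult adj_adj)
  ultimately show ?thesis using c by (simp add: adj_adj)
qed

lemma nrm_unit_le: assumes e: "is_unit A e" shows "nrm A e \<le> 1"
proof -
  have c: "e \<in> carrier A" using e by (auto simp: is_unit_def)
  have "adj A e \<otimes> e = e" using adj_unit[OF e] e c by (simp add: is_unit_def)
  then have "nrm A e * nrm A e = nrm A e * 1" using nrm_cstar[OF c] by (simp add: power2_eq_square)
  then show ?thesis by (metis less_eq_real_def mult_left_cancel zero_le_one)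
qed

end

section \<open>One Banach algebra type for all unital C*-algebras on a carrier type\<close>

definition ucstar :: "'a calg set" where
  "ucstar = {A. cstar_algebra A \<and> unital A}"

lemma ucstarI: "cstar_algebra A \<Longrightarrow> unital A \<Longrightarrow> A \<in> ucstar"
  by (simp add: ucstar_def)

lemma ucstarD: "A \<in> ucstar \<Longrightarrow> cstar_algebra A" "A \<in> ucstar \<Longrightarrow> unital A"
  by (simp_all add: ucstar_def)

lemma ucstar_one:
  assumes "A \<in> ucstar"
  shows "\<one>\<^bsub>A\<^esub> \<in> carrier A" "x \<in> carrier A \<Longrightarrow> \<one>\<^bsub>A\<^esub> \<otimes>\<^bsub>A\<^esub> x = x"
    "x \<in> carrier A \<Longrightarrow> x \<otimes>\<^bsub>A\<^esub> \<one>\<^bsub>A\<^esub> = x" "nrm A \<one>\<^bsub>A\<^esub> \<le> 1" "adj A \<one>\<^bsub>A\<^esub> = \<one>\<^bsub>A\<^esub>"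
  using cstar_algebra.is_unit_one[OF ucstarD[OF assms]]
    cstar_algebra.nrm_unit_le[OF ucstarD(1)[OF assms]] cstar_algebra.adj_unit[OF ucstarD(1)[OF assms]]
  by (auto simp: is_unit_def)

text \<open>The product of all unital C*-algebras carried by one type is itself a type.  The factor
  \<^typ>\<open>complex\<close> only ensures that the product is nonzero.\<close>

definition univ_set :: "(complex \<times> ('a calg \<Rightarrow> 'a)) set" where
  "univ_set = {(z, F). (\<forall>A\<in>ucstar. F A \<in> carrier A) \<and> (\<forall>A. A \<notin> ucstar \<longrightarrow> F A = undefined) \<and>
     (\<exists>M. \<forall>A\<in>ucstar. nrm A (F A) \<le> M)}"

lemma univ_setI:
  assumes "\<And>A. A \<in> ucstar \<Longrightarrow> F A \<in> carrier A" "\<And>A. A \<in> ucstar \<Longrightarrow> nrm A (F A) \<le> M"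
  shows "(z, \<lambda>A. if A \<in> ucstar then F A else undefined) \<in> univ_set"
  using assms by (auto simp: univ_set_def)

typedef 'a univ = "univ_set :: (complex \<times> ('a calg \<Rightarrow> 'a)) set"
proof
  show "(0, \<lambda>A. if A \<in> ucstar then \<zero>\<^bsub>A\<^esub> else undefined) \<in> univ_set"
    by (rule univ_setI[where M=0])
      (auto dest!: ucstarD(1) intro: cstar_algebra.zero_closed simp: cstar_algebra.nrm_zero)
qed

definition cpt :: "'a univ \<Rightarrow> complex" where "cpt x = fst (Rep_univ x)"
definition ev :: "'a calg \<Rightarrow> 'a univ \<Rightarrow> 'a" where "ev A x = snd (Rep_univ x) A"
text \<open>The value \<open>undefined\<close> off \<open>ucstar\<close> makes an element depend
  only on its meaningful coordinates, as \<open>univ_set\<close> demands and \<open>univ_eqI\<close>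
  uses.\<close>

definition mk :: "complex \<Rightarrow> ('a calg \<Rightarrow> 'a) \<Rightarrow> 'a univ" where
  "mk z F = Abs_univ (z, \<lambda>A. if A \<in> ucstar then F A else undefined)"

lemma ev_closed: "A \<in> ucstar \<Longrightarrow> ev A x \<in> carrier A"
  using Rep_univ[of x] by (auto simp: univ_set_def ev_def)

lemma ev_bounded: "\<exists>M. \<forall>A\<in>ucstar. nrm A (ev A x) \<le> M"
  using Rep_univ[of x] by (simp add: univ_set_def ev_def case_prod_beta)

lemma univ_eqI:
  assumes "cpt x = cpt y" "\<And>A. A \<in> ucstar \<Longrightarrow> ev A x = ev A y"
  shows "x = y"
proof -
  obtain z F w G where r: "Rep_univ x = (z, F)" "Rep_univ y = (w, G)" by (metis surj_pair)
  have "F A = G A" for A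
    using assms(2)[of A] Rep_univ[of x] Rep_univ[of y] by (cases "A \<in> ucstar") (auto simp: r ev_def univ_set_def)
  then show ?thesis using assms(1) r by (metis Rep_univ_inject cpt_def ext fst_conv)
qed

lemma
  assumes "\<And>A. A \<in> ucstar \<Longrightarrow> F A \<in> carrier A" "\<And>A. A \<in> ucstar \<Longrightarrow> nrm A (F A) \<le> M"
  shows cpt_mk: "cpt (mk z F) = z" and ev_mk: "A \<in> ucstar \<Longrightarrow> ev A (mk z F) = F A"
  by (simp_all add: cpt_def ev_def mk_def Abs_univ_inverse[OF univ_setI[OF assms]])

text \<open>Plain constants beside the class operations: \<open>dist\<close>, \<open>sgn\<close>,
  the uniformity and the open sets of the instance are expressed through them directly.\<close>

definition univ_plus :: "'a univ \<Rightarrow> 'a univ \<Rightarrow> 'a univ" where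
  "univ_plus x y = mk (cpt x + cpt y) (\<lambda>A. ev A x \<oplus>\<^bsub>A\<^esub> ev A y)"
definition univ_scale :: "real \<Rightarrow> 'a univ \<Rightarrow> 'a univ" where
  "univ_scale r x = mk (r *\<^sub>R cpt x) (\<lambda>A. complex_of_real r \<odot>\<^bsub>A\<^esub> ev A x)"
definition univ_norm :: "'a univ \<Rightarrow> real" where
  "univ_norm x = Sup (insert (cmod (cpt x)) ((\<lambda>A. nrm A (ev A x)) ` ucstar))"

instantiation univ :: (type) real_normed_algebra_1
begin

definition "0 = mk 0 (\<lambda>A. \<zero>\<^bsub>A\<^esub>)"
definition "1 = mk 1 (\<lambda>A. \<one>\<^bsub>A\<^esub>)"
definition "x + y = univ_plus x y"
definition "x * y = mk (cpt x * cpt y) (\<lambda>A. ev A x \<otimes>\<^bsub>A\<^esub> ev A y)"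
definition "r *\<^sub>R x = univ_scale r x"
definition "- x = univ_scale (- 1) x"
definition "x - y = univ_plus x (univ_scale (- 1) y)"
definition "norm x = univ_norm x"
definition "dist x y = univ_norm (univ_plus x (univ_scale (- 1) y))"
definition "sgn x = univ_scale (inverse (univ_norm x)) x"
definition "(uniformity :: ('a univ \<times> 'a univ) filter) =
  (INF e\<in>{0 <..}. principal {(x, y). univ_norm (univ_plus x (univ_scale (- 1) y)) < e})"
definition "open (U :: 'a univ set) = (\<forall>x\<in>U. eventually (\<lambda>(x', y). x' = x \<longrightarrow> y \<in> U)
  (INF e\<in>{0 <..}. principal {(x, y). univ_norm (univ_plus x (univ_scale (- 1) y)) < e}))"

lemmas univ_defs = plus_univ_def[symmetric] scaleR_univ_def[symmetric] norm_univ_def[symmetric]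

lemma norm_univ_le_iff: "norm x \<le> c \<longleftrightarrow> cmod (cpt x) \<le> c \<and> (\<forall>A\<in>ucstar. nrm A (ev A x) \<le> c)"
proof -
  obtain M where "\<forall>A\<in>ucstar. nrm A (ev A x) \<le> M" using ev_bounded by blast
  then have "bdd_above (insert (cmod (cpt x)) ((\<lambda>A. nrm A (ev A x)) ` ucstar))" by auto
  then show ?thesis unfolding norm_univ_def univ_norm_def by (subst cSup_le_iff) auto
qed

lemma cpt_le_norm: "cmod (cpt x) \<le> norm x" and nrm_ev_le_norm: "A \<in> ucstar \<Longrightarrow> nrm A (ev A x) \<le> norm x"
  using norm_univ_le_iff[of x "norm x"] by auto

lemma zero_univ [simp]: "cpt 0 = 0" "A \<in> ucstar \<Longrightarrow> ev A 0 = \<zero>\<^bsub>A\<^esub>"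
proof -
  have "\<And>A. A \<in> ucstar \<Longrightarrow> \<zero>\<^bsub>A\<^esub> \<in> carrier A" "\<And>A. A \<in> ucstar \<Longrightarrow> nrm A \<zero>\<^bsub>A\<^esub> \<le> 0"
    by (auto dest!: ucstarD(1) intro: cstar_algebra.zero_closed simp: cstar_algebra.nrm_zero)
  from cpt_mk[OF this] ev_mk[OF this] show "cpt 0 = 0" "A \<in> ucstar \<Longrightarrow> ev A 0 = \<zero>\<^bsub>A\<^esub>"
    by (simp_all add: zero_univ_def)
qed

lemma one_univ [simp]: "cpt 1 = 1" "A \<in> ucstar \<Longrightarrow> ev A 1 = \<one>\<^bsub>A\<^esub>"
proof -
  from cpt_mk[OF ucstar_one(1,4)] ev_mk[OF ucstar_one(1,4)] show "cpt 1 = 1" "A \<in> ucstar \<Longrightarrow> ev A 1 = \<one>\<^bsub>A\<^esub>"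
    by (simp_all add: one_univ_def)
qed

lemma plus_univ [simp]:
  "cpt (x + y) = cpt x + cpt y" "A \<in> ucstar \<Longrightarrow> ev A (x + y) = ev A x \<oplus>\<^bsub>A\<^esub> ev A y"
proof -
  have "ev A x \<oplus>\<^bsub>A\<^esub> ev A y \<in> carrier A \<and> nrm A (ev A x \<oplus>\<^bsub>A\<^esub> ev A y) \<le> norm x + norm y"
    if A: "A \<in> ucstar" for A
    using cstar_algebra.add_closed[OF ucstarD(1)[OF A] ev_closed[OF A] ev_closed[OF A]]
      cstar_algebra.nrm_triangle[OF ucstarD(1)[OF A] ev_closed[OF A] ev_closed[OF A], of x y]
      nrm_ev_le_norm[OF A, of x] nrm_ev_le_norm[OF A, of y] by auto
  then have *: "\<And>A. A \<in> ucstar \<Longrightarrow> ev A x \<oplus>\<^bsub>A\<^esub> ev A y \<in> carrier A"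
    "\<And>A. A \<in> ucstar \<Longrightarrow> nrm A (ev A x \<oplus>\<^bsub>A\<^esub> ev A y) \<le> norm x + norm y" by auto
  show "cpt (x + y) = cpt x + cpt y" "A \<in> ucstar \<Longrightarrow> ev A (x + y) = ev A x \<oplus>\<^bsub>A\<^esub> ev A y"
    unfolding plus_univ_def univ_plus_def by (rule cpt_mk[OF *] ev_mk[OF *]; assumption)+
qed

lemma times_univ [simp]:
  "cpt (x * y) = cpt x * cpt y" "A \<in> ucstar \<Longrightarrow> ev A (x * y) = ev A x \<otimes>\<^bsub>A\<^esub> ev A y"
proof -
  have "ev A x \<otimes>\<^bsub>A\<^esub> ev A y \<in> carrier A \<and> nrm A (ev A x \<otimes>\<^bsub>A\<^esub> ev A y) \<le> norm x * norm y"
    if A: "A \<in> ucstar" for A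
  proof -
    have "nrm A (ev A x) * nrm A (ev A y) \<le> norm x * norm y"
      using nrm_ev_le_norm[OF A, of x] nrm_ev_le_norm[OF A, of y]
        cstar_algebra.nrm_nonneg[OF ucstarD(1)[OF A] ev_closed[OF A]]
      by (meson mult_mono order_trans)
    then show ?thesis
      using cstar_algebra.mult_closed[OF ucstarD(1)[OF A] ev_closed[OF A] ev_closed[OF A]]
      cstar_algebra.nrm_mult[OF ucstarD(1)[OF A] ev_closed[OF A] ev_closed[OF A], of x y] by auto
  qed
  then have *: "\<And>A. A \<in> ucstar \<Longrightarrow> ev A x \<otimes>\<^bsub>A\<^esub> ev A y \<in> carrier A"
    "\<And>A. A \<in> ucstar \<Longrightarrow> nrm A (ev A x \<otimes>\<^bsub>A\<^esub> ev A y) \<le> norm x * norm y" by auto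
  show "cpt (x * y) = cpt x * cpt y" "A \<in> ucstar \<Longrightarrow> ev A (x * y) = ev A x \<otimes>\<^bsub>A\<^esub> ev A y"
    unfolding times_univ_def by (rule cpt_mk[OF *] ev_mk[OF *]; assumption)+
qed

lemma scaleR_univ [simp]:
  "cpt (r *\<^sub>R x) = r *\<^sub>R cpt x" "A \<in> ucstar \<Longrightarrow> ev A (r *\<^sub>R x) = complex_of_real r \<odot>\<^bsub>A\<^esub> ev A x"
proof -
  have "complex_of_real r \<odot>\<^bsub>A\<^esub> ev A x \<in> carrier A \<and> nrm A (complex_of_real r \<odot>\<^bsub>A\<^esub> ev A x) \<le> \<bar>r\<bar> * norm x"
    if A: "A \<in> ucstar" for A
    using cstar_algebra.scale_closed[OF ucstarD(1)[OF A] ev_closed[OF A]]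
      cstar_algebra.nrm_scale[OF ucstarD(1)[OF A] ev_closed[OF A], of "complex_of_real r" x]
      nrm_ev_le_norm[OF A, of x] by (auto intro: mult_left_mono)
  then have *: "\<And>A. A \<in> ucstar \<Longrightarrow> complex_of_real r \<odot>\<^bsub>A\<^esub> ev A x \<in> carrier A"
    "\<And>A. A \<in> ucstar \<Longrightarrow> nrm A (complex_of_real r \<odot>\<^bsub>A\<^esub> ev A x) \<le> \<bar>r\<bar> * norm x" by auto
  show "cpt (r *\<^sub>R x) = r *\<^sub>R cpt x" "A \<in> ucstar \<Longrightarrow> ev A (r *\<^sub>R x) = complex_of_real r \<odot>\<^bsub>A\<^esub> ev A x"
    unfolding scaleR_univ_def univ_scale_def by (rule cpt_mk[OF *] ev_mk[OF *]; assumption)+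
qed

lemma uminus_univ [simp]:
  "cpt (- x) = - cpt x" "A \<in> ucstar \<Longrightarrow> ev A (- x) = (- 1) \<odot>\<^bsub>A\<^esub> ev A x"
  by (simp_all add: uminus_univ_def univ_defs)

lemma minus_univ [simp]:
  "cpt (x - y) = cpt x - cpt y" "A \<in> ucstar \<Longrightarrow> ev A (x - y) = ev A x \<ominus>\<^bsub>A\<^esub> ev A y"
  by (simp_all add: minus_univ_def diff_def univ_defs)

instance
proof
  fix x y z :: "'a univ" and r s :: real
  note cl = ev_closed and D = ucstarD(1)
  show "x + y + z = x + (y + z)"
    by (rule univ_eqI) (simp_all add: cstar_algebra.add_assoc[OF D] cl add.assoc)
  show "x + y = y + x"
    by (rule univ_eqI) (simp_all add: cstar_algebra.add_commute[OF D] cl)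
  show "0 + x = x"
    by (rule univ_eqI) (simp_all add: cstar_algebra.zero_add[OF D] cl)
  show "- x + x = 0"
    by (rule univ_eqI) (simp_all add: cstar_algebra.add_minus[OF D] cstar_algebra.add_commute[OF D _ cl]
       cstar_algebra.scale_closed[OF D] cl)
  show "x - y = x + - y" by (simp add: minus_univ_def uminus_univ_def univ_defs)
  show "r *\<^sub>R (x + y) = r *\<^sub>R x + r *\<^sub>R y"
    by (rule univ_eqI) (simp_all add: cstar_algebra.scale_add_right[OF D] cl scaleR_add_right)
  show "(r + s) *\<^sub>R x = r *\<^sub>R x + s *\<^sub>R x"
    by (rule univ_eqI) (simp_all add: cstar_algebra.scale_add_left[OF D] cl scaleR_add_left)
  show "r *\<^sub>R s *\<^sub>R x = (r * s) *\<^sub>R x"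
    by (rule univ_eqI) (simp_all add: cstar_algebra.scale_scale[OF D] cl)
  show "1 *\<^sub>R x = x"
    by (rule univ_eqI) (simp_all add: cstar_algebra.scale_one[OF D] cl)
  show "x * y * z = x * (y * z)"
    by (rule univ_eqI) (simp_all add: cstar_algebra.mult_assoc[OF D] cl mult.assoc)
  show "(x + y) * z = x * z + y * z"
    by (rule univ_eqI) (simp_all add: cstar_algebra.mult_add_left[OF D] cl algebra_simps)
  show "x * (y + z) = x * y + x * z"
    by (rule univ_eqI) (simp_all add: cstar_algebra.mult_add_right[OF D] cl algebra_simps)
  show "r *\<^sub>R x * y = r *\<^sub>R (x * y)"
    by (rule univ_eqI) (simp_all add: cstar_algebra.mult_scale_left[OF D] cl)
  show "x * r *\<^sub>R y = r *\<^sub>R (x * y)"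
    by (rule univ_eqI) (simp_all add: cstar_algebra.mult_scale_right[OF D] cl)
  show "1 * x = x"
    by (rule univ_eqI) (simp_all add: ucstar_one cl)
  show "x * 1 = x"
    by (rule univ_eqI) (simp_all add: ucstar_one cl)
  show "(0 :: 'a univ) \<noteq> 1"
    using zero_univ(1) one_univ(1) by (metis zero_neq_one)
  show "dist x y = norm (x - y)" by (simp add: dist_univ_def minus_univ_def univ_defs)
  show "sgn x = scaleR (inverse (norm x)) x" by (simp add: sgn_univ_def univ_defs)
  show "(uniformity :: ('a univ \<times> 'a univ) filter) = (INF e\<in>{0 <..}. principal {(x, y). dist x y < e})"
    by (simp add: uniformity_univ_def dist_univ_def)
  show "open U = (\<forall>x\<in>U. eventually (\<lambda>(x', y). x' = x \<longrightarrow> y \<in> U) uniformity)" for U :: "'a univ set"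
    by (simp add: open_univ_def uniformity_univ_def)
  have nn: "0 \<le> norm u" for u :: "'a univ" using cpt_le_norm[of u] by (meson norm_ge_zero order_trans)
  have nz: "norm (0 :: 'a univ) \<le> 0"
    by (simp add: norm_univ_le_iff cstar_algebra.nrm_zero[OF D])
  show "(norm x = 0) = (x = 0)"
  proof
    assume "norm x = 0"
    then have le: "cmod (cpt x) \<le> 0" "\<And>A. A \<in> ucstar \<Longrightarrow> nrm A (ev A x) \<le> 0"
      using norm_univ_le_iff[of x 0] by auto
    show "x = 0"
    proof (rule univ_eqI)
      show "ev A x = ev A 0" if A: "A \<in> ucstar" for A
        using le(2)[OF A] cstar_algebra.nrm_nonneg[OF D[OF A] cl[OF A], of x]
          cstar_algebra.nrm_eq_zero[OF D[OF A] cl[OF A], of x] A by simp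
    qed (use le in simp)
  qed (use nz nn[of 0] in auto)
  show "norm (x + y) \<le> norm x + norm y"
    unfolding norm_univ_le_iff
  proof safe
    show "cmod (cpt (x + y)) \<le> norm x + norm y"
      using cpt_le_norm[of x] cpt_le_norm[of y] norm_triangle_ineq[of "cpt x" "cpt y"] by simp
    show "nrm A (ev A (x + y)) \<le> norm x + norm y" if A: "A \<in> ucstar" for A
      using cstar_algebra.nrm_triangle[OF D[OF A] cl[OF A] cl[OF A], of x y]
        nrm_ev_le_norm[OF A, of x] nrm_ev_le_norm[OF A, of y] A by simp
  qed
  have sc: "norm (t *\<^sub>R u) \<le> \<bar>t\<bar> * norm u" for t and u :: "'a univ"
    unfolding norm_univ_le_iff
    using cpt_le_norm[of u] nrm_ev_le_norm[of _ u]
    by (auto simp: cstar_algebra.nrm_scale[OF D] cl intro: mult_left_mono)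
  show "norm (r *\<^sub>R x) = \<bar>r\<bar> * norm x"
  proof (cases "r = 0")
    case True
    then show ?thesis using sc[of 0 x] nn[of "0 *\<^sub>R x"] by simp
  next
    case False
    then have "(1 / r) *\<^sub>R (r *\<^sub>R x) = x"
      by (intro univ_eqI) (simp_all add: cstar_algebra.scale_scale[OF D] cstar_algebra.scale_one[OF D] cl flip: of_real_mult)
    then have "norm x \<le> \<bar>1 / r\<bar> * norm (r *\<^sub>R x)" using sc[of "1 / r" "r *\<^sub>R x"] by simp
    then have "\<bar>r\<bar> * norm x \<le> norm (r *\<^sub>R x)" using False by (simp add: field_simps)
    then show ?thesis using sc[of r x] by simp
  qed
  show "norm (x * y) \<le> norm x * norm y"
    unfolding norm_univ_le_iff
  proof safe
    show "cmod (cpt (x * y)) \<le> norm x * norm y"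
      using cpt_le_norm[of x] cpt_le_norm[of y] nn by (simp add: norm_mult mult_mono)
    show "nrm A (ev A (x * y)) \<le> norm x * norm y" if A: "A \<in> ucstar" for A
    proof -
      have "nrm A (ev A x) * nrm A (ev A y) \<le> norm x * norm y"
        using nrm_ev_le_norm[OF A, of x] nrm_ev_le_norm[OF A, of y]
          cstar_algebra.nrm_nonneg[OF D[OF A] cl[OF A]] nn by (intro mult_mono)
      then show ?thesis
        using cstar_algebra.nrm_mult[OF D[OF A] cl[OF A] cl[OF A], of x y] A by simp
    qed
  qed
  have "norm (1 :: 'a univ) \<le> 1"
    unfolding norm_univ_le_iff by (simp add: ucstar_one(4))
  then show "norm (1 :: 'a univ) = 1" using cpt_le_norm[of "1 :: 'a univ"] by simp
qed

end

lemma norm_univ_less: "0 < e \<Longrightarrow> norm x \<le> e / 2 \<Longrightarrow> norm (x :: 'a univ) < e"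
  by simp

instance univ :: (type) banach
proof
  fix X :: "nat \<Rightarrow> 'a univ" assume C: "Cauchy X"
  note cl = ev_closed and D = ucstarD(1)
  have C': "\<exists>N. \<forall>m\<ge>N. \<forall>n\<ge>N. norm (X m - X n) \<le> e" if "0 < e" for e
    using CauchyD[OF C that] less_imp_le by metis
  have "Cauchy (\<lambda>n. cpt (X n))"
  proof (rule CauchyI)
    fix e :: real assume "0 < e"
    then obtain N where N: "\<And>m n. m \<ge> N \<Longrightarrow> n \<ge> N \<Longrightarrow> norm (X m - X n) < e" using CauchyD[OF C] by metis
    show "\<exists>N. \<forall>m\<ge>N. \<forall>n\<ge>N. norm (cpt (X m) - cpt (X n)) < e"
      using cpt_le_norm[of "X _ - X _"] N by (intro exI[of _ N] allI impI) (metis minus_univ(1) order_le_less_trans)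
  qed
  then obtain z where z: "(\<lambda>n. cpt (X n)) \<longlonglongrightarrow> z" by (metis Cauchy_convergent convergent_def)
  have "\<exists>l\<in>carrier A. (\<lambda>n. nrm A (ev A (X n) \<ominus>\<^bsub>A\<^esub> l)) \<longlonglongrightarrow> 0" if A: "A \<in> ucstar" for A
  proof -
    interpret cstar_algebra A by (rule D[OF A])
    interpret Metric_space "carrier A" "cdist A" by (rule Metric_space_cdist)
    have "MCauchy (\<lambda>n. ev A (X n))"
      unfolding MCauchy_def
    proof safe
      fix e :: real assume "0 < e"
      then obtain N where N: "\<And>m n. m \<ge> N \<Longrightarrow> n \<ge> N \<Longrightarrow> norm (X m - X n) < e" using CauchyD[OF C] by metis
      have "cdist A (ev A (X m)) (ev A (X n)) < e" if "N \<le> m" "N \<le> n" for m n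
        using nrm_ev_le_norm[OF A, of "X m - X n"] N[OF that] A cl[OF A] by (simp add: cdist_def)
      then show "\<exists>N. \<forall>n n'. N \<le> n \<longrightarrow> N \<le> n' \<longrightarrow> cdist A (ev A (X n)) (ev A (X n')) < e" by blast
    qed (use cl[OF A] in auto)
    then obtain l where l: "limitin mtopology (\<lambda>n. ev A (X n)) l sequentially"
      using complete unfolding mcomplete_def by blast
    then have "l \<in> carrier A" "(\<lambda>n. cdist A (ev A (X n)) l) \<longlonglongrightarrow> 0"
      unfolding limitin_metric_dist_null by auto
    then show ?thesis using cl[OF A] by (intro bexI[of _ l]) (auto simp: cdist_def)
  qed
  then obtain l where l: "\<And>A. A \<in> ucstar \<Longrightarrow> l A \<in> carrier A"
    "\<And>A. A \<in> ucstar \<Longrightarrow> (\<lambda>n. nrm A (ev A (X n) \<ominus>\<^bsub>A\<^esub> l A)) \<longlonglongrightarrow> 0" by metis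
  \<comment> \<open>The bound is uniform in \<open>A\<close>; the triangle inequality is taken to
    the limit in the second index only. It yields first the boundedness of the family
    \<open>l\<close>, so that \<open>mk z l\<close> has the right coordinates, and then convergence
    in the supremum norm.\<close>
  have lim_le: "nrm A (ev A (X m) \<ominus>\<^bsub>A\<^esub> l A) \<le> e"
    if A: "A \<in> ucstar" and N: "\<And>n. n \<ge> N \<Longrightarrow> norm (X m - X n) \<le> e" for A m N e
  proof -
    interpret cstar_algebra A by (rule D[OF A])
    interpret Metric_space "carrier A" "cdist A" by (rule Metric_space_cdist)
    have "nrm A (ev A (X m) \<ominus>\<^bsub>A\<^esub> l A) \<le> e + nrm A (ev A (X n) \<ominus>\<^bsub>A\<^esub> l A)" if "n \<ge> N" for n
      using triangle[OF cl[OF A] cl[OF A] l(1)[OF A], of "X m" "X n"] nrm_ev_le_norm[OF A, of "X m - X n"] N[OF that] A cl[OF A] l(1)[OF A]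
      by (simp add: cdist_def)
    then have "nrm A (ev A (X m) \<ominus>\<^bsub>A\<^esub> l A) \<le> e + 0"
      by (intro LIMSEQ_le_const[OF tendsto_add[OF tendsto_const l(2)[OF A]]]) blast
    then show ?thesis by simp
  qed
  obtain N1 where N1: "\<And>m n. m \<ge> N1 \<Longrightarrow> n \<ge> N1 \<Longrightarrow> norm (X m - X n) \<le> 1" using C'[of 1] by auto
  have "nrm A (l A) \<le> norm (X N1) + 1" if A: "A \<in> ucstar" for A
  proof -
    interpret cstar_algebra A by (rule D[OF A])
    interpret Metric_space "carrier A" "cdist A" by (rule Metric_space_cdist)
    have e: "x \<ominus>\<^bsub>A\<^esub> \<zero>\<^bsub>A\<^esub> = x" if "x \<in> carrier A" for x using that by (simp add: diff_def scale_zero add_zero)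
    have L: "nrm A (ev A (X N1) \<ominus>\<^bsub>A\<^esub> l A) \<le> 1" by (rule lim_le[OF A N1[OF order_refl]])
    show ?thesis
      using triangle[OF l(1)[OF A] cl[OF A] zero_closed, of "X N1"] L cl[OF A] l(1)[OF A] e
        zero_closed nrm_ev_le_norm[OF A, of "X N1"] commute[of "l A" "ev A (X N1)"] by (simp add: cdist_def)
  qed
  note mk = cpt_mk[OF l(1) this, of z] ev_mk[OF l(1) this, of _ z]
  have "X \<longlonglongrightarrow> mk z l"
  proof (rule LIMSEQ_I)
    fix e :: real assume e: "0 < e"
    obtain N2 where N2: "\<And>m n. m \<ge> N2 \<Longrightarrow> n \<ge> N2 \<Longrightarrow> norm (X m - X n) \<le> e / 2" using C'[of "e / 2"] e by auto
    obtain N3 where N3: "\<And>n. n \<ge> N3 \<Longrightarrow> norm (cpt (X n) - z) < e / 2" using LIMSEQ_D[OF z, of "e / 2"] e by auto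
    have "norm (X n - mk z l) \<le> e / 2" if "n \<ge> max N2 N3" for n
      unfolding norm_univ_le_iff
      using N3[of n] that lim_le[of _ N2 n "e / 2"] N2 by (auto simp: mk less_imp_le)
    then show "\<exists>N. \<forall>n\<ge>N. norm (X n - mk z l) < e"
      using e by (intro exI[of _ "max N2 N3"] allI impI norm_univ_less) auto
  qed
  then show "convergent X" by (auto simp: convergent_def)
qed

instantiation univ :: (type) cstar
begin

definition star_univ :: "'a univ \<Rightarrow> 'a univ" where
  "star_univ x = mk (cnj (cpt x)) (\<lambda>A. adj A (ev A x))"

definition iu_univ :: "'a univ" where
  "iu_univ = mk \<i> (\<lambda>A. \<i> \<odot>\<^bsub>A\<^esub> \<one>\<^bsub>A\<^esub>)"

lemma star_univ [simp]:
  "cpt (star x) = cnj (cpt x)" "A \<in> ucstar \<Longrightarrow> ev A (star x) = adj A (ev A x)"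
proof -
  have *: "\<And>A. A \<in> ucstar \<Longrightarrow> adj A (ev A x) \<in> carrier A"
    "\<And>A. A \<in> ucstar \<Longrightarrow> nrm A (adj A (ev A x)) \<le> norm x"
    by (simp_all add: cstar_algebra.adj_closed[OF ucstarD(1)] ev_closed cstar_algebra.nrm_adj[OF ucstarD(1)] nrm_ev_le_norm)
  show "cpt (star x) = cnj (cpt x)" "A \<in> ucstar \<Longrightarrow> ev A (star x) = adj A (ev A x)"
    unfolding star_univ_def by (rule cpt_mk[OF *] ev_mk[OF *]; assumption)+
qed

lemma iu_univ [simp]:
  "cpt iu = \<i>" "A \<in> ucstar \<Longrightarrow> ev A iu = \<i> \<odot>\<^bsub>A\<^esub> \<one>\<^bsub>A\<^esub>"
proof -
  have *: "\<And>A :: 'a calg. A \<in> ucstar \<Longrightarrow> \<i> \<odot>\<^bsub>A\<^esub> \<one>\<^bsub>A\<^esub> \<in> carrier A"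
    "\<And>A :: 'a calg. A \<in> ucstar \<Longrightarrow> nrm A (\<i> \<odot>\<^bsub>A\<^esub> \<one>\<^bsub>A\<^esub>) \<le> 1"
    by (simp_all add: cstar_algebra.scale_closed[OF ucstarD(1)] ucstar_one cstar_algebra.nrm_scale[OF ucstarD(1)])
  show "cpt iu = \<i>" "A \<in> ucstar \<Longrightarrow> ev A iu = \<i> \<odot>\<^bsub>A\<^esub> \<one>\<^bsub>A\<^esub>"
    unfolding iu_univ_def by (rule cpt_mk[OF *] ev_mk[OF *]; assumption)+
qed

instance
proof
  fix x y :: "'a univ" and r :: real
  note cl = ev_closed and D = ucstarD(1)
  show "star (star x) = x"
    by (rule univ_eqI) (simp_all add: cstar_algebra.adj_adj[OF D] cl)
  show "star (x + y) = star x + star y"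
    by (rule univ_eqI) (simp_all add: cstar_algebra.adj_add[OF D] cl)
  show "star (x * y) = star y * star x"
    by (rule univ_eqI) (simp_all add: cstar_algebra.adj_mult[OF D] cl)
  show "star (r *\<^sub>R x) = r *\<^sub>R star x"
    by (rule univ_eqI) (simp_all add: cstar_algebra.adj_scale[OF D] cl)
  show "iu * iu = - (1 :: 'a univ)"
    by (rule univ_eqI) (simp_all add: cstar_algebra.mult_scale_left[OF D] cstar_algebra.mult_scale_right[OF D]
       cstar_algebra.scale_closed[OF D] ucstar_one cstar_algebra.scale_scale[OF D])
  show "star iu = - (iu :: 'a univ)"
    by (rule univ_eqI) (simp_all add: cstar_algebra.adj_scale[OF D] ucstar_one cstar_algebra.scale_scale[OF D])
  show "iu * x = x * iu"
    by (rule univ_eqI) (simp_all add: cstar_algebra.mult_scale_left[OF D] cstar_algebra.mult_scale_right[OF D] cl ucstar_one)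
  \<comment> \<open>The C*-identity holds in each coordinate; taking the root first turns the claim
    about a supremum into one bound per coordinate.\<close>
  have le: "norm x \<le> sqrt (norm (star x * x))"
    unfolding norm_univ_le_iff
  proof safe
    have "(cmod (cpt x))\<^sup>2 \<le> norm (star x * x)"
      using cpt_le_norm[of "star x * x"] by (simp add: norm_mult power2_eq_square)
    then show "cmod (cpt x) \<le> sqrt (norm (star x * x))" by (rule real_le_rsqrt)
    show "nrm A (ev A x) \<le> sqrt (norm (star x * x))" if A: "A \<in> ucstar" for A
      using nrm_ev_le_norm[OF A, of "star x * x"] A
      by (intro real_le_rsqrt) (simp add: cstar_algebra.nrm_cstar[OF D] cl)
  qed
  have "(norm x)\<^sup>2 \<le> norm (star x * x)"
    using power_mono[OF le, of 2] by simp
  moreover have "norm (star x * x) \<le> (norm x)\<^sup>2"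
    unfolding norm_univ_le_iff
    using cpt_le_norm[of x] nrm_ev_le_norm[of _ x] cstar_algebra.nrm_nonneg[OF D cl]
    by (auto simp: norm_mult cstar_algebra.nrm_cstar[OF D] cl power2_eq_square[symmetric] intro!: power_mono)
  ultimately show "norm (star x * x) = (norm x)\<^sup>2" by simp
qed

end

section \<open>Embedding a single algebra as a corner\<close>

definition cs :: "complex \<Rightarrow> 'a::cstar \<Rightarrow> 'a" where
  "cs c x = Re c *\<^sub>R x + Im c *\<^sub>R (iu * x)"

lemma ev_cs [simp]:
  assumes A: "A \<in> ucstar"
  shows "ev A (cs c x) = c \<odot>\<^bsub>A\<^esub> ev A x"
proof -
  interpret cstar_algebra A by (rule ucstarD(1)[OF A])
  have "ev A (cs c x) = (complex_of_real (Re c) + complex_of_real (Im c) * \<i>) \<odot>\<^bsub>A\<^esub> ev A x"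
    using A by (simp add: cs_def mult_scale_left ucstar_one ev_closed scale_scale flip: scale_add_left)
  then show ?thesis by (simp add: complex_eq mult.commute flip: complex_eq)
qed

text \<open>Extension by zero. It is not unital: the image of the unit of \<open>A\<close> is a
  central projection different from \<open>1\<close>, and \<open>A\<close> becomes the corner cut
  out by it. Products with ambient elements stay in this corner.\<close>

definition emb :: "'a calg \<Rightarrow> 'a \<Rightarrow> 'a univ" where
  "emb A x = mk 0 (\<lambda>B. if B = A then x else \<zero>\<^bsub>B\<^esub>)"

context
  fixes A :: "'a calg"
  assumes A: "A \<in> ucstar"
begin

interpretation cstar_algebra A by (rule ucstarD(1)[OF A])

lemma emb_components:
  assumes "x \<in> carrier A"
  shows cpt_emb: "cpt (emb A x) = 0" and ev_emb_if: "B \<in> ucstar \<Longrightarrow> ev B (emb A x) = (if B = A then x else \<zero>\<^bsub>B\<^esub>)"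
proof -
  have "(if B = A then x else \<zero>\<^bsub>B\<^esub>) \<in> carrier B \<and> nrm B (if B = A then x else \<zero>\<^bsub>B\<^esub>) \<le> nrm A x"
    if B: "B \<in> ucstar" for B
    using assms ucstarD(1)[OF B] nrm_nonneg[OF assms] by (auto simp: cstar_algebra.zero_closed cstar_algebra.nrm_zero)
  then have *: "\<And>B. B \<in> ucstar \<Longrightarrow> (if B = A then x else \<zero>\<^bsub>B\<^esub>) \<in> carrier B"
    "\<And>B. B \<in> ucstar \<Longrightarrow> nrm B (if B = A then x else \<zero>\<^bsub>B\<^esub>) \<le> nrm A x" by auto
  show "cpt (emb A x) = 0" "B \<in> ucstar \<Longrightarrow> ev B (emb A x) = (if B = A then x else \<zero>\<^bsub>B\<^esub>)"
    unfolding emb_def by (rule cpt_mk[OF *] ev_mk[OF *]; assumption)+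
qed

lemma ev_emb: "x \<in> carrier A \<Longrightarrow> ev A (emb A x) = x"
  by (simp add: ev_emb_if A)

lemma emb_eq_iff: "x \<in> carrier A \<Longrightarrow> y \<in> carrier A \<Longrightarrow> emb A x = emb A y \<longleftrightarrow> x = y"
  by (metis ev_emb)

lemma emb_zero: "emb A \<zero>\<^bsub>A\<^esub> = 0"
  by (rule univ_eqI) (simp_all add: cpt_emb ev_emb_if zero_closed)

lemma emb_eq_zero_iff: "x \<in> carrier A \<Longrightarrow> emb A x = 0 \<longleftrightarrow> x = \<zero>\<^bsub>A\<^esub>"
  using emb_eq_iff[OF _ zero_closed] by (simp add: emb_zero)

lemma emb_add: "x \<in> carrier A \<Longrightarrow> y \<in> carrier A \<Longrightarrow> emb A (x \<oplus>\<^bsub>A\<^esub> y) = emb A x + emb A y"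
  by (rule univ_eqI) (auto simp: cpt_emb ev_emb_if add_closed
      cstar_algebra.add_zero[OF ucstarD(1)] cstar_algebra.zero_closed[OF ucstarD(1)])

lemma emb_mult: "x \<in> carrier A \<Longrightarrow> y \<in> carrier A \<Longrightarrow> emb A (x \<otimes>\<^bsub>A\<^esub> y) = emb A x * emb A y"
  by (rule univ_eqI) (auto simp: cpt_emb ev_emb_if mult_closed
      cstar_algebra.zero_mult[OF ucstarD(1)] cstar_algebra.zero_closed[OF ucstarD(1)])

lemma emb_adj: "x \<in> carrier A \<Longrightarrow> emb A (adj A x) = star (emb A x)"
  by (rule univ_eqI) (auto simp: cpt_emb ev_emb_if adj_closed cstar_algebra.adj_zero[OF ucstarD(1)])

lemma emb_scale: "x \<in> carrier A \<Longrightarrow> emb A (c \<odot>\<^bsub>A\<^esub> x) = cs c (emb A x)"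
  by (rule univ_eqI) (auto simp: cpt_emb ev_emb_if scale_closed cstar_algebra.scale_zero[OF ucstarD(1)] cs_def[of c "emb A x", THEN arg_cong[of _ _ cpt]])

lemma emb_scaleR: "x \<in> carrier A \<Longrightarrow> emb A (complex_of_real r \<odot>\<^bsub>A\<^esub> x) = r *\<^sub>R emb A x"
  by (simp add: emb_scale cs_def)

lemma emb_diff: "x \<in> carrier A \<Longrightarrow> y \<in> carrier A \<Longrightarrow> emb A (x \<ominus>\<^bsub>A\<^esub> y) = emb A x - emb A y"
  using emb_scaleR[of y "-1"] by (simp add: diff_def emb_add scale_closed)

lemma norm_emb: assumes "x \<in> carrier A" shows "norm (emb A x) = nrm A x"
proof (rule antisym)
  show "norm (emb A x) \<le> nrm A x"
    using nrm_nonneg[OF assms]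
    by (auto simp: norm_univ_le_iff cpt_emb ev_emb_if assms cstar_algebra.nrm_zero[OF ucstarD(1)])
  show "nrm A x \<le> norm (emb A x)"
    using nrm_ev_le_norm[OF A, of "emb A x"] by (simp add: ev_emb assms)
qed

text \<open>Evaluating and embedding again is compression by the central projection. This is the way
  back: roots and polar parts are formed in the ambient type, and whatever is fixed by this
  projection comes from \<open>A\<close>.\<close>

lemma emb_ev: "emb A (ev A X) = X * emb A \<one>\<^bsub>A\<^esub>" "emb A (ev A X) = emb A \<one>\<^bsub>A\<^esub> * X"
  by (rule univ_eqI; auto simp: cpt_emb ev_emb_if ev_closed A ucstar_one cstar_algebra.mult_zero[OF ucstarD(1)]
     cstar_algebra.zero_mult[OF ucstarD(1)])+

lemma emb_one_mult: "x \<in> carrier A \<Longrightarrow> emb A \<one>\<^bsub>A\<^esub> * emb A x = emb A x" "x \<in> carrier A \<Longrightarrow> emb A x * emb A \<one>\<^bsub>A\<^esub> = emb A x"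
  by (simp_all add: ucstar_one A flip: emb_mult)

lemma emb_one: "star (emb A \<one>\<^bsub>A\<^esub>) = emb A \<one>\<^bsub>A\<^esub>" "emb A \<one>\<^bsub>A\<^esub> * emb A \<one>\<^bsub>A\<^esub> = emb A \<one>\<^bsub>A\<^esub>"
  by (simp_all add: ucstar_one A flip: emb_mult emb_adj)

end

section \<open>Homomorphisms\<close>

context cstar_algebra begin

lemma closedin_norm_iff:
  "closedin (norm_topology A) S \<longleftrightarrow> S \<subseteq> carrier A \<and>
     (\<forall>x\<in>carrier A. (\<forall>e>0. \<exists>s\<in>S. nrm A (x \<ominus> s) < e) \<longrightarrow> x \<in> S)"
proof -
  interpret Metric_space "carrier A" "cdist A" by (rule Metric_space_cdist)
  have eq: "disjnt S (mball x r) \<longleftrightarrow> \<not> (\<exists>s\<in>S. nrm A (x \<ominus> s) < r)" if "S \<subseteq> carrier A" "x \<in> carrier A" for x r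
    using that by (auto simp: disjnt_iff cdist_def subset_iff)
  show ?thesis
  proof (cases "S \<subseteq> carrier A")
    case True
    then show ?thesis
      unfolding norm_topology_def closedin_metric by (simp add: eq) blast
  qed (auto simp: norm_topology_def closedin_metric)
qed

lemma closure_norm_iff:
  assumes "S \<subseteq> carrier A"
  shows "x \<in> norm_topology A closure_of S \<longleftrightarrow> x \<in> carrier A \<and> (\<forall>e>0. \<exists>s\<in>S. nrm A (x \<ominus> s) < e)"
proof -
  interpret Metric_space "carrier A" "cdist A" by (rule Metric_space_cdist)
  show ?thesis
    using assms by (fastforce simp: norm_topology_def metric_closure_of cdist_def subset_iff)
qed

lemma limitin_norm_iff:
  assumes "\<And>n. f n \<in> carrier A"
  shows "limitin (norm_topology A) f l sequentially \<longleftrightarrow> l \<in> carrier A \<and> (\<lambda>n. nrm A (f n \<ominus> l)) \<longlonglongrightarrow> 0"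
proof -
  interpret Metric_space "carrier A" "cdist A" by (rule Metric_space_cdist)
  show ?thesis
    unfolding norm_topology_def limitin_metric_dist_null
    using assms by (auto simp: cdist_def eventually_sequentially cong: conj_cong)
qed

lemma carrier_topspace: "topspace (norm_topology A) = carrier A"
  unfolding norm_topology_def using Metric_space.topspace_mtopology[OF Metric_space_cdist] .

end

text \<open>Preservation of \<open>1\<close> cannot be demanded, because the ambient extension of a
  homomorphism through \<open>ev\<close> and \<open>emb\<close> sends \<open>1\<close> to a proper
  projection. Only real scalars appear, which is what the norm arguments work with.\<close>

definition star_hom :: "('a::cstar \<Rightarrow> 'b::cstar) \<Rightarrow> bool" where
  "star_hom h \<longleftrightarrow> (\<forall>x y. h (x + y) = h x + h y) \<and> (\<forall>x y. h (x * y) = h x * h y) \<and>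
     (\<forall>x. h (star x) = star (h x)) \<and> (\<forall>r x. h (r *\<^sub>R x) = r *\<^sub>R h x)"

lemma star_homD:
  assumes "star_hom h"
  shows "h (x + y) = h x + h y" "h (x * y) = h x * h y" "h (star x) = star (h x)" "h (r *\<^sub>R x) = r *\<^sub>R h x"
    "h 0 = 0" "h (- x) = - h x" "h (x - y) = h x - h y"
proof -
  show *: "h (x + y) = h x + h y" "h (x * y) = h x * h y" "h (star x) = star (h x)" "h (r *\<^sub>R x) = r *\<^sub>R h x" for x y r
    using assms unfolding star_hom_def by auto
  show "h 0 = 0" using *(4)[of 0 0] by simp
  show m: "h (- x) = - h x" for x using *(4)[of "-1" x] by simp
  show "h (x - y) = h x - h y" using *(1)[of x "- y"] m by simp
qed

lemma star_hom_Pos: "star_hom h \<Longrightarrow> Pos x \<Longrightarrow> Pos (h x)"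
  unfolding Pos_def by (metis star_homD(2,3))

text \<open>If \<open>\<parallel>x\<parallel> \<le> 1\<close> then a selfadjoint \<open>x\<close> is the real part of a unitary, and the image of a
  unitary is a partial isometry.\<close>

lemma star_hom_contractive:
  assumes h: "star_hom h"
  shows "norm (h x) \<le> norm x"
proof -
  note [simp] = star_homD[OF h]
  have n1: "norm (h 1) \<le> 1"
  proof -
    have "star (h 1) * h 1 = h 1" by (metis star_homD(2,3)[OF h] mult_1 star_one)
    then have "(norm (h 1))\<^sup>2 = norm (h 1)" using cstar_norm[of "h 1"] by simp
    then show ?thesis by (metis less_eq_real_def mult_cancel_left2 power2_eq_square zero_le_one)
  qed
  have sa: "norm (h x) \<le> 1" if x: "star x = x" "norm x \<le> 1" for x
  proof -
    have sx: "star (x * x) = x * x" by (simp add: star_simps x)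
    have "norm (x * x) \<le> 1" using x by (simp add: norm_sa_sq power_le_one)
    then obtain s where s: "star s = s" "s * s = 1 - x * x" "\<And>c. c * (x * x) = x * x * c \<Longrightarrow> c * s = s * c"
      using sqrt_one_minus[OF sx] by metis
    have c: "x * s = s * x" by (rule s(3)) (simp add: mult.assoc)
    have "(norm (h x))\<^sup>2 \<le> norm (h x * h x + h s * h s)"
    proof (rule commuting_sq_norm)
      show "star (h x) = h x" "star (h s) = h s" using x(1) s(1) star_homD(3)[OF h] by metis+
      show "h x * h s = h s * h x" using c star_homD(2)[OF h] by metis
    qed
    \<comment> \<open>The image of \<open>1\<close> is only a projection, but its norm is at most
      \<open>1\<close>, which suffices.\<close>
    also have "h x * h x + h s * h s = h 1"
      by (simp add: s(2) flip: star_homD(2)[OF h])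
    finally have "(norm (h x))\<^sup>2 \<le> 1" using n1 by simp
    then show ?thesis by (simp add: power_le_one_iff)
  qed
  have sa': "norm (h x) \<le> norm x" if x: "star x = x" for x
  proof (cases "x = 0")
    case False
    then have "norm (h ((1 / norm x) *\<^sub>R x)) \<le> 1" by (intro sa) (auto simp: star_simps x)
    then show ?thesis using False by (simp add: field_simps)
  qed simp
  have "(norm (h x))\<^sup>2 \<le> (norm x)\<^sup>2"
    using sa'[of "star x * x"] cstar_norm[of x] cstar_norm[of "h x"] by (simp add: star_simps)
  then show ?thesis by simp
qed

text \<open>For \<open>y \<ge> 0\<close> and \<open>\<rho> = \<parallel>h y\<parallel>\<close> the image of \<open>|y - \<rho>|\<close> is \<open>\<rho> - h y\<close>, so that
  \<open>|y - \<rho>| = \<rho> - y\<close> by injectivity.  The central projection \<open>e\<close> stands for the unit of the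
  subalgebra on which \<open>h\<close> is injective.\<close>

lemma star_hom_isometric:
  assumes h: "star_hom h" and e: "star e = e" "e * e = e" "\<And>x. e * x = x * e"
    and inj: "\<And>x. e * x = x \<Longrightarrow> h x = 0 \<Longrightarrow> x = 0" and x: "e * x = x"
  shows "norm (h x) = norm x"
proof (rule antisym)
  note [simp] = star_homD(1,4-7)[OF h]
  have sa: "norm x \<le> norm (h x)" if x: "star x = x" "e * x = x" for x
  proof -
    define y where "y = x * x"
    have ey: "e * y = y" "y * e = y" using x(2) e(3) by (simp_all add: y_def flip: mult.assoc) (metis mult.assoc)
    have y: "Pos y" by (simp add: y_def Pos_square x)
    define \<rho> where "\<rho> = norm (h y)"
    have hy: "Pos (h y)" using star_hom_Pos[OF h y] .
    define f where "f = h e"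
    have f: "star f = f" "f * f = f" using e star_homD(2,3)[OF h] unfolding f_def by metis+
    have fy: "f * h y = h y" "h y * f = h y" unfolding f_def using ey star_homD(2)[OF h] by metis+
    have "Pos (star f * (\<rho> *\<^sub>R 1 - h y) * f)"
      by (intro Pos_conj Pos_norm_minus hy) (simp add: \<rho>_def)
    then have P1: "Pos (\<rho> *\<^sub>R f - h y)" by (simp add: f algebra_simps fy)
    define k where "k = y - \<rho> *\<^sub>R e"
    have k: "star k = k" "e * k = k" "k * e = k" by (simp_all add: k_def star_simps Pos_sa y e(1,2) algebra_simps ey)
    obtain m where m: "Pos m" "m * m = k * k" "\<And>c. c * (k * k) = (k * k) * c \<Longrightarrow> c * m = m * c"
      using Pos_root[OF Pos_square[OF k(1)]] by metis
    have km: "k * m = m * k" by (rule m(3)) (simp add: mult.assoc)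
    \<comment> \<open>The root \<open>m\<close> is taken in the ambient algebra; compressing it by
      \<open>e\<close> brings it to the part on which \<open>h\<close> is injective and keeps its
      square.\<close>
    define q where "q = e * m * e"
    have Pq: "Pos q" using Pos_conj[OF m(1), of e] by (simp add: q_def e(1))
    have qe: "q = m * e" unfolding q_def using e(3)[of m] e(2) by (metis mult.assoc)
    have qq: "q * q = k * k" unfolding qe using k(3) m(2) e(3)[of m] e(2) by (metis mult.assoc)
    have qk: "k * q = q * k" unfolding qe using km k(2,3) by (metis mult.assoc)
    have "h q = \<rho> *\<^sub>R f - h y"
    proof (rule Pos_root_unique)
      have hk: "h k = - (\<rho> *\<^sub>R f - h y)" by (simp add: k_def f_def)
      have "h q * h q = h k * h k" using qq star_homD(2)[OF h] by metis
      then show "h q * h q = (\<rho> *\<^sub>R f - h y) * (\<rho> *\<^sub>R f - h y)"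
        unfolding hk by (simp only: minus_mult_minus)
      have "h k * h q = h q * h k" using qk star_homD(2)[OF h] by metis
      then show "h q * (\<rho> *\<^sub>R f - h y) = (\<rho> *\<^sub>R f - h y) * h q"
        unfolding hk by (simp only: mult_minus_left mult_minus_right neg_equal_iff_equal)
    qed (use P1 star_hom_Pos[OF h Pq] in auto)
    then have "h (q + k) = 0" by (simp add: k_def f_def)
    moreover have "e * (q + k) = q + k" by (simp add: distrib_left k q_def) (simp add: e(2) flip: mult.assoc)
    ultimately have "q + k = 0" using inj by blast
    then have "\<rho> *\<^sub>R e - y = q" unfolding k_def by (simp add: algebra_simps eq_neg_iff_add_eq_0)
    then have "Pos (\<rho> *\<^sub>R e - y)" using Pq by simp
    moreover have "Pos (\<rho> *\<^sub>R (1 - e))"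
    proof -
      have "(1 - e) * (1 - e) = 1 - e" by (simp add: algebra_simps e(2))
      then show ?thesis using Pos_square[of "1 - e"] by (intro Pos_scaleR) (simp_all add: \<rho>_def star_simps e(1))
    qed
    ultimately have "Pos (\<rho> *\<^sub>R (1 - e) + (\<rho> *\<^sub>R e - y))" by (intro Pos_add)
    then have "Pos (\<rho> *\<^sub>R 1 - y)" by (simp add: algebra_simps)
    then have "norm y \<le> \<rho>" by (rule Pos_le_norm[OF y]) (simp add: \<rho>_def)
    then have "(norm x)\<^sup>2 \<le> norm (h x * h x)"
      by (simp add: y_def \<rho>_def norm_sa_sq x star_homD(2)[OF h])
    also have "\<dots> \<le> (norm (h x))\<^sup>2" using norm_mult_ineq[of "h x" "h x"] by (simp add: power2_eq_square)
    finally show ?thesis by simp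
  qed
  have "e * (star x * x) = star x * x" by (metis e(3) mult.assoc x)
  then have "norm (star x * x) \<le> norm (h (star x * x))" by (intro sa) (simp_all add: star_simps)
  then have "(norm x)\<^sup>2 \<le> (norm (h x))\<^sup>2"
    by (simp add: cstar_norm star_homD(2,3)[OF h])
  then show "norm x \<le> norm (h x)" by simp
qed (rule star_hom_contractive[OF h])

section \<open>Homomorphisms between carrier-based algebras\<close>

lemma cstar_homD:
  assumes "cstar_hom A B f"
  shows "x \<in> carrier A \<Longrightarrow> f x \<in> carrier B"
    "x \<in> carrier A \<Longrightarrow> y \<in> carrier A \<Longrightarrow> f (x \<oplus>\<^bsub>A\<^esub> y) = f x \<oplus>\<^bsub>B\<^esub> f y"
    "x \<in> carrier A \<Longrightarrow> f (c \<odot>\<^bsub>A\<^esub> x) = c \<odot>\<^bsub>B\<^esub> f x"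
    "x \<in> carrier A \<Longrightarrow> y \<in> carrier A \<Longrightarrow> f (x \<otimes>\<^bsub>A\<^esub> y) = f x \<otimes>\<^bsub>B\<^esub> f y"
    "x \<in> carrier A \<Longrightarrow> f (adj A x) = adj B (f x)"
  using assms unfolding cstar_hom_def by auto

lemma cstar_hom_comp:
  assumes f: "cstar_hom A B f" and g: "cstar_hom B C g"
  shows "cstar_hom A C (\<lambda>x. g (f x))"
  unfolding cstar_hom_def by (auto simp: cstar_homD[OF f] cstar_homD[OF g])

lemma cstar_hom_zero:
  assumes A: "cstar_algebra A" and B: "cstar_algebra B" and f: "cstar_hom A B f"
  shows "f \<zero>\<^bsub>A\<^esub> = \<zero>\<^bsub>B\<^esub>"
proof -
  have z: "\<zero>\<^bsub>A\<^esub> \<in> carrier A" by (rule cstar_algebra.zero_closed[OF A])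
  then have "f (0 \<odot>\<^bsub>A\<^esub> \<zero>\<^bsub>A\<^esub>) = 0 \<odot>\<^bsub>B\<^esub> f \<zero>\<^bsub>A\<^esub>" by (rule cstar_homD(3)[OF f])
  then show ?thesis
    using cstar_algebra.zero_scale[OF B cstar_homD(1)[OF f z]] by (simp add: cstar_algebra.scale_zero[OF A])
qed

lemma cstar_hom_diff:
  assumes A: "cstar_algebra A" and f: "cstar_hom A B f" and "x \<in> carrier A" "y \<in> carrier A"
  shows "f (x \<ominus>\<^bsub>A\<^esub> y) = f x \<ominus>\<^bsub>B\<^esub> f y"
  unfolding diff_def by (simp add: cstar_homD[OF f] cstar_algebra.scale_closed[OF A] assms)

text \<open>Transfers the norm theory of the type class to carrier-based homomorphisms: all
  coordinates other than \<open>A\<close> are discarded, so the extension respects the operations on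
  the whole type.\<close>

lemma star_hom_lift:
  assumes A: "A \<in> ucstar" and B: "B \<in> ucstar" and f: "cstar_hom A B f"
  shows "star_hom (\<lambda>X. emb B (f (ev A X)))"
proof -
  have r: "f (complex_of_real r \<odot>\<^bsub>A\<^esub> ev A x) = complex_of_real r \<odot>\<^bsub>B\<^esub> f (ev A x)" for r x
    by (simp add: cstar_homD(3)[OF f] ev_closed A)
  show ?thesis
    unfolding star_hom_def
    by (auto simp: A B cstar_homD[OF f] ev_closed[OF A] emb_add emb_mult emb_adj emb_scaleR)
qed

lemma cstar_hom_contractive:
  assumes A: "A \<in> ucstar" and B: "B \<in> ucstar" and f: "cstar_hom A B f" and x: "x \<in> carrier A"
  shows "nrm B (f x) \<le> nrm A x"
  using star_hom_contractive[OF star_hom_lift[OF A B f], of "emb A x"]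
  by (simp add: ev_emb[OF A x] norm_emb[OF A x] norm_emb[OF B cstar_homD(1)[OF f x]])

text \<open>Injectivity of \<open>f\<close> is injectivity of its extension on the corner of the
  embedded unit, which is the central projection that \<open>star_hom_isometric\<close> asks
  for.\<close>

lemma cstar_hom_isometric:
  assumes A: "A \<in> ucstar" and B: "B \<in> ucstar" and f: "cstar_hom A B f" and x: "x \<in> carrier A"
    and inj: "\<And>y. y \<in> carrier A \<Longrightarrow> f y = \<zero>\<^bsub>B\<^esub> \<Longrightarrow> y = \<zero>\<^bsub>A\<^esub>"
  shows "nrm B (f x) = nrm A x"
proof -
  have "norm (emb B (f (ev A (emb A x)))) = norm (emb A x)"
  proof (rule star_hom_isometric[OF star_hom_lift[OF A B f], where e="emb A \<one>\<^bsub>A\<^esub>"])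
    show "emb A \<one>\<^bsub>A\<^esub> * y = y * emb A \<one>\<^bsub>A\<^esub>" for y
      using emb_ev[OF A, of y] by simp
    show "y = 0" if "emb A \<one>\<^bsub>A\<^esub> * y = y" "emb B (f (ev A y)) = 0" for y
      using that emb_ev(2)[OF A, of y] inj[of "ev A y"] emb_eq_zero_iff[OF B, of "f (ev A y)"]
        cstar_homD(1)[OF f ev_closed[OF A, of y]] ev_closed[OF A, of y] emb_zero[OF A] by simp
  qed (simp_all add: emb_one[OF A] emb_one_mult[OF A x])
  then show ?thesis
    by (simp add: ev_emb[OF A x] norm_emb[OF A x] norm_emb[OF B cstar_homD(1)[OF f x]])
qed

section \<open>Bounded sequences and quotients\<close>

abbreviation linf :: "'a calg \<Rightarrow> (nat \<Rightarrow> 'a) calg" where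
  "linf A \<equiv> bounded_product (\<lambda>_. A)"

lemma linf_simps [simp]:
  "\<zero>\<^bsub>linf A\<^esub> = (\<lambda>n. \<zero>\<^bsub>A\<^esub>)" "x \<oplus>\<^bsub>linf A\<^esub> y = (\<lambda>n. x n \<oplus>\<^bsub>A\<^esub> y n)"
  "c \<odot>\<^bsub>linf A\<^esub> x = (\<lambda>n. c \<odot>\<^bsub>A\<^esub> x n)" "x \<otimes>\<^bsub>linf A\<^esub> y = (\<lambda>n. x n \<otimes>\<^bsub>A\<^esub> y n)"
  "adj (linf A) x = (\<lambda>n. adj A (x n))" "x \<ominus>\<^bsub>linf A\<^esub> y = (\<lambda>n. x n \<ominus>\<^bsub>A\<^esub> y n)"
  by (simp_all add: bounded_product_def diff_def)

context cstar_algebra begin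

lemma linf_carrier: "x \<in> carrier (linf A) \<longleftrightarrow> (\<forall>n. x n \<in> carrier A) \<and> (\<exists>M. \<forall>n. nrm A (x n) \<le> M)"
  by (auto simp: bounded_product_def bdd_above_def)

lemma linf_carrierI: "(\<And>n. x n \<in> carrier A) \<Longrightarrow> (\<And>n. nrm A (x n) \<le> M) \<Longrightarrow> x \<in> carrier (linf A)"
  by (auto simp: linf_carrier)

lemma linf_closed: "x \<in> carrier (linf A) \<Longrightarrow> x n \<in> carrier A"
  by (simp add: linf_carrier)

lemma linf_norm_le_iff: "x \<in> carrier (linf A) \<Longrightarrow> nrm (linf A) x \<le> c \<longleftrightarrow> (\<forall>n. nrm A (x n) \<le> c)"
  by (auto simp: bounded_product_def cSUP_le_iff)

lemma linf_norm_ge: "x \<in> carrier (linf A) \<Longrightarrow> nrm A (x n) \<le> nrm (linf A) x"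
  using linf_norm_le_iff[of x "nrm (linf A) x"] by simp

lemma nrm_minus_commute: "x \<in> carrier A \<Longrightarrow> y \<in> carrier A \<Longrightarrow> nrm A (x \<ominus> y) = nrm A (y \<ominus> x)"
  using Metric_space.commute[OF Metric_space_cdist, of x y] by (simp add: cdist_def)

lemma nrm_triangle_diff:
  "\<lbrakk>x \<in> carrier A; y \<in> carrier A; z \<in> carrier A\<rbrakk> \<Longrightarrow> nrm A (x \<ominus> z) \<le> nrm A (x \<ominus> y) + nrm A (y \<ominus> z)"
  using Metric_space.triangle[OF Metric_space_cdist, of x y z] by (simp add: cdist_def)

lemma diff_zero: "x \<in> carrier A \<Longrightarrow> x \<ominus> \<zero> = x"
  by (simp add: diff_def scale_zero add_zero)

lemma nrm_triangle_sub: "\<lbrakk>x \<in> carrier A; y \<in> carrier A\<rbrakk> \<Longrightarrow> nrm A x \<le> nrm A (x \<ominus> y) + nrm A y"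
  using nrm_triangle_diff[of x y \<zero>] by (simp add: zero_closed diff_zero)

lemma linf_add: "\<lbrakk>x \<in> carrier (linf A); y \<in> carrier (linf A)\<rbrakk> \<Longrightarrow> (\<lambda>n. x n \<oplus> y n) \<in> carrier (linf A)"
  by (rule linf_carrierI[where M="nrm (linf A) x + nrm (linf A) y"])
    (auto simp: linf_closed add_closed intro!: order_trans[OF nrm_triangle] add_mono linf_norm_ge)

lemma linf_mult: "\<lbrakk>x \<in> carrier (linf A); y \<in> carrier (linf A)\<rbrakk> \<Longrightarrow> (\<lambda>n. x n \<otimes> y n) \<in> carrier (linf A)"
  by (rule linf_carrierI[where M="nrm (linf A) x * nrm (linf A) y"])
    (auto simp: linf_closed mult_closed nrm_nonneg intro!: order_trans[OF nrm_mult] mult_mono linf_norm_ge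
      intro: order_trans[OF nrm_nonneg linf_norm_ge])

lemma linf_scale: "x \<in> carrier (linf A) \<Longrightarrow> (\<lambda>n. c \<odot> x n) \<in> carrier (linf A)"
  by (rule linf_carrierI[where M="cmod c * nrm (linf A) x"])
    (auto simp: linf_closed scale_closed nrm_scale intro!: mult_left_mono linf_norm_ge)

lemma linf_adj: "x \<in> carrier (linf A) \<Longrightarrow> (\<lambda>n. adj A (x n)) \<in> carrier (linf A)"
  by (rule linf_carrierI[where M="nrm (linf A) x"])
    (auto simp: linf_closed adj_closed nrm_adj intro!: linf_norm_ge)

lemma linf_diff: "\<lbrakk>x \<in> carrier (linf A); y \<in> carrier (linf A)\<rbrakk> \<Longrightarrow> (\<lambda>n. x n \<ominus> y n) \<in> carrier (linf A)"
  unfolding diff_def by (intro linf_add linf_scale)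

lemma linf_const: "a \<in> carrier A \<Longrightarrow> (\<lambda>n. a) \<in> carrier (linf A)"
  by (rule linf_carrierI[where M="nrm A a"]) auto

lemma linf_nrm_nonneg: "x \<in> carrier (linf A) \<Longrightarrow> 0 \<le> nrm (linf A) x"
  by (rule order_trans[OF nrm_nonneg linf_norm_ge]) (auto simp: linf_closed)

lemma linf_complete: "Metric_space.mcomplete (carrier (linf A)) (cdist (linf A))"
proof -
  have cd: "cdist (linf A) x y \<le> e \<longleftrightarrow> (\<forall>n. cdist A (x n) (y n) \<le> e)"
    if "x \<in> carrier (linf A)" "y \<in> carrier (linf A)" for x y e
    using that linf_diff[OF that] by (simp add: cdist_def linf_norm_le_iff linf_closed)
  interpret A: Metric_space "carrier A" "cdist A" by (rule Metric_space_cdist)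
  \<comment> \<open>The metric axioms are checked directly: obtaining them from
    \<open>Metric_space_cdist\<close> would presuppose the C*-algebra structure, of which
    completeness is an axiom.\<close>
  have M: "Metric_space (carrier (linf A)) (cdist (linf A))"
  proof
    fix x y z
    show "0 \<le> cdist (linf A) x y" by (simp add: cdist_def linf_nrm_nonneg linf_diff)
    have le: "cdist (linf A) x y \<le> cdist (linf A) y x" for x y
    proof (cases "x \<in> carrier (linf A) \<and> y \<in> carrier (linf A)")
      case True
      then show ?thesis using cd[of y x "cdist (linf A) y x"] cd[of x y "cdist (linf A) y x"] A.commute by simp
    qed (auto simp: cdist_def)
    show "cdist (linf A) x y = cdist (linf A) y x" using le[of x y] le[of y x] by simp
    show "(cdist (linf A) x y = 0) = (x = y)" if c: "x \<in> carrier (linf A)" "y \<in> carrier (linf A)"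
    proof -
      have "0 \<le> cdist (linf A) x y" using c by (simp add: cdist_def linf_nrm_nonneg linf_diff)
      then have "cdist (linf A) x y = 0 \<longleftrightarrow> (\<forall>n. cdist A (x n) (y n) \<le> 0)" using cd[OF c, of 0] by auto
      also have "\<dots> \<longleftrightarrow> (\<forall>n. x n = y n)"
        using A.zero[OF linf_closed[OF c(1)] linf_closed[OF c(2)]] A.nonneg by (metis order_antisym order_refl)
      finally show ?thesis by auto
    qed
    show "cdist (linf A) x z \<le> cdist (linf A) x y + cdist (linf A) y z"
      if c: "x \<in> carrier (linf A)" "y \<in> carrier (linf A)" "z \<in> carrier (linf A)"
      unfolding cd[OF c(1,3)]
    proof
      fix n
      show "cdist A (x n) (z n) \<le> cdist (linf A) x y + cdist (linf A) y z"
        using A.triangle[OF linf_closed[OF c(1)] linf_closed[OF c(2)] linf_closed[OF c(3)], of n n n]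
          cd[OF c(1,2), THEN iffD1, OF order_refl, rule_format, of n]
          cd[OF c(2,3), THEN iffD1, OF order_refl, rule_format, of n] by linarith
    qed
  qed
  interpret L: Metric_space "carrier (linf A)" "cdist (linf A)" by (rule M)
  show ?thesis
    unfolding L.mcomplete_def
  proof (intro allI impI)
    fix s assume C: "L.MCauchy s"
    then have s: "s k \<in> carrier (linf A)" for k by (auto simp: L.MCauchy_def)
    have cau: "\<exists>N. \<forall>k\<ge>N. \<forall>l\<ge>N. \<forall>n. cdist A (s k n) (s l n) \<le> e" if "0 < e" for e
    proof -
      obtain N where N: "\<And>k l. N \<le> k \<Longrightarrow> N \<le> l \<Longrightarrow> cdist (linf A) (s k) (s l) < e"
        using C \<open>0 < e\<close> unfolding L.MCauchy_def by meson
      show ?thesis using N cd[OF s s] by (meson less_imp_le)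
    qed
    have "\<exists>l. limitin A.mtopology (\<lambda>k. s k n) l sequentially" for n
    proof -
      have "A.MCauchy (\<lambda>k. s k n)"
        unfolding A.MCauchy_def
      proof safe
        fix e :: real assume "0 < e"
        then obtain N where "\<forall>k\<ge>N. \<forall>l\<ge>N. \<forall>n. cdist A (s k n) (s l n) \<le> e / 2" using cau[of "e / 2"] by auto
        moreover have "e / 2 < e" using \<open>0 < e\<close> by simp
        ultimately show "\<exists>N. \<forall>k l. N \<le> k \<longrightarrow> N \<le> l \<longrightarrow> cdist A (s k n) (s l n) < e"
          by (meson order_le_less_trans)
      qed (use linf_closed[OF s] in auto)
      then show ?thesis using complete unfolding A.mcomplete_def by blast
    qed
    then obtain l where l: "\<And>n. limitin A.mtopology (\<lambda>k. s k n) (l n) sequentially" by metis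
    have lc: "l n \<in> carrier A" and ld: "(\<lambda>k. cdist A (s k n) (l n)) \<longlonglongrightarrow> 0" for n
      using l[of n] unfolding A.limitin_metric_dist_null by auto
    have le: "cdist A (s k n) (l n) \<le> e" if N: "\<forall>k\<ge>N. \<forall>l\<ge>N. \<forall>n. cdist A (s k n) (s l n) \<le> e" "k \<ge> N" for e N k n
    proof -
      have "cdist A (s k n) (l n) \<le> e + cdist A (s j n) (l n)" if "j \<ge> N" for j
        using A.triangle[OF linf_closed[OF s] linf_closed[OF s] lc, of k n n j n] N(1)[rule_format, OF N(2) that, of n] by linarith
      then have "cdist A (s k n) (l n) \<le> e + 0"
        by (intro LIMSEQ_le_const[OF tendsto_add[OF tendsto_const ld]]) blast
      then show ?thesis by simp
    qed
    have lL: "l \<in> carrier (linf A)"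
    proof -
      obtain N where N: "\<forall>k\<ge>N. \<forall>l\<ge>N. \<forall>n. cdist A (s k n) (s l n) \<le> 1" using cau[of 1] by auto
      have "nrm A (l n) \<le> 1 + nrm (linf A) (s N)" for n
        using le[OF N order_refl, of n] nrm_triangle_sub[OF lc linf_closed[OF s], of n N n]
          linf_norm_ge[OF s, of N n] A.commute[of "s N n" "l n"] by (simp add: cdist_def lc linf_closed[OF s])
      then show ?thesis using lc by (intro linf_carrierI)
    qed
    have "(\<lambda>k. cdist (linf A) (s k) l) \<longlonglongrightarrow> 0"
    proof (rule LIMSEQ_I)
      fix e :: real assume "0 < e"
      then obtain N where N: "\<forall>k\<ge>N. \<forall>l\<ge>N. \<forall>n. cdist A (s k n) (s l n) \<le> e / 2" using cau[of "e / 2"] by auto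
      have "norm (cdist (linf A) (s k) l - 0) < e" if "k \<ge> N" for k
        using cd[OF s lL, of k "e / 2"] le[OF N that] \<open>0 < e\<close> L.nonneg[of "s k" l] by simp
      then show "\<exists>N. \<forall>k\<ge>N. norm (cdist (linf A) (s k) l - 0) < e" by blast
    qed
    then show "\<exists>x. limitin L.mtopology s x sequentially"
      unfolding L.limitin_metric_dist_null using s lL by auto
  qed
qed

lemma cstar_algebra_linf: "cstar_algebra (linf A)"
proof
  fix x y assume x: "x \<in> carrier (linf A)"
  note [simp] = linf_closed[OF x]
  show "c \<odot>\<^bsub>linf A\<^esub> x \<in> carrier (linf A)" for c using x by (simp add: linf_scale)
  show "adj (linf A) x \<in> carrier (linf A)" using x by (simp add: linf_adj)
  show "x \<oplus>\<^bsub>linf A\<^esub> \<zero>\<^bsub>linf A\<^esub> = x" by (simp add: add_zero)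
  show "x \<oplus>\<^bsub>linf A\<^esub> ((- 1) \<odot>\<^bsub>linf A\<^esub> x) = \<zero>\<^bsub>linf A\<^esub>" by (simp add: add_minus)
  show "1 \<odot>\<^bsub>linf A\<^esub> x = x" by (simp add: scale_one)
  show "c \<odot>\<^bsub>linf A\<^esub> (d \<odot>\<^bsub>linf A\<^esub> x) = (c * d) \<odot>\<^bsub>linf A\<^esub> x" for c d by (simp add: scale_scale)
  show "(c + d) \<odot>\<^bsub>linf A\<^esub> x = (c \<odot>\<^bsub>linf A\<^esub> x) \<oplus>\<^bsub>linf A\<^esub> (d \<odot>\<^bsub>linf A\<^esub> x)" for c d by (simp add: scale_add_left)
  show "adj (linf A) (adj (linf A) x) = x" by (simp add: adj_adj)
  show "adj (linf A) (c \<odot>\<^bsub>linf A\<^esub> x) = cnj c \<odot>\<^bsub>linf A\<^esub> adj (linf A) x" for c by (simp add: adj_scale)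
  show "0 \<le> nrm (linf A) x" by (rule linf_nrm_nonneg[OF x])
  show "(nrm (linf A) x = 0) = (x = \<zero>\<^bsub>linf A\<^esub>)"
  proof -
    have "nrm (linf A) x = 0 \<longleftrightarrow> (\<forall>n. nrm A (x n) \<le> 0)"
      using linf_norm_le_iff[OF x, of 0] linf_nrm_nonneg[OF x] by auto
    also have "\<dots> \<longleftrightarrow> (\<forall>n. x n = \<zero>)"
      using nrm_eq_zero[OF linf_closed[OF x]] nrm_nonneg[OF linf_closed[OF x]] by (metis order_antisym order_refl)
    finally show ?thesis by auto
  qed
  have sc: "nrm (linf A) (c \<odot>\<^bsub>linf A\<^esub> y) \<le> cmod c * nrm (linf A) y" if y: "y \<in> carrier (linf A)" for c y
    using linf_norm_ge[OF y] by (simp add: linf_norm_le_iff linf_scale y nrm_scale linf_closed mult_left_mono)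
  show "nrm (linf A) (c \<odot>\<^bsub>linf A\<^esub> x) = cmod c * nrm (linf A) x" for c
  proof (cases "c = 0")
    case True
    then show ?thesis using sc[OF x, of c] linf_nrm_nonneg[OF linf_scale[OF x], of c] by simp
  next
    case False
    have "nrm (linf A) ((1 / c) \<odot>\<^bsub>linf A\<^esub> (c \<odot>\<^bsub>linf A\<^esub> x)) \<le> cmod (1 / c) * nrm (linf A) (c \<odot>\<^bsub>linf A\<^esub> x)"
      by (rule sc) (simp add: linf_scale x)
    then have "nrm (linf A) x \<le> cmod (1 / c) * nrm (linf A) (c \<odot>\<^bsub>linf A\<^esub> x)"
      using False by (simp add: scale_scale scale_one)
    then show ?thesis using sc[OF x, of c] False by (simp add: norm_divide field_simps)
  qed
  show "nrm (linf A) (adj (linf A) x \<otimes>\<^bsub>linf A\<^esub> x) = (nrm (linf A) x)\<^sup>2"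
  proof -
    have c: "adj (linf A) x \<otimes>\<^bsub>linf A\<^esub> x \<in> carrier (linf A)" using linf_mult[OF linf_adj[OF x] x] by simp
    have n0: "0 \<le> nrm (linf A) (adj (linf A) x \<otimes>\<^bsub>linf A\<^esub> x)" by (rule linf_nrm_nonneg[OF c])
    have "nrm (linf A) x \<le> sqrt (nrm (linf A) (adj (linf A) x \<otimes>\<^bsub>linf A\<^esub> x))"
      unfolding linf_norm_le_iff[OF x]
    proof
      fix n
      show "nrm A (x n) \<le> sqrt (nrm (linf A) (adj (linf A) x \<otimes>\<^bsub>linf A\<^esub> x))"
        using linf_norm_ge[OF c, of n] by (intro real_le_rsqrt) (simp add: nrm_cstar)
    qed
    then have "(nrm (linf A) x)\<^sup>2 \<le> nrm (linf A) (adj (linf A) x \<otimes>\<^bsub>linf A\<^esub> x)"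
      using power_mono[of "nrm (linf A) x" _ 2] linf_nrm_nonneg[OF x] n0 by fastforce
    moreover have "nrm (linf A) (adj (linf A) x \<otimes>\<^bsub>linf A\<^esub> x) \<le> (nrm (linf A) x)\<^sup>2"
      unfolding linf_norm_le_iff[OF c]
      by (simp add: nrm_cstar power_mono[OF linf_norm_ge[OF x] nrm_nonneg])
    ultimately show ?thesis by simp
  qed
  assume y: "y \<in> carrier (linf A)"
  note [simp] = linf_closed[OF y]
  show "x \<oplus>\<^bsub>linf A\<^esub> y \<in> carrier (linf A)" "x \<otimes>\<^bsub>linf A\<^esub> y \<in> carrier (linf A)"
    using x y by (simp_all add: linf_add linf_mult)
  show "x \<oplus>\<^bsub>linf A\<^esub> y = y \<oplus>\<^bsub>linf A\<^esub> x" by (simp add: add_commute)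
  show "c \<odot>\<^bsub>linf A\<^esub> (x \<oplus>\<^bsub>linf A\<^esub> y) = (c \<odot>\<^bsub>linf A\<^esub> x) \<oplus>\<^bsub>linf A\<^esub> (c \<odot>\<^bsub>linf A\<^esub> y)" for c by (simp add: scale_add_right)
  show "(c \<odot>\<^bsub>linf A\<^esub> x) \<otimes>\<^bsub>linf A\<^esub> y = c \<odot>\<^bsub>linf A\<^esub> (x \<otimes>\<^bsub>linf A\<^esub> y)" for c by (simp add: mult_scale_left)
  show "x \<otimes>\<^bsub>linf A\<^esub> (c \<odot>\<^bsub>linf A\<^esub> y) = c \<odot>\<^bsub>linf A\<^esub> (x \<otimes>\<^bsub>linf A\<^esub> y)" for c by (simp add: mult_scale_right)
  show "adj (linf A) (x \<oplus>\<^bsub>linf A\<^esub> y) = adj (linf A) x \<oplus>\<^bsub>linf A\<^esub> adj (linf A) y" by (simp add: adj_add)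
  show "adj (linf A) (x \<otimes>\<^bsub>linf A\<^esub> y) = adj (linf A) y \<otimes>\<^bsub>linf A\<^esub> adj (linf A) x" by (simp add: adj_mult)
  show "nrm (linf A) (x \<oplus>\<^bsub>linf A\<^esub> y) \<le> nrm (linf A) x + nrm (linf A) y"
    using x y by (auto simp: linf_norm_le_iff linf_add intro!: order_trans[OF nrm_triangle] add_mono linf_norm_ge)
  show "nrm (linf A) (x \<otimes>\<^bsub>linf A\<^esub> y) \<le> nrm (linf A) x * nrm (linf A) y"
    using x y by (auto simp: linf_norm_le_iff linf_mult nrm_nonneg linf_nrm_nonneg
        intro!: order_trans[OF nrm_mult] mult_mono linf_norm_ge)
  fix z assume z: "z \<in> carrier (linf A)"
  note [simp] = linf_closed[OF z]
  show "x \<oplus>\<^bsub>linf A\<^esub> y \<oplus>\<^bsub>linf A\<^esub> z = x \<oplus>\<^bsub>linf A\<^esub> (y \<oplus>\<^bsub>linf A\<^esub> z)" by (simp add: add_assoc)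
  show "x \<otimes>\<^bsub>linf A\<^esub> y \<otimes>\<^bsub>linf A\<^esub> z = x \<otimes>\<^bsub>linf A\<^esub> (y \<otimes>\<^bsub>linf A\<^esub> z)" by (simp add: mult_assoc)
  show "(x \<oplus>\<^bsub>linf A\<^esub> y) \<otimes>\<^bsub>linf A\<^esub> z = (x \<otimes>\<^bsub>linf A\<^esub> z) \<oplus>\<^bsub>linf A\<^esub> (y \<otimes>\<^bsub>linf A\<^esub> z)" by (simp add: mult_add_left)
  show "x \<otimes>\<^bsub>linf A\<^esub> (y \<oplus>\<^bsub>linf A\<^esub> z) = (x \<otimes>\<^bsub>linf A\<^esub> y) \<oplus>\<^bsub>linf A\<^esub> (x \<otimes>\<^bsub>linf A\<^esub> z)" by (simp add: mult_add_right)
qed (simp_all add: linf_const[OF zero_closed] linf_complete)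

end

lemma ucstar_linf:
  assumes "A \<in> ucstar"
  shows "linf A \<in> ucstar"
proof (rule ucstarI)
  interpret cstar_algebra A by (rule ucstarD(1)[OF assms])
  show "cstar_algebra (linf A)" by (rule cstar_algebra_linf)
  have "is_unit (linf A) (\<lambda>n. \<one>\<^bsub>A\<^esub>)"
    unfolding is_unit_def
    by (auto simp: linf_const ucstar_one[OF assms] linf_closed)
  then show "unital (linf A)" by (auto simp: unital_def)
qed

text \<open>Closed ideals are selfadjoint, but for the ideals needed here this is immediate, so it is kept
  as an assumption.\<close>

locale quotient_calg =
  fixes E :: "'a calg" and J :: "'a set"
  assumes E: "E \<in> ucstar" and J: "closed_ideal J E" and J_adj: "\<And>x. x \<in> J \<Longrightarrow> adj E x \<in> J"
begin

sublocale cstar_algebra E by (rule ucstarD(1)[OF E])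

abbreviation "q \<equiv> coset E J"
abbreviation "Q \<equiv> quot_algebra E J"

lemma J_sub: "j \<in> J \<Longrightarrow> j \<in> carrier E"
  using J closedin_subset[of "norm_topology E" J] by (auto simp: closed_ideal_def carrier_topspace)

lemma J_closed: "x \<in> carrier E \<Longrightarrow> (\<And>e. e > 0 \<Longrightarrow> \<exists>s\<in>J. nrm E (x \<ominus>\<^bsub>E\<^esub> s) < e) \<Longrightarrow> x \<in> J"
  using J unfolding closed_ideal_def closedin_norm_iff by blast

lemma J_ops: "\<zero>\<^bsub>E\<^esub> \<in> J" "x \<in> J \<Longrightarrow> y \<in> J \<Longrightarrow> x \<oplus>\<^bsub>E\<^esub> y \<in> J" "x \<in> J \<Longrightarrow> c \<odot>\<^bsub>E\<^esub> x \<in> J"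
  "x \<in> J \<Longrightarrow> a \<in> carrier E \<Longrightarrow> a \<otimes>\<^bsub>E\<^esub> x \<in> J" "x \<in> J \<Longrightarrow> a \<in> carrier E \<Longrightarrow> x \<otimes>\<^bsub>E\<^esub> a \<in> J"
  "x \<in> J \<Longrightarrow> y \<in> J \<Longrightarrow> x \<ominus>\<^bsub>E\<^esub> y \<in> J"
  using J unfolding closed_ideal_def diff_def by auto

lemmas closed = add_closed scale_closed mult_closed adj_closed zero_closed diff_closed J_sub
lemmas emb_simps = emb_add[OF E] emb_mult[OF E] emb_adj[OF E] emb_diff[OF E] emb_zero[OF E] emb_scale[OF E]

lemma eqI: "x \<in> carrier E \<Longrightarrow> y \<in> carrier E \<Longrightarrow> emb E x = emb E y \<Longrightarrow> x = y"
  using emb_eq_iff[OF E] by blast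

lemma mem_coset:
  assumes x: "x \<in> carrier E"
  shows "y \<in> q x \<longleftrightarrow> y \<in> carrier E \<and> y \<ominus>\<^bsub>E\<^esub> x \<in> J"
proof
  assume "y \<in> q x"
  then obtain j where j: "j \<in> J" "y = x \<oplus>\<^bsub>E\<^esub> j" by (auto simp: coset_def)
  have "y \<ominus>\<^bsub>E\<^esub> x = j" by (rule eqI) (simp_all add: j x closed emb_simps)
  then show "y \<in> carrier E \<and> y \<ominus>\<^bsub>E\<^esub> x \<in> J" using j x closed by simp
next
  assume y: "y \<in> carrier E \<and> y \<ominus>\<^bsub>E\<^esub> x \<in> J"
  have "y = x \<oplus>\<^bsub>E\<^esub> (y \<ominus>\<^bsub>E\<^esub> x)" by (rule eqI) (simp_all add: y x closed emb_simps)
  then show "y \<in> q x" using y by (auto simp: coset_def)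
qed

lemma q_eq_iff:
  assumes x: "x \<in> carrier E" and y: "y \<in> carrier E"
  shows "q x = q y \<longleftrightarrow> x \<ominus>\<^bsub>E\<^esub> y \<in> J"
proof
  assume "q x = q y"
  moreover have "x \<in> q x"
  proof -
    have "x \<ominus>\<^bsub>E\<^esub> x = \<zero>\<^bsub>E\<^esub>" by (rule eqI) (simp_all add: x closed emb_simps)
    then show ?thesis using x J_ops(1) by (simp add: mem_coset)
  qed
  ultimately show "x \<ominus>\<^bsub>E\<^esub> y \<in> J" using mem_coset[OF y] by blast
next
  assume xy: "x \<ominus>\<^bsub>E\<^esub> y \<in> J"
  have "z \<ominus>\<^bsub>E\<^esub> x \<in> J \<longleftrightarrow> z \<ominus>\<^bsub>E\<^esub> y \<in> J" if z: "z \<in> carrier E" for z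
  proof -
    have "z \<ominus>\<^bsub>E\<^esub> y = (z \<ominus>\<^bsub>E\<^esub> x) \<oplus>\<^bsub>E\<^esub> (x \<ominus>\<^bsub>E\<^esub> y)"
      "z \<ominus>\<^bsub>E\<^esub> x = (z \<ominus>\<^bsub>E\<^esub> y) \<ominus>\<^bsub>E\<^esub> (x \<ominus>\<^bsub>E\<^esub> y)"
      by (rule eqI; simp add: x y z closed emb_simps)+
    then show ?thesis using xy J_ops by metis
  qed
  then show "q x = q y" by (auto simp: mem_coset x y)
qed

lemma q_self: "x \<in> carrier E \<Longrightarrow> x \<in> q x"
  using q_eq_iff[of x x] mem_coset[of x x] by blast

lemma q_mem_eq: "x \<in> carrier E \<Longrightarrow> y \<in> q x \<Longrightarrow> q y = q x"
  by (simp add: mem_coset q_eq_iff)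

lemma carrier_Q: "carrier Q = q ` carrier E"
  by (simp add: quot_algebra_def)

lemma q_closed: "x \<in> carrier E \<Longrightarrow> q x \<in> carrier Q"
  by (simp add: carrier_Q)

lemma Q_zero: "\<zero>\<^bsub>Q\<^esub> = q \<zero>\<^bsub>E\<^esub>"
proof -
  have "q \<zero>\<^bsub>E\<^esub> = J" by (auto simp: mem_coset closed diff_zero)
  then show ?thesis by (simp add: quot_algebra_def)
qed

text \<open>The quotient operations are unions over all representatives; they collapse to a single
  coset once every choice of representatives gives the same one.\<close>

lemma UN_const: "X \<noteq> {} \<Longrightarrow> (\<And>x. x \<in> X \<Longrightarrow> f x = c) \<Longrightarrow> (\<Union>x\<in>X. f x) = c"
  by auto

lemma UN2_const:
  "X \<noteq> {} \<Longrightarrow> Y \<noteq> {} \<Longrightarrow> (\<And>x y. x \<in> X \<Longrightarrow> y \<in> Y \<Longrightarrow> f x y = c) \<Longrightarrow> (\<Union>x\<in>X. \<Union>y\<in>Y. f x y) = c"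
  by auto

lemma q_nonempty: "x \<in> carrier E \<Longrightarrow> q x \<noteq> {}"
  using q_self by blast

lemma Q_add: assumes x: "x \<in> carrier E" and y: "y \<in> carrier E" shows "q x \<oplus>\<^bsub>Q\<^esub> q y = q (x \<oplus>\<^bsub>E\<^esub> y)"
proof -
  have "q (u \<oplus>\<^bsub>E\<^esub> v) = q (x \<oplus>\<^bsub>E\<^esub> y)" if "u \<in> q x" "v \<in> q y" for u v
  proof -
    have u: "u \<in> carrier E" "u \<ominus>\<^bsub>E\<^esub> x \<in> J" and v: "v \<in> carrier E" "v \<ominus>\<^bsub>E\<^esub> y \<in> J" using that by (auto simp: mem_coset x y)
    have "(u \<oplus>\<^bsub>E\<^esub> v) \<ominus>\<^bsub>E\<^esub> (x \<oplus>\<^bsub>E\<^esub> y) = (u \<ominus>\<^bsub>E\<^esub> x) \<oplus>\<^bsub>E\<^esub> (v \<ominus>\<^bsub>E\<^esub> y)"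
      by (rule eqI) (simp_all add: x y u(1) v(1) closed emb_simps)
    then show ?thesis using u v by (simp add: q_eq_iff x y closed J_ops)
  qed
  from UN2_const[OF q_nonempty[OF x] q_nonempty[OF y] this] show ?thesis
    by (simp add: quot_algebra_def)
qed

lemma Q_mult: assumes x: "x \<in> carrier E" and y: "y \<in> carrier E" shows "q x \<otimes>\<^bsub>Q\<^esub> q y = q (x \<otimes>\<^bsub>E\<^esub> y)"
proof -
  have "q (u \<otimes>\<^bsub>E\<^esub> v) = q (x \<otimes>\<^bsub>E\<^esub> y)" if "u \<in> q x" "v \<in> q y" for u v
  proof -
    have u: "u \<in> carrier E" "u \<ominus>\<^bsub>E\<^esub> x \<in> J" and v: "v \<in> carrier E" "v \<ominus>\<^bsub>E\<^esub> y \<in> J" using that by (auto simp: mem_coset x y)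
    have "(u \<otimes>\<^bsub>E\<^esub> v) \<ominus>\<^bsub>E\<^esub> (x \<otimes>\<^bsub>E\<^esub> y) = ((u \<ominus>\<^bsub>E\<^esub> x) \<otimes>\<^bsub>E\<^esub> v) \<oplus>\<^bsub>E\<^esub> (x \<otimes>\<^bsub>E\<^esub> (v \<ominus>\<^bsub>E\<^esub> y))"
      by (rule eqI) (simp_all add: x y u(1) v(1) closed emb_simps algebra_simps)
    then show ?thesis using u v by (simp add: q_eq_iff x y closed J_ops)
  qed
  from UN2_const[OF q_nonempty[OF x] q_nonempty[OF y] this] show ?thesis
    by (simp add: quot_algebra_def)
qed

lemma Q_scale: assumes x: "x \<in> carrier E" shows "c \<odot>\<^bsub>Q\<^esub> q x = q (c \<odot>\<^bsub>E\<^esub> x)"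
proof -
  have "q (c \<odot>\<^bsub>E\<^esub> u) = q (c \<odot>\<^bsub>E\<^esub> x)" if "u \<in> q x" for u
  proof -
    have u: "u \<in> carrier E" "u \<ominus>\<^bsub>E\<^esub> x \<in> J" using that by (auto simp: mem_coset x)
    have "(c \<odot>\<^bsub>E\<^esub> u) \<ominus>\<^bsub>E\<^esub> (c \<odot>\<^bsub>E\<^esub> x) = c \<odot>\<^bsub>E\<^esub> (u \<ominus>\<^bsub>E\<^esub> x)"
      by (rule eqI) (simp_all add: x u(1) closed emb_simps cs_def algebra_simps)
    then show ?thesis using u by (simp add: q_eq_iff x closed J_ops)
  qed
  from UN_const[OF q_nonempty[OF x] this] show ?thesis
    by (simp add: quot_algebra_def)
qed

lemma Q_adj: assumes x: "x \<in> carrier E" shows "adj Q (q x) = q (adj E x)"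
proof -
  have "q (adj E u) = q (adj E x)" if "u \<in> q x" for u
  proof -
    have u: "u \<in> carrier E" "u \<ominus>\<^bsub>E\<^esub> x \<in> J" using that by (auto simp: mem_coset x)
    have "(adj E u) \<ominus>\<^bsub>E\<^esub> (adj E x) = adj E (u \<ominus>\<^bsub>E\<^esub> x)"
      by (rule eqI) (simp_all add: x u(1) closed emb_simps star_simps)
    then show ?thesis using u by (simp add: q_eq_iff x closed J_adj)
  qed
  from UN_const[OF q_nonempty[OF x] this] show ?thesis
    by (simp add: quot_algebra_def)
qed

lemma Q_diff: assumes x: "x \<in> carrier E" and y: "y \<in> carrier E" shows "q x \<ominus>\<^bsub>Q\<^esub> q y = q (x \<ominus>\<^bsub>E\<^esub> y)"
  unfolding diff_def by (simp add: Q_add Q_scale x y closed)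

lemma Q_nrm_less: assumes x: "x \<in> carrier E" shows "nrm Q (q x) < e \<longleftrightarrow> (\<exists>y\<in>q x. nrm E y < e)"
proof -
  have "bdd_below (nrm E ` q x)"
    by (rule bdd_belowI[of _ 0]) (auto simp: mem_coset x nrm_nonneg)
  then show ?thesis
    using q_self[OF x] by (simp add: quot_algebra_def) (subst cInf_less_iff; auto)
qed

lemma Q_nrm_le: assumes x: "x \<in> carrier E" shows "nrm Q (q x) \<le> nrm E x"
  using Q_nrm_less[OF x, of "nrm Q (q x)"] q_self[OF x] by force

lemma Q_nrm_near: assumes x: "x \<in> carrier E" and e: "nrm Q (q x) < e"
  obtains y where "y \<in> carrier E" "q y = q x" "nrm E y < e"
  using Q_nrm_less[OF x, of e] e q_mem_eq[OF x] mem_coset[OF x] by blast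

lemma Q_nrm_nonneg: "x \<in> carrier E \<Longrightarrow> 0 \<le> nrm Q (q x)"
  by (rule ccontr) (use Q_nrm_less[of x 0] mem_coset[of x] nrm_nonneg in force)

lemma Q_nrm_eq_zero: assumes x: "x \<in> carrier E" shows "nrm Q (q x) = 0 \<longleftrightarrow> q x = q \<zero>\<^bsub>E\<^esub>"
proof
  assume n: "nrm Q (q x) = 0"
  have "x \<in> J"
  proof (rule J_closed[OF x])
    fix e :: real assume "e > 0"
    then obtain y where y: "y \<in> carrier E" "q y = q x" "nrm E y < e" using Q_nrm_near[OF x, of e] n by metis
    have "x \<ominus>\<^bsub>E\<^esub> y \<in> J" using y q_eq_iff[OF x y(1)] by simp
    moreover have "x \<ominus>\<^bsub>E\<^esub> (x \<ominus>\<^bsub>E\<^esub> y) = y" by (rule eqI) (simp_all add: x y closed emb_simps)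
    ultimately show "\<exists>s\<in>J. nrm E (x \<ominus>\<^bsub>E\<^esub> s) < e" using y by metis
  qed
  then show "q x = q \<zero>\<^bsub>E\<^esub>" by (simp add: q_eq_iff x closed diff_zero)
next
  assume "q x = q \<zero>\<^bsub>E\<^esub>"
  then show "nrm Q (q x) = 0" using Q_nrm_le[OF zero_closed] Q_nrm_nonneg[OF zero_closed] nrm_zero by simp
qed

lemma Q_nrm_triangle: assumes x: "x \<in> carrier E" and y: "y \<in> carrier E"
  shows "nrm Q (q x \<oplus>\<^bsub>Q\<^esub> q y) \<le> nrm Q (q x) + nrm Q (q y)"
proof (rule field_le_epsilon)
  fix e :: real assume "e > 0"
  then have "nrm Q (q x) < nrm Q (q x) + e / 2" "nrm Q (q y) < nrm Q (q y) + e / 2" by auto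
  then obtain u v where u: "u \<in> carrier E" "q u = q x" "nrm E u < nrm Q (q x) + e / 2"
    and v: "v \<in> carrier E" "q v = q y" "nrm E v < nrm Q (q y) + e / 2"
    using Q_nrm_near[OF x] Q_nrm_near[OF y] by metis
  have "nrm Q (q x \<oplus>\<^bsub>Q\<^esub> q y) = nrm Q (q (u \<oplus>\<^bsub>E\<^esub> v))" by (simp add: u v flip: Q_add)
  also have "\<dots> \<le> nrm E u + nrm E v" using Q_nrm_le[OF add_closed[OF u(1) v(1)]] nrm_triangle[OF u(1) v(1)] by simp
  finally show "nrm Q (q x \<oplus>\<^bsub>Q\<^esub> q y) \<le> nrm Q (q x) + nrm Q (q y) + e" using u v by simp
qed

lemma Q_nrm_scale_le: assumes x: "x \<in> carrier E"
  shows "nrm Q (c \<odot>\<^bsub>Q\<^esub> q x) \<le> cmod c * nrm Q (q x)"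
proof (cases "c = 0")
  case True
  then show ?thesis using Q_nrm_le[OF zero_closed] by (simp add: Q_scale x zero_scale nrm_zero)
next
  case False
  have "nrm Q (c \<odot>\<^bsub>Q\<^esub> q x) / cmod c \<le> nrm Q (q x)"
  proof (rule dense_ge)
    fix e assume "nrm Q (q x) < e"
    then obtain u where u: "u \<in> carrier E" "q u = q x" "nrm E u < e" using Q_nrm_near[OF x] by metis
    have "nrm Q (c \<odot>\<^bsub>Q\<^esub> q x) = nrm Q (q (c \<odot>\<^bsub>E\<^esub> u))" by (simp add: u flip: Q_scale)
    also have "\<dots> \<le> cmod c * nrm E u" using Q_nrm_le[OF scale_closed[OF u(1)]] nrm_scale[OF u(1)] by simp
    also have "\<dots> \<le> cmod c * e" using u by (simp add: mult_left_mono)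
    finally show "nrm Q (c \<odot>\<^bsub>Q\<^esub> q x) / cmod c \<le> e" using False by (simp add: field_simps)
  qed
  then show ?thesis using False by (simp add: field_simps)
qed

lemma Q_nrm_scale: assumes x: "x \<in> carrier E"
  shows "nrm Q (c \<odot>\<^bsub>Q\<^esub> q x) = cmod c * nrm Q (q x)"
proof (cases "c = 0")
  case True
  then show ?thesis using Q_nrm_scale_le[OF x, of c] Q_nrm_nonneg[OF scale_closed[OF x], of c] by (simp add: Q_scale x)
next
  case False
  have "(1 / c) \<odot>\<^bsub>Q\<^esub> q (c \<odot>\<^bsub>E\<^esub> x) = q x" using False by (simp add: Q_scale x closed scale_scale scale_one)
  then have "nrm Q (q x) \<le> cmod (1 / c) * nrm Q (c \<odot>\<^bsub>Q\<^esub> q x)"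
    using Q_nrm_scale_le[OF scale_closed[OF x, of c], of "1 / c"] by (simp only: Q_scale[OF x])
  then show ?thesis using Q_nrm_scale_le[OF x, of c] False by (simp add: norm_divide field_simps)
qed

lemma Q_nrm_mult: assumes x: "x \<in> carrier E" and y: "y \<in> carrier E"
  shows "nrm Q (q x \<otimes>\<^bsub>Q\<^esub> q y) \<le> nrm Q (q x) * nrm Q (q y)"
proof -
  have le: "nrm Q (q x \<otimes>\<^bsub>Q\<^esub> q y) \<le> a * b" if a: "nrm Q (q x) < a" and b: "nrm Q (q y) < b" for a b
  proof -
    obtain u v where u: "u \<in> carrier E" "q u = q x" "nrm E u < a"
      and v: "v \<in> carrier E" "q v = q y" "nrm E v < b"
      using Q_nrm_near[OF x a] Q_nrm_near[OF y b] by metis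
    have "nrm Q (q x \<otimes>\<^bsub>Q\<^esub> q y) = nrm Q (q (u \<otimes>\<^bsub>E\<^esub> v))" by (simp add: u v flip: Q_mult)
    also have "\<dots> \<le> nrm E u * nrm E v" using Q_nrm_le[OF mult_closed[OF u(1) v(1)]] nrm_mult[OF u(1) v(1)] by simp
    also have "\<dots> \<le> a * b"
      using u v nrm_nonneg[OF u(1)] nrm_nonneg[OF v(1)] by (intro mult_mono) auto
    finally show ?thesis .
  qed
  have lim: "(\<lambda>n. c + 1 / real (Suc n)) \<longlonglongrightarrow> c + 0" for c :: real
    using LIMSEQ_inverse_real_of_nat by (intro tendsto_add tendsto_const) (simp add: divide_inverse)
  have "nrm Q (q x \<otimes>\<^bsub>Q\<^esub> q y) \<le> (nrm Q (q x) + 0) * (nrm Q (q y) + 0)"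
    by (rule LIMSEQ_le_const[OF tendsto_mult[OF lim lim]]) (auto intro!: le)
  then show ?thesis by simp
qed

lemma Metric_space_Q: "Metric_space (carrier Q) (cdist Q)"
proof
  have dc: "X \<ominus>\<^bsub>Q\<^esub> Y \<in> carrier Q" "nrm Q (X \<ominus>\<^bsub>Q\<^esub> Y) = nrm Q (Y \<ominus>\<^bsub>Q\<^esub> X)"
    "0 \<le> nrm Q (X \<ominus>\<^bsub>Q\<^esub> Y)" if XY: "X \<in> carrier Q" "Y \<in> carrier Q" for X Y
  proof -
    obtain x y where xy: "x \<in> carrier E" "y \<in> carrier E" "X = q x" "Y = q y" using XY by (auto simp: carrier_Q)
    show "X \<ominus>\<^bsub>Q\<^esub> Y \<in> carrier Q" "0 \<le> nrm Q (X \<ominus>\<^bsub>Q\<^esub> Y)" by (simp_all add: xy Q_diff q_closed closed Q_nrm_nonneg)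
    have "y \<ominus>\<^bsub>E\<^esub> x = (-1) \<odot>\<^bsub>E\<^esub> (x \<ominus>\<^bsub>E\<^esub> y)" by (rule eqI) (simp_all add: xy closed emb_simps cs_def)
    then have "nrm Q (Y \<ominus>\<^bsub>Q\<^esub> X) = nrm Q ((-1) \<odot>\<^bsub>Q\<^esub> q (x \<ominus>\<^bsub>E\<^esub> y))" by (simp add: xy Q_diff Q_scale closed)
    also have "\<dots> = nrm Q (q (x \<ominus>\<^bsub>E\<^esub> y))" by (subst Q_nrm_scale) (simp_all add: xy closed)
    finally show "nrm Q (X \<ominus>\<^bsub>Q\<^esub> Y) = nrm Q (Y \<ominus>\<^bsub>Q\<^esub> X)" by (simp add: xy Q_diff)
  qed
  show "0 \<le> cdist Q X Y" for X Y by (simp add: cdist_def dc)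
  show "cdist Q X Y = cdist Q Y X" for X Y by (auto simp: cdist_def dc(2))
  show "(cdist Q X Y = 0) = (X = Y)" if XY: "X \<in> carrier Q" "Y \<in> carrier Q" for X Y
  proof -
    obtain x y where xy: "x \<in> carrier E" "y \<in> carrier E" "X = q x" "Y = q y" using XY by (auto simp: carrier_Q)
    have "cdist Q X Y = 0 \<longleftrightarrow> q (x \<ominus>\<^bsub>E\<^esub> y) = q \<zero>\<^bsub>E\<^esub>"
      by (simp add: cdist_def xy q_closed Q_diff Q_nrm_eq_zero closed)
    also have "\<dots> \<longleftrightarrow> X = Y" by (simp add: q_eq_iff xy closed diff_zero)
    finally show ?thesis .
  qed
  show "cdist Q X Z \<le> cdist Q X Y + cdist Q Y Z" if XY: "X \<in> carrier Q" "Y \<in> carrier Q" "Z \<in> carrier Q" for X Y Z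
  proof -
    obtain x y z where xy: "x \<in> carrier E" "y \<in> carrier E" "z \<in> carrier E" "X = q x" "Y = q y" "Z = q z"
      using XY by (auto simp: carrier_Q)
    have "x \<ominus>\<^bsub>E\<^esub> z = (x \<ominus>\<^bsub>E\<^esub> y) \<oplus>\<^bsub>E\<^esub> (y \<ominus>\<^bsub>E\<^esub> z)" by (rule eqI) (simp_all add: xy closed emb_simps)
    then show ?thesis
      using Q_nrm_triangle[of "x \<ominus>\<^bsub>E\<^esub> y" "y \<ominus>\<^bsub>E\<^esub> z"] by (simp add: cdist_def xy q_closed Q_diff closed Q_add)
  qed
qed

text \<open>A subsequence with distances below \<open>(1/2) ^ j\<close> is lifted one term at a
  time, each lift correcting the previous one by an element of comparably small norm. The lifts
  converge, hence the subsequence, hence the Cauchy sequence.\<close>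

lemma Q_complete: "Metric_space.mcomplete (carrier Q) (cdist Q)"
proof -
  interpret M: Metric_space "carrier Q" "cdist Q" by (rule Metric_space_Q)
  show ?thesis
    unfolding M.mcomplete_def
  proof (intro allI impI)
    fix s assume C: "M.MCauchy s"
    then have s: "s k \<in> carrier Q" for k by (auto simp: M.MCauchy_def)
    have "\<exists>N. \<forall>k\<ge>N. \<forall>l\<ge>N. cdist Q (s k) (s l) < (1/2) ^ j" for j :: nat
      using C unfolding M.MCauchy_def by (metis half_gt_zero_iff zero_less_numeral zero_less_one zero_less_power)
    then obtain N where N: "\<And>j k l. k \<ge> N j \<Longrightarrow> l \<ge> N j \<Longrightarrow> cdist Q (s k) (s l) < (1/2) ^ j" by metis
    define r where "r = rec_nat (N 0) (\<lambda>j m. max (Suc m) (N (Suc j)))"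
    have rS: "r (Suc j) = max (Suc (r j)) (N (Suc j))" for j by (simp add: r_def)
    have rN: "r j \<ge> N j" for j by (cases j) (simp_all add: rS, simp add: r_def)
    have sm: "strict_mono r" by (rule strict_monoI_Suc) (simp add: rS)
    have step: "cdist Q (s (r (Suc j))) (s (r j)) < (1/2) ^ j" for j
      by (rule N) (use rN[of j] strict_monoD[OF sm, of j "Suc j"] in auto)
    have "\<exists>y. \<forall>j. (y j \<in> carrier E \<and> q (y j) = s (r j)) \<and> nrm E (y (Suc j) \<ominus>\<^bsub>E\<^esub> y j) < (1/2) ^ j"
    proof (rule dependent_nat_choice)
      show "\<exists>x. x \<in> carrier E \<and> q x = s (r 0)" using s[of "r 0"] by (auto simp: carrier_Q)
      fix x j assume x: "x \<in> carrier E \<and> q x = s (r j)"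
      obtain x' where x': "x' \<in> carrier E" "q x' = s (r (Suc j))" using s[of "r (Suc j)"] by (auto simp: carrier_Q)
      have "nrm Q (q (x' \<ominus>\<^bsub>E\<^esub> x)) < (1/2) ^ j"
        using step[of j] s x x' by (simp add: cdist_def flip: Q_diff)
      then obtain d where d: "d \<in> carrier E" "q d = q (x' \<ominus>\<^bsub>E\<^esub> x)" "nrm E d < (1/2) ^ j"
        using Q_nrm_near[of "x' \<ominus>\<^bsub>E\<^esub> x"] x x' closed by metis
      have "(x \<oplus>\<^bsub>E\<^esub> d) \<ominus>\<^bsub>E\<^esub> x = d" by (rule eqI) (simp_all add: x d closed emb_simps)
      moreover have "q (x \<oplus>\<^bsub>E\<^esub> d) = q x'"
      proof -
        have "q (x \<oplus>\<^bsub>E\<^esub> d) = q (x \<oplus>\<^bsub>E\<^esub> (x' \<ominus>\<^bsub>E\<^esub> x))" using x x' d by (simp add: closed flip: Q_add)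
        also have "x \<oplus>\<^bsub>E\<^esub> (x' \<ominus>\<^bsub>E\<^esub> x) = x'" by (rule eqI) (simp_all add: x x' closed emb_simps)
        finally show ?thesis .
      qed
      ultimately show "\<exists>y. (y \<in> carrier E \<and> q y = s (r (Suc j))) \<and> nrm E (y \<ominus>\<^bsub>E\<^esub> x) < (1/2) ^ j"
        using x x' d by (intro exI[of _ "x \<oplus>\<^bsub>E\<^esub> d"]) (simp add: closed)
    qed
    then obtain y where y: "\<And>j. y j \<in> carrier E" "\<And>j. q (y j) = s (r j)" "\<And>j. nrm E (y (Suc j) \<ominus>\<^bsub>E\<^esub> y j) < (1/2) ^ j"
      by auto
    \<comment> \<open>The telescoping series is summed in the Banach space of the ambient type, and
      \<open>ev\<close> brings the limit back to \<open>E\<close>.\<close>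
    define Y where "Y j = emb E (y j)" for j
    have "summable (\<lambda>j. Y (Suc j) - Y j)"
    proof (rule summable_comparison_test[OF _ summable_geometric[of "1/2 :: real"]])
      have "norm (Y (Suc j) - Y j) \<le> (1/2) ^ j" for j
        using less_imp_le[OF y(3)[of j]] norm_emb[OF E diff_closed[OF y(1) y(1)], of "Suc j" j]
        by (simp add: Y_def emb_simps y(1))
      then show "\<exists>N. \<forall>n\<ge>N. norm (Y (Suc n) - Y n) \<le> (1/2) ^ n" by blast
    qed simp
    then have "convergent (\<lambda>n. \<Sum>j<n. Y (Suc j) - Y j)" by (simp add: summable_iff_convergent)
    then obtain L where "(\<lambda>n. \<Sum>j<n. Y (Suc j) - Y j) \<longlonglongrightarrow> L" by (auto simp: convergent_def)
    then have L: "(\<lambda>n. Y n - Y 0) \<longlonglongrightarrow> L" by (simp add: sum_lessThan_telescope)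
    then have "(\<lambda>n. norm (Y n - (L + Y 0))) \<longlonglongrightarrow> 0" using tendsto_norm_zero[OF LIM_zero[OF L]] by (simp add: algebra_simps)
    define l where "l = ev E (L + Y 0)"
    have l: "l \<in> carrier E" unfolding l_def by (rule ev_closed[OF E])
    have "nrm E (y n \<ominus>\<^bsub>E\<^esub> l) \<le> norm (Y n - (L + Y 0))" for n
      using nrm_ev_le_norm[OF E, of "Y n - (L + Y 0)"] by (simp add: E l_def Y_def ev_emb[OF E] y(1))
    then have d: "cdist Q (s (r n)) (q l) \<le> norm (Y n - (L + Y 0))" for n
      using Q_nrm_le[OF diff_closed[OF y(1) l], of n] s[of "r n"]
      by (simp add: cdist_def q_closed l y Q_diff flip: y(2)) (meson order_trans)
    have "(\<lambda>n. cdist Q (s (r n)) (q l)) \<longlonglongrightarrow> 0"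
      by (rule tendsto_sandwich[OF _ _ tendsto_const \<open>(\<lambda>n. norm (Y n - (L + Y 0))) \<longlonglongrightarrow> 0\<close>]) (use d M.nonneg in auto)
    then have "limitin M.mtopology (s \<circ> r) (q l) sequentially"
      unfolding M.limitin_metric_dist_null using s q_closed[OF l] by (auto simp: o_def)
    then show "\<exists>x. limitin M.mtopology s x sequentially"
      using M.MCauchy_convergent_subsequence[OF C sm] by blast
  qed
qed

text \<open>One half of the C*-identity does not follow formally from the infimum norm, so it is
  left as a premise; for the sequence algebra it comes from the description of the norm as a limes
  superior.\<close>

lemma cstar_algebra_Q:
  assumes cstar: "\<And>x. x \<in> carrier E \<Longrightarrow> (nrm Q (q x))\<^sup>2 \<le> nrm Q (q (adj E x \<otimes>\<^bsub>E\<^esub> x))"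
  shows "cstar_algebra Q"
proof
  note [simp] = Q_zero Q_add Q_mult Q_scale Q_adj closed q_closed
  show "\<zero>\<^bsub>Q\<^esub> \<in> carrier Q" by simp
  show "Metric_space.mcomplete (carrier Q) (cdist Q)" by (rule Q_complete)
  fix X assume "X \<in> carrier Q"
  then obtain x where x [simp]: "x \<in> carrier E" and X [simp]: "X = q x" by (auto simp: carrier_Q)
  show "c \<odot>\<^bsub>Q\<^esub> X \<in> carrier Q" "adj Q X \<in> carrier Q" for c by simp_all
  show "X \<oplus>\<^bsub>Q\<^esub> \<zero>\<^bsub>Q\<^esub> = X" by (simp add: add_zero)
  show "X \<oplus>\<^bsub>Q\<^esub> (- 1) \<odot>\<^bsub>Q\<^esub> X = \<zero>\<^bsub>Q\<^esub>" by (simp add: add_minus)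
  show "1 \<odot>\<^bsub>Q\<^esub> X = X" by (simp add: scale_one)
  show "c \<odot>\<^bsub>Q\<^esub> d \<odot>\<^bsub>Q\<^esub> X = (c * d) \<odot>\<^bsub>Q\<^esub> X" for c d by (simp add: scale_scale)
  show "(c + d) \<odot>\<^bsub>Q\<^esub> X = c \<odot>\<^bsub>Q\<^esub> X \<oplus>\<^bsub>Q\<^esub> d \<odot>\<^bsub>Q\<^esub> X" for c d by (simp add: scale_add_left)
  show "adj Q (adj Q X) = X" by (simp add: adj_adj)
  show "adj Q (c \<odot>\<^bsub>Q\<^esub> X) = cnj c \<odot>\<^bsub>Q\<^esub> adj Q X" for c by (simp add: adj_scale)
  show "0 \<le> nrm Q X" by (simp add: Q_nrm_nonneg)
  show "(nrm Q X = 0) = (X = \<zero>\<^bsub>Q\<^esub>)" by (simp add: Q_nrm_eq_zero)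
  show "nrm Q (c \<odot>\<^bsub>Q\<^esub> X) = cmod c * nrm Q X" for c using Q_nrm_scale[OF x] by simp
  show "nrm Q (adj Q X \<otimes>\<^bsub>Q\<^esub> X) = (nrm Q X)\<^sup>2"
  proof (rule antisym)
    have a: "nrm Q (q (adj E x)) \<le> nrm Q (q x)"
    proof (rule dense_ge)
      fix e assume "nrm Q (q x) < e"
      then obtain u where u: "u \<in> carrier E" "q u = q x" "nrm E u < e" using Q_nrm_near[OF x] by metis
      have "nrm Q (q (adj E x)) = nrm Q (q (adj E u))" using u by (metis Q_adj x)
      then show "nrm Q (q (adj E x)) \<le> e"
        using Q_nrm_le[OF adj_closed[OF u(1)]] nrm_adj[OF u(1)] u(3) by simp
    qed
    show "nrm Q (adj Q X \<otimes>\<^bsub>Q\<^esub> X) \<le> (nrm Q X)\<^sup>2"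
      using Q_nrm_mult[of "adj E x" x] mult_right_mono[OF a Q_nrm_nonneg[OF x]] by (simp add: power2_eq_square)
  qed (use cstar[OF x] in simp)
  fix Y assume "Y \<in> carrier Q"
  then obtain y where y [simp]: "y \<in> carrier E" and Y [simp]: "Y = q y" by (auto simp: carrier_Q)
  show "X \<oplus>\<^bsub>Q\<^esub> Y \<in> carrier Q" "X \<otimes>\<^bsub>Q\<^esub> Y \<in> carrier Q" by simp_all
  show "X \<oplus>\<^bsub>Q\<^esub> Y = Y \<oplus>\<^bsub>Q\<^esub> X" by (simp add: add_commute)
  show "c \<odot>\<^bsub>Q\<^esub> (X \<oplus>\<^bsub>Q\<^esub> Y) = c \<odot>\<^bsub>Q\<^esub> X \<oplus>\<^bsub>Q\<^esub> c \<odot>\<^bsub>Q\<^esub> Y" for c by (simp add: scale_add_right)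
  show "(c \<odot>\<^bsub>Q\<^esub> X) \<otimes>\<^bsub>Q\<^esub> Y = c \<odot>\<^bsub>Q\<^esub> (X \<otimes>\<^bsub>Q\<^esub> Y)" for c by (simp add: mult_scale_left)
  show "X \<otimes>\<^bsub>Q\<^esub> (c \<odot>\<^bsub>Q\<^esub> Y) = c \<odot>\<^bsub>Q\<^esub> (X \<otimes>\<^bsub>Q\<^esub> Y)" for c by (simp add: mult_scale_right)
  show "adj Q (X \<oplus>\<^bsub>Q\<^esub> Y) = adj Q X \<oplus>\<^bsub>Q\<^esub> adj Q Y" by (simp add: adj_add)
  show "adj Q (X \<otimes>\<^bsub>Q\<^esub> Y) = adj Q Y \<otimes>\<^bsub>Q\<^esub> adj Q X" by (simp add: adj_mult)
  show "nrm Q (X \<oplus>\<^bsub>Q\<^esub> Y) \<le> nrm Q X + nrm Q Y" using Q_nrm_triangle[OF x y] by simp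
  show "nrm Q (X \<otimes>\<^bsub>Q\<^esub> Y) \<le> nrm Q X * nrm Q Y" using Q_nrm_mult[OF x y] by simp
  fix Z assume "Z \<in> carrier Q"
  then obtain z where z [simp]: "z \<in> carrier E" and Z [simp]: "Z = q z" by (auto simp: carrier_Q)
  show "X \<oplus>\<^bsub>Q\<^esub> Y \<oplus>\<^bsub>Q\<^esub> Z = X \<oplus>\<^bsub>Q\<^esub> (Y \<oplus>\<^bsub>Q\<^esub> Z)" by (simp add: add_assoc)
  show "X \<otimes>\<^bsub>Q\<^esub> Y \<otimes>\<^bsub>Q\<^esub> Z = X \<otimes>\<^bsub>Q\<^esub> (Y \<otimes>\<^bsub>Q\<^esub> Z)" by (simp add: mult_assoc)
  show "(X \<oplus>\<^bsub>Q\<^esub> Y) \<otimes>\<^bsub>Q\<^esub> Z = X \<otimes>\<^bsub>Q\<^esub> Z \<oplus>\<^bsub>Q\<^esub> Y \<otimes>\<^bsub>Q\<^esub> Z" by (simp add: mult_add_left)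
  show "X \<otimes>\<^bsub>Q\<^esub> (Y \<oplus>\<^bsub>Q\<^esub> Z) = X \<otimes>\<^bsub>Q\<^esub> Y \<oplus>\<^bsub>Q\<^esub> X \<otimes>\<^bsub>Q\<^esub> Z" by (simp add: mult_add_right)
qed

lemma is_unit_Q: "is_unit Q (q \<one>\<^bsub>E\<^esub>)"
  unfolding is_unit_def carrier_Q using ucstar_one[OF E] by (auto simp: Q_mult)

lemma Q_one: "\<one>\<^bsub>Q\<^esub> = q \<one>\<^bsub>E\<^esub>"
proof -
  have u: "e = q \<one>\<^bsub>E\<^esub>" if "is_unit Q e" for e
    using that is_unit_Q unfolding is_unit_def by metis
  show ?thesis unfolding one_def[of Q]
    by (rule the_equality[where P="is_unit Q", OF is_unit_Q u])
qed

lemma unital_Q: "unital Q"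
  using is_unit_Q by (auto simp: unital_def)

end

section \<open>The sequence algebra\<close>

abbreviation c0 :: "'a calg \<Rightarrow> (nat \<Rightarrow> 'a) set" where
  "c0 A \<equiv> c0_sum (\<lambda>_. A)"

abbreviation cls :: "'a calg \<Rightarrow> (nat \<Rightarrow> 'a) \<Rightarrow> (nat \<Rightarrow> 'a) set" where
  "cls A \<equiv> coset (linf A) (c0 A)"

lemma c0_iff: "x \<in> c0 A \<longleftrightarrow> x \<in> carrier (linf A) \<and> (\<lambda>n. nrm A (x n)) \<longlonglongrightarrow> 0"
  by (simp add: c0_sum_def)

lemma (in cstar_algebra) null_le:
  assumes "\<And>n. x n \<in> carrier A" "\<And>n. nrm A (x n) \<le> f n" "f \<longlonglongrightarrow> 0"
  shows "(\<lambda>n. nrm A (x n)) \<longlonglongrightarrow> 0"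
  by (rule tendsto_sandwich[OF _ _ tendsto_const assms(3)]) (simp_all add: assms nrm_nonneg)

lemma quotient_c0:
  assumes A: "A \<in> ucstar"
  shows "quotient_calg (linf A) (c0 A)"
proof
  interpret cstar_algebra A by (rule ucstarD(1)[OF A])
  interpret L: cstar_algebra "linf A" by (rule cstar_algebra_linf)
  show "linf A \<in> ucstar" by (rule ucstar_linf[OF A])
  show "adj (linf A) x \<in> c0 A" if "x \<in> c0 A" for x
    using that by (simp add: c0_iff linf_adj linf_closed nrm_adj)
  have mult: "(\<lambda>n. nrm A (a n \<otimes>\<^bsub>A\<^esub> x n)) \<longlonglongrightarrow> 0 \<and> (\<lambda>n. nrm A (x n \<otimes>\<^bsub>A\<^esub> a n)) \<longlonglongrightarrow> 0"
    if x: "x \<in> c0 A" and a: "a \<in> carrier (linf A)" for x a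
  proof -
    have lim: "(\<lambda>n. nrm (linf A) a * nrm A (x n)) \<longlonglongrightarrow> 0"
      using tendsto_mult[OF tendsto_const, of "\<lambda>n. nrm A (x n)" 0 sequentially "nrm (linf A) a"] x by (simp add: c0_iff)
    have c: "\<And>n. x n \<in> carrier A" "\<And>n. a n \<in> carrier A" using x a by (auto simp: c0_iff linf_closed)
    have b: "nrm A (a n) * nrm A (x n) \<le> nrm (linf A) a * nrm A (x n)" for n
      by (intro mult_right_mono linf_norm_ge a nrm_nonneg c)
    have le: "nrm A (a n \<otimes>\<^bsub>A\<^esub> x n) \<le> nrm (linf A) a * nrm A (x n)"
      "nrm A (x n \<otimes>\<^bsub>A\<^esub> a n) \<le> nrm (linf A) a * nrm A (x n)" for n
      using nrm_mult[OF c(2)[of n] c(1)[of n]] nrm_mult[OF c(1)[of n] c(2)[of n]] b[of n] by (simp_all add: mult.commute)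
    show ?thesis
      using null_le[OF mult_closed[OF c(2,1)] le(1) lim] null_le[OF mult_closed[OF c(1,2)] le(2) lim] by blast
  qed
  show "closed_ideal (c0 A) (linf A)"
    unfolding closed_ideal_def L.closedin_norm_iff
  proof (intro conjI ballI allI impI)
    show "c0 A \<subseteq> carrier (linf A)" by (auto simp: c0_iff)
    show "\<zero>\<^bsub>linf A\<^esub> \<in> c0 A" by (simp add: c0_iff linf_const zero_closed nrm_zero)
    show "x \<oplus>\<^bsub>linf A\<^esub> y \<in> c0 A" if "x \<in> c0 A" "y \<in> c0 A" for x y
    proof -
      have "(\<lambda>n. nrm A (x n) + nrm A (y n)) \<longlonglongrightarrow> 0" using that by (intro tendsto_add_zero) (simp_all add: c0_iff)
      then have "(\<lambda>n. nrm A (x n \<oplus>\<^bsub>A\<^esub> y n)) \<longlonglongrightarrow> 0"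
        using that by (intro null_le[where f="\<lambda>n. nrm A (x n) + nrm A (y n)"]) (auto simp: c0_iff linf_closed add_closed nrm_triangle)
      then show ?thesis using that by (simp add: c0_iff linf_add)
    qed
    show "c \<odot>\<^bsub>linf A\<^esub> x \<in> c0 A" if "x \<in> c0 A" for x c
      using that tendsto_mult[OF tendsto_const, of "\<lambda>n. nrm A (x n)" 0 sequentially "cmod c"]
      by (simp add: c0_iff linf_scale linf_closed nrm_scale)
    show "a \<otimes>\<^bsub>linf A\<^esub> x \<in> c0 A" "x \<otimes>\<^bsub>linf A\<^esub> a \<in> c0 A" if "x \<in> c0 A" "a \<in> carrier (linf A)" for x a
      using mult[OF that] that by (simp_all add: c0_iff linf_mult)
    fix x assume x: "x \<in> carrier (linf A)" and ap: "\<forall>e>0. \<exists>s\<in>c0 A. nrm (linf A) (x \<ominus>\<^bsub>linf A\<^esub> s) < e"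
    have "(\<lambda>n. nrm A (x n)) \<longlonglongrightarrow> 0"
    proof (rule LIMSEQ_I)
      fix e :: real assume "0 < e"
      then obtain s where s: "s \<in> c0 A" "nrm (linf A) (x \<ominus>\<^bsub>linf A\<^esub> s) < e / 2" using ap half_gt_zero by blast
      have sc: "s \<in> carrier (linf A)" using s by (simp add: c0_iff)
      obtain N where N: "\<And>n. n \<ge> N \<Longrightarrow> norm (nrm A (s n) - 0) < e / 2"
        using s LIMSEQ_D[of "\<lambda>n. nrm A (s n)" 0 "e / 2"] \<open>0 < e\<close> by (auto simp: c0_iff)
      have "norm (nrm A (x n) - 0) < e" if "n \<ge> N" for n
        using N[OF that] nrm_triangle_sub[OF linf_closed[OF x] linf_closed[OF sc], of n n] s(2)
          linf_norm_ge[OF linf_diff[OF x sc], of n] nrm_nonneg[OF linf_closed[OF x, of n]] by simp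
      then show "\<exists>no. \<forall>n\<ge>no. norm (nrm A (x n) - 0) < e" by blast
    qed
    then show "x \<in> c0 A" using x by (simp add: c0_iff)
  qed
qed

context
  fixes A :: "'a calg"
  assumes A: "A \<in> ucstar"
begin

interpretation cstar_algebra A by (rule ucstarD(1)[OF A])
interpretation C: quotient_calg "linf A" "c0 A" by (rule quotient_c0[OF A])

lemma seq_algebra_eq: "seq_algebra A = quot_algebra (linf A) (c0 A)"
  by (simp add: seq_algebra_def)

lemma carrier_seq: "carrier (seq_algebra A) = cls A ` carrier (linf A)"
  by (simp add: seq_algebra_eq C.carrier_Q)

lemma cls_closed: "x \<in> carrier (linf A) \<Longrightarrow> cls A x \<in> carrier (seq_algebra A)"
  by (simp add: carrier_seq)

lemma cls_eq_iff:
  assumes "x \<in> carrier (linf A)" "y \<in> carrier (linf A)"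
  shows "cls A x = cls A y \<longleftrightarrow> (\<lambda>n. nrm A (x n \<ominus>\<^bsub>A\<^esub> y n)) \<longlonglongrightarrow> 0"
  using C.q_eq_iff[OF assms] linf_diff[OF assms] by (simp add: c0_iff)

lemma cls_mem_eq: "x \<in> carrier (linf A) \<Longrightarrow> y \<in> cls A x \<Longrightarrow> y \<in> carrier (linf A) \<and> cls A y = cls A x"
  using C.q_mem_eq C.mem_coset by blast

lemma cls_ops:
  assumes "x \<in> carrier (linf A)"
  shows "y \<in> carrier (linf A) \<Longrightarrow> cls A x \<oplus>\<^bsub>seq_algebra A\<^esub> cls A y = cls A (\<lambda>n. x n \<oplus>\<^bsub>A\<^esub> y n)"
    "y \<in> carrier (linf A) \<Longrightarrow> cls A x \<otimes>\<^bsub>seq_algebra A\<^esub> cls A y = cls A (\<lambda>n. x n \<otimes>\<^bsub>A\<^esub> y n)"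
    "y \<in> carrier (linf A) \<Longrightarrow> cls A x \<ominus>\<^bsub>seq_algebra A\<^esub> cls A y = cls A (\<lambda>n. x n \<ominus>\<^bsub>A\<^esub> y n)"
    "c \<odot>\<^bsub>seq_algebra A\<^esub> cls A x = cls A (\<lambda>n. c \<odot>\<^bsub>A\<^esub> x n)"
    "adj (seq_algebra A) (cls A x) = cls A (\<lambda>n. adj A (x n))"
  using assms by (simp_all add: seq_algebra_eq C.Q_add C.Q_mult C.Q_scale C.Q_adj C.Q_diff)

text \<open>A representative of norm below \<open>e\<close> differs from \<open>x\<close> by a null
  sequence. This is the passage by which strict inequalities in the sequence algebra reach all but
  finitely many coordinates.\<close>

lemma cls_nrm_less:
  assumes x: "x \<in> carrier (linf A)" and e: "nrm (seq_algebra A) (cls A x) < e"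
  shows "\<forall>\<^sub>F n in sequentially. nrm A (x n) < e"
proof -
  obtain y where y: "y \<in> carrier (linf A)" "cls A y = cls A x" "nrm (linf A) y < e"
    using C.Q_nrm_near[OF x] e unfolding seq_algebra_eq by metis
  have "(\<lambda>n. nrm A (x n \<ominus>\<^bsub>A\<^esub> y n)) \<longlonglongrightarrow> 0" using y cls_eq_iff[OF x y(1)] by simp
  then have "\<forall>\<^sub>F n in sequentially. nrm A (x n \<ominus>\<^bsub>A\<^esub> y n) < e - nrm (linf A) y"
    by (rule order_tendstoD) (use y in simp)
  then show ?thesis
  proof eventually_elim
    case (elim n)
    then show ?case
      using nrm_triangle_sub[OF linf_closed[OF x] linf_closed[OF y(1)], of n n] linf_norm_ge[OF y(1), of n] by simp
  qed
qed

text \<open>Replacing the first \<open>N\<close> terms by zero changes \<open>x\<close> by a null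
  sequence only. Together with \<open>cls_nrm_less\<close> this describes the quotient norm as the
  limes superior of the coordinate norms.\<close>

lemma cls_nrm_leI:
  assumes x: "x \<in> carrier (linf A)" and e: "\<And>e. e > c \<Longrightarrow> \<forall>\<^sub>F n in sequentially. nrm A (x n) < e"
  shows "nrm (seq_algebra A) (cls A x) \<le> c"
proof (rule dense_ge)
  fix e assume ce: "c < e"
  then obtain N where N: "\<And>n. n \<ge> N \<Longrightarrow> nrm A (x n) < e" using e unfolding eventually_sequentially by blast
  then have e0: "0 \<le> e" using nrm_nonneg[OF linf_closed[OF x, of N]] by (meson less_imp_le order_trans order_refl)
  define y where "y n = (if n \<ge> N then x n else \<zero>\<^bsub>A\<^esub>)" for n
  have bd: "nrm A (y n) \<le> e" for n using N e0 by (auto simp: y_def nrm_zero less_imp_le)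
  have y: "y \<in> carrier (linf A)"
    by (rule linf_carrierI[OF _ bd]) (auto simp: y_def linf_closed[OF x] zero_closed)
  have "\<forall>\<^sub>F n in sequentially. nrm A (y n \<ominus>\<^bsub>A\<^esub> x n) = 0"
    using eventually_ge_at_top[of N]
  proof eventually_elim
    case (elim n)
    then show ?case using Metric_space.zero[OF Metric_space_cdist, of "x n" "x n"] linf_closed[OF x, of n]
      by (simp add: y_def cdist_def)
  qed
  then have "cls A y = cls A x"
    using cls_eq_iff[OF y x] by (simp add: tendsto_eventually)
  then have "nrm (seq_algebra A) (cls A x) \<le> nrm (linf A) y"
    using C.Q_nrm_le[OF y] by (simp add: seq_algebra_eq)
  also have "\<dots> \<le> e" using bd linf_norm_le_iff[OF y] by simp
  finally show "nrm (seq_algebra A) (cls A x) \<le> e" .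
qed

text \<open>The remaining half of the C*-identity is checked in coordinates, where
  \<open>nrm_cstar\<close> turns a bound \<open>e\<^sup>2\<close> on the squares into the bound
  \<open>e\<close>.\<close>

lemma ucstar_seq: "seq_algebra A \<in> ucstar"
proof (rule ucstarI)
  show "unital (seq_algebra A)" using C.unital_Q by (simp add: seq_algebra_eq)
  show "cstar_algebra (seq_algebra A)"
    unfolding seq_algebra_eq
  proof (rule C.cstar_algebra_Q)
    fix x assume x: "x \<in> carrier (linf A)"
    let ?c = "nrm (quot_algebra (linf A) (c0 A)) (cls A (adj (linf A) x \<otimes>\<^bsub>linf A\<^esub> x))"
    have xx: "adj (linf A) x \<otimes>\<^bsub>linf A\<^esub> x \<in> carrier (linf A)" using linf_mult[OF linf_adj[OF x] x] by simp
    have c0: "0 \<le> ?c" by (rule C.Q_nrm_nonneg[OF xx])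
    have "nrm (seq_algebra A) (cls A x) \<le> sqrt ?c"
    proof (rule cls_nrm_leI[OF x])
      fix e assume e: "sqrt ?c < e"
      then have "?c < e\<^sup>2" using power_strict_mono[OF e, of 2] c0 by simp
      then have "\<forall>\<^sub>F n in sequentially. nrm A (adj A (x n) \<otimes>\<^bsub>A\<^esub> x n) < e\<^sup>2"
        using cls_nrm_less[OF xx, of "e\<^sup>2"] by (simp add: seq_algebra_eq)
      then show "\<forall>\<^sub>F n in sequentially. nrm A (x n) < e"
      proof eventually_elim
        case (elim n)
        have "0 \<le> e" using e real_sqrt_ge_zero[OF c0] by linarith
        then show ?case using elim by (simp add: nrm_cstar linf_closed[OF x] power2_less_imp_less)
      qed
    qed
    then show "(nrm (quot_algebra (linf A) (c0 A)) (cls A x))\<^sup>2 \<le> ?c"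
      using power_mono[of "nrm (quot_algebra (linf A) (c0 A)) (cls A x)" "sqrt ?c" 2] c0 C.Q_nrm_nonneg[OF x]
      by (simp add: seq_algebra_eq)
  qed
qed

lemma seq_const_eq: "seq_const A a = cls A (\<lambda>_. a)"
  by (simp add: seq_const_def)

lemma seq_one: "\<one>\<^bsub>seq_algebra A\<^esub> = seq_const A \<one>\<^bsub>A\<^esub>"
proof -
  have "is_unit (linf A) (\<lambda>n. \<one>\<^bsub>A\<^esub>)"
    unfolding is_unit_def by (auto simp: linf_const ucstar_one[OF A] linf_closed)
  then have "\<one>\<^bsub>linf A\<^esub> = (\<lambda>n. \<one>\<^bsub>A\<^esub>)" by (rule C.one_eq)
  then show ?thesis using C.Q_one by (simp add: seq_algebra_eq seq_const_eq)
qed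

lemma cstar_hom_seq_const: "cstar_hom A (seq_algebra A) (seq_const A)"
  unfolding cstar_hom_def
  by (auto simp: seq_const_eq cls_ops linf_const cls_closed)

lemma seq_const_eq_zero:
  assumes a: "a \<in> carrier A" and z: "seq_const A a = \<zero>\<^bsub>seq_algebra A\<^esub>"
  shows "a = \<zero>\<^bsub>A\<^esub>"
proof -
  have "cls A (\<lambda>_. a) = cls A (\<lambda>_. \<zero>\<^bsub>A\<^esub>)"
    using z C.Q_zero by (simp add: seq_const_eq seq_algebra_eq)
  then have "(\<lambda>n::nat. nrm A a) \<longlonglongrightarrow> 0"
    using cls_eq_iff[OF linf_const[OF a] linf_const[OF zero_closed]] by (simp add: diff_zero a)
  then show ?thesis using nrm_eq_zero[OF a] by (simp add: LIMSEQ_const_iff)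
qed

lemma seq_zero: "\<zero>\<^bsub>seq_algebra A\<^esub> = cls A (\<lambda>_. \<zero>\<^bsub>A\<^esub>)"
  using C.Q_zero by (simp add: seq_algebra_eq)

end

section \<open>Lifting to coordinates\<close>

text \<open>Copy of an algebra along an injection into another type, needed because the lifting
  properties of \<open>D\<close> speak only of targets on the type of \<open>D\<close>.\<close>

definition transport :: "('a \<Rightarrow> 'b) \<Rightarrow> 'a calg \<Rightarrow> 'b calg" where
  "transport f A = (let g = inv_into (carrier A) f in
     \<lparr>carrier = f ` carrier A,
      zero = f \<zero>\<^bsub>A\<^esub>,
      add = \<lambda>x y. f (g x \<oplus>\<^bsub>A\<^esub> g y),
      scale = \<lambda>c x. f (c \<odot>\<^bsub>A\<^esub> g x),
      mult = \<lambda>x y. f (g x \<otimes>\<^bsub>A\<^esub> g y),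
      adj = \<lambda>x. f (adj A (g x)),
      nrm = \<lambda>x. nrm A (g x)\<rparr>)"

locale transported = cstar_algebra A for A :: "'a calg" +
  fixes f :: "'a \<Rightarrow> 'b"
  assumes inj: "inj_on f (carrier A)"
begin

abbreviation "T \<equiv> transport f A"
abbreviation "g \<equiv> inv_into (carrier A) f"

lemma g_f [simp]: "x \<in> carrier A \<Longrightarrow> g (f x) = x"
  using inj by (rule inv_into_f_f)

lemma T_simps [simp]:
  "carrier T = f ` carrier A" "\<zero>\<^bsub>T\<^esub> = f \<zero>\<^bsub>A\<^esub>"
  "x \<in> carrier A \<Longrightarrow> y \<in> carrier A \<Longrightarrow> f x \<oplus>\<^bsub>T\<^esub> f y = f (x \<oplus>\<^bsub>A\<^esub> y)"
  "x \<in> carrier A \<Longrightarrow> c \<odot>\<^bsub>T\<^esub> f x = f (c \<odot>\<^bsub>A\<^esub> x)"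
  "x \<in> carrier A \<Longrightarrow> y \<in> carrier A \<Longrightarrow> f x \<otimes>\<^bsub>T\<^esub> f y = f (x \<otimes>\<^bsub>A\<^esub> y)"
  "x \<in> carrier A \<Longrightarrow> adj T (f x) = f (adj A x)"
  "x \<in> carrier A \<Longrightarrow> nrm T (f x) = nrm A x"
  by (simp_all add: transport_def Let_def)

lemma T_diff [simp]: "x \<in> carrier A \<Longrightarrow> y \<in> carrier A \<Longrightarrow> f x \<ominus>\<^bsub>T\<^esub> f y = f (x \<ominus>\<^bsub>A\<^esub> y)"
  by (simp add: diff_def scale_closed)

lemma f_eq_iff: "x \<in> carrier A \<Longrightarrow> y \<in> carrier A \<Longrightarrow> f x = f y \<longleftrightarrow> x = y"
  using inj by (simp add: inj_on_eq_iff)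

lemma cdist_T: "x \<in> carrier A \<Longrightarrow> y \<in> carrier A \<Longrightarrow> cdist T (f x) (f y) = cdist A x y"
  by (simp add: cdist_def diff_closed)

lemma Metric_space_T: "Metric_space (carrier T) (cdist T)"
proof -
  interpret M: Metric_space "carrier A" "cdist A" by (rule Metric_space_cdist)
  show ?thesis
  proof
    have nn: "0 \<le> cdist T x y \<and> cdist T x y = cdist T y x" for x y
    proof (cases "x \<in> carrier T \<and> y \<in> carrier T")
      case True
      then show ?thesis by (auto simp: cdist_T M.commute)
    next
      case False
      then show ?thesis by (simp only: cdist_def) auto
    qed
    then show "0 \<le> cdist T x y" "cdist T x y = cdist T y x" for x y by auto
    show "x \<in> carrier T \<Longrightarrow> y \<in> carrier T \<Longrightarrow> (cdist T x y = 0) = (x = y)" for x y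
      by (auto simp: cdist_T f_eq_iff)
    show "x \<in> carrier T \<Longrightarrow> y \<in> carrier T \<Longrightarrow> z \<in> carrier T \<Longrightarrow> cdist T x z \<le> cdist T x y + cdist T y z" for x y z
      by (auto simp: cdist_T M.triangle)
  qed
qed

lemma T_complete: "Metric_space.mcomplete (carrier T) (cdist T)"
proof -
  interpret M: Metric_space "carrier A" "cdist A" by (rule Metric_space_cdist)
  interpret MT: Metric_space "carrier T" "cdist T" by (rule Metric_space_T)
  show ?thesis
    unfolding MT.mcomplete_def
  proof (intro allI impI)
    fix s assume C: "MT.MCauchy s"
    then have "s n \<in> f ` carrier A" for n using C[unfolded MT.MCauchy_def] by auto
    then obtain r where r: "\<And>n. r n \<in> carrier A" "\<And>n. s n = f (r n)" unfolding image_iff by metis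
    have "M.MCauchy r"
      using C r(1) unfolding M.MCauchy_def MT.MCauchy_def by (auto simp: r cdist_T)
    then obtain l where l: "limitin M.mtopology r l sequentially"
      using complete unfolding M.mcomplete_def by blast
    then have lc: "l \<in> carrier A" "(\<lambda>n. cdist A (r n) l) \<longlonglongrightarrow> 0" unfolding M.limitin_metric_dist_null by auto
    have "limitin MT.mtopology s (f l) sequentially"
      unfolding MT.limitin_metric_dist_null using lc r by (simp add: cdist_T)
    then show "\<exists>x. limitin MT.mtopology s x sequentially" by blast
  qed
qed

lemma cstar_algebra_T: "cstar_algebra T"
proof
  note [simp] = add_closed scale_closed mult_closed adj_closed zero_closed f_eq_iff
  show "\<zero>\<^bsub>T\<^esub> \<in> carrier T" by simp
  show "Metric_space.mcomplete (carrier T) (cdist T)" by (rule T_complete)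
  fix X assume "X \<in> carrier T"
  then obtain x where x [simp]: "x \<in> carrier A" and X [simp]: "X = f x" by auto
  show "c \<odot>\<^bsub>T\<^esub> X \<in> carrier T" "adj T X \<in> carrier T" for c by simp_all
  show "X \<oplus>\<^bsub>T\<^esub> \<zero>\<^bsub>T\<^esub> = X" by (simp add: add_zero)
  show "X \<oplus>\<^bsub>T\<^esub> (- 1) \<odot>\<^bsub>T\<^esub> X = \<zero>\<^bsub>T\<^esub>" by (simp add: add_minus)
  show "1 \<odot>\<^bsub>T\<^esub> X = X" by (simp add: scale_one)
  show "c \<odot>\<^bsub>T\<^esub> d \<odot>\<^bsub>T\<^esub> X = (c * d) \<odot>\<^bsub>T\<^esub> X" for c d by (simp add: scale_scale)
  show "(c + d) \<odot>\<^bsub>T\<^esub> X = c \<odot>\<^bsub>T\<^esub> X \<oplus>\<^bsub>T\<^esub> d \<odot>\<^bsub>T\<^esub> X" for c d by (simp add: scale_add_left)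
  show "adj T (adj T X) = X" by (simp add: adj_adj)
  show "adj T (c \<odot>\<^bsub>T\<^esub> X) = cnj c \<odot>\<^bsub>T\<^esub> adj T X" for c by (simp add: adj_scale)
  show "0 \<le> nrm T X" by (simp add: nrm_nonneg)
  show "(nrm T X = 0) = (X = \<zero>\<^bsub>T\<^esub>)" by (simp add: nrm_eq_zero)
  show "nrm T (c \<odot>\<^bsub>T\<^esub> X) = cmod c * nrm T X" for c by (simp add: nrm_scale)
  show "nrm T (adj T X \<otimes>\<^bsub>T\<^esub> X) = (nrm T X)\<^sup>2" by (simp add: nrm_cstar)
  fix Y assume "Y \<in> carrier T"
  then obtain y where y [simp]: "y \<in> carrier A" and Y [simp]: "Y = f y" by auto
  show "X \<oplus>\<^bsub>T\<^esub> Y \<in> carrier T" "X \<otimes>\<^bsub>T\<^esub> Y \<in> carrier T" by simp_all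
  show "X \<oplus>\<^bsub>T\<^esub> Y = Y \<oplus>\<^bsub>T\<^esub> X" by (simp add: add_commute)
  show "c \<odot>\<^bsub>T\<^esub> (X \<oplus>\<^bsub>T\<^esub> Y) = c \<odot>\<^bsub>T\<^esub> X \<oplus>\<^bsub>T\<^esub> c \<odot>\<^bsub>T\<^esub> Y" for c by (simp add: scale_add_right)
  show "(c \<odot>\<^bsub>T\<^esub> X) \<otimes>\<^bsub>T\<^esub> Y = c \<odot>\<^bsub>T\<^esub> (X \<otimes>\<^bsub>T\<^esub> Y)" for c by (simp add: mult_scale_left)
  show "X \<otimes>\<^bsub>T\<^esub> (c \<odot>\<^bsub>T\<^esub> Y) = c \<odot>\<^bsub>T\<^esub> (X \<otimes>\<^bsub>T\<^esub> Y)" for c by (simp add: mult_scale_right)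
  show "adj T (X \<oplus>\<^bsub>T\<^esub> Y) = adj T X \<oplus>\<^bsub>T\<^esub> adj T Y" by (simp add: adj_add)
  show "adj T (X \<otimes>\<^bsub>T\<^esub> Y) = adj T Y \<otimes>\<^bsub>T\<^esub> adj T X" by (simp add: adj_mult)
  show "nrm T (X \<oplus>\<^bsub>T\<^esub> Y) \<le> nrm T X + nrm T Y" by (simp add: nrm_triangle)
  show "nrm T (X \<otimes>\<^bsub>T\<^esub> Y) \<le> nrm T X * nrm T Y" by (simp add: nrm_mult)
  fix Z assume "Z \<in> carrier T"
  then obtain z where z [simp]: "z \<in> carrier A" and Z [simp]: "Z = f z" by auto
  show "X \<oplus>\<^bsub>T\<^esub> Y \<oplus>\<^bsub>T\<^esub> Z = X \<oplus>\<^bsub>T\<^esub> (Y \<oplus>\<^bsub>T\<^esub> Z)" by (simp add: add_assoc)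
  show "X \<otimes>\<^bsub>T\<^esub> Y \<otimes>\<^bsub>T\<^esub> Z = X \<otimes>\<^bsub>T\<^esub> (Y \<otimes>\<^bsub>T\<^esub> Z)" by (simp add: mult_assoc)
  show "(X \<oplus>\<^bsub>T\<^esub> Y) \<otimes>\<^bsub>T\<^esub> Z = X \<otimes>\<^bsub>T\<^esub> Z \<oplus>\<^bsub>T\<^esub> Y \<otimes>\<^bsub>T\<^esub> Z" by (simp add: mult_add_left)
  show "X \<otimes>\<^bsub>T\<^esub> (Y \<oplus>\<^bsub>T\<^esub> Z) = X \<otimes>\<^bsub>T\<^esub> Y \<oplus>\<^bsub>T\<^esub> X \<otimes>\<^bsub>T\<^esub> Z" by (simp add: mult_add_right)
qed

lemma ucstar_T: "A \<in> ucstar \<Longrightarrow> T \<in> ucstar"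
proof (rule ucstarI[OF cstar_algebra_T])
  assume "A \<in> ucstar"
  then have "is_unit T (f \<one>\<^bsub>A\<^esub>)" unfolding is_unit_def by (auto simp: ucstar_one)
  then show "unital T" by (auto simp: unital_def)
qed

lemma cstar_hom_f: "cstar_hom A T f"
  unfolding cstar_hom_def by simp

lemma cstar_hom_g: "cstar_hom T A g"
  unfolding cstar_hom_def by (auto simp: add_closed scale_closed mult_closed adj_closed)

lemma quotient_T:
  assumes "quotient_calg A J"
  shows "quotient_calg T (f ` J)"
proof -
  interpret Q: quotient_calg A J by (rule assms)
  have Jf: "f x \<in> f ` J \<longleftrightarrow> x \<in> J" if "x \<in> carrier A" for x
    using that Q.J_sub by (auto simp: f_eq_iff)
  show ?thesis
  proof
    show "T \<in> ucstar" by (rule ucstar_T[OF Q.E])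
    show "adj T x \<in> f ` J" if "x \<in> f ` J" for x using that Q.J_sub Q.J_adj by auto
    show "closed_ideal (f ` J) T"
      unfolding closed_ideal_def cstar_algebra.closedin_norm_iff[OF cstar_algebra_T]
    proof (intro conjI ballI allI impI)
      show "x \<in> f ` J" if xs: "x \<in> carrier T" "\<forall>e>0. \<exists>s\<in>f ` J. nrm T (x \<ominus>\<^bsub>T\<^esub> s) < e" for x
      proof -
        obtain y where y: "y \<in> carrier A" "x = f y" using xs(1) by auto
        have "y \<in> J"
        proof (rule Q.J_closed[OF y(1)])
          fix e :: real assume "e > 0"
          then obtain s where "s \<in> J" "nrm T (x \<ominus>\<^bsub>T\<^esub> f s) < e" using xs(2) by blast
          then show "\<exists>s\<in>J. nrm A (y \<ominus>\<^bsub>A\<^esub> s) < e" using y Q.J_sub by (auto simp: diff_closed)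
        qed
        then show ?thesis using y by simp
      qed
    qed (use Q.J_sub Q.J_ops in auto)
  qed
qed

end

text \<open>Since \<open>h\<close> is constant on cosets, the representative chosen by
  \<open>SOME\<close> does not matter.\<close>

lemma (in quotient_calg) lift:
  assumes h: "cstar_hom E B h" and wd: "\<And>x y. x \<in> carrier E \<Longrightarrow> y \<in> carrier E \<Longrightarrow> x \<ominus>\<^bsub>E\<^esub> y \<in> J \<Longrightarrow> h x = h y"
  shows "\<exists>k. cstar_hom Q B k \<and> (\<forall>x\<in>carrier E. k (q x) = h x)"
proof -
  define k where "k X = h (SOME x. x \<in> X)" for X
  have k: "k (q x) = h x" if x: "x \<in> carrier E" for x
  proof -
    have "(SOME y. y \<in> q x) \<in> q x" using q_self[OF x] by (rule someI)
    then show ?thesis unfolding k_def using wd x by (simp add: mem_coset[OF x])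
  qed
  have "cstar_hom Q B k"
    unfolding cstar_hom_def by (auto simp: carrier_Q k Q_add Q_mult Q_scale Q_adj closed cstar_homD[OF h])
  then show ?thesis using k by blast
qed

lemma (in quotient_calg) cstar_hom_q: "cstar_hom E Q q"
  unfolding cstar_hom_def by (auto simp: Q_add Q_mult Q_scale Q_adj carrier_Q)

lemma (in cstar_algebra) cstar_hom_coordinate: "cstar_hom (linf A) A (\<lambda>x. x n)"
  unfolding cstar_hom_def by (simp add: linf_closed)

text \<open>A point is coded by the pairs \<open>(i, k)\<close> for which its distance to the
  \<open>i\<close>-th term of a dense sequence is below \<open>1 / (k + 1)\<close>. Points with the
  same code share arbitrarily good approximations and hence coincide.\<close>

lemma separable_inj:
  assumes A: "cstar_algebra A" and sep: "separable A"
  obtains e :: "'a \<Rightarrow> nat set" where "inj_on e (carrier A)"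
proof -
  interpret cstar_algebra A by (rule A)
  obtain S where S: "countable S" "S \<subseteq> carrier A" "norm_topology A closure_of S = carrier A"
    using sep by (auto simp: separable_def separable_space_def carrier_topspace)
  have dense: "\<exists>s\<in>S. nrm A (x \<ominus>\<^bsub>A\<^esub> s) < r" if "x \<in> carrier A" "r > 0" for x r
    using closure_norm_iff[OF S(2), of x] S(3) that by blast
  have "S \<noteq> {}" using dense zero_closed zero_less_one by blast
  define s where "s = from_nat_into S"
  have s: "range s = S" unfolding s_def using range_from_nat_into[OF \<open>S \<noteq> {}\<close> S(1)] .
  define e where "e x = {m. nrm A (x \<ominus>\<^bsub>A\<^esub> s (fst (prod_decode m))) < 1 / real (Suc (snd (prod_decode m)))}" for x
  have em: "prod_encode (i, k) \<in> e x \<longleftrightarrow> nrm A (x \<ominus>\<^bsub>A\<^esub> s i) < 1 / real (Suc k)" for i k x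
    unfolding e_def by (simp only: mem_Collect_eq prod_encode_inverse fst_conv snd_conv)
  have "inj_on e (carrier A)"
  proof (rule inj_onI)
    fix x y assume x: "x \<in> carrier A" and y: "y \<in> carrier A" and eq: "e x = e y"
    have sc: "s i \<in> carrier A" for i using s S(2) by auto
    have "nrm A (x \<ominus>\<^bsub>A\<^esub> y) \<le> 0"
    proof (rule field_le_epsilon)
      fix r :: real assume "0 < r"
      then obtain k where k: "1 / real (Suc k) < r / 2" using nat_approx_posE[of "r / 2"] by auto
      obtain i where i: "nrm A (x \<ominus>\<^bsub>A\<^esub> s i) < 1 / real (Suc k)"
        using dense[OF x, of "1 / real (Suc k)"] s by auto
      then have "nrm A (y \<ominus>\<^bsub>A\<^esub> s i) < 1 / real (Suc k)" using em eq by blast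
      then show "nrm A (x \<ominus>\<^bsub>A\<^esub> y) \<le> 0 + r"
        using i k nrm_triangle_diff[OF x sc y, of i] nrm_minus_commute[OF sc y, of i] by simp
    qed
    then have "cdist A x y = 0" using nrm_nonneg[OF diff_closed[OF x y]] by (simp add: cdist_def x y)
    then show "x = y" using Metric_space.zero[OF Metric_space_cdist x y] by simp
  qed
  then show ?thesis using that by blast
qed

text \<open>The real multiples of the nonzero unit form a copy of the reals inside
  \<open>carrier D\<close>, so the type has room for all sets of natural numbers.\<close>

lemma nat_sets_inj:
  fixes D :: "'u calg"
  assumes D: "D \<in> ucstar" and nz: "carrier D \<noteq> {\<zero>\<^bsub>D\<^esub>}"
  obtains i :: "nat set \<Rightarrow> 'u" where "inj i"
proof -
  interpret cstar_algebra D by (rule ucstarD(1)[OF D])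
  note one = ucstar_one[OF D]
  have "\<one>\<^bsub>D\<^esub> \<noteq> \<zero>\<^bsub>D\<^esub>"
  proof
    assume "\<one>\<^bsub>D\<^esub> = \<zero>\<^bsub>D\<^esub>"
    then have "x = \<zero>\<^bsub>D\<^esub>" if "x \<in> carrier D" for x using one(2)[OF that] zero_mult[OF that] by simp
    then show False using nz zero_closed by blast
  qed
  then have n1: "nrm D \<one>\<^bsub>D\<^esub> \<noteq> 0" using nrm_eq_zero[OF one(1)] by simp
  obtain r :: "nat set \<Rightarrow> real" where r: "inj r" using nat_sets_eqpoll_reals by (auto simp: eqpoll_def bij_betw_def)
  have "inj (\<lambda>X. complex_of_real (r X) \<odot>\<^bsub>D\<^esub> \<one>\<^bsub>D\<^esub>)"
  proof (rule injI)
    fix X Y assume "complex_of_real (r X) \<odot>\<^bsub>D\<^esub> \<one>\<^bsub>D\<^esub> = complex_of_real (r Y) \<odot>\<^bsub>D\<^esub> \<one>\<^bsub>D\<^esub>"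
    then have "complex_of_real (r X) \<odot>\<^bsub>D\<^esub> \<one>\<^bsub>D\<^esub> \<oplus>\<^bsub>D\<^esub> (complex_of_real (- r Y) \<odot>\<^bsub>D\<^esub> \<one>\<^bsub>D\<^esub>)
      = complex_of_real (r Y) \<odot>\<^bsub>D\<^esub> \<one>\<^bsub>D\<^esub> \<oplus>\<^bsub>D\<^esub> (complex_of_real (- r Y) \<odot>\<^bsub>D\<^esub> \<one>\<^bsub>D\<^esub>)" by simp
    then have "complex_of_real (r X - r Y) \<odot>\<^bsub>D\<^esub> \<one>\<^bsub>D\<^esub> = \<zero>\<^bsub>D\<^esub>"
      using one(1) by (simp add: zero_scale flip: scale_add_left)
    then have "\<bar>r X - r Y\<bar> * nrm D \<one>\<^bsub>D\<^esub> = 0"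
      using nrm_scale[OF one(1), of "complex_of_real (r X - r Y)"] nrm_zero by simp
    then show "X = Y" using n1 injD[OF r] by simp
  qed
  then show ?thesis by (rule that)
qed

text \<open>Both \<open>A\<close> and the algebra of bounded sequences in \<open>A\<close> have at most the cardinality of the
  continuum, so they can be copied to the type carrying \<open>D\<close>.\<close>

lemma lift_to_coordinates:
  fixes A :: "'a calg" and D :: "'u calg"
  assumes A: "A \<in> ucstar" and sep: "separable A" and D: "D \<in> ucstar"
    and sp: "semiprojective D \<or> weakly_semiprojective D"
    and \<phi>: "cstar_hom D (seq_algebra A) \<phi>"
  obtains N \<pi> where "\<And>n. n \<ge> N \<Longrightarrow> cstar_hom D A (\<pi> n)"
    "\<And>d. d \<in> carrier D \<Longrightarrow> \<exists>x\<in>carrier (linf A). \<phi> d = cls A x \<and> (\<forall>n\<ge>N. \<pi> n d = x n)"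
proof (cases "carrier D = {\<zero>\<^bsub>D\<^esub>}")
  \<comment> \<open>For the zero algebra the type of \<open>D\<close> may be too small to hold a
    copy of \<open>A\<close>, but then only zero homomorphisms occur.\<close>
  case True
  interpret cstar_algebra A by (rule ucstarD(1)[OF A])
  interpret D: cstar_algebra D by (rule ucstarD(1)[OF D])
  show ?thesis
  proof (rule that[of 0 "\<lambda>_ _. \<zero>\<^bsub>A\<^esub>"])
    show "cstar_hom D A (\<lambda>_. \<zero>\<^bsub>A\<^esub>)"
      unfolding cstar_hom_def by (simp add: zero_closed add_zero scale_zero zero_mult adj_zero)
    have "\<phi> \<zero>\<^bsub>D\<^esub> = cls A (\<lambda>_. \<zero>\<^bsub>A\<^esub>)"
      using cstar_hom_zero[OF ucstarD(1)[OF D] ucstarD(1)[OF ucstar_seq[OF A]] \<phi>] by (simp add: seq_zero[OF A])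
    then show "\<exists>x\<in>carrier (linf A). \<phi> d = cls A x \<and> (\<forall>n\<ge>0. \<zero>\<^bsub>A\<^esub> = x n)" if "d \<in> carrier D" for d
      using that True linf_const[OF zero_closed] by auto
  qed
next
  case False
  interpret cstar_algebra A by (rule ucstarD(1)[OF A])
  interpret C: quotient_calg "linf A" "c0 A" by (rule quotient_c0[OF A])
  obtain e :: "'a \<Rightarrow> nat set" where e: "inj_on e (carrier A)" using separable_inj[OF ucstarD(1)[OF A] sep] .
  obtain i :: "nat set \<Rightarrow> 'u" where i: "inj i" using nat_sets_inj[OF D False] .
  note seq = seq_algebra_eq[OF A]
  from sp show ?thesis
  proof
    assume sp: "semiprojective D"
    \<comment> \<open>A whole sequence is coded by one set: \<open>prod_decode\<close> splits
      \<open>m\<close> into an index and a candidate element of the code at that index.\<close>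
    define F where "F x = i {m. snd (prod_decode m) \<in> e (x (fst (prod_decode m)))}" for x :: "nat \<Rightarrow> 'a"
    have "inj_on F (carrier (linf A))"
    proof (rule inj_onI)
      fix x y assume x: "x \<in> carrier (linf A)" and y: "y \<in> carrier (linf A)" and "F x = F y"
      then have eq: "{m. snd (prod_decode m) \<in> e (x (fst (prod_decode m)))} = {m. snd (prod_decode m) \<in> e (y (fst (prod_decode m)))}"
        using injD[OF i] unfolding F_def by blast
      have "k \<in> e (x n) \<longleftrightarrow> k \<in> e (y n)" for k n
        using eq[THEN set_eq_iff[THEN iffD1], rule_format, of "prod_encode (n, k)"] by simp
      then have "e (x n) = e (y n)" for n by blast
      then show "x = y" using inj_onD[OF e] linf_closed[OF x] linf_closed[OF y] by (intro ext) blast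
    qed
    then interpret T: transported "linf A" F by unfold_locales
    \<comment> \<open>Sequences vanishing from \<open>n\<close> on form an increasing chain of
      ideals whose union is dense in \<open>c0 A\<close>, so semiprojectivity applies. Modulo
      \<open>J n\<close> the coordinates from \<open>n\<close> on are still defined.\<close>
    define J where "J n = {x \<in> carrier (linf A). \<forall>m\<ge>n. x m = \<zero>\<^bsub>A\<^esub>}" for n :: nat
    have QJ: "quotient_calg (linf A) (J n)" for n
    proof
      show "linf A \<in> ucstar" by (rule ucstar_linf[OF A])
      show "adj (linf A) x \<in> J n" if "x \<in> J n" for x using that by (simp add: J_def linf_adj adj_zero)
      show "closed_ideal (J n) (linf A)"
        unfolding closed_ideal_def C.closedin_norm_iff
      proof (intro conjI ballI allI impI)
        fix x assume x: "x \<in> carrier (linf A)" and ap: "\<forall>e>0. \<exists>s\<in>J n. nrm (linf A) (x \<ominus>\<^bsub>linf A\<^esub> s) < e"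
        have "x m = \<zero>\<^bsub>A\<^esub>" if m: "m \<ge> n" for m
        proof -
          have "nrm A (x m) \<le> 0"
          proof (rule field_le_epsilon)
            fix r :: real assume "0 < r"
            then obtain s where s: "s \<in> J n" "nrm (linf A) (x \<ominus>\<^bsub>linf A\<^esub> s) < r" using ap by blast
            then show "nrm A (x m) \<le> 0 + r"
              using linf_norm_ge[OF linf_diff[OF x, of s], of m] m linf_closed[OF x, of m] by (simp add: J_def diff_zero)
          qed
          then show ?thesis using nrm_eq_zero[OF linf_closed[OF x]] nrm_nonneg[OF linf_closed[OF x]] by (metis order_antisym)
        qed
        then show "x \<in> J n" using x by (simp add: J_def)
      qed (auto simp: J_def linf_const linf_add linf_scale linf_mult zero_closed add_zero scale_zero zero_mult mult_zero linf_closed)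
    qed
    have JF: "x \<in> S" if "F x \<in> F ` S" "x \<in> carrier (linf A)" "S \<subseteq> carrier (linf A)" for x S
      using that T.f_eq_iff by blast
    have Jsub: "J n \<subseteq> carrier (linf A)" "c0 A \<subseteq> carrier (linf A)" for n
      by (auto simp: J_def c0_iff)
    interpret TL: cstar_algebra T.T by (rule T.cstar_algebra_T)
    interpret QT: quotient_calg T.T "F ` J n" for n by (rule T.quotient_T[OF QJ])
    interpret QK: quotient_calg T.T "F ` c0 A" by (rule T.quotient_T[OF C.quotient_calg_axioms])
    have K: "F ` c0 A = norm_topology T.T closure_of (\<Union>n. F ` J n)"
    proof (rule set_eqI)
      fix X
      have sub: "(\<Union>n. F ` J n) \<subseteq> carrier T.T" by (auto simp: J_def)
      have "X \<in> norm_topology T.T closure_of (\<Union>n. F ` J n) \<longleftrightarrow>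
        (\<exists>x\<in>carrier (linf A). X = F x \<and> (\<forall>e>0. \<exists>n. \<exists>s\<in>J n. nrm (linf A) (x \<ominus>\<^bsub>linf A\<^esub> s) < e))"
        unfolding TL.closure_norm_iff[OF sub] by (auto simp: J_def C.diff_closed simp del: linf_simps) (metis C.diff_closed T.T_diff T.T_simps(7))+
      also have "\<dots> \<longleftrightarrow> (\<exists>x\<in>carrier (linf A). X = F x \<and> x \<in> c0 A)"
      proof (intro bex_cong refl conj_cong)
        fix x assume x: "x \<in> carrier (linf A)"
        show "(\<forall>e>0. \<exists>n. \<exists>s\<in>J n. nrm (linf A) (x \<ominus>\<^bsub>linf A\<^esub> s) < e) \<longleftrightarrow> x \<in> c0 A"
        proof
          assume ap: "\<forall>e>0. \<exists>n. \<exists>s\<in>J n. nrm (linf A) (x \<ominus>\<^bsub>linf A\<^esub> s) < e"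
          have "(\<lambda>n. nrm A (x n)) \<longlonglongrightarrow> 0"
          proof (rule LIMSEQ_I)
            fix r :: real assume "0 < r"
            then obtain n s where s: "s \<in> J n" "nrm (linf A) (x \<ominus>\<^bsub>linf A\<^esub> s) < r" using ap by blast
            have "norm (nrm A (x m) - 0) < r" if "m \<ge> n" for m
              using linf_norm_ge[OF linf_diff[OF x, of s], of m] that s linf_closed[OF x, of m]
                nrm_nonneg[OF linf_closed[OF x, of m]] by (simp add: J_def diff_zero)
            then show "\<exists>no. \<forall>n\<ge>no. norm (nrm A (x n) - 0) < r" by blast
          qed
          then show "x \<in> c0 A" using x by (simp add: c0_iff)
        next
          assume x0: "x \<in> c0 A"
          show "\<forall>e>0. \<exists>n. \<exists>s\<in>J n. nrm (linf A) (x \<ominus>\<^bsub>linf A\<^esub> s) < e"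
          proof (intro allI impI)
            fix r :: real assume r: "0 < r"
            then obtain N where N: "\<And>n. n \<ge> N \<Longrightarrow> norm (nrm A (x n) - 0) < r / 2"
              using x0 LIMSEQ_D[of "\<lambda>n. nrm A (x n)" 0 "r / 2"] by (auto simp: c0_iff)
            define s where "s n = (if n \<ge> N then \<zero>\<^bsub>A\<^esub> else x n)" for n
            have s: "s \<in> carrier (linf A)"
              by (rule linf_carrierI[where M="nrm (linf A) x"])
                (auto simp: s_def linf_closed[OF x] linf_norm_ge[OF x] zero_closed nrm_zero linf_nrm_nonneg[OF x])
            have "nrm A (x n \<ominus>\<^bsub>A\<^esub> s n) \<le> r / 2" for n
            proof (cases "n \<ge> N")
              case True
              then show ?thesis using N[OF True] by (simp add: s_def diff_zero linf_closed[OF x])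
            next
              case False
              then show ?thesis using Metric_space.zero[OF Metric_space_cdist, of "x n" "x n"] linf_closed[OF x, of n] r
                by (simp add: s_def cdist_def)
            qed
            then have "nrm (linf A) (x \<ominus>\<^bsub>linf A\<^esub> s) \<le> r / 2"
              using linf_norm_le_iff[OF linf_diff[OF x s], of "r / 2"] by simp
            moreover have "s \<in> J N" using s by (simp add: J_def s_def)
            ultimately show "\<exists>n. \<exists>s\<in>J n. nrm (linf A) (x \<ominus>\<^bsub>linf A\<^esub> s) < r"
              using r by (intro exI[of _ N] bexI[of _ s]) simp_all
          qed
        qed
      qed
      also have "\<dots> \<longleftrightarrow> X \<in> F ` c0 A" using Jsub(2) by blast
      finally show "X \<in> F ` c0 A \<longleftrightarrow> X \<in> norm_topology T.T closure_of (\<Union>n. F ` J n)" by simp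
    qed
    have hF: "cstar_hom (linf A) QK.Q (\<lambda>x. QK.q (F x))"
      by (rule cstar_hom_comp[OF T.cstar_hom_f QK.cstar_hom_q])
    have wd: "QK.q (F x) = QK.q (F y)"
      if "x \<in> carrier (linf A)" "y \<in> carrier (linf A)" "x \<ominus>\<^bsub>linf A\<^esub> y \<in> c0 A" for x y
      using that by (subst QK.q_eq_iff) (simp_all del: linf_simps)
    \<comment> \<open>Carries homomorphisms into the sequence algebra over to the quotient of its
      copy.\<close>
    obtain k where k: "cstar_hom C.Q QK.Q k" "\<And>x. x \<in> carrier (linf A) \<Longrightarrow> k (C.q x) = QK.q (F x)"
      using C.lift[OF hF wd] by metis
    have "cstar_hom D QK.Q (\<lambda>d. k (\<phi> d))" using cstar_hom_comp[OF \<phi>[unfolded seq] k(1)] .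
    moreover have "closed_ideal (F ` J n) T.T" for n by (rule QT.J)
    moreover have "mono (\<lambda>n. F ` J n)" by (force simp: mono_def J_def)
    ultimately have "\<exists>n \<psi>. cstar_hom D (quot_algebra T.T (F ` J n)) \<psi> \<and>
        (\<forall>d\<in>carrier D. \<forall>x\<in>\<psi> d. QK.q x = k (\<phi> d))"
      using sp[unfolded semiprojective_def, rule_format, of T.T "\<lambda>n. F ` J n" "F ` c0 A" "\<lambda>d. k (\<phi> d)"]
        T.cstar_algebra_T K by blast
    then obtain N \<psi> where \<psi>: "cstar_hom D (quot_algebra T.T (F ` J N)) \<psi>"
      "\<And>d x. d \<in> carrier D \<Longrightarrow> x \<in> \<psi> d \<Longrightarrow> QK.q x = k (\<phi> d)" by blast
    have hn: "cstar_hom T.T A (\<lambda>X. T.g X n)" for n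
      by (rule cstar_hom_comp[OF T.cstar_hom_g cstar_hom_coordinate])
    \<comment> \<open>Evaluation at a coordinate from \<open>N\<close> on is insensitive to
      \<open>J N\<close>, so it descends to the quotient into which \<open>\<psi>\<close> maps.
      Composing the two gives the coordinate homomorphisms.\<close>
    have "\<exists>l. cstar_hom (quot_algebra T.T (F ` J N)) A l \<and> (\<forall>X\<in>carrier T.T. l (coset T.T (F ` J N) X) = T.g X n)"
      if n: "n \<ge> N" for n
    proof -
      have "\<And>X Y. X \<in> carrier T.T \<Longrightarrow> Y \<in> carrier T.T \<Longrightarrow> X \<ominus>\<^bsub>T.T\<^esub> Y \<in> F ` J N \<Longrightarrow> T.g X n = T.g Y n"
      proof -
        fix X Y assume X: "X \<in> carrier T.T" and Y: "Y \<in> carrier T.T" and XY: "X \<ominus>\<^bsub>T.T\<^esub> Y \<in> F ` J N"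
        obtain x y where x: "x \<in> carrier (linf A)" "X = F x" and y: "y \<in> carrier (linf A)" "Y = F y" using X Y by auto
        have "x \<ominus>\<^bsub>linf A\<^esub> y \<in> J N"
          using XY JF[OF _ C.diff_closed[OF x(1) y(1)] Jsub(1)] by (simp add: x y del: linf_simps)
        then have "cdist A (x n) (y n) = 0"
          using n by (simp add: J_def cdist_def nrm_zero)
        then have "x n = y n" using Metric_space.zero[OF Metric_space_cdist linf_closed[OF x(1)] linf_closed[OF y(1)]] by blast
        then show "T.g X n = T.g Y n" using x y by simp
      qed
      from QT.lift[OF hn this] show ?thesis .
    qed
    then obtain l where l: "\<And>n. n \<ge> N \<Longrightarrow> cstar_hom (quot_algebra T.T (F ` J N)) A (l n)"
      "\<And>n X. n \<ge> N \<Longrightarrow> X \<in> carrier T.T \<Longrightarrow> l n (coset T.T (F ` J N) X) = T.g X n" by metis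
    show ?thesis
    proof (rule that[of N "\<lambda>n d. l n (\<psi> d)"])
      show "cstar_hom D A (\<lambda>d. l n (\<psi> d))" if "N \<le> n" for n
        by (rule cstar_hom_comp[OF \<psi>(1) l(1)[OF that]])
      fix d assume d: "d \<in> carrier D"
      obtain X where X: "X \<in> carrier T.T" "\<psi> d = coset T.T (F ` J N) X"
        using cstar_homD(1)[OF \<psi>(1) d] by (auto simp: QT.carrier_Q)
      obtain x where x: "x \<in> carrier (linf A)" "X = F x" using X by auto
      obtain y where y: "y \<in> carrier (linf A)" "\<phi> d = cls A y"
        using cstar_homD(1)[OF \<phi> d] by (auto simp: carrier_seq[OF A])
      \<comment> \<open>The lift comes with its own representative \<open>x\<close>, which only has
        to agree with the given \<open>y\<close> modulo null sequences.\<close>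
      have "QK.q (F x) = QK.q (F y)"
        using \<psi>(2)[OF d, of X] QT.q_self[OF X(1)] X k(2) x y by simp
      then have "F x \<ominus>\<^bsub>T.T\<^esub> F y \<in> F ` c0 A"
        using QK.q_eq_iff[of "F x" "F y"] x(1) y(1) by simp
      then have "x \<ominus>\<^bsub>linf A\<^esub> y \<in> c0 A"
        using JF[OF _ C.diff_closed[OF x(1) y(1)] Jsub(2)] by (simp add: x(1) y(1) del: linf_simps)
      then have "cls A x = \<phi> d" using C.q_eq_iff[OF x(1) y(1)] y(2) by simp
      then show "\<exists>x\<in>carrier (linf A). \<phi> d = cls A x \<and> (\<forall>n\<ge>N. l n (\<psi> d) = x n)"
        using x X l(2)[OF _ X(1)] by (intro bexI[of _ x]) auto
    qed
  next
    assume sp: "weakly_semiprojective D"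
    \<comment> \<open>Here \<open>A\<close> itself is copied and taken as a constant sequence of
      targets. The lift reaches the full product, so no initial coordinates are lost and
      \<open>N = 0\<close>.\<close>
    define f where "f x = i (e x)" for x
    have "inj_on f (carrier A)" using e i by (auto simp: inj_on_def f_def)
    then interpret T: transported A f by unfold_locales
    have TU: "T.T \<in> ucstar" by (rule T.ucstar_T[OF A])
    interpret QT: quotient_calg "linf T.T" "c0 T.T" by (rule quotient_c0[OF TU])
    interpret TC: cstar_algebra T.T by (rule T.cstar_algebra_T)
    have fc: "(\<lambda>n. f (x n)) \<in> carrier (linf T.T)" if "x \<in> carrier (linf A)" for x
      by (rule TC.linf_carrierI[where M="nrm (linf A) x"]) (auto simp: linf_closed[OF that] linf_norm_ge[OF that])
    have "cstar_hom (linf A) (linf T.T) (\<lambda>x n. f (x n))"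
      unfolding cstar_hom_def by (auto simp: fc linf_closed)
    from cstar_hom_comp[OF this QT.cstar_hom_q]
    have hF: "cstar_hom (linf A) QT.Q (\<lambda>x. QT.q (\<lambda>n. f (x n)))" .
    have null: "(\<lambda>n. f (x n)) \<ominus>\<^bsub>linf T.T\<^esub> (\<lambda>n. f (y n)) \<in> c0 T.T \<longleftrightarrow> x \<ominus>\<^bsub>linf A\<^esub> y \<in> c0 A"
      if "x \<in> carrier (linf A)" "y \<in> carrier (linf A)" for x y
      using fc[OF linf_diff[OF that]] linf_diff[OF that] that by (simp add: c0_iff linf_closed diff_closed)
    have wd: "QT.q (\<lambda>n. f (x n)) = QT.q (\<lambda>n. f (y n))"
      if "x \<in> carrier (linf A)" "y \<in> carrier (linf A)" "x \<ominus>\<^bsub>linf A\<^esub> y \<in> c0 A" for x y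
      using QT.q_eq_iff[OF fc[OF that(1)] fc[OF that(2)]] null[OF that(1,2)] that(3) by blast
    obtain k where k: "cstar_hom C.Q QT.Q k" "\<And>x. x \<in> carrier (linf A) \<Longrightarrow> k (C.q x) = QT.q (\<lambda>n. f (x n))"
      using C.lift[OF hF wd] by metis
    have "cstar_hom D QT.Q (\<lambda>d. k (\<phi> d))" using cstar_hom_comp[OF \<phi>[unfolded seq] k(1)] .
    then obtain \<psi> where \<psi>: "cstar_hom D (linf T.T) \<psi>" "\<And>d. d \<in> carrier D \<Longrightarrow> QT.q (\<psi> d) = k (\<phi> d)"
      using sp[unfolded weakly_semiprojective_def, rule_format, of "\<lambda>_. T.T" "\<lambda>d. k (\<phi> d)"] T.cstar_algebra_T by blast
    show ?thesis
    proof (rule that[of 0 "\<lambda>n d. T.g (\<psi> d n)"])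
      from cstar_hom_comp[OF cstar_hom_comp[OF \<psi>(1) TC.cstar_hom_coordinate] T.cstar_hom_g]
      show "cstar_hom D A (\<lambda>d. T.g (\<psi> d n))" for n .
      fix d assume d: "d \<in> carrier D"
      have pd: "\<psi> d \<in> carrier (linf T.T)" by (rule cstar_homD(1)[OF \<psi>(1) d])
      define x where "x n = T.g (\<psi> d n)" for n
      have xc: "x n \<in> carrier A" "\<psi> d n = f (x n)" for n
        using TC.linf_closed[OF pd, of n] by (auto simp: x_def)
      have x: "x \<in> carrier (linf A)"
        by (rule linf_carrierI[OF xc(1), where M="nrm (linf T.T) (\<psi> d)"])
          (use TC.linf_norm_ge[OF pd] xc in simp)
      obtain y where y: "y \<in> carrier (linf A)" "\<phi> d = cls A y"
        using cstar_homD(1)[OF \<phi> d] by (auto simp: carrier_seq[OF A])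
      have "QT.q (\<lambda>n. f (x n)) = QT.q (\<lambda>n. f (y n))"
        using \<psi>(2)[OF d] k(2)[OF y(1)] y(2) xc(2) by (metis ext)
      then have "x \<ominus>\<^bsub>linf A\<^esub> y \<in> c0 A" using QT.q_eq_iff[OF fc[OF x] fc[OF y(1)]] null[OF x y(1)] by blast
      then have "cls A x = \<phi> d" using C.q_eq_iff[OF x y(1)] y(2) by simp
      then show "\<exists>x\<in>carrier (linf A). \<phi> d = cls A x \<and> (\<forall>n\<ge>0. T.g (\<psi> d n) = x n)"
        using x by (intro bexI[of _ x]) (auto simp: x_def)
    qed
  qed
qed

section \<open>Projections, corners and images\<close>

lemma partial_isometry:
  fixes v :: "'a::cstar"
  assumes v: "star v * v = f" and f: "f * f = f"
  shows "v * f = v" "v * star v * (v * star v) = v * star v"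
proof -
  have sf: "star f = f" using v by (metis star_mult star_star)
  have "star (v - v * f) * (v - v * f) = f - f * f - f * f + f * f * f"
    by (simp add: star_simps sf algebra_simps mult.assoc flip: v)
  also have "\<dots> = 0" by (simp add: f)
  finally show vf: "v * f = v" by (simp add: star_eq_zero)
  then show "v * star v * (v * star v) = v * star v" by (metis mult.assoc v)
qed

lemma norm_projection:
  fixes e :: "'a::cstar"
  assumes "star e = e" "e * e = e"
  shows "norm e \<le> 1"
proof -
  have "(norm e)\<^sup>2 = norm e" using norm_sa_sq[OF assms(1)] assms(2) by simp
  then show ?thesis by (metis less_eq_real_def mult_cancel_left2 power2_eq_square zero_le_one)
qed

lemma norm_mult_le:
  fixes x y :: "'a::real_normed_algebra"
  shows "norm x \<le> a \<Longrightarrow> norm y \<le> b \<Longrightarrow> norm (x * y) \<le> a * b"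
  by (meson mult_mono norm_ge_zero norm_mult_ineq order_trans)

lemma norm_compress:
  fixes s t x :: "'a::real_normed_algebra"
  assumes "norm s \<le> 1" "norm t \<le> 1" "norm x \<le> b"
  shows "norm (s * x * t) \<le> b"
  using norm_mult_le[OF norm_mult_le[OF assms(1,3)] assms(2)] by simp

locale ucalg =
  fixes A :: "'a calg"
  assumes A: "A \<in> ucstar"
begin

sublocale cstar_algebra A by (rule ucstarD(1)[OF A])

abbreviation "\<alpha> \<equiv> emb A"

lemmas closed = add_closed scale_closed mult_closed adj_closed zero_closed diff_closed ucstar_one(1)[OF A]
lemmas emb_simps = emb_add[OF A] emb_mult[OF A] emb_adj[OF A] emb_diff[OF A] emb_zero[OF A] emb_scale[OF A]
lemmas one = ucstar_one[OF A]

lemma eqI: "x \<in> carrier A \<Longrightarrow> y \<in> carrier A \<Longrightarrow> \<alpha> x = \<alpha> y \<Longrightarrow> x = y"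
  using emb_eq_iff[OF A] by blast

lemma nrm_eq: "x \<in> carrier A \<Longrightarrow> nrm A x = norm (\<alpha> x)"
  by (simp add: norm_emb[OF A])

lemma emb_ev_eq: "\<alpha> \<one>\<^bsub>A\<^esub> * X = X \<Longrightarrow> \<alpha> (ev A X) = X" "X * \<alpha> \<one>\<^bsub>A\<^esub> = X \<Longrightarrow> \<alpha> (ev A X) = X"
  using emb_ev[OF A, of X] by simp_all

lemma unit_mult: "x \<in> carrier A \<Longrightarrow> \<alpha> \<one>\<^bsub>A\<^esub> * \<alpha> x = \<alpha> x" "x \<in> carrier A \<Longrightarrow> \<alpha> x * \<alpha> \<one>\<^bsub>A\<^esub> = \<alpha> x"
  by (rule emb_one_mult[OF A]; assumption)+

lemma unit_mult_left: "x \<in> carrier A \<Longrightarrow> \<alpha> \<one>\<^bsub>A\<^esub> * (\<alpha> x * Y) = \<alpha> x * Y"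
  by (simp add: unit_mult flip: mult.assoc)

lemma projectionD:
  assumes "p \<in> projections A"
  shows "p \<in> carrier A" "star (\<alpha> p) = \<alpha> p" "\<alpha> p * \<alpha> p = \<alpha> p" "norm (\<alpha> p) \<le> 1"
proof -
  show p: "p \<in> carrier A" "star (\<alpha> p) = \<alpha> p" "\<alpha> p * \<alpha> p = \<alpha> p"
    using assms by (auto simp: projections_def simp flip: emb_mult[OF A] emb_adj[OF A])
  show "norm (\<alpha> p) \<le> 1" by (rule norm_projection[OF p(2,3)])
qed

lemma projectionI: "p \<in> carrier A \<Longrightarrow> star (\<alpha> p) = \<alpha> p \<Longrightarrow> \<alpha> p * \<alpha> p = \<alpha> p \<Longrightarrow> p \<in> projections A"
  unfolding projections_def by (auto intro!: eqI simp: closed emb_simps)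

lemma positives_emb:
  assumes "a \<in> positives A"
  shows "a \<in> carrier A" "Pos (\<alpha> a)" "star (\<alpha> a) = \<alpha> a"
proof -
  obtain x where x: "x \<in> carrier A" "a = adj A x \<otimes>\<^bsub>A\<^esub> x" using assms by (auto simp: positives_def)
  show "a \<in> carrier A" using x closed by simp
  show "Pos (\<alpha> a)" using x by (simp add: closed emb_simps Pos_star_mult)
  then show "star (\<alpha> a) = \<alpha> a" by (rule Pos_sa)
qed

lemma hereditary_genD:
  assumes "z \<in> carrier A" "r \<in> hereditary_gen A z" "0 < e"
  obtains x where "x \<in> carrier A" "norm (\<alpha> r - \<alpha> z * \<alpha> x * \<alpha> z) < e" "r \<in> carrier A"
proof -
  have sub: "{z \<otimes>\<^bsub>A\<^esub> x \<otimes>\<^bsub>A\<^esub> z | x. x \<in> carrier A} \<subseteq> carrier A" using assms closed by auto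
  have r: "r \<in> carrier A" and "\<exists>s\<in>{z \<otimes>\<^bsub>A\<^esub> x \<otimes>\<^bsub>A\<^esub> z | x. x \<in> carrier A}. nrm A (r \<ominus>\<^bsub>A\<^esub> s) < e"
    using assms(2,3) unfolding hereditary_gen_def closure_norm_iff[OF sub] by auto
  then obtain x where "x \<in> carrier A" "nrm A (r \<ominus>\<^bsub>A\<^esub> (z \<otimes>\<^bsub>A\<^esub> x \<otimes>\<^bsub>A\<^esub> z)) < e" by blast
  then show ?thesis using that r assms(1) by (simp add: nrm_eq closed emb_simps)
qed

lemma hereditary_genI:
  assumes "z \<in> carrier A" "x \<in> carrier A"
  shows "z \<otimes>\<^bsub>A\<^esub> x \<otimes>\<^bsub>A\<^esub> z \<in> hereditary_gen A z"
proof -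
  have sub: "{z \<otimes>\<^bsub>A\<^esub> x \<otimes>\<^bsub>A\<^esub> z | x. x \<in> carrier A} \<subseteq> topspace (norm_topology A)"
    using assms closed by (auto simp: carrier_topspace)
  then show ?thesis unfolding hereditary_gen_def using closure_of_subset[OF sub] assms(2) by blast
qed

text \<open>If \<open>1 - p\<close> is approximately of the form \<open>(ac)\<^sup>*(ac)\<close>, then the polar part of \<open>ac(1 - p)\<close>
  implements the required equivalence exactly.\<close>

lemma mvn_hereditary:
  assumes p: "p \<in> projections A" and a: "a \<in> positives A" and c: "c \<in> carrier A"
    and n: "nrm A ((\<one>\<^bsub>A\<^esub> \<ominus>\<^bsub>A\<^esub> p) \<ominus>\<^bsub>A\<^esub> adj A (a \<otimes>\<^bsub>A\<^esub> c) \<otimes>\<^bsub>A\<^esub> (a \<otimes>\<^bsub>A\<^esub> c)) < 1"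
  shows "\<exists>r\<in>projections A. r \<in> hereditary_gen A a \<and> mvn_equiv A (\<one>\<^bsub>A\<^esub> \<ominus>\<^bsub>A\<^esub> p) r"
proof -
  note P = projectionD[OF p] and ac = positives_emb[OF a]
  define f where "f = \<alpha> \<one>\<^bsub>A\<^esub> - \<alpha> p"
  have f: "star f = f" "f * f = f"
    by (simp_all add: f_def star_simps emb_one[OF A] P algebra_simps unit_mult)
  have fA: "f = \<alpha> (\<one>\<^bsub>A\<^esub> \<ominus>\<^bsub>A\<^esub> p)" by (simp add: f_def emb_simps closed P)
  have Ef: "\<alpha> \<one>\<^bsub>A\<^esub> * f = f" "f * \<alpha> \<one>\<^bsub>A\<^esub> = f" by (simp_all add: fA unit_mult closed P)
  define w where "w = \<alpha> a * \<alpha> c * f"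
  have wf: "w * f = w" by (simp add: w_def mult.assoc f)
  have sw: "star w = f * star (\<alpha> c) * \<alpha> a" by (simp add: w_def star_simps f ac mult.assoc)
  \<comment> \<open>Since \<open>w\<close> is the product \<open>a c\<close> cut by
    \<open>f\<close>, compression by \<open>f\<close> passes the hypothesis on \<open>a c\<close> to
    \<open>w\<close>.\<close>
  have "f - star w * w = f * (f - star (\<alpha> a * \<alpha> c) * (\<alpha> a * \<alpha> c)) * f"
    unfolding sw by (simp add: w_def algebra_simps f star_simps ac)
  moreover have "norm (f - star (\<alpha> a * \<alpha> c) * (\<alpha> a * \<alpha> c)) < 1"
    using n by (simp add: nrm_eq closed ac c P emb_simps f_def)
  ultimately have "norm (f - star w * w) < 1"
    using norm_compress[OF norm_projection[OF f] norm_projection[OF f] order_refl] by (metis order_le_less_trans)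
  then obtain k where k: "star k = k" "star (w * k) * (w * k) = f" using polar[OF f wf] by metis
  have Ew: "\<alpha> \<one>\<^bsub>A\<^esub> * (w * k) = w * k" by (simp add: w_def mult.assoc unit_mult_left ac)
  define v where "v = ev A (w * k)"
  have v: "v \<in> carrier A" "\<alpha> v = w * k" using emb_ev_eq(1)[OF Ew] ev_closed[OF A] by (simp_all add: v_def)
  define r where "r = v \<otimes>\<^bsub>A\<^esub> adj A v"
  have r: "r \<in> carrier A" "\<alpha> r = w * k * star (w * k)" by (simp_all add: r_def closed v emb_simps)
  have "r \<in> projections A"
  proof (rule projectionI)
    show "star (\<alpha> r) = \<alpha> r" unfolding r(2) by (subst star_mult) simp
    show "\<alpha> r * \<alpha> r = \<alpha> r" unfolding r(2) by (rule partial_isometry(2)[OF k(2) f(2)])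
  qed (rule r)
  moreover have "mvn_equiv A (\<one>\<^bsub>A\<^esub> \<ominus>\<^bsub>A\<^esub> p) r"
    unfolding mvn_equiv_def
  proof (intro bexI conjI)
    show "adj A v \<otimes>\<^bsub>A\<^esub> v = \<one>\<^bsub>A\<^esub> \<ominus>\<^bsub>A\<^esub> p"
      by (rule eqI) (simp_all add: closed v P emb_simps k(2), simp add: f_def)
  qed (use v in \<open>simp_all add: r_def\<close>)
  moreover have "r \<in> hereditary_gen A a"
  proof -
    \<comment> \<open>The explicit middle factor puts \<open>r\<close> into the form
      \<open>a x a\<close>, so membership in the hereditary subalgebra needs no
      approximation.\<close>
    define x where "x = \<alpha> c * f * (k * k) * f * star (\<alpha> c)"
    have "\<alpha> \<one>\<^bsub>A\<^esub> * x = x" by (simp add: x_def mult.assoc unit_mult_left c)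
    then have x: "ev A x \<in> carrier A" "\<alpha> (ev A x) = x" using emb_ev_eq(1) ev_closed[OF A] by auto
    have "r = a \<otimes>\<^bsub>A\<^esub> ev A x \<otimes>\<^bsub>A\<^esub> a"
      by (rule eqI) (simp_all add: r closed ac x emb_simps, simp add: x_def star_mult k(1) sw, simp add: w_def mult.assoc)
    then show ?thesis using hereditary_genI[OF ac(1) x(1)] by simp
  qed
  ultimately show ?thesis by blast
qed

text \<open>Approximate converse of \<open>mvn_hereditary\<close>: if \<open>r\<close> is close to
  \<open>z x z\<close>, then the partial isometry \<open>v = r v\<close> is close to
  \<open>z (x z v)\<close>, and \<open>c = x z v\<close> is the element sought.\<close>

lemma hereditary_mvn:
  assumes z: "z \<in> carrier A" "star (\<alpha> z) = \<alpha> z" and r: "r \<in> projections A" "r \<in> hereditary_gen A z"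
    and m: "mvn_equiv A f r" and d: "0 < \<delta>"
  obtains c where "c \<in> carrier A" "norm (\<alpha> f - star (\<alpha> z * \<alpha> c) * (\<alpha> z * \<alpha> c)) < \<delta>"
proof -
  note R = projectionD[OF r(1)]
  obtain v where v: "v \<in> carrier A" "adj A v \<otimes>\<^bsub>A\<^esub> v = f" "v \<otimes>\<^bsub>A\<^esub> adj A v = r" using m by (auto simp: mvn_equiv_def)
  have vv: "star (\<alpha> v) * \<alpha> v = \<alpha> f" "\<alpha> v * star (\<alpha> v) = \<alpha> r" using v by (simp_all add: closed flip: emb_mult[OF A] emb_adj[OF A])
  have "star (\<alpha> v) * \<alpha> r = star (\<alpha> v)"
    by (rule partial_isometry(1)) (use vv R in simp_all)
  then have "star (star (\<alpha> v) * \<alpha> r) = star (star (\<alpha> v))" by simp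
  then have rv: "\<alpha> r * \<alpha> v = \<alpha> v" by (simp add: star_mult R(2))
  have "(norm (\<alpha> v))\<^sup>2 = norm (\<alpha> r)" using cstar_norm[of "star (\<alpha> v)"] vv by simp
  then have "(norm (\<alpha> v))\<^sup>2 \<le> 1" using R(4) by simp
  then have nv: "norm (\<alpha> v) \<le> 1" by (simp add: power_le_one_iff)
  \<comment> \<open>The final error is at most \<open>1 + 2\<close> times the distance of
    \<open>v\<close> and \<open>u\<close>, from the norm bounds \<open>1\<close> on \<open>v\<close>
    and \<open>2\<close> on \<open>u\<close>; the minimum with \<open>1\<close> secures the
    latter.\<close>
  define e where "e = min 1 (\<delta> / 3)"
  have e: "0 < e" "e \<le> 1" "e \<le> \<delta> / 3" using d by (auto simp: e_def)
  obtain x where x: "x \<in> carrier A" "norm (\<alpha> r - \<alpha> z * \<alpha> x * \<alpha> z) < e" using hereditary_genD[OF z(1) r(2) e(1)] by metis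
  define c where "c = x \<otimes>\<^bsub>A\<^esub> z \<otimes>\<^bsub>A\<^esub> v"
  define u where "u = \<alpha> z * \<alpha> c"
  have u: "u = \<alpha> z * \<alpha> x * \<alpha> z * \<alpha> v" by (simp add: u_def c_def closed z x v emb_simps mult.assoc)
  have "\<alpha> v - u = (\<alpha> r - \<alpha> z * \<alpha> x * \<alpha> z) * \<alpha> v" by (simp add: u algebra_simps rv)
  then have vu: "norm (\<alpha> v - u) < e"
    using norm_mult_ineq[of "\<alpha> r - \<alpha> z * \<alpha> x * \<alpha> z" "\<alpha> v"] mult_left_mono[OF nv, of "norm (\<alpha> r - \<alpha> z * \<alpha> x * \<alpha> z)"] x(2) by simp
  have nu: "norm u \<le> 2" using norm_triangle_ineq2[of u "\<alpha> v"] nv vu e by (simp add: norm_minus_commute)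
  have "\<alpha> f - star u * u = star (\<alpha> v) * (\<alpha> v - u) + star (\<alpha> v - u) * u"
    by (simp add: star_simps algebra_simps vv)
  then have "norm (\<alpha> f - star u * u) \<le> norm (star (\<alpha> v) * (\<alpha> v - u)) + norm (star (\<alpha> v - u) * u)"
    by (metis norm_triangle_ineq)
  also have "\<dots> \<le> 1 * norm (\<alpha> v - u) + norm (\<alpha> v - u) * 2"
    by (intro add_mono norm_mult_le) (use nv nu in simp_all)
  also have "\<dots> < \<delta>" using vu e by simp
  finally show ?thesis using that[of c] by (simp add: u_def c_def closed x z v)
qed

end

text \<open>Only the zero set of \<open>h\<close> is asked to absorb products, so that both the
  kernel of a homomorphism and the annihilator of an element are covered; the norm bound makes this
  set closed.\<close>

lemma kernel_ideal:
  assumes A: "cstar_algebra A" and h0: "h \<zero>\<^bsub>A\<^esub> = (0 :: 'b::cstar)"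
    and h: "\<And>x y. x \<in> carrier A \<Longrightarrow> y \<in> carrier A \<Longrightarrow> h (x \<oplus>\<^bsub>A\<^esub> y) = h x + h y"
      "\<And>x c. x \<in> carrier A \<Longrightarrow> h x = 0 \<Longrightarrow> h (c \<odot>\<^bsub>A\<^esub> x) = 0"
      "\<And>x y. x \<in> carrier A \<Longrightarrow> y \<in> carrier A \<Longrightarrow> h x = 0 \<Longrightarrow> h (y \<otimes>\<^bsub>A\<^esub> x) = 0 \<and> h (x \<otimes>\<^bsub>A\<^esub> y) = 0"
    and bd: "\<And>x. x \<in> carrier A \<Longrightarrow> norm (h x) \<le> M * nrm A x"
  shows "closed_ideal {x \<in> carrier A. h x = 0} A"
proof -
  interpret cstar_algebra A by (rule A)
  have "h x = 0" if x: "x \<in> carrier A" and ap: "\<forall>e>0. \<exists>s\<in>{x \<in> carrier A. h x = 0}. nrm A (x \<ominus>\<^bsub>A\<^esub> s) < e" for x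
  proof -
    have "norm (h x) \<le> 0"
    proof (rule field_le_epsilon)
      fix e :: real assume "0 < e"
      then have "0 < e / (\<bar>M\<bar> + 1)" by simp
      then obtain s where s: "s \<in> carrier A" "h s = 0" "nrm A (x \<ominus>\<^bsub>A\<^esub> s) < e / (\<bar>M\<bar> + 1)" using ap by blast
      have "h (x \<ominus>\<^bsub>A\<^esub> s) = h x" unfolding diff_def by (simp add: h x s scale_closed)
      then have "norm (h x) \<le> M * nrm A (x \<ominus>\<^bsub>A\<^esub> s)" using bd[OF diff_closed[OF x s(1)]] by simp
      also have "\<dots> \<le> (\<bar>M\<bar> + 1) * nrm A (x \<ominus>\<^bsub>A\<^esub> s)"
        by (rule mult_right_mono) (use nrm_nonneg[OF diff_closed[OF x s(1)]] in auto)
      also have "\<dots> \<le> e" using s(3) by (simp add: field_simps less_imp_le)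
      finally show "norm (h x) \<le> 0 + e" by simp
    qed
    then show ?thesis by simp
  qed
  then show ?thesis
    unfolding closed_ideal_def closedin_norm_iff
    using h by (auto simp: zero_closed h0 add_closed scale_closed mult_closed)
qed

text \<open>The elements of \<open>A\<close> that annihilate \<open>f\<close> form a closed ideal.\<close>

lemma simple_annihilator:
  assumes A: "A \<in> ucstar" and s: "simple A" and E: "E \<in> ucstar" and k: "cstar_hom A E k"
    and f: "f \<in> carrier E" and comm: "\<And>x. x \<in> carrier A \<Longrightarrow> f \<otimes>\<^bsub>E\<^esub> k x = k x \<otimes>\<^bsub>E\<^esub> f"
    and x: "x \<in> carrier A" "x \<noteq> \<zero>\<^bsub>A\<^esub>" "k x \<otimes>\<^bsub>E\<^esub> f = \<zero>\<^bsub>E\<^esub>"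
  shows "k \<one>\<^bsub>A\<^esub> \<otimes>\<^bsub>E\<^esub> f = \<zero>\<^bsub>E\<^esub>"
proof -
  interpret A: ucalg A by unfold_locales (rule A)
  interpret E: ucalg E by unfold_locales (rule E)
  define h where "h y = E.\<alpha> (k y) * E.\<alpha> f" for y
  have kc: "k y \<in> carrier E" if "y \<in> carrier A" for y by (rule cstar_homD(1)[OF k that])
  have c: "E.\<alpha> f * E.\<alpha> (k y) = E.\<alpha> (k y) * E.\<alpha> f" if "y \<in> carrier A" for y
    using comm[OF that] by (simp add: kc that f flip: emb_mult[OF E])
  \<comment> \<open>As \<open>f\<close> commutes with the image of \<open>k\<close>, it can be moved
    past either factor; this makes the annihilator a two-sided ideal.\<close>
  have hm: "h (y \<otimes>\<^bsub>A\<^esub> z) = E.\<alpha> (k y) * h z" "h (y \<otimes>\<^bsub>A\<^esub> z) = h y * E.\<alpha> (k z)" if "y \<in> carrier A" "z \<in> carrier A" for y z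
    using c[OF that(2)] by (simp_all add: h_def cstar_homD(4)[OF k that] E.emb_simps kc that mult.assoc)
  have "closed_ideal {y \<in> carrier A. h y = 0} A"
  proof (rule kernel_ideal[where M="norm (E.\<alpha> f)"])
    show "h \<zero>\<^bsub>A\<^esub> = 0"
      by (simp add: h_def cstar_hom_zero[OF A.cstar_algebra_axioms E.cstar_algebra_axioms k] E.emb_simps)
    show "norm (h y) \<le> norm (E.\<alpha> f) * nrm A y" if y: "y \<in> carrier A" for y
      using norm_mult_ineq[of "E.\<alpha> (k y)" "E.\<alpha> f"] cstar_hom_contractive[OF A E k y]
        mult_right_mono[of "nrm E (k y)" "nrm A y" "norm (E.\<alpha> f)"]
      by (simp add: h_def E.nrm_eq kc y mult.commute)
    show "h (y \<oplus>\<^bsub>A\<^esub> z) = h y + h z" if "y \<in> carrier A" "z \<in> carrier A" for y z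
      by (simp add: h_def cstar_homD(2)[OF k that] E.emb_simps kc that distrib_right)
    show "h (t \<odot>\<^bsub>A\<^esub> y) = 0" if "y \<in> carrier A" "h y = 0" for y t
      using that by (simp add: h_def cstar_homD(3)[OF k] E.emb_simps kc cs_def distrib_right mult.assoc)
    show "h (z \<otimes>\<^bsub>A\<^esub> y) = 0 \<and> h (y \<otimes>\<^bsub>A\<^esub> z) = 0" if "y \<in> carrier A" "z \<in> carrier A" "h y = 0" for y z
      using that by (simp add: hm(1)[of z y] hm(2)[of y z])
  qed (rule A.cstar_algebra_axioms)
  moreover have "h x = 0" using x by (simp add: h_def kc f E.emb_simps flip: emb_mult[OF E])
  ultimately have "{y \<in> carrier A. h y = 0} = carrier A"
    using s x unfolding simple_def by blast
  then have "h \<one>\<^bsub>A\<^esub> = 0" using A.one(1) by blast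
  then show ?thesis by (intro E.eqI) (simp_all add: h_def E.emb_simps kc f A.one(1) E.closed)
qed

section \<open>Subalgebras: corners and images of homomorphisms\<close>

lemma restrict_simps [simp]:
  "carrier (restrict_to A S) = S" "\<zero>\<^bsub>restrict_to A S\<^esub> = \<zero>\<^bsub>A\<^esub>" "add (restrict_to A S) = add A"
  "scale (restrict_to A S) = scale A" "mult (restrict_to A S) = mult A" "adj (restrict_to A S) = adj A"
  "nrm (restrict_to A S) = nrm A"
  by (simp_all add: restrict_to_def)

lemma cstar_hom_restrict: "S \<subseteq> carrier A \<Longrightarrow> cstar_hom D (restrict_to A S) f \<Longrightarrow> cstar_hom D A f"
  unfolding cstar_hom_def by auto

lemma (in cstar_algebra) subalgebra_carrier: "cstar_subalgebra S A \<Longrightarrow> S \<subseteq> carrier A"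
  unfolding cstar_subalgebra_def closedin_norm_iff by blast

context ucalg begin

definition corner :: "'a \<Rightarrow> 'a set" where
  "corner s = {x \<in> carrier A. s \<otimes>\<^bsub>A\<^esub> x = x \<and> x \<otimes>\<^bsub>A\<^esub> s = x}"

lemma corner_iff:
  assumes "s \<in> carrier A"
  shows "x \<in> corner s \<longleftrightarrow> x \<in> carrier A \<and> \<alpha> s * \<alpha> x = \<alpha> x \<and> \<alpha> x * \<alpha> s = \<alpha> x"
  unfolding corner_def using assms
  by (auto simp: closed intro!: eqI simp flip: emb_mult[OF A])

text \<open>For \<open>0 \<le> a \<le> b\<close> write \<open>a\<close> and \<open>b - a\<close> as
  \<open>star c * c\<close> and \<open>star d * d\<close>. Compression by \<open>t = 1 - s\<close>
  annihilates \<open>b\<close>, and a sum of two such squares vanishes only if both do, so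
  \<open>c = c * s\<close> and \<open>a\<close> lies in the corner.\<close>

lemma hereditary_corner:
  assumes s: "s \<in> projections A"
  shows "hereditary (corner s) A"
proof -
  note S = projectionD[OF s]
  note ci = corner_iff[OF S(1)]
  have closed_corner: "x \<in> corner s" if x: "x \<in> carrier A" and ap: "\<forall>e>0. \<exists>y\<in>corner s. nrm A (x \<ominus>\<^bsub>A\<^esub> y) < e" for x
  proof -
    have "norm (\<alpha> s * \<alpha> x - \<alpha> x) \<le> 0 \<and> norm (\<alpha> x * \<alpha> s - \<alpha> x) \<le> 0"
    proof (intro conjI; rule field_le_epsilon)
      fix e :: real assume "0 < e"
      then obtain y where y: "y \<in> corner s" "nrm A (x \<ominus>\<^bsub>A\<^esub> y) < e / 2" using ap half_gt_zero by blast
      then have yc: "y \<in> carrier A" "\<alpha> s * \<alpha> y = \<alpha> y" "\<alpha> y * \<alpha> s = \<alpha> y" by (auto simp: ci)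
      have n: "norm (\<alpha> x - \<alpha> y) < e / 2" using y(2) by (simp add: nrm_eq closed x yc emb_simps)
      have eq: "\<alpha> s * \<alpha> x - \<alpha> x = \<alpha> s * (\<alpha> x - \<alpha> y) - (\<alpha> x - \<alpha> y)" "\<alpha> x * \<alpha> s - \<alpha> x = (\<alpha> x - \<alpha> y) * \<alpha> s - (\<alpha> x - \<alpha> y)"
        by (simp_all add: algebra_simps yc)
      have "norm (\<alpha> s * (\<alpha> x - \<alpha> y)) \<le> 1 * (e / 2)" "norm ((\<alpha> x - \<alpha> y) * \<alpha> s) \<le> e / 2 * 1"
        by (rule norm_mult_le; use S(4) n in simp)+
      then show "norm (\<alpha> s * \<alpha> x - \<alpha> x) \<le> 0 + e" "norm (\<alpha> x * \<alpha> s - \<alpha> x) \<le> 0 + e"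
        unfolding eq using norm_triangle_ineq4[of "\<alpha> s * (\<alpha> x - \<alpha> y)" "\<alpha> x - \<alpha> y"]
          norm_triangle_ineq4[of "(\<alpha> x - \<alpha> y) * \<alpha> s" "\<alpha> x - \<alpha> y"] n by simp_all
    qed
    then show ?thesis using x by (simp add: ci)
  qed
  have sub: "cstar_subalgebra (corner s) A"
    unfolding cstar_subalgebra_def closedin_norm_iff
  proof (intro conjI ballI allI impI)
    show "corner s \<subseteq> carrier A" by (auto simp: ci)
    show "\<zero>\<^bsub>A\<^esub> \<in> corner s" by (simp add: ci closed emb_simps)
    show "x \<oplus>\<^bsub>A\<^esub> y \<in> corner s" if "x \<in> corner s" "y \<in> corner s" for x y
      using that by (simp add: ci closed emb_simps algebra_simps)
    show "x \<otimes>\<^bsub>A\<^esub> y \<in> corner s" if xy: "x \<in> corner s" "y \<in> corner s" for x y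
    proof -
      have "\<alpha> s * (\<alpha> x * \<alpha> y) = \<alpha> x * \<alpha> y" using xy unfolding ci by (metis mult.assoc)
      then show ?thesis using xy by (simp add: ci closed emb_simps mult.assoc)
    qed
    show "adj A x \<in> corner s" if "x \<in> corner s" for x
    proof -
      have x: "x \<in> carrier A" "\<alpha> s * \<alpha> x = \<alpha> x" "\<alpha> x * \<alpha> s = \<alpha> x" using that by (auto simp: ci)
      have "star (\<alpha> x * \<alpha> s) = star (\<alpha> x)" "star (\<alpha> s * \<alpha> x) = star (\<alpha> x)" by (simp_all only: x)
      then show ?thesis using x(1) by (simp add: ci closed emb_simps star_mult S)
    qed
    show "c \<odot>\<^bsub>A\<^esub> x \<in> corner s" if "x \<in> corner s" for x c
      using that by (simp add: corner_def closed mult_scale_left mult_scale_right S)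
  qed (use closed_corner in auto)
  have "a \<in> corner s" if a: "a \<in> positives A" and b: "b \<in> corner s" and ba: "b \<ominus>\<^bsub>A\<^esub> a \<in> positives A" for a b
  proof -
    obtain c where c: "c \<in> carrier A" "a = adj A c \<otimes>\<^bsub>A\<^esub> c" using a by (auto simp: positives_def)
    obtain d where d: "d \<in> carrier A" "b \<ominus>\<^bsub>A\<^esub> a = adj A d \<otimes>\<^bsub>A\<^esub> d" using ba by (auto simp: positives_def)
    have bc: "b \<in> carrier A" "\<alpha> s * \<alpha> b = \<alpha> b" "\<alpha> b * \<alpha> s = \<alpha> b" using b by (auto simp: ci)
    have ac: "a \<in> carrier A" "\<alpha> a = star (\<alpha> c) * \<alpha> c" using c by (simp_all add: closed emb_simps)
    have "\<alpha> b - \<alpha> a = star (\<alpha> d) * \<alpha> d" using arg_cong[OF d(2), of \<alpha>] by (simp add: emb_simps closed bc(1) ac(1) d(1))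
    then have eq: "star (\<alpha> c) * \<alpha> c + star (\<alpha> d) * \<alpha> d = \<alpha> b" using ac(2) by (simp add: algebra_simps)
    define t where "t = 1 - \<alpha> s"
    have t: "star t = t" "\<alpha> b * t = 0" by (simp_all add: t_def star_simps S algebra_simps bc)
    have "star (\<alpha> c * t) * (\<alpha> c * t) + star (\<alpha> d * t) * (\<alpha> d * t) = t * (star (\<alpha> c) * \<alpha> c + star (\<alpha> d) * \<alpha> d) * t"
      by (simp add: star_mult t(1) algebra_simps)
    also have "\<dots> = 0" unfolding eq by (simp add: mult.assoc t)
    finally have "\<alpha> c * t = 0" by (rule star_mult_sum_eq_zero)
    then have cs: "\<alpha> c * \<alpha> s = \<alpha> c" by (simp add: t_def algebra_simps)
    have "star (\<alpha> c * \<alpha> s) = star (\<alpha> c)" by (simp only: cs)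
    then have sc: "\<alpha> s * star (\<alpha> c) = star (\<alpha> c)" by (simp add: star_mult S)
    show ?thesis unfolding ci ac(2) using ac(1) cs sc by (metis mult.assoc)
  qed
  then show ?thesis using sub unfolding hereditary_def by blast
qed

end

text \<open>Closedness is the point that is not formal: by isometry the preimages of a convergent
  sequence are Cauchy, and they converge in the ambient type.\<close>

lemma isometric_image:
  assumes D: "D \<in> ucstar" and A: "A \<in> ucstar" and f: "cstar_hom D A f"
    and iso: "\<And>x. x \<in> carrier D \<Longrightarrow> nrm A (f x) = nrm D x"
  shows "cstar_subalgebra (f ` carrier D) A"
proof -
  interpret D: ucalg D by unfold_locales (rule D)
  interpret A: ucalg A by unfold_locales (rule A)
  note fD = cstar_homD[OF f]
  have fdiff: "f (x \<ominus>\<^bsub>D\<^esub> y) = f x \<ominus>\<^bsub>A\<^esub> f y" if "x \<in> carrier D" "y \<in> carrier D" for x y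
    by (rule cstar_hom_diff[OF D.cstar_algebra_axioms f that])
  have "x \<in> f ` carrier D" if x: "x \<in> carrier A" and ap: "\<forall>e>0. \<exists>s\<in>f ` carrier D. nrm A (x \<ominus>\<^bsub>A\<^esub> s) < e" for x
  proof -
    have "\<exists>d\<in>carrier D. nrm A (x \<ominus>\<^bsub>A\<^esub> f d) < 1 / real (Suc n)" for n using ap by (auto simp: image_iff)
    then obtain d where d: "\<And>n. d n \<in> carrier D" "\<And>n. nrm A (x \<ominus>\<^bsub>A\<^esub> f (d n)) < 1 / real (Suc n)" by metis
    have lim: "(\<lambda>n. 1 / real (Suc n)) \<longlonglongrightarrow> 0"
      using LIMSEQ_inverse_real_of_nat by (simp add: divide_inverse)
    have "(\<lambda>n. norm (A.\<alpha> x - A.\<alpha> (f (d n)))) \<longlonglongrightarrow> 0"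
      by (rule tendsto_sandwich[OF _ _ tendsto_const lim])
        (use d in \<open>auto simp: A.nrm_eq A.closed x fD A.emb_simps less_imp_le intro!: always_eventually\<close>)
    then have "(\<lambda>n. norm (A.\<alpha> (f (d n)) - A.\<alpha> x)) \<longlonglongrightarrow> 0" by (simp add: norm_minus_commute)
    then have l: "(\<lambda>n. A.\<alpha> (f (d n))) \<longlonglongrightarrow> A.\<alpha> x" by (simp add: LIM_zero_iff tendsto_norm_zero_iff)
    have eq: "norm (D.\<alpha> y - D.\<alpha> z) = norm (A.\<alpha> (f y) - A.\<alpha> (f z))" if "y \<in> carrier D" "z \<in> carrier D" for y z
      using iso[OF D.diff_closed[OF that]] that by (simp add: fdiff D.nrm_eq A.nrm_eq D.closed A.closed fD D.emb_simps A.emb_simps)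
    have "Cauchy (\<lambda>n. D.\<alpha> (d n))"
      using LIMSEQ_imp_Cauchy[OF l] unfolding Cauchy_def dist_norm by (simp add: eq d)
    then obtain L where L: "(\<lambda>n. D.\<alpha> (d n)) \<longlonglongrightarrow> L" by (metis Cauchy_convergent convergent_def)
    define y where "y = ev D L"
    have y: "y \<in> carrier D" by (simp add: y_def ev_closed D)
    \<comment> \<open>The limit could a priori leave the corner of \<open>D\<close>; being fixed by
      its unit, it does not.\<close>
    have "(\<lambda>n. D.\<alpha> \<one>\<^bsub>D\<^esub> * D.\<alpha> (d n)) \<longlonglongrightarrow> D.\<alpha> \<one>\<^bsub>D\<^esub> * L" by (intro tendsto_mult tendsto_const L)
    then have "(\<lambda>n. D.\<alpha> (d n)) \<longlonglongrightarrow> D.\<alpha> \<one>\<^bsub>D\<^esub> * L" by (simp add: D.unit_mult d)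
    then have "D.\<alpha> \<one>\<^bsub>D\<^esub> * L = L" using L by (rule LIMSEQ_unique)
    then have "D.\<alpha> y = L" unfolding y_def by (rule D.emb_ev_eq(1))
    then have "(\<lambda>n. norm (D.\<alpha> (d n) - D.\<alpha> y)) \<longlonglongrightarrow> 0" using L by (simp add: LIM_zero tendsto_norm_zero)
    then have "(\<lambda>n. norm (A.\<alpha> (f (d n)) - A.\<alpha> (f y))) \<longlonglongrightarrow> 0" by (simp add: eq d y)
    then have "(\<lambda>n. A.\<alpha> (f (d n))) \<longlonglongrightarrow> A.\<alpha> (f y)" by (simp add: LIM_zero_iff tendsto_norm_zero_iff)
    then have "A.\<alpha> x = A.\<alpha> (f y)" using l by (metis LIMSEQ_unique)
    then have "x = f y" by (rule A.eqI[OF x fD(1)[OF y]])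
    then show ?thesis using y by blast
  qed
  then have closed: "closedin (norm_topology A) (f ` carrier D)"
    unfolding A.closedin_norm_iff using fD(1) by blast
  have "\<zero>\<^bsub>A\<^esub> \<in> f ` carrier D"
    using cstar_hom_zero[OF D.cstar_algebra_axioms A.cstar_algebra_axioms f] D.zero_closed by (metis imageI)
  then show ?thesis
    unfolding cstar_subalgebra_def using closed
  proof (intro conjI ballI allI)
    fix u v c assume u: "u \<in> f ` carrier D"
    obtain x where x: "x \<in> carrier D" "u = f x" using u by auto
    show "adj A u \<in> f ` carrier D" "c \<odot>\<^bsub>A\<^esub> u \<in> f ` carrier D"
      using fD(5)[OF x(1)] fD(3)[OF x(1), of c] x by (metis D.adj_closed D.scale_closed imageI)+
    assume "v \<in> f ` carrier D"
    then obtain y where y: "y \<in> carrier D" "v = f y" by auto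
    show "u \<oplus>\<^bsub>A\<^esub> v \<in> f ` carrier D" "u \<otimes>\<^bsub>A\<^esub> v \<in> f ` carrier D"
      using fD(2)[OF x(1) y(1)] fD(4)[OF x(1) y(1)] x y by (metis D.add_closed D.mult_closed imageI)+
  qed
qed

text \<open>The image of \<open>D\<close> is a quotient of \<open>D\<close>, and quotients are only
  approximated by members of the class. An approximating \<open>S'\<close> in the quotient is pushed
  forward by the injective map \<open>k\<close> induced by \<open>\<pi>\<close>; injectivity makes
  the composite isometric, so the image is again a subalgebra isomorphic to a member.\<close>

lemma image_in_class:
  fixes \<C> :: "'u calg set"
  assumes \<C>: "\<C> \<subseteq> ucstar" and D: "D \<in> \<C>" and A: "A \<in> ucstar"
    and quotients: "\<And>J. closed_ideal J D \<Longrightarrow> locally_approx_unitarily \<C> (quot_algebra D J)"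
    and \<pi>: "cstar_hom D A \<pi>" and F: "finite F" "F \<subseteq> carrier D" and \<epsilon>: "0 < \<epsilon>"
  obtains S where "cstar_subalgebra S A" "in_class \<C> (restrict_to A S)" "is_unit (restrict_to A S) (\<pi> \<one>\<^bsub>D\<^esub>)"
    "\<And>x. x \<in> F \<Longrightarrow> \<exists>s\<in>S. nrm A (\<pi> x \<ominus>\<^bsub>A\<^esub> s) < \<epsilon>"
proof -
  have DU: "D \<in> ucstar" using \<C> D by blast
  interpret D: ucalg D by unfold_locales (rule DU)
  interpret A: ucalg A by unfold_locales (rule A)
  note pD = cstar_homD[OF \<pi>]
  define J where "J = {x \<in> carrier D. A.\<alpha> (\<pi> x) = 0}"
  have J: "x \<in> J \<longleftrightarrow> x \<in> carrier D \<and> \<pi> x = \<zero>\<^bsub>A\<^esub>" for x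
    using emb_eq_zero_iff[OF A pD(1)] by (auto simp: J_def)
  have ideal: "closed_ideal J D"
    unfolding J_def
  proof (rule kernel_ideal[where M=1])
    show "A.\<alpha> (\<pi> \<zero>\<^bsub>D\<^esub>) = 0"
      by (simp add: cstar_hom_zero[OF D.cstar_algebra_axioms A.cstar_algebra_axioms \<pi>] A.emb_simps)
    show "norm (A.\<alpha> (\<pi> x)) \<le> 1 * nrm D x" if "x \<in> carrier D" for x
      using cstar_hom_contractive[OF DU A \<pi> that] by (simp add: A.nrm_eq pD that)
  qed (simp_all add: pD A.emb_simps cs_def D.cstar_algebra_axioms)
  interpret Q: quotient_calg D J
  proof
    show "adj D x \<in> J" if "x \<in> J" for x
      using that by (simp add: J D.closed pD A.adj_zero)
  qed (rule DU ideal)+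
  obtain k where k: "cstar_hom Q.Q A k" "\<And>x. x \<in> carrier D \<Longrightarrow> k (Q.q x) = \<pi> x"
  proof -
    have "\<pi> x = \<pi> y" if xy: "x \<in> carrier D" "y \<in> carrier D" "x \<ominus>\<^bsub>D\<^esub> y \<in> J" for x y
    proof (rule A.eqI)
      have "\<pi> x \<ominus>\<^bsub>A\<^esub> \<pi> y = \<zero>\<^bsub>A\<^esub>"
        using xy(3) cstar_hom_diff[OF D.cstar_algebra_axioms \<pi> xy(1,2)] by (simp add: J)
      then have "A.\<alpha> (\<pi> x) - A.\<alpha> (\<pi> y) = 0" using xy by (simp add: pD flip: A.emb_simps)
      then show "A.\<alpha> (\<pi> x) = A.\<alpha> (\<pi> y)" by simp
    qed (simp_all add: pD xy)
    from Q.lift[OF \<pi> this] show ?thesis using that by blast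
  qed
  note kD = cstar_homD[OF k(1)]
  have "finite (Q.q ` F) \<and> Q.q ` F \<subseteq> carrier Q.Q \<and> 0 < \<epsilon> / 2" using F \<epsilon> Q.q_closed by auto
  then obtain S' where S': "cstar_subalgebra S' Q.Q" "in_class \<C> (restrict_to Q.Q S')"
    "is_unit (restrict_to Q.Q S') \<one>\<^bsub>Q.Q\<^esub>" "\<forall>X\<in>Q.q ` F. dist_to Q.Q X S' \<le> \<epsilon> / 2"
    using quotients[OF ideal] unfolding locally_approx_unitarily_def by meson
  have sub: "S' \<subseteq> carrier Q.Q"
    using S'(1) closedin_subset[of "norm_topology Q.Q" S'] Metric_space.topspace_mtopology[OF Q.Metric_space_Q]
    by (simp add: cstar_subalgebra_def norm_topology_def)
  obtain D0 f where D0: "D0 \<in> \<C>" and f: "cstar_hom D0 (restrict_to Q.Q S') f" "bij_betw f (carrier D0) S'"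
    using S'(2) by (auto simp: in_class_def cstar_iso_def)
  have D0U: "D0 \<in> ucstar" using \<C> D0 by blast
  interpret D0: ucalg D0 by unfold_locales (rule D0U)
  have fQ: "cstar_hom D0 Q.Q f" by (rule cstar_hom_restrict[OF sub f(1)])
  note fD = cstar_homD[OF fQ]
  define h where "h d = k (f d)" for d
  have h: "cstar_hom D0 A h" unfolding h_def by (rule cstar_hom_comp[OF fQ k(1)])
  have kinj: "X = \<zero>\<^bsub>Q.Q\<^esub>" if X: "X \<in> carrier Q.Q" "k X = \<zero>\<^bsub>A\<^esub>" for X
  proof -
    obtain x where x: "x \<in> carrier D" "X = Q.q x" using X(1) by (auto simp: Q.carrier_Q)
    then have "x \<in> J" using X(2) k(2) by (simp add: J)
    then show ?thesis using x by (simp add: Q.Q_zero Q.q_eq_iff D.closed D.diff_zero)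
  qed
  have f0: "f \<zero>\<^bsub>D0\<^esub> = \<zero>\<^bsub>Q.Q\<^esub>"
  proof -
    have "f (0 \<odot>\<^bsub>D0\<^esub> \<zero>\<^bsub>D0\<^esub>) = 0 \<odot>\<^bsub>Q.Q\<^esub> f \<zero>\<^bsub>D0\<^esub>" by (rule fD(3)[OF D0.zero_closed])
    moreover obtain x where "x \<in> carrier D" "f \<zero>\<^bsub>D0\<^esub> = Q.q x"
      using fD(1)[OF D0.zero_closed] by (auto simp: Q.carrier_Q)
    ultimately show ?thesis by (simp add: D0.scale_zero Q.Q_scale D.zero_scale Q.Q_zero)
  qed
  have hinj: "d = \<zero>\<^bsub>D0\<^esub>" if "d \<in> carrier D0" "h d = \<zero>\<^bsub>A\<^esub>" for d
  proof -
    have "f d = f \<zero>\<^bsub>D0\<^esub>" using kinj[OF fD(1)] that f0 by (simp add: h_def)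
    then show ?thesis using f(2) that(1) D0.zero_closed by (auto simp: bij_betw_def dest: inj_onD)
  qed
  have iso: "nrm A (h d) = nrm D0 d" if "d \<in> carrier D0" for d
    by (rule cstar_hom_isometric[OF D0U A h that hinj])
  define S where "S = h ` carrier D0"
  have kS: "S = k ` S'" using f(2) by (auto simp: S_def h_def bij_betw_def image_image)
  have S: "cstar_subalgebra S A" unfolding S_def by (rule isometric_image[OF D0U A h iso])
  have "inj_on h (carrier D0)"
  proof (rule inj_onI)
    fix x y assume xy: "x \<in> carrier D0" "y \<in> carrier D0" "h x = h y"
    have "h (x \<ominus>\<^bsub>D0\<^esub> y) = h x \<ominus>\<^bsub>A\<^esub> h y" by (rule cstar_hom_diff[OF D0.cstar_algebra_axioms h xy(1,2)])
    also have "\<dots> = \<zero>\<^bsub>A\<^esub>"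
      by (rule A.eqI) (simp_all add: xy(3) cstar_homD(1)[OF h xy(2)] A.closed A.emb_simps)
    finally have "x \<ominus>\<^bsub>D0\<^esub> y = \<zero>\<^bsub>D0\<^esub>" by (intro hinj D0.closed xy)
    then have "D0.\<alpha> x - D0.\<alpha> y = 0" using xy by (simp flip: D0.emb_simps)
    then show "x = y" by (intro D0.eqI xy) simp
  qed
  moreover have "cstar_hom D0 (restrict_to A S) h"
    using h unfolding cstar_hom_def by (auto simp: S_def)
  ultimately have cl: "in_class \<C> (restrict_to A S)"
    unfolding in_class_def cstar_iso_def using D0 by (auto simp: bij_betw_def S_def)
  have one: "\<one>\<^bsub>Q.Q\<^esub> \<in> S'" "k \<one>\<^bsub>Q.Q\<^esub> = \<pi> \<one>\<^bsub>D\<^esub>"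
    using S'(3) k(2)[OF D.one(1)] by (auto simp: is_unit_def Q.Q_one)
  have u: "is_unit (restrict_to A S) (\<pi> \<one>\<^bsub>D\<^esub>)"
    unfolding is_unit_def kS one(2)[symmetric]
  proof (intro conjI ballI)
    fix y assume "y \<in> carrier (restrict_to A (k ` S'))"
    then obtain X where X: "X \<in> S'" "y = k X" by auto
    have "\<one>\<^bsub>Q.Q\<^esub> \<otimes>\<^bsub>Q.Q\<^esub> X = X" "X \<otimes>\<^bsub>Q.Q\<^esub> \<one>\<^bsub>Q.Q\<^esub> = X" using S'(3) X(1) by (auto simp: is_unit_def)
    then show "k \<one>\<^bsub>Q.Q\<^esub> \<otimes>\<^bsub>restrict_to A (k ` S')\<^esub> y = y" "y \<otimes>\<^bsub>restrict_to A (k ` S')\<^esub> k \<one>\<^bsub>Q.Q\<^esub> = y"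
      using X one(1) sub by (auto simp: subset_iff simp flip: kD)
  qed (use one(1) in simp)
  have ap: "\<exists>s\<in>S. nrm A (\<pi> x \<ominus>\<^bsub>A\<^esub> s) < \<epsilon>" if x: "x \<in> F" for x
  proof -
    have xc: "x \<in> carrier D" using F x by blast
    have "(INF s\<in>S'. nrm Q.Q (Q.q x \<ominus>\<^bsub>Q.Q\<^esub> s)) < \<epsilon>" using S'(4) x \<epsilon> by (fastforce simp: dist_to_def)
    moreover have "S' \<noteq> {}" using one by auto
    moreover have "bdd_below ((\<lambda>s. nrm Q.Q (Q.q x \<ominus>\<^bsub>Q.Q\<^esub> s)) ` S')"
    proof (rule bdd_belowI[of _ 0])
      fix t assume "t \<in> (\<lambda>s. nrm Q.Q (Q.q x \<ominus>\<^bsub>Q.Q\<^esub> s)) ` S'"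
      then obtain y where "y \<in> carrier D" "t = nrm Q.Q (Q.q x \<ominus>\<^bsub>Q.Q\<^esub> Q.q y)" using sub by (auto simp: Q.carrier_Q)
      then show "0 \<le> t" by (simp add: Q.Q_diff xc Q.Q_nrm_nonneg D.closed)
    qed
    ultimately obtain X where X: "X \<in> S'" "nrm Q.Q (Q.q x \<ominus>\<^bsub>Q.Q\<^esub> X) < \<epsilon>"
      using cINF_less_iff[of S'] by blast
    obtain y where y: "y \<in> carrier D" "X = Q.q y" using X(1) sub by (auto simp: Q.carrier_Q)
    \<comment> \<open>Smallness in the quotient is realised by a representative \<open>z\<close> of
      small norm in \<open>D\<close>, which has the same image under \<open>\<pi>\<close>.\<close>
    obtain z where z: "z \<in> carrier D" "Q.q z = Q.q (x \<ominus>\<^bsub>D\<^esub> y)" "nrm D z < \<epsilon>"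
      using Q.Q_nrm_near[of "x \<ominus>\<^bsub>D\<^esub> y" \<epsilon>] X(2) y xc by (metis D.diff_closed Q.Q_diff)
    have "\<pi> x \<ominus>\<^bsub>A\<^esub> k X = \<pi> (x \<ominus>\<^bsub>D\<^esub> y)"
      using cstar_hom_diff[OF D.cstar_algebra_axioms \<pi> xc y(1)] y k(2) by simp
    also have "\<dots> = \<pi> z" using z(1,2) k(2) xc y(1) by (metis D.diff_closed)
    finally have "nrm A (\<pi> x \<ominus>\<^bsub>A\<^esub> k X) < \<epsilon>" using cstar_hom_contractive[OF DU A \<pi> z(1)] z(3) by simp
    then show ?thesis using X(1) kS by blast
  qed
  show ?thesis by (rule that[OF S cl u ap])
qed

section \<open>Splitting off two orthogonal pieces\<close>

text \<open>Every representative of the class of a constant sequence converges to that constant, and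
  so do its subsequences.\<close>

lemma seq_const_strictly_positive:
  assumes A: "A \<in> ucstar" and a: "a \<in> positives A" "a \<noteq> \<zero>\<^bsub>A\<^esub>"
  shows "seq_const A a \<in> seq_strictly_positives A" "seq_const A a \<noteq> \<zero>\<^bsub>seq_algebra A\<^esub>"
proof -
  interpret A: ucalg A by unfold_locales (rule A)
  note k = cstar_homD[OF cstar_hom_seq_const[OF A]]
  have ac: "a \<in> carrier A" using A.positives_emb[OF a(1)] by simp
  show "seq_const A a \<noteq> \<zero>\<^bsub>seq_algebra A\<^esub>" using seq_const_eq_zero[OF A ac] a(2) by blast
  obtain x where x: "x \<in> carrier A" "a = adj A x \<otimes>\<^bsub>A\<^esub> x" using a(1) by (auto simp: positives_def)
  have "seq_const A a = adj (seq_algebra A) (seq_const A x) \<otimes>\<^bsub>seq_algebra A\<^esub> seq_const A x"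
    using x by (simp add: k A.closed)
  then have "seq_const A a \<in> positives (seq_algebra A)" using k(1)[OF x(1)] by (auto simp: positives_def)
  moreover have False
    if y: "y \<in> seq_const A a" and j: "strict_mono j" "limitin (norm_topology A) (y \<circ> j) \<zero>\<^bsub>A\<^esub> sequentially" for y and j :: "nat \<Rightarrow> nat"
  proof -
    have la: "(\<lambda>_. a) \<in> carrier (linf A)" by (rule A.linf_const[OF ac])
    have yl: "y \<in> carrier (linf A)" "cls A y = cls A (\<lambda>_. a)"
      using cls_mem_eq[OF A la, of y] y by (simp_all add: seq_const_eq[OF A])
    have yc: "y n \<in> carrier A" for n by (rule A.linf_closed[OF yl(1)])
    have "(\<lambda>n. nrm A (y n \<ominus>\<^bsub>A\<^esub> a)) \<longlonglongrightarrow> 0" using cls_eq_iff[OF A yl(1) la] yl(2) by simp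
    then have "(\<lambda>n. norm (A.\<alpha> (y n) - A.\<alpha> a)) \<longlonglongrightarrow> 0" by (simp add: A.nrm_eq A.closed A.emb_simps yc ac)
    then have "(\<lambda>n. A.\<alpha> (y n)) \<longlonglongrightarrow> A.\<alpha> a" by (simp add: LIM_zero_iff tendsto_norm_zero_iff)
    then have "(\<lambda>n. A.\<alpha> (y (j n))) \<longlonglongrightarrow> A.\<alpha> a" using LIMSEQ_subseq_LIMSEQ[OF _ j(1)] by (simp add: o_def)
    moreover have "(\<lambda>n. A.\<alpha> (y (j n))) \<longlonglongrightarrow> 0"
    proof -
      have "(\<lambda>n. nrm A (y (j n) \<ominus>\<^bsub>A\<^esub> \<zero>\<^bsub>A\<^esub>)) \<longlonglongrightarrow> 0"
        using j(2) A.limitin_norm_iff[of "y \<circ> j"] yc by simp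
      then show ?thesis by (simp add: A.diff_zero yc A.nrm_eq tendsto_norm_zero_iff)
    qed
    ultimately have "A.\<alpha> a = 0" by (rule LIMSEQ_unique)
    then show False using a(2) emb_eq_zero_iff[OF A ac] by simp
  qed
  ultimately show "seq_const A a \<in> seq_strictly_positives A"
    unfolding seq_strictly_positives_def by blast
qed

text \<open>With \<open>v\<^sup>*v = f\<close> central and \<open>vv\<^sup>* \<le> e\<close>, the element \<open>x = vwv\<^sup>*\<close> of \<open>eA\<^sub>\<infinity>e\<close> is normal, which forces
  \<open>fww\<^sup>* = fw\<^sup>*w\<close> for \<open>w = ew(1 - e)\<close> and hence \<open>fww\<^sup>* = 0\<close>.\<close>

lemma minimal_central_zero:
  assumes A: "A \<in> ucstar" and s: "simple A"
    and e: "e \<in> projections A" "e \<noteq> \<zero>\<^bsub>A\<^esub>" "e \<noteq> \<one>\<^bsub>A\<^esub>"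
    and norm: "\<And>y. (emb A e * y * emb A e) * star (emb A e * y * emb A e) = star (emb A e * y * emb A e) * (emb A e * y * emb A e)"
    and f: "f \<in> projections (seq_algebra A)" "f \<in> central_sequences A"
    and r: "r \<in> projections (seq_algebra A)" "r \<in> hereditary_gen (seq_algebra A) (seq_const A e)"
    and m: "mvn_equiv (seq_algebra A) f r"
  shows "f = \<zero>\<^bsub>seq_algebra A\<^esub>"
proof -
  interpret A: ucalg A by unfold_locales (rule A)
  interpret E: ucalg "seq_algebra A" by unfold_locales (rule ucstar_seq[OF A])
  note kh = cstar_hom_seq_const[OF A]
  note k = cstar_homD[OF kh]
  define K where "K x = E.\<alpha> (seq_const A x)" for x
  have Kh: "K (x \<otimes>\<^bsub>A\<^esub> y) = K x * K y" "K (adj A x) = star (K x)" if "x \<in> carrier A" "y \<in> carrier A" for x y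
    using that by (simp_all add: K_def k E.emb_simps)
  note P = A.projectionD[OF e(1)]
  have one_e: "\<one>\<^bsub>A\<^esub> \<ominus>\<^bsub>A\<^esub> e \<noteq> \<zero>\<^bsub>A\<^esub>"
  proof
    assume "\<one>\<^bsub>A\<^esub> \<ominus>\<^bsub>A\<^esub> e = \<zero>\<^bsub>A\<^esub>"
    then have "A.\<alpha> \<one>\<^bsub>A\<^esub> - A.\<alpha> e = 0" using P A.closed by (simp flip: A.emb_simps)
    then show False using e(3) A.eqI[OF A.one(1) P(1)] by simp
  qed
  \<comment> \<open>A central \<open>e\<close> would be annihilated by the nonzero element
    \<open>1 - e\<close>, so simplicity would give \<open>e = 0\<close>.\<close>
  have "\<exists>y\<in>carrier A. e \<otimes>\<^bsub>A\<^esub> y \<noteq> y \<otimes>\<^bsub>A\<^esub> e"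
  proof (rule ccontr)
    assume "\<not> ?thesis"
    then have c: "\<And>y. y \<in> carrier A \<Longrightarrow> e \<otimes>\<^bsub>A\<^esub> y = y \<otimes>\<^bsub>A\<^esub> e" by blast
    have id: "cstar_hom A A (\<lambda>x. x)" by (simp add: cstar_hom_def)
    have e0: "(\<one>\<^bsub>A\<^esub> \<ominus>\<^bsub>A\<^esub> e) \<otimes>\<^bsub>A\<^esub> e = \<zero>\<^bsub>A\<^esub>"
      by (rule A.eqI) (simp_all add: A.closed P A.emb_simps algebra_simps A.unit_mult)
    have "\<one>\<^bsub>A\<^esub> \<otimes>\<^bsub>A\<^esub> e = \<zero>\<^bsub>A\<^esub>"
      by (rule simple_annihilator[OF A s A id P(1) c A.diff_closed[OF A.one(1) P(1)] one_e e0])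
    then show False using e(2) P(1) A.one(2) by simp
  qed
  then obtain y where y: "y \<in> carrier A" "e \<otimes>\<^bsub>A\<^esub> y \<noteq> y \<otimes>\<^bsub>A\<^esub> e" by blast
  have "A.\<alpha> e * A.\<alpha> y \<noteq> A.\<alpha> y * A.\<alpha> e" using y P(1) A.eqI A.closed by (metis A.emb_simps(2))
  \<comment> \<open>Failure to commute shows up in one of the two off-diagonal corners; passing to
    the adjoint of \<open>y\<close>, if necessary, moves it to the corner from \<open>1 - e\<close>
    to \<open>e\<close>.\<close>
  then have "A.\<alpha> e * A.\<alpha> y - A.\<alpha> e * A.\<alpha> y * A.\<alpha> e \<noteq> 0 \<or> A.\<alpha> y * A.\<alpha> e - A.\<alpha> e * A.\<alpha> y * A.\<alpha> e \<noteq> 0" by auto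
  moreover have "A.\<alpha> e * star (A.\<alpha> y) - A.\<alpha> e * star (A.\<alpha> y) * A.\<alpha> e = star (A.\<alpha> y * A.\<alpha> e - A.\<alpha> e * A.\<alpha> y * A.\<alpha> e)"
    by (simp add: star_simps P mult.assoc)
  ultimately obtain z where z: "z \<in> carrier A" "A.\<alpha> e * A.\<alpha> z - A.\<alpha> e * A.\<alpha> z * A.\<alpha> e \<noteq> 0"
    using y(1) A.adj_closed[OF y(1)] A.emb_simps(3)[OF y(1)] by (metis star_zero star_star)
  define w where "w = e \<otimes>\<^bsub>A\<^esub> z \<ominus>\<^bsub>A\<^esub> e \<otimes>\<^bsub>A\<^esub> z \<otimes>\<^bsub>A\<^esub> e"
  have w: "w \<in> carrier A" "A.\<alpha> w = A.\<alpha> e * A.\<alpha> z - A.\<alpha> e * A.\<alpha> z * A.\<alpha> e"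
    by (simp_all add: w_def A.closed P z A.emb_simps)
  have we: "w \<otimes>\<^bsub>A\<^esub> e = \<zero>\<^bsub>A\<^esub>" "e \<otimes>\<^bsub>A\<^esub> w = w"
    by (rule A.eqI; simp add: A.closed P w A.emb_simps algebra_simps; simp add: P flip: mult.assoc)+
  have KeKw: "K w * K e = 0" "K e * K w = K w"
    using arg_cong[OF we(1), of K] arg_cong[OF we(2), of K] cstar_hom_zero[OF A.cstar_algebra_axioms E.cstar_algebra_axioms kh]
    by (simp_all add: Kh w P) (simp add: K_def E.emb_simps)
  have Ke: "star (K e) = K e" "K e * K e = K e"
    using e(1) P(1) by (auto simp: projections_def simp flip: Kh)
  have KwKe: "star (K w) * K e = star (K w)"
    using arg_cong[OF KeKw(2), of star] by (simp add: star_mult Ke)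
  note Fp = E.projectionD[OF f(1)] and Rp = E.projectionD[OF r(1)]
  define F where "F = E.\<alpha> f"
  have FK: "F * K x = K x * F" if "x \<in> carrier A" for x
    using f(2) that k(1)[OF that] Fp(1) unfolding central_sequences_def F_def K_def by (auto simp flip: E.emb_simps)
  obtain v where v: "v \<in> carrier (seq_algebra A)" "adj (seq_algebra A) v \<otimes>\<^bsub>seq_algebra A\<^esub> v = f"
    "v \<otimes>\<^bsub>seq_algebra A\<^esub> adj (seq_algebra A) v = r" using m by (auto simp: mvn_equiv_def)
  define V where "V = E.\<alpha> v"
  have VV: "star V * V = F" "V * star V = E.\<alpha> r" using v by (simp_all add: V_def F_def E.closed flip: E.emb_simps)
  have VF: "V * F = V" by (rule partial_isometry(1)[OF VV(1)]) (simp add: F_def Fp)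
  have FV: "F * star V = star V" using arg_cong[OF VF, of star] by (simp add: star_mult F_def Fp)
  have "norm (K e * E.\<alpha> r - E.\<alpha> r) \<le> 0"
  proof (rule field_le_epsilon)
    fix d :: real assume d: "0 < d"
    obtain x where x: "x \<in> carrier (seq_algebra A)" "norm (E.\<alpha> r - K e * E.\<alpha> x * K e) < d / 2"
      using E.hereditary_genD[OF k(1)[OF P(1)] r(2), of "d / 2"] d unfolding K_def by (metis half_gt_zero)
    have "K e * E.\<alpha> r - E.\<alpha> r = K e * (E.\<alpha> r - K e * E.\<alpha> x * K e) - (E.\<alpha> r - K e * E.\<alpha> x * K e)"
      by (simp add: algebra_simps) (simp add: Ke flip: mult.assoc)
    also have "norm \<dots> \<le> 1 * (d / 2) + d / 2"
      by (rule order_trans[OF norm_triangle_ineq4], intro add_mono norm_mult_le norm_projection[OF Ke]) (use x in simp_all)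
    finally show "norm (K e * E.\<alpha> r - E.\<alpha> r) \<le> 0 + d" by simp
  qed
  then have KeR: "K e * E.\<alpha> r = E.\<alpha> r" by simp
  have "V = E.\<alpha> r * V" using VF by (simp add: mult.assoc VV flip: VV(2))
  then have KeV: "K e * V = V" using KeR by (metis mult.assoc)
  have VKe: "star V * K e = star V" using arg_cong[OF KeV, of star] by (simp add: star_mult Ke)
  define \<xi> where "\<xi> = v \<otimes>\<^bsub>seq_algebra A\<^esub> seq_const A w \<otimes>\<^bsub>seq_algebra A\<^esub> adj (seq_algebra A) v"
  have \<xi>: "\<xi> \<in> carrier (seq_algebra A)" "E.\<alpha> \<xi> = V * K w * star V"
    by (simp_all add: \<xi>_def E.closed v k w E.emb_simps V_def K_def)
  have "\<xi> = seq_const A e \<otimes>\<^bsub>seq_algebra A\<^esub> \<xi> \<otimes>\<^bsub>seq_algebra A\<^esub> seq_const A e"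
  proof (rule E.eqI)
    have "K e * (V * K w * star V) * K e = V * K w * star V" using KeV VKe by (metis mult.assoc)
    then show "E.\<alpha> \<xi> = E.\<alpha> (seq_const A e \<otimes>\<^bsub>seq_algebra A\<^esub> \<xi> \<otimes>\<^bsub>seq_algebra A\<^esub> seq_const A e)"
      by (simp add: E.emb_simps E.closed k P \<xi>(1)) (simp add: \<xi>(2) K_def)
  qed (simp_all add: E.closed k P \<xi>)
  \<comment> \<open>As \<open>\<xi>\<close> is fixed by compression with the constant
    \<open>e\<close>, it has a representative inside \<open>e A e\<close>, where the hypothesis
    \<open>norm\<close> gives normality coordinate by coordinate.\<close>
  moreover obtain x where x: "x \<in> carrier (linf A)" "\<xi> = cls A x" using \<xi>(1) by (auto simp: carrier_seq[OF A])
  ultimately have xx: "\<xi> = cls A (\<lambda>n. e \<otimes>\<^bsub>A\<^esub> x n \<otimes>\<^bsub>A\<^esub> e)"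
    by (simp add: seq_const_eq[OF A] cls_ops[OF A] A.linf_const P A.linf_mult)
  have xl: "(\<lambda>n. e \<otimes>\<^bsub>A\<^esub> x n \<otimes>\<^bsub>A\<^esub> e) \<in> carrier (linf A)"
    by (intro A.linf_mult A.linf_const P(1) x(1))
  have "(e \<otimes>\<^bsub>A\<^esub> x n \<otimes>\<^bsub>A\<^esub> e) \<otimes>\<^bsub>A\<^esub> adj A (e \<otimes>\<^bsub>A\<^esub> x n \<otimes>\<^bsub>A\<^esub> e) = adj A (e \<otimes>\<^bsub>A\<^esub> x n \<otimes>\<^bsub>A\<^esub> e) \<otimes>\<^bsub>A\<^esub> (e \<otimes>\<^bsub>A\<^esub> x n \<otimes>\<^bsub>A\<^esub> e)" for n
    by (rule A.eqI) (use norm[of "A.\<alpha> (x n)"] in \<open>simp_all add: A.closed P A.linf_closed[OF x(1)] A.emb_simps\<close>)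
  then have "\<xi> \<otimes>\<^bsub>seq_algebra A\<^esub> adj (seq_algebra A) \<xi> = adj (seq_algebra A) \<xi> \<otimes>\<^bsub>seq_algebra A\<^esub> \<xi>"
    unfolding xx by (simp add: cls_ops[OF A] xl A.linf_adj)
  then have comm: "E.\<alpha> \<xi> * star (E.\<alpha> \<xi>) = star (E.\<alpha> \<xi>) * E.\<alpha> \<xi>"
    using \<xi>(1) E.closed by (metis E.emb_simps(2,3))
  have sX: "star (E.\<alpha> \<xi>) = V * star (K w) * star V" by (simp add: \<xi> star_mult mult.assoc)
  have Fsw: "F * star (K w) = star (K w) * F" using FK[OF A.adj_closed[OF w(1)]] Kh(2)[OF w(1) w(1)] by simp
  have sandwich: "star V * ((V * x * star V) * (V * y * star V)) * V = F * x * F * y * F" for x y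
    by (simp add: VV(1)[symmetric] mult.assoc)
  have "star V * (E.\<alpha> \<xi> * star (E.\<alpha> \<xi>)) * V = F * K w * F * star (K w) * F"
    unfolding sX unfolding \<xi>(2) by (rule sandwich)
  also have "\<dots> = F * (K w * star (K w))"
    using FK[OF w(1)] Fsw Fp(3) unfolding F_def by (metis mult.assoc)
  finally have 1: "star V * (E.\<alpha> \<xi> * star (E.\<alpha> \<xi>)) * V = F * (K w * star (K w))" .
  have "star V * (star (E.\<alpha> \<xi>) * E.\<alpha> \<xi>) * V = F * star (K w) * F * K w * F"
    unfolding sX unfolding \<xi>(2) by (rule sandwich)
  also have "\<dots> = F * (star (K w) * K w)"
    using FK[OF w(1)] Fsw Fp(3) unfolding F_def by (metis mult.assoc)
  finally have "F * (K w * star (K w)) = F * (star (K w) * K w)" using 1 comm by simp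
  \<comment> \<open>Multiplying by \<open>e\<close> on the right keeps the first product and kills
    the second, because \<open>w = e w (1 - e)\<close>.\<close>
  then have "F * (K w * star (K w)) * K e = F * (star (K w) * K w) * K e" by simp
  then have F0: "F * (K w * star (K w)) = 0" by (simp add: mult.assoc KwKe KeKw)
  \<comment> \<open>A nonzero element of \<open>A\<close> that annihilates \<open>f\<close>, as
    input for \<open>simple_annihilator\<close>.\<close>
  define t where "t = w \<otimes>\<^bsub>A\<^esub> adj A w"
  have t: "t \<in> carrier A" by (simp add: t_def A.closed w)
  have "t \<noteq> \<zero>\<^bsub>A\<^esub>"
  proof
    assume "t = \<zero>\<^bsub>A\<^esub>"
    then have "A.\<alpha> w * star (A.\<alpha> w) = 0" using w(1) by (simp add: t_def A.closed A.emb_simps flip: A.emb_simps(2,3))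
    then have "star (A.\<alpha> w) = 0" using star_eq_zero[of "star (A.\<alpha> w)"] by simp
    then have "A.\<alpha> w = 0" by (metis star_star star_zero)
    then show False using w(2) z(2) by simp
  qed
  moreover have "seq_const A t \<otimes>\<^bsub>seq_algebra A\<^esub> f = \<zero>\<^bsub>seq_algebra A\<^esub>"
  proof (rule E.eqI)
    have "K t = K w * star (K w)" by (simp add: t_def Kh(1) Kh(2)[OF w(1) w(1)] w(1) A.closed)
    then have "K t * F = 0" using F0 FK[OF t] by simp
    then show "E.\<alpha> (seq_const A t \<otimes>\<^bsub>seq_algebra A\<^esub> f) = E.\<alpha> \<zero>\<^bsub>seq_algebra A\<^esub>"
      by (simp add: E.emb_simps k t Fp F_def K_def)
  qed (simp_all add: E.closed k t Fp)
  moreover have "f \<otimes>\<^bsub>seq_algebra A\<^esub> seq_const A x = seq_const A x \<otimes>\<^bsub>seq_algebra A\<^esub> f" if "x \<in> carrier A" for x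
    using f(2) that unfolding central_sequences_def by blast
  ultimately have "seq_const A \<one>\<^bsub>A\<^esub> \<otimes>\<^bsub>seq_algebra A\<^esub> f = \<zero>\<^bsub>seq_algebra A\<^esub>"
    by (intro simple_annihilator[OF A s ucstar_seq[OF A] kh Fp(1) _ t])
  then show ?thesis by (simp add: E.one Fp(1) flip: seq_one[OF A])
qed

text \<open>The second outcome provides a reserve element \<open>b\<close>: for any
  \<open>d\<close>, the defect \<open>1 - g\<close> and the square of \<open>b d\<close> fit
  together under \<open>a\<close>. The former comes from the split, while the latter is kept free
  for the defect that arises in \<open>B\<close>, whose \<open>d\<close> is known only later. The
  first outcome is the case of an invertible \<open>a\<close>.\<close>

lemma split_choice:
  assumes A: "A \<in> ucstar" and s: "simple A" and split: "tracially_sequentially_split A B \<phi>"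
    and a: "a \<in> positives A" "a \<noteq> \<zero>\<^bsub>A\<^esub>"
  obtains x where "x \<in> carrier A" "\<one>\<^bsub>A\<^esub> = a \<otimes>\<^bsub>A\<^esub> x \<otimes>\<^bsub>A\<^esub> a"
  | \<psi> g b where "cstar_hom B (seq_algebra A) \<psi>" "g \<in> projections (seq_algebra A)" "g \<in> central_sequences A"
      "g \<noteq> \<zero>\<^bsub>seq_algebra A\<^esub>" "\<And>x. x \<in> carrier A \<Longrightarrow> \<psi> (\<phi> x) = seq_const A x \<otimes>\<^bsub>seq_algebra A\<^esub> g"
      "b \<in> positives A" "b \<noteq> \<zero>\<^bsub>A\<^esub>"
      "\<And>\<delta> d. 0 < \<delta> \<Longrightarrow> d \<in> carrier (seq_algebra A) \<Longrightarrow> \<exists>c\<in>carrier (seq_algebra A).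
         norm (emb (seq_algebra A) \<one>\<^bsub>seq_algebra A\<^esub> - emb (seq_algebra A) g
           + star (emb (seq_algebra A) (seq_const A b) * emb (seq_algebra A) d) * (emb (seq_algebra A) (seq_const A b) * emb (seq_algebra A) d)
           - star (emb (seq_algebra A) (seq_const A a) * emb (seq_algebra A) c) * (emb (seq_algebra A) (seq_const A a) * emb (seq_algebra A) c)) < \<delta>"
proof -
  interpret A: ucalg A by unfold_locales (rule A)
  interpret E: ucalg "seq_algebra A" by unfold_locales (rule ucstar_seq[OF A])
  note kh = cstar_hom_seq_const[OF A]
  note k = cstar_homD[OF kh]
  define K where "K x = E.\<alpha> (seq_const A x)" for x
  have Kh: "K (x \<otimes>\<^bsub>A\<^esub> y) = K x * K y" "K (adj A x) = star (K x)" if "x \<in> carrier A" "y \<in> carrier A" for x y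
    using that by (simp_all add: K_def k E.emb_simps)
  note ap = A.positives_emb[OF a(1)]
  have evc: "A.\<alpha> (ev A X) = A.\<alpha> \<one>\<^bsub>A\<^esub> * X" "A.\<alpha> (ev A X) = X * A.\<alpha> \<one>\<^bsub>A\<^esub>" "ev A X \<in> carrier A" for X
    using emb_ev[OF A, of X] ev_closed[OF A] by auto
  have a1: "A.\<alpha> \<one>\<^bsub>A\<^esub> * A.\<alpha> a = A.\<alpha> a" "A.\<alpha> a * A.\<alpha> \<one>\<^bsub>A\<^esub> = A.\<alpha> a" by (simp_all add: A.unit_mult ap)
  have "A.\<alpha> a \<noteq> 0" using a(2) emb_eq_zero_iff[OF A ap(1)] by simp
  from orthogonal_or_minimal[OF ap(3) this] show ?thesis
  proof cases
    case (1 c d p q)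
    have pos: "a \<otimes>\<^bsub>A\<^esub> ev A x \<in> positives A" "A.\<alpha> (a \<otimes>\<^bsub>A\<^esub> ev A x) = y * y"
      if y: "star y = y" "A.\<alpha> a * x = y * y" for x y
    proof -
      show eq: "A.\<alpha> (a \<otimes>\<^bsub>A\<^esub> ev A x) = y * y" using y(2) a1(2) by (simp add: A.emb_simps ap evc(3)) (simp add: evc(1) flip: mult.assoc)
      have u: "A.\<alpha> \<one>\<^bsub>A\<^esub> * (y * y) = y * y" unfolding y(2)[symmetric] using a1(1) by (simp flip: mult.assoc)
      have "A.\<alpha> (adj A (ev A y) \<otimes>\<^bsub>A\<^esub> ev A y) = star (y * A.\<alpha> \<one>\<^bsub>A\<^esub>) * (y * A.\<alpha> \<one>\<^bsub>A\<^esub>)"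
        by (simp add: A.emb_simps A.closed evc(3)) (simp add: evc(2))
      also have "\<dots> = A.\<alpha> \<one>\<^bsub>A\<^esub> * (y * y) * A.\<alpha> \<one>\<^bsub>A\<^esub>" by (simp add: star_mult y emb_one[OF A] mult.assoc)
      also have "\<dots> = y * y" using u emb_ev[OF A, of "y * y"] by simp
      finally have "a \<otimes>\<^bsub>A\<^esub> ev A x = adj A (ev A y) \<otimes>\<^bsub>A\<^esub> ev A y"
        using eq by (intro A.eqI A.closed ap evc(3)) simp
      then show "a \<otimes>\<^bsub>A\<^esub> ev A x \<in> positives A" using evc(3) by (auto simp: positives_def)
    qed
    define a1 a2 where "a1 = a \<otimes>\<^bsub>A\<^esub> ev A c" and "a2 = a \<otimes>\<^bsub>A\<^esub> ev A d"
    have P: "a1 \<in> positives A" "A.\<alpha> a1 = p * p" "a2 \<in> positives A" "A.\<alpha> a2 = q * q"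
      unfolding a1_def a2_def by (rule pos; fact 1)+
    have pp: "p * p \<noteq> 0" "q * q \<noteq> 0" using sa_sq_eq_zero 1 by metis+
    have nz: "a1 \<noteq> \<zero>\<^bsub>A\<^esub>" "a2 \<noteq> \<zero>\<^bsub>A\<^esub>" using pp P A.emb_simps(5) by metis+
    note p1 = A.positives_emb[OF P(1)] and p2 = A.positives_emb[OF P(3)]
    have orth: "a1 \<otimes>\<^bsub>A\<^esub> a2 = \<zero>\<^bsub>A\<^esub>" "a2 \<otimes>\<^bsub>A\<^esub> a1 = \<zero>\<^bsub>A\<^esub>"
    proof -
      have "p * p * (q * q) = p * (p * q) * q" "q * q * (p * p) = q * (q * p) * p" by (simp_all only: mult.assoc)
      then show "a1 \<otimes>\<^bsub>A\<^esub> a2 = \<zero>\<^bsub>A\<^esub>" "a2 \<otimes>\<^bsub>A\<^esub> a1 = \<zero>\<^bsub>A\<^esub>"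
        by (intro A.eqI; simp add: A.closed p1 p2 A.emb_simps P 1)+
    qed
    have sa: "adj A a1 = a1" "adj A a2 = a2" by (rule A.eqI; simp add: A.closed p1 p2 A.emb_simps)+
    have Ksa: "star (K a1) = K a1" "star (K a2) = K a2" using Kh(2)[OF p1(1) p1(1)] Kh(2)[OF p2(1) p2(1)] sa by simp_all
    have K0: "K \<zero>\<^bsub>A\<^esub> = 0"
      using cstar_hom_zero[OF A.cstar_algebra_axioms E.cstar_algebra_axioms kh] by (simp add: K_def E.emb_simps)
    have Korth: "K a1 * K a2 = 0" "K a2 * K a1 = 0" using Kh(1)[OF p1(1) p2(1)] Kh(1)[OF p2(1) p1(1)] orth K0 by simp_all
    have z: "seq_const A a1 \<in> carrier (seq_algebra A)" "star (E.\<alpha> (seq_const A a1)) = E.\<alpha> (seq_const A a1)"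
      using k(1) p1(1) Ksa by (simp_all add: K_def)
    obtain \<psi> g r where sp: "cstar_hom B (seq_algebra A) \<psi>" "g \<in> projections (seq_algebra A)" "g \<in> central_sequences A"
      "g \<noteq> \<zero>\<^bsub>seq_algebra A\<^esub>" "\<And>x. x \<in> carrier A \<Longrightarrow> \<psi> (\<phi> x) = seq_const A x \<otimes>\<^bsub>seq_algebra A\<^esub> g"
      and r: "r \<in> projections (seq_algebra A)" "r \<in> hereditary_gen (seq_algebra A) (seq_const A a1)"
      "mvn_equiv (seq_algebra A) (\<one>\<^bsub>seq_algebra A\<^esub> \<ominus>\<^bsub>seq_algebra A\<^esub> g) r"
      using split seq_const_strictly_positive[OF A P(1) nz(1)] unfolding tracially_sequentially_split_def by metis
    show ?thesis
    proof (rule that(2)[OF sp P(3) nz(2)])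
      fix \<delta> :: real and y assume \<delta>: "0 < \<delta>" and y: "y \<in> carrier (seq_algebra A)"
      obtain x where x: "x \<in> carrier (seq_algebra A)"
        "norm (E.\<alpha> (\<one>\<^bsub>seq_algebra A\<^esub> \<ominus>\<^bsub>seq_algebra A\<^esub> g) - star (K a1 * E.\<alpha> x) * (K a1 * E.\<alpha> x)) < \<delta>"
        using E.hereditary_mvn[OF z r \<delta>] unfolding K_def by metis
      \<comment> \<open>Combining the two factorisations through \<open>a\<close> makes
        \<open>a c'\<close> equal to \<open>a1 x + a2 y\<close>; the cross terms of its square
        vanish by orthogonality.\<close>
      define c' where "c' = seq_const A (ev A c) \<otimes>\<^bsub>seq_algebra A\<^esub> x \<oplus>\<^bsub>seq_algebra A\<^esub> seq_const A (ev A d) \<otimes>\<^bsub>seq_algebra A\<^esub> y"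
      have c': "c' \<in> carrier (seq_algebra A)" by (simp add: c'_def E.closed k evc x y)
      have "K a * E.\<alpha> c' = K a1 * E.\<alpha> x + K a2 * E.\<alpha> y"
        by (simp add: c'_def E.closed k evc(3) x y E.emb_simps a1_def a2_def Kh ap distrib_left) (simp add: K_def mult.assoc)
      moreover have "star (K a1 * E.\<alpha> x + K a2 * E.\<alpha> y) * (K a1 * E.\<alpha> x + K a2 * E.\<alpha> y)
        = star (K a1 * E.\<alpha> x) * (K a1 * E.\<alpha> x) + star (K a2 * E.\<alpha> y) * (K a2 * E.\<alpha> y)"
      proof -
        have "star (K a1 * E.\<alpha> x) * (K a2 * E.\<alpha> y) = star (E.\<alpha> x) * (K a1 * K a2) * E.\<alpha> y"
          "star (K a2 * E.\<alpha> y) * (K a1 * E.\<alpha> x) = star (E.\<alpha> y) * (K a2 * K a1) * E.\<alpha> x"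
          by (simp_all only: star_mult Ksa mult.assoc)
        then show ?thesis by (simp only: star_add distrib_left distrib_right Korth mult_zero_left mult_zero_right add_0 add_0_right)
      qed
      moreover have "E.\<alpha> (\<one>\<^bsub>seq_algebra A\<^esub> \<ominus>\<^bsub>seq_algebra A\<^esub> g) = E.\<alpha> \<one>\<^bsub>seq_algebra A\<^esub> - E.\<alpha> g"
        using E.projectionD[OF sp(2)] by (simp add: E.emb_simps E.closed)
      ultimately have "norm (E.\<alpha> \<one>\<^bsub>seq_algebra A\<^esub> - E.\<alpha> g + star (K a2 * E.\<alpha> y) * (K a2 * E.\<alpha> y)
        - star (K a * E.\<alpha> c') * (K a * E.\<alpha> c')) < \<delta>"
        using x(2) by simp
      then show "\<exists>c\<in>carrier (seq_algebra A). norm (E.\<alpha> \<one>\<^bsub>seq_algebra A\<^esub> - E.\<alpha> g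
          + star (E.\<alpha> (seq_const A a2) * E.\<alpha> y) * (E.\<alpha> (seq_const A a2) * E.\<alpha> y)
          - star (E.\<alpha> (seq_const A a) * E.\<alpha> c) * (E.\<alpha> (seq_const A a) * E.\<alpha> c)) < \<delta>"
        using c' unfolding K_def by blast
    qed
  next
    case (2 e t)
    define e0 where "e0 = ev A e"
    have "A.\<alpha> \<one>\<^bsub>A\<^esub> * e = e" unfolding 2(1) using a1(1) by (simp flip: mult.assoc)
    then have e0: "e0 \<in> carrier A" "A.\<alpha> e0 = e" unfolding e0_def using evc(3) A.emb_ev_eq(1) by auto
    have pe: "e0 \<in> projections A" by (rule A.projectionI) (simp_all add: e0 2(2,3))
    have pose: "e0 \<in> positives A"
    proof -
      have "e0 = adj A e0 \<otimes>\<^bsub>A\<^esub> e0" using pe by (simp add: projections_def)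
      then show ?thesis using e0(1) by (auto simp: positives_def)
    qed
    have nz: "e0 \<noteq> \<zero>\<^bsub>A\<^esub>" using 2(4) e0 emb_eq_zero_iff[OF A e0(1)] by auto
    have e0a: "e0 = a \<otimes>\<^bsub>A\<^esub> (complex_of_real t \<odot>\<^bsub>A\<^esub> \<one>\<^bsub>A\<^esub>) \<otimes>\<^bsub>A\<^esub> a"
      by (rule A.eqI) (simp_all add: A.closed e0 ap A.emb_simps 2(1) cs_def a1)
    show ?thesis
    proof (cases "e0 = \<one>\<^bsub>A\<^esub>")
      case True
      then show ?thesis using that(1) e0a A.closed by metis
    next
      \<comment> \<open>Here \<open>1 - g\<close> is central and equivalent to a projection under
        the constant \<open>e0\<close>, hence zero by \<open>minimal_central_zero\<close>. With
        \<open>g = 1\<close> there is no first defect, and \<open>b\<close> may be \<open>e0\<close>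
        itself.\<close>
      case False
      obtain \<psi> g r where sp: "cstar_hom B (seq_algebra A) \<psi>" "g \<in> projections (seq_algebra A)" "g \<in> central_sequences A"
        "g \<noteq> \<zero>\<^bsub>seq_algebra A\<^esub>" "\<And>x. x \<in> carrier A \<Longrightarrow> \<psi> (\<phi> x) = seq_const A x \<otimes>\<^bsub>seq_algebra A\<^esub> g"
        and r: "r \<in> projections (seq_algebra A)" "r \<in> hereditary_gen (seq_algebra A) (seq_const A e0)"
        "mvn_equiv (seq_algebra A) (\<one>\<^bsub>seq_algebra A\<^esub> \<ominus>\<^bsub>seq_algebra A\<^esub> g) r"
        using split seq_const_strictly_positive[OF A pose nz] unfolding tracially_sequentially_split_def by metis
      note G = E.projectionD[OF sp(2)]
      have "\<one>\<^bsub>seq_algebra A\<^esub> \<ominus>\<^bsub>seq_algebra A\<^esub> g = \<zero>\<^bsub>seq_algebra A\<^esub>"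
      proof (rule minimal_central_zero[OF A s pe nz False _ _ _ r])
        show "A.\<alpha> e0 * y * A.\<alpha> e0 * star (A.\<alpha> e0 * y * A.\<alpha> e0) = star (A.\<alpha> e0 * y * A.\<alpha> e0) * (A.\<alpha> e0 * y * A.\<alpha> e0)" for y
        proof -
          obtain l m where "e * y * e = l *\<^sub>R e + m *\<^sub>R (iu * e)" using 2(5) by blast
          then have eq: "A.\<alpha> e0 * y * A.\<alpha> e0 = l *\<^sub>R e + m *\<^sub>R (iu * e)" by (simp add: e0)
          have c: "iu * e = e * iu" "iu * (e * x) = e * (iu * x)" "e * (e * x) = e * x" for x
            using 2(3) by (simp_all add: iu_commute[of e] flip: mult.assoc)
          show ?thesis
            unfolding eq by (simp add: star_simps 2(2,3) algebra_simps c)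
        qed
        show "\<one>\<^bsub>seq_algebra A\<^esub> \<ominus>\<^bsub>seq_algebra A\<^esub> g \<in> projections (seq_algebra A)"
          by (rule E.projectionI) (simp_all add: E.closed G E.emb_simps star_simps emb_one[OF E.A] algebra_simps E.unit_mult)
        have "g \<otimes>\<^bsub>seq_algebra A\<^esub> seq_const A x = seq_const A x \<otimes>\<^bsub>seq_algebra A\<^esub> g" if "x \<in> carrier A" for x
          using sp(3) that by (auto simp: central_sequences_def)
        then have gc: "E.\<alpha> g * E.\<alpha> (seq_const A x) = E.\<alpha> (seq_const A x) * E.\<alpha> g" if "x \<in> carrier A" for x
          using that k(1) G(1) E.emb_simps(2) by metis
        show "\<one>\<^bsub>seq_algebra A\<^esub> \<ominus>\<^bsub>seq_algebra A\<^esub> g \<in> central_sequences A"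
          unfolding central_sequences_def
        proof (intro CollectI conjI ballI)
          show "(\<one>\<^bsub>seq_algebra A\<^esub> \<ominus>\<^bsub>seq_algebra A\<^esub> g) \<otimes>\<^bsub>seq_algebra A\<^esub> seq_const A x
            = seq_const A x \<otimes>\<^bsub>seq_algebra A\<^esub> (\<one>\<^bsub>seq_algebra A\<^esub> \<ominus>\<^bsub>seq_algebra A\<^esub> g)" if x: "x \<in> carrier A" for x
            by (rule E.eqI) (simp_all add: E.closed G k x E.emb_simps algebra_simps E.unit_mult gc)
        qed (simp add: E.closed G)
      qed
      then have "E.\<alpha> (\<one>\<^bsub>seq_algebra A\<^esub> \<ominus>\<^bsub>seq_algebra A\<^esub> g) = 0" by (simp add: E.emb_simps)
      then have g1: "E.\<alpha> \<one>\<^bsub>seq_algebra A\<^esub> - E.\<alpha> g = 0" by (simp add: E.emb_simps E.closed G)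
      show ?thesis
      proof (rule that(2)[OF sp pose nz])
        fix \<delta> :: real and y assume \<delta>: "0 < \<delta>" and y: "y \<in> carrier (seq_algebra A)"
        define x where "x = (complex_of_real t \<odot>\<^bsub>A\<^esub> \<one>\<^bsub>A\<^esub>) \<otimes>\<^bsub>A\<^esub> a"
        have x: "x \<in> carrier A" "e0 = a \<otimes>\<^bsub>A\<^esub> x" using e0a by (simp_all add: x_def A.closed ap A.mult_assoc)
        have eq: "E.\<alpha> (seq_const A a) * E.\<alpha> (seq_const A x \<otimes>\<^bsub>seq_algebra A\<^esub> y) = E.\<alpha> (seq_const A e0) * E.\<alpha> y"
          by (simp add: E.emb_simps k x ap y mult.assoc)
        show "\<exists>c\<in>carrier (seq_algebra A). norm (E.\<alpha> \<one>\<^bsub>seq_algebra A\<^esub> - E.\<alpha> g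
            + star (E.\<alpha> (seq_const A e0) * E.\<alpha> y) * (E.\<alpha> (seq_const A e0) * E.\<alpha> y)
            - star (E.\<alpha> (seq_const A a) * E.\<alpha> c) * (E.\<alpha> (seq_const A a) * E.\<alpha> c)) < \<delta>"
          by (intro bexI[of _ "seq_const A x \<otimes>\<^bsub>seq_algebra A\<^esub> y"]) (simp_all add: eq g1 \<delta> E.closed k x y)
      qed
    qed
  qed
qed

section \<open>Tracial approximation\<close>

lemma (in cstar_algebra) dist_to_near:
  assumes "x \<in> carrier A" "S \<subseteq> carrier A" "S \<noteq> {}" "dist_to A x S < e"
  shows "\<exists>s\<in>S. nrm A (x \<ominus> s) < e"
proof -
  have "bdd_below ((\<lambda>s. nrm A (x \<ominus> s)) ` S)"
    by (rule bdd_belowI[of _ 0]) (use assms in \<open>auto simp: diff_closed nrm_nonneg\<close>)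
  then show ?thesis using assms by (simp add: dist_to_def cINF_less_iff)
qed

lemma (in cstar_algebra) dist_to_le:
  assumes "x \<in> carrier A" "S \<subseteq> carrier A" "s \<in> S" "nrm A (x \<ominus> s) \<le> e"
  shows "dist_to A x S \<le> e"
proof -
  have "bdd_below ((\<lambda>s. nrm A (x \<ominus> s)) ` S)"
    by (rule bdd_belowI[of _ 0]) (use assms in \<open>auto simp: diff_closed nrm_nonneg\<close>)
  then show ?thesis using cINF_lower2[OF _ assms(3), of "\<lambda>s. nrm A (x \<ominus> s)" e] assms(4) by (simp add: dist_to_def)
qed

lemma finite_norm_bound:
  assumes "finite F"
  obtains M :: real where "1 \<le> M" "\<And>x. x \<in> F \<Longrightarrow> n x \<le> M"
proof -
  obtain M where "\<forall>x\<in>F. n x \<le> M" using bdd_above_finite[OF finite_imageI[OF assms, of n]] by (auto simp: bdd_above_def)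
  then show ?thesis using that[of "max 1 M"] by fastforce
qed

text \<open>The projection \<open>p\<close> from the tracial approximation almost commutes with
  \<open>q\<close> but need not lie below it. The compression \<open>p q p\<close> is almost
  idempotent and almost in the approximating algebra, so a projection there lies close to it; the
  corner it cuts out is hereditary, hence again in the class, and its unit is almost below
  \<open>q\<close>. For elements with \<open>q x = x = x q\<close> the smaller projection still
  almost commutes.\<close>

lemma TA_corner:
  fixes \<C> :: "'u calg set" and B :: "'b calg"
  assumes \<C>: "\<C> \<subseteq> ucstar" and hered: "\<And>D H. D \<in> \<C> \<Longrightarrow> hereditary H D \<Longrightarrow> in_class \<C> (restrict_to D H)"
    and TA: "TA \<C> B" and B: "B \<in> ucstar" and q: "q \<in> projections B"
    and F: "finite F" "F \<subseteq> carrier B" "\<And>x. x \<in> F \<Longrightarrow> q \<otimes>\<^bsub>B\<^esub> x = x \<and> x \<otimes>\<^bsub>B\<^esub> q = x"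
    and b: "b \<in> positives B" "b \<noteq> \<zero>\<^bsub>B\<^esub>" and \<eta>: "0 < \<eta>"
  obtains D \<theta> where "D \<in> \<C>" "cstar_hom D B \<theta>"
    "norm (emb B (\<theta> \<one>\<^bsub>D\<^esub>) * emb B q - emb B (\<theta> \<one>\<^bsub>D\<^esub>)) \<le> \<eta>"
    "norm (emb B q * emb B (\<theta> \<one>\<^bsub>D\<^esub>) - emb B (\<theta> \<one>\<^bsub>D\<^esub>)) \<le> \<eta>"
    "\<And>x. x \<in> F \<Longrightarrow> norm (emb B (\<theta> \<one>\<^bsub>D\<^esub>) * emb B x - emb B x * emb B (\<theta> \<one>\<^bsub>D\<^esub>)) \<le> \<eta>"
    "\<And>x. x \<in> F \<Longrightarrow> \<exists>d\<in>carrier D. norm (emb B (\<theta> \<one>\<^bsub>D\<^esub>) * emb B x * emb B (\<theta> \<one>\<^bsub>D\<^esub>) - emb B (\<theta> d)) \<le> \<eta>"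
    "\<exists>c\<in>carrier B. norm (emb B q - emb B (\<theta> \<one>\<^bsub>D\<^esub>) - star (emb B b * emb B c) * (emb B b * emb B c)) \<le> \<eta>"
proof -
  interpret B: ucalg B by unfold_locales (rule B)
  note Qp = B.projectionD[OF q] and bp = B.positives_emb[OF b(1)]
  obtain M where M: "1 \<le> M" "\<And>x. x \<in> F \<Longrightarrow> nrm B x \<le> M" using finite_norm_bound[OF F(1)] by metis
  \<comment> \<open>The largest errors below are \<open>64 \<epsilon>\<close> and
    \<open>42 \<epsilon> M + \<epsilon>\<close>; the bound \<open>1 / 100\<close> ensures
    \<open>9 \<epsilon> < 1/4\<close>, as required for \<open>projection_near\<close>.\<close>
  define \<epsilon> where "\<epsilon> = min (1 / 100) (\<eta> / (100 * M))"
  have \<epsilon>: "0 < \<epsilon>" "100 * \<epsilon> \<le> 1" "100 * (\<epsilon> * M) \<le> \<eta>"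
  proof -
    show "0 < \<epsilon>" "100 * \<epsilon> \<le> 1" using \<eta> M by (auto simp: \<epsilon>_def)
    have "\<epsilon> \<le> \<eta> / (100 * M)" by (simp add: \<epsilon>_def)
    then show "100 * (\<epsilon> * M) \<le> \<eta>" using M by (simp add: field_simps)
  qed
  have \<epsilon>M: "\<epsilon> \<le> \<epsilon> * M" using \<epsilon>(1) M(1) by simp
  \<comment> \<open>Adding \<open>q\<close> to the finite set is what makes \<open>p\<close> almost
    commute with it and puts \<open>p q p\<close> close to \<open>S\<close>.\<close>
  have "finite (insert q F) \<and> insert q F \<subseteq> carrier B \<and> 0 < \<epsilon> \<and> b \<in> positives B \<and> b \<noteq> \<zero>\<^bsub>B\<^esub>"
    using F Qp b \<epsilon> by simp
  then obtain p S r where p: "p \<in> projections B" and S: "cstar_subalgebra S B" "in_class \<C> (restrict_to B S)" "is_unit (restrict_to B S) p"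
    and ap: "\<And>x. x \<in> insert q F \<Longrightarrow> nrm B (p \<otimes>\<^bsub>B\<^esub> x \<ominus>\<^bsub>B\<^esub> x \<otimes>\<^bsub>B\<^esub> p) \<le> \<epsilon> \<and> dist_to B (p \<otimes>\<^bsub>B\<^esub> x \<otimes>\<^bsub>B\<^esub> p) S \<le> \<epsilon>"
    and r: "r \<in> projections B" "r \<in> hereditary_gen B b" "mvn_equiv B (\<one>\<^bsub>B\<^esub> \<ominus>\<^bsub>B\<^esub> p) r"
    using TA unfolding TA_def by metis
  note Pp = B.projectionD[OF p]
  have Sc: "S \<subseteq> carrier B" by (rule B.subalgebra_carrier[OF S(1)])
  have pS: "p \<in> S" using S(3) by (simp add: is_unit_def)
  have near: "\<exists>y\<in>S. norm (B.\<alpha> p * B.\<alpha> x * B.\<alpha> p - B.\<alpha> y) < 2 * \<epsilon>" if "x \<in> insert q F" for x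
  proof -
    have x: "x \<in> carrier B" using that Qp F by auto
    have "dist_to B (p \<otimes>\<^bsub>B\<^esub> x \<otimes>\<^bsub>B\<^esub> p) S < 2 * \<epsilon>" using ap[OF that] \<epsilon> by linarith
    then obtain y where y: "y \<in> S" "nrm B (p \<otimes>\<^bsub>B\<^esub> x \<otimes>\<^bsub>B\<^esub> p \<ominus>\<^bsub>B\<^esub> y) < 2 * \<epsilon>"
      using B.dist_to_near[OF _ Sc] pS x Pp(1) B.mult_closed by (metis empty_iff)
    have yc: "y \<in> carrier B" using y Sc by auto
    show ?thesis by (rule bexI[OF _ y(1)]) (use y(2) yc x Pp(1) in \<open>simp add: B.nrm_eq B.closed B.emb_simps\<close>)
  qed
  obtain D0 f where D0: "D0 \<in> \<C>" and f: "cstar_hom D0 (restrict_to B S) f" "bij_betw f (carrier D0) S"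
    using S(2) by (auto simp: in_class_def cstar_iso_def)
  have D0U: "D0 \<in> ucstar" using \<C> D0 by blast
  interpret D0: ucalg D0 by unfold_locales (rule D0U)
  have fB: "cstar_hom D0 B f" by (rule cstar_hom_restrict[OF Sc f(1)])
  note fD = cstar_homD[OF fB]
  have fiso: "nrm B (f d) = nrm D0 d" if "d \<in> carrier D0" for d
  proof (rule cstar_hom_isometric[OF D0U B fB that])
    show "y = \<zero>\<^bsub>D0\<^esub>" if "y \<in> carrier D0" "f y = \<zero>\<^bsub>B\<^esub>" for y
      using that f(2) cstar_hom_zero[OF D0.cstar_algebra_axioms B.cstar_algebra_axioms fB] D0.zero_closed
      by (metis bij_betw_def inj_onD)
  qed
  have fsurj: "\<exists>d\<in>carrier D0. y = f d" if "y \<in> S" for y using f(2) that by (auto simp: bij_betw_def)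
  define P Q where "P = B.\<alpha> p" and "Q = B.\<alpha> q"
  have P: "star P = P" "P * P = P" "norm P \<le> 1" and Q: "star Q = Q" "Q * Q = Q" "norm Q \<le> 1"
    using Pp Qp by (simp_all add: P_def Q_def)
  have PQ: "norm (P * Q - Q * P) \<le> \<epsilon>"
    using ap[of q] Pp Qp by (simp add: B.nrm_eq B.closed B.emb_simps P_def Q_def)
  obtain d where d: "d \<in> carrier D0" "norm (P * Q * P - B.\<alpha> (f d)) < 2 * \<epsilon>"
    using near[of q] fsurj unfolding P_def Q_def by blast
  \<comment> \<open>The approximant is replaced by its real part, since
    \<open>projection_near\<close> wants a selfadjoint element; as \<open>p q p\<close> is
    selfadjoint, the error does not grow.\<close>
  define d1 where "d1 = complex_of_real (1/2) \<odot>\<^bsub>D0\<^esub> (d \<oplus>\<^bsub>D0\<^esub> adj D0 d)"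
  have d1: "d1 \<in> carrier D0" "D0.\<alpha> d1 = (1/2) *\<^sub>R (D0.\<alpha> d + star (D0.\<alpha> d))"
    by (simp_all add: d1_def D0.closed d emb_scaleR[OF D0U] D0.emb_simps(1,3) del: of_real_divide)
  define T where "T = B.\<alpha> (f d1)"
  have T: "T = (1/2) *\<^sub>R (B.\<alpha> (f d) + star (B.\<alpha> (f d)))"
    by (simp add: T_def d1_def D0.closed d fD emb_scaleR[OF B] B.closed B.emb_simps(1,3) del: of_real_divide)
  define G where "G = P * Q * P"
  have G: "star G = G" by (simp add: G_def star_mult P Q mult.assoc)
  have nG: "norm G \<le> 1" unfolding G_def by (rule norm_compress[OF P(3) P(3) Q(3)])
  have GT: "norm (T - G) \<le> 2 * \<epsilon>"
  proof -
    have "T - G = (1/2) *\<^sub>R ((B.\<alpha> (f d) - G) + star (B.\<alpha> (f d) - G))"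
      unfolding T star_diff G by (simp add: algebra_simps flip: scaleR_add_left)
    moreover have "norm ((B.\<alpha> (f d) - G) + star (B.\<alpha> (f d) - G)) \<le> 2 * \<epsilon> + 2 * \<epsilon>"
      by (rule norm_triangle_mono) (use d(2) in \<open>simp_all add: G_def norm_minus_commute\<close>)
    ultimately show ?thesis by simp
  qed
  have GG: "norm (G * G - G) \<le> \<epsilon>"
  proof -
    have nPQ: "norm (P * Q) \<le> 1" using norm_mult_le[OF P(3) Q(3)] by simp
    \<comment> \<open>The difference \<open>G * G - G\<close> is a compressed commutator of
      \<open>P\<close> and \<open>Q\<close>, which explains the bound by a single
      \<open>\<epsilon>\<close>.\<close>
    have "P * Q * (P * Q - Q * P) * P = P * Q * P * Q * P - P * (Q * Q) * (P * P)" by (simp add: algebra_simps)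
    also have "\<dots> = P * Q * (P * P) * Q * P - P * Q * P" by (simp add: P Q)
    also have "\<dots> = G * G - G" by (simp add: G_def mult.assoc)
    finally show ?thesis using norm_compress[OF nPQ P(3) PQ] by simp
  qed
  \<comment> \<open>With \<open>norm T \<le> 2\<close> the four differences contribute
    \<open>4\<close>, \<open>2\<close>, \<open>1\<close> and \<open>2\<close> times
    \<open>\<epsilon>\<close>.\<close>
  have TT: "norm (T * T - T) \<le> 9 * \<epsilon>"
  proof -
    have nT: "norm T \<le> 2" using norm_triangle_ineq2[of T G] GT nG \<epsilon> by linarith
    have "norm (T * T - T) = norm (((T - G) * T + G * (T - G)) + ((G * G - G) - (T - G)))"
      by (rule arg_cong[of _ _ norm]) (simp add: algebra_simps)
    moreover have "norm ((T - G) * T) \<le> 2 * \<epsilon> * 2" "norm (G * (T - G)) \<le> 1 * (2 * \<epsilon>)"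
      by (rule norm_mult_le; use GT nT nG in simp)+
    ultimately show ?thesis
      using norm_triangle_ineq[of "(T - G) * T + G * (T - G)" "(G * G - G) - (T - G)"]
        norm_triangle_ineq[of "(T - G) * T" "G * (T - G)"] norm_triangle_ineq4[of "G * G - G" "T - G"] GT GG by linarith
  qed
  have fnorm: "norm (D0.\<alpha> x) = norm (B.\<alpha> (f x))" if "x \<in> carrier D0" for x
    using fiso[OF that] by (simp add: D0.nrm_eq B.nrm_eq that fD)
  have "norm (D0.\<alpha> d1 * D0.\<alpha> d1 - D0.\<alpha> d1) = norm (D0.\<alpha> (d1 \<otimes>\<^bsub>D0\<^esub> d1 \<ominus>\<^bsub>D0\<^esub> d1))"
    by (simp add: D0.emb_simps D0.closed d1(1))
  also have "\<dots> = norm (B.\<alpha> (f (d1 \<otimes>\<^bsub>D0\<^esub> d1 \<ominus>\<^bsub>D0\<^esub> d1)))" by (rule fnorm) (simp add: D0.closed d1(1))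
  also have "\<dots> = norm (T * T - T)"
    using d1(1) cstar_hom_diff[OF D0.cstar_algebra_axioms fB] by (simp add: D0.closed B.emb_simps B.closed fD T_def)
  finally have dd: "norm (D0.\<alpha> d1 * D0.\<alpha> d1 - D0.\<alpha> d1) \<le> 9 * \<epsilon>" using TT by simp
  moreover have "star (D0.\<alpha> d1) = D0.\<alpha> d1" by (simp add: d1 star_simps add.commute)
  moreover have "9 * \<epsilon> < 1/4" using \<epsilon> by simp
  ultimately obtain s where s: "star s = s" "s * s = s" "norm (s - D0.\<alpha> d1) \<le> 2 * norm (D0.\<alpha> d1 * D0.\<alpha> d1 - D0.\<alpha> d1)"
    using projection_near[of "D0.\<alpha> d1"] by (metis order_le_less_trans)
  define s0 where "s0 = ev D0 s"
  have s0: "s0 \<in> carrier D0" by (simp add: s0_def ev_closed D0U)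
  have s0p: "s0 \<in> projections D0"
    using arg_cong[OF s(1), of "ev D0"] arg_cong[OF s(2), of "ev D0"] s0 by (simp add: projections_def s0_def D0U)
  define \<sigma> where "\<sigma> = f s0"
  have \<sigma>: "\<sigma> \<in> carrier B" "\<sigma> \<in> S" using fD(1)[OF s0] f(2) s0 by (auto simp: \<sigma>_def bij_betw_def)
  define R where "R = B.\<alpha> \<sigma>"
  have s0s: "adj D0 s0 = s0" "s0 \<otimes>\<^bsub>D0\<^esub> s0 = s0" using s0p by (simp_all add: projections_def)
  have "\<sigma> \<in> projections B"
    using fD(4)[OF s0 s0] fD(5)[OF s0] \<sigma>(1) by (simp add: projections_def s0s flip: \<sigma>_def)
  note R = B.projectionD(2-4)[OF this, folded R_def]
  have "norm (R - T) \<le> 18 * \<epsilon>"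
  proof -
    have "R - T = B.\<alpha> (f (s0 \<ominus>\<^bsub>D0\<^esub> d1))"
      using cstar_hom_diff[OF D0.cstar_algebra_axioms fB s0 d1(1)] by (simp add: R_def T_def \<sigma>_def B.emb_simps fD s0 d1)
    then have "norm (R - T) = nrm D0 (s0 \<ominus>\<^bsub>D0\<^esub> d1)"
      using fiso[OF D0.diff_closed[OF s0 d1(1)]] by (simp add: B.nrm_eq fD D0.closed s0 d1(1))
    also have "s0 \<ominus>\<^bsub>D0\<^esub> d1 = ev D0 (s - D0.\<alpha> d1)" by (simp add: D0U s0_def ev_emb[OF D0U d1(1)])
    also have "nrm D0 \<dots> \<le> norm (s - D0.\<alpha> d1)" by (rule nrm_ev_le_norm[OF D0U])
    finally show ?thesis using s(3) dd by linarith
  qed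
  then have RG: "norm (R - G) \<le> 20 * \<epsilon>"
    using norm_triangle_ineq[of "R - T" "T - G"] GT by simp
  have RP: "P * R = R" "R * P = R"
    using S(3) \<sigma> Pp(1) by (simp_all add: is_unit_def R_def P_def flip: B.emb_simps)
  \<comment> \<open>Since \<open>p q p\<close> and \<open>p q\<close> differ by one commutator, the
    new projection is close to both \<open>p q\<close> and \<open>q p\<close>; these one-sided forms
    are what the remaining estimates use.\<close>
  have RPQ: "norm (R - P * Q) \<le> 21 * \<epsilon>"
  proof -
    have "P * (Q * P - P * Q) = P * Q * P - (P * P) * Q" by (simp add: algebra_simps)
    then have "norm (R - P * Q) = norm ((R - G) + P * (Q * P - P * Q))" by (simp add: G_def P)
    moreover have "norm (P * (Q * P - P * Q)) \<le> 1 * \<epsilon>"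
      by (rule norm_mult_le[OF P(3)]) (use PQ in \<open>simp add: norm_minus_commute\<close>)
    ultimately show ?thesis using RG norm_triangle_ineq[of "R - G" "P * (Q * P - P * Q)"] by linarith
  qed
  have RQP: "norm (R - Q * P) \<le> 21 * \<epsilon>"
  proof -
    have "star (R - P * Q) = R - Q * P" by (simp add: star_simps P Q R)
    then show ?thesis using RPQ norm_star[of "R - P * Q"] by simp
  qed
  have RQ: "norm (R * Q - R) \<le> 42 * \<epsilon>"
  proof -
    have "norm (R * Q - R) = norm ((R - P * Q) * Q - (R - P * Q))"
      by (rule arg_cong[of _ _ norm]) (simp add: algebra_simps Q)
    moreover have "norm ((R - P * Q) * Q) \<le> 21 * \<epsilon> * 1" by (rule norm_mult_le[OF RPQ Q(3)])
    ultimately show ?thesis using RPQ norm_triangle_ineq4[of "(R - P * Q) * Q" "R - P * Q"] by linarith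
  qed
  have QR: "norm (Q * R - R) \<le> 42 * \<epsilon>"
  proof -
    have "star (R * Q - R) = Q * R - R" by (simp add: star_simps Q R)
    then show ?thesis using RQ norm_star[of "R * Q - R"] by simp
  qed
  have \<epsilon>\<eta>: "64 * \<epsilon> \<le> \<eta>" "42 * \<epsilon> \<le> \<eta>" "2 * \<epsilon> \<le> \<eta>" "42 * (\<epsilon> * M) + \<epsilon> \<le> \<eta>" using \<epsilon> \<epsilon>M by linarith+
  have comm: "norm (R * B.\<alpha> x - B.\<alpha> x * R) \<le> \<eta>" if x: "x \<in> F" for x
  proof -
    define X where "X = B.\<alpha> x"
    have xc: "x \<in> carrier B" using x F by auto
    have QX: "Q * X = X" "X * Q = X" using F(3)[OF x] xc Qp(1) by (simp_all add: Q_def X_def flip: B.emb_simps)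
    have nX: "norm X \<le> M" using M(2)[OF x] xc by (simp add: X_def B.nrm_eq)
    have PX: "norm (P * X - X * P) \<le> \<epsilon>" using ap[of x] x xc Pp by (simp add: B.nrm_eq B.closed B.emb_simps P_def X_def)
    have "P * Q * X = P * X" "X * (Q * P) = X * P" using QX by (metis mult.assoc)+
    then have "norm (R * X - X * R) = norm (((R - P * Q) * X - X * (R - Q * P)) + (P * X - X * P))"
      by (intro arg_cong[of _ _ norm]) (simp add: algebra_simps)
    moreover have "norm ((R - P * Q) * X) \<le> 21 * \<epsilon> * M" "norm (X * (R - Q * P)) \<le> M * (21 * \<epsilon>)"
      by (rule norm_mult_le; use RPQ RQP nX in simp)+
    ultimately have "norm (R * X - X * R) \<le> 21 * \<epsilon> * M + M * (21 * \<epsilon>) + \<epsilon>"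
      using PX norm_triangle_ineq[of "(R - P * Q) * X - X * (R - Q * P)" "P * X - X * P"]
        norm_triangle_ineq4[of "(R - P * Q) * X" "X * (R - Q * P)"] by linarith
    then show ?thesis using \<epsilon>\<eta>(4) by (simp add: X_def algebra_simps)
  qed
  have "in_class \<C> (restrict_to D0 (D0.corner s0))" by (rule hered[OF D0 D0.hereditary_corner[OF s0p]])
  then obtain D h where D: "D \<in> \<C>" and h: "cstar_hom D (restrict_to D0 (D0.corner s0)) h" "bij_betw h (carrier D) (D0.corner s0)"
    by (auto simp: in_class_def cstar_iso_def)
  have DU: "D \<in> ucstar" using \<C> D by blast
  interpret D: ucalg D by unfold_locales (rule DU)
  have cc: "D0.corner s0 \<subseteq> carrier D0" by (auto simp: D0.corner_def)
  have hD0: "cstar_hom D D0 h" by (rule cstar_hom_restrict[OF cc h(1)])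
  have hsurj: "\<exists>d\<in>carrier D. y = h d" if "y \<in> D0.corner s0" for y using h(2) that by (auto simp: bij_betw_def)
  have h1: "h \<one>\<^bsub>D\<^esub> = s0"
  proof -
    have "s0 \<in> D0.corner s0" using s0p by (simp add: D0.corner_def projections_def)
    then obtain u where u: "u \<in> carrier D" "s0 = h u" using hsurj by blast
    have "h \<one>\<^bsub>D\<^esub> \<in> D0.corner s0" using h(2) D.one(1) by (auto simp: bij_betw_def)
    then have "h \<one>\<^bsub>D\<^esub> = h \<one>\<^bsub>D\<^esub> \<otimes>\<^bsub>D0\<^esub> s0" by (simp add: D0.corner_def)
    also have "\<dots> = h (\<one>\<^bsub>D\<^esub> \<otimes>\<^bsub>D\<^esub> u)" using u D.one(1) by (simp add: cstar_homD(4)[OF hD0])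
    also have "\<dots> = s0" using u D.one(2) by simp
    finally show ?thesis .
  qed
  show ?thesis
  proof (rule that[of D "\<lambda>x. f (h x)"])
    show "cstar_hom D B (\<lambda>x. f (h x))" by (rule cstar_hom_comp[OF hD0 fB])
    have fh1: "emb B (f (h \<one>\<^bsub>D\<^esub>)) = R" by (simp add: h1 R_def \<sigma>_def)
    show "norm (emb B (f (h \<one>\<^bsub>D\<^esub>)) * emb B q - emb B (f (h \<one>\<^bsub>D\<^esub>))) \<le> \<eta>"
      "norm (emb B q * emb B (f (h \<one>\<^bsub>D\<^esub>)) - emb B (f (h \<one>\<^bsub>D\<^esub>))) \<le> \<eta>"
      unfolding fh1 using RQ QR \<epsilon>\<eta> by (simp_all add: Q_def)
    show "norm (emb B (f (h \<one>\<^bsub>D\<^esub>)) * emb B x - emb B x * emb B (f (h \<one>\<^bsub>D\<^esub>))) \<le> \<eta>" if "x \<in> F" for x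
      unfolding fh1 by (rule comm[OF that])
    show "\<exists>d\<in>carrier D. norm (emb B (f (h \<one>\<^bsub>D\<^esub>)) * emb B x * emb B (f (h \<one>\<^bsub>D\<^esub>)) - emb B (f (h d))) \<le> \<eta>"
      if x: "x \<in> F" for x
    proof -
      have xc: "x \<in> carrier B" using x F by auto
      obtain e where e: "e \<in> carrier D0" "norm (P * B.\<alpha> x * P - B.\<alpha> (f e)) < 2 * \<epsilon>"
        using near[of x] x fsurj unfolding P_def by blast
      have "s0 \<otimes>\<^bsub>D0\<^esub> e \<otimes>\<^bsub>D0\<^esub> s0 \<in> D0.corner s0"
      proof -
        have "s0 \<otimes>\<^bsub>D0\<^esub> s0 = s0" using s0p by (simp add: projections_def)
        then have "s0 \<otimes>\<^bsub>D0\<^esub> (s0 \<otimes>\<^bsub>D0\<^esub> y) = s0 \<otimes>\<^bsub>D0\<^esub> y" if "y \<in> carrier D0" for y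
          using D0.mult_assoc[OF s0 s0 that] by simp
        then show ?thesis using \<open>s0 \<otimes>\<^bsub>D0\<^esub> s0 = s0\<close> by (simp add: D0.corner_def D0.closed s0 e D0.mult_assoc)
      qed
      then obtain d where d: "d \<in> carrier D" "h d = s0 \<otimes>\<^bsub>D0\<^esub> e \<otimes>\<^bsub>D0\<^esub> s0" using hsurj by metis
      have "B.\<alpha> (f (h d)) = R * B.\<alpha> (f e) * R"
        by (simp add: d(2) fD D0.closed s0 e B.emb_simps B.closed R_def \<sigma>_def)
      moreover have "R * (P * B.\<alpha> x * P - B.\<alpha> (f e)) * R = R * B.\<alpha> x * R - R * B.\<alpha> (f e) * R"
      proof -
        have "R * (P * B.\<alpha> x * P) * R = (R * P) * B.\<alpha> x * (P * R)" by (simp only: mult.assoc)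
        then show ?thesis by (simp only: right_diff_distrib left_diff_distrib RP)
      qed
      ultimately have "norm (R * B.\<alpha> x * R - B.\<alpha> (f (h d))) \<le> 2 * \<epsilon>"
        using norm_compress[OF R(3) R(3), of "P * B.\<alpha> x * P - B.\<alpha> (f e)" "2 * \<epsilon>"] e(2) by simp
      then show ?thesis unfolding fh1 using d(1) \<epsilon>\<eta>(3) by (intro bexI[of _ d]) linarith+
    qed
    \<comment> \<open>Compressing \<open>1 - p\<close> by \<open>q\<close> gives
      \<open>q - q p q\<close>, and \<open>q p q\<close> is close to \<open>\<sigma>\<close>; the
      factor \<open>c\<close> is accordingly replaced by \<open>c q\<close>.\<close>
    obtain c where c: "c \<in> carrier B" "norm (B.\<alpha> (\<one>\<^bsub>B\<^esub> \<ominus>\<^bsub>B\<^esub> p) - star (B.\<alpha> b * B.\<alpha> c) * (B.\<alpha> b * B.\<alpha> c)) < \<epsilon>"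
      using B.hereditary_mvn[OF bp(1,3) r \<epsilon>(1)] by metis
    define W where "W = star (B.\<alpha> b * B.\<alpha> c) * (B.\<alpha> b * B.\<alpha> c)"
    have c': "norm (B.\<alpha> \<one>\<^bsub>B\<^esub> - P - W) \<le> \<epsilon>" using c Pp by (simp add: B.emb_simps B.closed P_def W_def)
    have "star (B.\<alpha> b * B.\<alpha> (c \<otimes>\<^bsub>B\<^esub> q)) * (B.\<alpha> b * B.\<alpha> (c \<otimes>\<^bsub>B\<^esub> q)) = Q * W * Q"
      by (simp add: B.emb_simps c Qp star_mult mult.assoc W_def Q_def)
    moreover have "norm (Q - R - Q * W * Q) \<le> \<eta>"
    proof -
      have EQ: "Q * B.\<alpha> \<one>\<^bsub>B\<^esub> * Q = Q" using B.unit_mult[OF Qp(1)] Q by (simp add: Q_def)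
      have "norm (Q - R - Q * W * Q) = norm (((Q * P - R) * Q + (R * Q - R)) + Q * (B.\<alpha> \<one>\<^bsub>B\<^esub> - P - W) * Q)"
        by (rule arg_cong[of _ _ norm]) (simp add: left_diff_distrib right_diff_distrib EQ)
      moreover have "norm (Q * (B.\<alpha> \<one>\<^bsub>B\<^esub> - P - W) * Q) \<le> \<epsilon>" by (rule norm_compress[OF Q(3) Q(3) c'])
      moreover have "norm ((Q * P - R) * Q) \<le> 21 * \<epsilon> * 1"
        by (rule norm_mult_le[OF _ Q(3)]) (use RQP in \<open>simp add: norm_minus_commute\<close>)
      ultimately show ?thesis
        using norm_triangle_ineq[of "(Q * P - R) * Q + (R * Q - R)" "Q * (B.\<alpha> \<one>\<^bsub>B\<^esub> - P - W) * Q"]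
          norm_triangle_ineq[of "(Q * P - R) * Q" "R * Q - R"] RQ \<epsilon>\<eta>(1) by linarith
    qed
    ultimately show "\<exists>c\<in>carrier B. norm (emb B q - emb B (f (h \<one>\<^bsub>D\<^esub>)) - star (emb B b * emb B c) * (emb B b * emb B c)) \<le> \<eta>"
      unfolding fh1 using c(1) Qp(1) by (intro bexI[of _ "c \<otimes>\<^bsub>B\<^esub> q"]) (simp_all add: Q_def B.closed)
  qed (rule D)
qed

text \<open>Here estimates turn into exact data: \<open>mvn_hereditary\<close> makes the last
  condition an equivalence, and \<open>image_in_class\<close> replaces the image of \<open>D\<close>
  by a subalgebra in the class, at the price of the second \<open>\<epsilon> / 2\<close>.\<close>

lemma TA_witness:
  fixes \<C> :: "'u calg set" and A :: "'a calg"
  assumes \<C>: "\<C> \<subseteq> ucstar" and D: "D \<in> \<C>" and A: "A \<in> ucstar"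
    and quotients: "\<And>J. closed_ideal J D \<Longrightarrow> locally_approx_unitarily \<C> (quot_algebra D J)"
    and \<pi>: "cstar_hom D A \<pi>" and F: "finite F" "F \<subseteq> carrier A" and \<epsilon>: "0 < \<epsilon>"
    and a: "a \<in> positives A" and c: "c \<in> carrier A"
    and comm: "\<And>x. x \<in> F \<Longrightarrow> nrm A (\<pi> \<one>\<^bsub>D\<^esub> \<otimes>\<^bsub>A\<^esub> x \<ominus>\<^bsub>A\<^esub> x \<otimes>\<^bsub>A\<^esub> \<pi> \<one>\<^bsub>D\<^esub>) \<le> \<epsilon>"
    and near: "\<And>x. x \<in> F \<Longrightarrow> \<exists>d\<in>carrier D. nrm A (\<pi> \<one>\<^bsub>D\<^esub> \<otimes>\<^bsub>A\<^esub> x \<otimes>\<^bsub>A\<^esub> \<pi> \<one>\<^bsub>D\<^esub> \<ominus>\<^bsub>A\<^esub> \<pi> d) < \<epsilon> / 2"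
    and small: "nrm A ((\<one>\<^bsub>A\<^esub> \<ominus>\<^bsub>A\<^esub> \<pi> \<one>\<^bsub>D\<^esub>) \<ominus>\<^bsub>A\<^esub> adj A (a \<otimes>\<^bsub>A\<^esub> c) \<otimes>\<^bsub>A\<^esub> (a \<otimes>\<^bsub>A\<^esub> c)) < 1"
  shows "\<exists>p\<in>projections A. \<exists>S.
          cstar_subalgebra S A \<and> in_class \<C> (restrict_to A S) \<and> is_unit (restrict_to A S) p \<and>
          (\<forall>x\<in>F. nrm A (p \<otimes>\<^bsub>A\<^esub> x \<ominus>\<^bsub>A\<^esub> x \<otimes>\<^bsub>A\<^esub> p) \<le> \<epsilon> \<and>
                 dist_to A (p \<otimes>\<^bsub>A\<^esub> x \<otimes>\<^bsub>A\<^esub> p) S \<le> \<epsilon>) \<and>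
          (\<exists>r\<in>projections A. r \<in> hereditary_gen A a \<and> mvn_equiv A (\<one>\<^bsub>A\<^esub> \<ominus>\<^bsub>A\<^esub> p) r)"
proof -
  have DU: "D \<in> ucstar" using \<C> D by blast
  interpret D: ucalg D by unfold_locales (rule DU)
  interpret A: ucalg A by unfold_locales (rule A)
  note pD = cstar_homD[OF \<pi>]
  define p where "p = \<pi> \<one>\<^bsub>D\<^esub>"
  have pc: "p \<in> carrier A" using pD(1)[OF D.one(1)] by (simp add: p_def)
  have p: "p \<in> projections A"
    using pc pD(4)[OF D.one(1) D.one(1)] pD(5)[OF D.one(1)] D.one D.adj_unit[OF D.is_unit_one[OF ucstarD(2)[OF DU]]]
    by (simp add: projections_def p_def)
  obtain d where d: "\<And>x. x \<in> F \<Longrightarrow> d x \<in> carrier D" "\<And>x. x \<in> F \<Longrightarrow> nrm A (p \<otimes>\<^bsub>A\<^esub> x \<otimes>\<^bsub>A\<^esub> p \<ominus>\<^bsub>A\<^esub> \<pi> (d x)) < \<epsilon> / 2"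
    using near unfolding p_def by metis
  have "finite (d ` F)" "d ` F \<subseteq> carrier D" "0 < \<epsilon> / 2" using F(1) d(1) \<epsilon> by auto
  then obtain S where S: "cstar_subalgebra S A" "in_class \<C> (restrict_to A S)" "is_unit (restrict_to A S) p"
    and Sn: "\<And>y. y \<in> d ` F \<Longrightarrow> \<exists>s\<in>S. nrm A (\<pi> y \<ominus>\<^bsub>A\<^esub> s) < \<epsilon> / 2"
    using image_in_class[OF \<C> D A quotients \<pi>] unfolding p_def by metis
  have Sc: "S \<subseteq> carrier A" by (rule A.subalgebra_carrier[OF S(1)])
  have dist: "dist_to A (p \<otimes>\<^bsub>A\<^esub> x \<otimes>\<^bsub>A\<^esub> p) S \<le> \<epsilon>" if x: "x \<in> F" for x
  proof -
    obtain s where s: "s \<in> S" "nrm A (\<pi> (d x) \<ominus>\<^bsub>A\<^esub> s) < \<epsilon> / 2" using Sn[of "d x"] x by auto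
    have xc: "x \<in> carrier A" and sc: "s \<in> carrier A" using x F Sc s by auto
    note dc = pD(1)[OF d(1)[OF x]]
    have "norm (A.\<alpha> p * A.\<alpha> x * A.\<alpha> p - A.\<alpha> s)
      \<le> norm (A.\<alpha> p * A.\<alpha> x * A.\<alpha> p - A.\<alpha> (\<pi> (d x))) + norm (A.\<alpha> (\<pi> (d x)) - A.\<alpha> s)"
      using norm_triangle_ineq[of "A.\<alpha> p * A.\<alpha> x * A.\<alpha> p - A.\<alpha> (\<pi> (d x))" "A.\<alpha> (\<pi> (d x)) - A.\<alpha> s"] by simp
    also have "\<dots> \<le> \<epsilon>" using d(2)[OF x] s(2) by (simp add: A.nrm_eq A.closed A.emb_simps pc xc sc dc)
    finally have "nrm A (p \<otimes>\<^bsub>A\<^esub> x \<otimes>\<^bsub>A\<^esub> p \<ominus>\<^bsub>A\<^esub> s) \<le> \<epsilon>" by (simp add: A.nrm_eq A.closed A.emb_simps pc xc sc)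
    then show ?thesis by (rule A.dist_to_le[OF A.mult_closed[OF A.mult_closed[OF pc xc] pc] Sc s(1)])
  qed
  show ?thesis
    using S comm dist A.mvn_hereditary[OF p a c] small unfolding p_def[symmetric]
    by (intro bexI[OF exI[of _ S] p]) simp
qed

text \<open>The premises \<open>comm\<close>, \<open>near\<close> and \<open>small\<close> are
  finitely many strict norm inequalities in the sequence algebra, so each holds in all large
  coordinates of the lift and a single coordinate serves for all of them.\<close>

lemma coordinate_witness:
  fixes \<C> :: "'u calg set" and A :: "'a calg"
  assumes \<C>: "\<C> \<subseteq> ucstar" and D: "D \<in> \<C>" and A: "A \<in> ucstar" and sep: "separable A"
    and sp: "semiprojective D \<or> weakly_semiprojective D"
    and quotients: "\<And>J. closed_ideal J D \<Longrightarrow> locally_approx_unitarily \<C> (quot_algebra D J)"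
    and \<psi>: "cstar_hom D (seq_algebra A) \<psi>" and F: "finite F" "F \<subseteq> carrier A" and \<epsilon>: "0 < \<epsilon>"
    and a: "a \<in> positives A" and c: "c \<in> carrier (seq_algebra A)"
    and comm: "\<And>x. x \<in> F \<Longrightarrow> nrm (seq_algebra A) (\<psi> \<one>\<^bsub>D\<^esub> \<otimes>\<^bsub>seq_algebra A\<^esub> seq_const A x
      \<ominus>\<^bsub>seq_algebra A\<^esub> seq_const A x \<otimes>\<^bsub>seq_algebra A\<^esub> \<psi> \<one>\<^bsub>D\<^esub>) < \<epsilon>"
    and near: "\<And>x. x \<in> F \<Longrightarrow> \<exists>d\<in>carrier D. nrm (seq_algebra A) (\<psi> \<one>\<^bsub>D\<^esub> \<otimes>\<^bsub>seq_algebra A\<^esub> seq_const A x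
      \<otimes>\<^bsub>seq_algebra A\<^esub> \<psi> \<one>\<^bsub>D\<^esub> \<ominus>\<^bsub>seq_algebra A\<^esub> \<psi> d) < \<epsilon> / 2"
    and small: "nrm (seq_algebra A) ((\<one>\<^bsub>seq_algebra A\<^esub> \<ominus>\<^bsub>seq_algebra A\<^esub> \<psi> \<one>\<^bsub>D\<^esub>)
      \<ominus>\<^bsub>seq_algebra A\<^esub> adj (seq_algebra A) (seq_const A a \<otimes>\<^bsub>seq_algebra A\<^esub> c) \<otimes>\<^bsub>seq_algebra A\<^esub> (seq_const A a \<otimes>\<^bsub>seq_algebra A\<^esub> c)) < 1"
  shows "\<exists>p\<in>projections A. \<exists>S.
          cstar_subalgebra S A \<and> in_class \<C> (restrict_to A S) \<and> is_unit (restrict_to A S) p \<and>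
          (\<forall>x\<in>F. nrm A (p \<otimes>\<^bsub>A\<^esub> x \<ominus>\<^bsub>A\<^esub> x \<otimes>\<^bsub>A\<^esub> p) \<le> \<epsilon> \<and>
                 dist_to A (p \<otimes>\<^bsub>A\<^esub> x \<otimes>\<^bsub>A\<^esub> p) S \<le> \<epsilon>) \<and>
          (\<exists>r\<in>projections A. r \<in> hereditary_gen A a \<and> mvn_equiv A (\<one>\<^bsub>A\<^esub> \<ominus>\<^bsub>A\<^esub> p) r)"
proof -
  have DU: "D \<in> ucstar" using \<C> D by blast
  interpret D: ucalg D by unfold_locales (rule DU)
  interpret A: ucalg A by unfold_locales (rule A)
  note ops = cls_ops[OF A]
  note linf = A.linf_mult A.linf_diff A.linf_adj A.linf_const
  note ac = A.positives_emb(1)[OF a]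
  obtain N \<pi> where \<pi>: "\<And>n. n \<ge> N \<Longrightarrow> cstar_hom D A (\<pi> n)"
    and lift: "\<And>d. d \<in> carrier D \<Longrightarrow> \<exists>x\<in>carrier (linf A). \<psi> d = cls A x \<and> (\<forall>n\<ge>N. \<pi> n d = x n)"
    using lift_to_coordinates[OF A sep DU sp \<psi>] by metis
  obtain p where p: "p \<in> carrier (linf A)" "\<psi> \<one>\<^bsub>D\<^esub> = cls A p" "\<And>n. n \<ge> N \<Longrightarrow> \<pi> n \<one>\<^bsub>D\<^esub> = p n"
    using lift[OF D.one(1)] by metis
  obtain z where z: "z \<in> carrier (linf A)" "c = cls A z" using c carrier_seq[OF A] by auto
  have e1: "\<forall>\<^sub>F n in sequentially. nrm A (p n \<otimes>\<^bsub>A\<^esub> x \<ominus>\<^bsub>A\<^esub> x \<otimes>\<^bsub>A\<^esub> p n) < \<epsilon>" if x: "x \<in> F" for x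
  proof (rule cls_nrm_less[OF A])
    have xc: "x \<in> carrier A" using x F by auto
    show "(\<lambda>n. p n \<otimes>\<^bsub>A\<^esub> x \<ominus>\<^bsub>A\<^esub> x \<otimes>\<^bsub>A\<^esub> p n) \<in> carrier (linf A)" by (intro linf p xc)
    show "nrm (seq_algebra A) (cls A (\<lambda>n. p n \<otimes>\<^bsub>A\<^esub> x \<ominus>\<^bsub>A\<^esub> x \<otimes>\<^bsub>A\<^esub> p n)) < \<epsilon>"
      using comm[OF x] by (simp add: p(1,2) seq_const_eq[OF A] ops linf xc)
  qed
  have "\<exists>d\<in>carrier D. \<forall>\<^sub>F n in sequentially. nrm A (p n \<otimes>\<^bsub>A\<^esub> x \<otimes>\<^bsub>A\<^esub> p n \<ominus>\<^bsub>A\<^esub> \<pi> n d) < \<epsilon> / 2" if x: "x \<in> F" for x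
  proof -
    have xc: "x \<in> carrier A" using x F by auto
    obtain d where d: "d \<in> carrier D" "nrm (seq_algebra A) (\<psi> \<one>\<^bsub>D\<^esub> \<otimes>\<^bsub>seq_algebra A\<^esub> seq_const A x
      \<otimes>\<^bsub>seq_algebra A\<^esub> \<psi> \<one>\<^bsub>D\<^esub> \<ominus>\<^bsub>seq_algebra A\<^esub> \<psi> d) < \<epsilon> / 2" using near[OF x] by blast
    obtain y where y: "y \<in> carrier (linf A)" "\<psi> d = cls A y" "\<And>n. n \<ge> N \<Longrightarrow> \<pi> n d = y n" using lift[OF d(1)] by metis
    have "\<forall>\<^sub>F n in sequentially. nrm A (p n \<otimes>\<^bsub>A\<^esub> x \<otimes>\<^bsub>A\<^esub> p n \<ominus>\<^bsub>A\<^esub> y n) < \<epsilon> / 2"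
    proof (rule cls_nrm_less[OF A])
      show "(\<lambda>n. p n \<otimes>\<^bsub>A\<^esub> x \<otimes>\<^bsub>A\<^esub> p n \<ominus>\<^bsub>A\<^esub> y n) \<in> carrier (linf A)" by (intro linf p xc y)
      show "nrm (seq_algebra A) (cls A (\<lambda>n. p n \<otimes>\<^bsub>A\<^esub> x \<otimes>\<^bsub>A\<^esub> p n \<ominus>\<^bsub>A\<^esub> y n)) < \<epsilon> / 2"
        using d(2) by (simp add: p(1,2) y(1,2) seq_const_eq[OF A] ops linf xc)
    qed
    then have "\<forall>\<^sub>F n in sequentially. nrm A (p n \<otimes>\<^bsub>A\<^esub> x \<otimes>\<^bsub>A\<^esub> p n \<ominus>\<^bsub>A\<^esub> \<pi> n d) < \<epsilon> / 2"
      using eventually_ge_at_top[of N] by eventually_elim (simp add: y(3))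
    then show ?thesis using d(1) by blast
  qed
  then obtain d where d: "\<And>x. x \<in> F \<Longrightarrow> d x \<in> carrier D"
    and e2: "\<And>x. x \<in> F \<Longrightarrow> \<forall>\<^sub>F n in sequentially. nrm A (p n \<otimes>\<^bsub>A\<^esub> x \<otimes>\<^bsub>A\<^esub> p n \<ominus>\<^bsub>A\<^esub> \<pi> n (d x)) < \<epsilon> / 2"
    by metis
  have e3: "\<forall>\<^sub>F n in sequentially. nrm A ((\<one>\<^bsub>A\<^esub> \<ominus>\<^bsub>A\<^esub> p n) \<ominus>\<^bsub>A\<^esub> adj A (a \<otimes>\<^bsub>A\<^esub> z n) \<otimes>\<^bsub>A\<^esub> (a \<otimes>\<^bsub>A\<^esub> z n)) < 1"
  proof (rule cls_nrm_less[OF A])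
    show "(\<lambda>n. (\<one>\<^bsub>A\<^esub> \<ominus>\<^bsub>A\<^esub> p n) \<ominus>\<^bsub>A\<^esub> adj A (a \<otimes>\<^bsub>A\<^esub> z n) \<otimes>\<^bsub>A\<^esub> (a \<otimes>\<^bsub>A\<^esub> z n)) \<in> carrier (linf A)"
      by (intro linf p z ac A.one)
    show "nrm (seq_algebra A) (cls A (\<lambda>n. (\<one>\<^bsub>A\<^esub> \<ominus>\<^bsub>A\<^esub> p n) \<ominus>\<^bsub>A\<^esub> adj A (a \<otimes>\<^bsub>A\<^esub> z n) \<otimes>\<^bsub>A\<^esub> (a \<otimes>\<^bsub>A\<^esub> z n))) < 1"
      using small by (simp add: p(1,2) z seq_const_eq[OF A] seq_one[OF A] ops linf ac A.one(1))
  qed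
  have "\<forall>\<^sub>F n in sequentially. n \<ge> N \<and> (\<forall>x\<in>F. nrm A (p n \<otimes>\<^bsub>A\<^esub> x \<ominus>\<^bsub>A\<^esub> x \<otimes>\<^bsub>A\<^esub> p n) < \<epsilon>)
      \<and> (\<forall>x\<in>F. nrm A (p n \<otimes>\<^bsub>A\<^esub> x \<otimes>\<^bsub>A\<^esub> p n \<ominus>\<^bsub>A\<^esub> \<pi> n (d x)) < \<epsilon> / 2)
      \<and> nrm A ((\<one>\<^bsub>A\<^esub> \<ominus>\<^bsub>A\<^esub> p n) \<ominus>\<^bsub>A\<^esub> adj A (a \<otimes>\<^bsub>A\<^esub> z n) \<otimes>\<^bsub>A\<^esub> (a \<otimes>\<^bsub>A\<^esub> z n)) < 1"
    by (intro eventually_conj eventually_ge_at_top eventually_ball_finite F(1) ballI e1 e2 e3)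
  then obtain n where n: "n \<ge> N" "\<And>x. x \<in> F \<Longrightarrow> nrm A (p n \<otimes>\<^bsub>A\<^esub> x \<ominus>\<^bsub>A\<^esub> x \<otimes>\<^bsub>A\<^esub> p n) < \<epsilon>"
      "\<And>x. x \<in> F \<Longrightarrow> nrm A (p n \<otimes>\<^bsub>A\<^esub> x \<otimes>\<^bsub>A\<^esub> p n \<ominus>\<^bsub>A\<^esub> \<pi> n (d x)) < \<epsilon> / 2"
      "nrm A ((\<one>\<^bsub>A\<^esub> \<ominus>\<^bsub>A\<^esub> p n) \<ominus>\<^bsub>A\<^esub> adj A (a \<otimes>\<^bsub>A\<^esub> z n) \<otimes>\<^bsub>A\<^esub> (a \<otimes>\<^bsub>A\<^esub> z n)) < 1"
    by (auto dest!: eventually_happens'[OF sequentially_bot])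
  show ?thesis
    by (rule TA_witness[OF \<C> D A quotients \<pi>[OF n(1)] F \<epsilon> a A.linf_closed[OF z(1), of n]])
      (use n(2-4) d in \<open>auto simp: p(3)[OF n(1)] intro: less_imp_le\<close>)
qed

section \<open>From estimates in \<open>B\<close> to estimates in the sequence algebra\<close>

theorem theorem2p14:
  fixes A :: "'a calg" and B :: "'b calg" and \<C> :: "'u calg set"
  assumes A: "cstar_algebra A" "separable A" "simple A" "unital A"
    and B: "cstar_algebra B" "separable B" "simple B" "unital B"
    and split: "\<exists>\<phi>. tracially_sequentially_split A B \<phi>"
    and \<C>: "\<forall>D\<in>\<C>. cstar_algebra D \<and> unital D \<and> separable D \<and>
               (semiprojective D \<or> weakly_semiprojective D)"
    and quotients: "\<forall>D\<in>\<C>. \<forall>J. closed_ideal J D \<longrightarrow> locally_approx_unitarily \<C> (quot_algebra D J)"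
    and matrices: "\<forall>D\<in>\<C>. \<forall>n\<ge>1. in_class \<C> (matrix_algebra n D)"
    and hereditary: "\<forall>D\<in>\<C>. \<forall>H. hereditary H D \<longrightarrow> in_class \<C> (restrict_to D H)"
    and comparison: "\<forall>D\<in>\<C>. strict_comparison D"
    and TA_B: "TA \<C> B"
  shows "TA \<C> A"
proof -
  have AU: "A \<in> ucstar" and BU: "B \<in> ucstar" and CU: "\<C> \<subseteq> ucstar" using A B \<C> by (auto intro: ucstarI)
  interpret A: ucalg A by unfold_locales (rule AU)
  interpret B: ucalg B by unfold_locales (rule BU)
  let ?E = "seq_algebra A"
  have EU: "?E \<in> ucstar" by (rule ucstar_seq[OF AU])
  interpret E: ucalg ?E by unfold_locales (rule EU)
  note kh = cstar_hom_seq_const[OF AU]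
  note k = cstar_homD[OF kh]
  obtain \<phi> where \<phi>: "tracially_sequentially_split A B \<phi>" using split by blast
  have \<phi>h: "cstar_hom A B \<phi>" using \<phi> by (simp add: tracially_sequentially_split_def)
  note f = cstar_homD[OF \<phi>h]
  have qp: "\<phi> \<one>\<^bsub>A\<^esub> \<in> projections B"
    using f(4)[OF A.one(1) A.one(1)] f(5)[OF A.one(1)] f(1)[OF A.one(1)] A.one A.adj_unit[OF A.is_unit_one[OF A(4)]]
    by (simp add: projections_def)
  note hered = hereditary[rule_format]
  show ?thesis
    unfolding TA_def
  proof (intro conjI allI impI A)
    fix F :: "'a set" and \<epsilon> :: real and a
    assume asm: "finite F \<and> F \<subseteq> carrier A \<and> 0 < \<epsilon> \<and> a \<in> positives A \<and> a \<noteq> \<zero>\<^bsub>A\<^esub>"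
    then have F: "finite F" "F \<subseteq> carrier A" and \<epsilon>: "0 < \<epsilon>" and a: "a \<in> positives A" "a \<noteq> \<zero>\<^bsub>A\<^esub>" by auto
    note ap = A.positives_emb[OF a(1)]
    from AU A(3) \<phi> a show "\<exists>p\<in>projections A. \<exists>S.
          cstar_subalgebra S A \<and> in_class \<C> (restrict_to A S) \<and> is_unit (restrict_to A S) p \<and>
          (\<forall>x\<in>F. nrm A (p \<otimes>\<^bsub>A\<^esub> x \<ominus>\<^bsub>A\<^esub> x \<otimes>\<^bsub>A\<^esub> p) \<le> \<epsilon> \<and>
                 dist_to A (p \<otimes>\<^bsub>A\<^esub> x \<otimes>\<^bsub>A\<^esub> p) S \<le> \<epsilon>) \<and>
          (\<exists>r\<in>projections A. r \<in> hereditary_gen A a \<and> mvn_equiv A (\<one>\<^bsub>A\<^esub> \<ominus>\<^bsub>A\<^esub> p) r)"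
    proof (cases rule: split_choice)
      \<comment> \<open>With \<open>a\<close> invertible \<open>p = 0\<close> will do, but the zero
        subalgebra must belong to the class. It arises from the zero map on any member
        \<open>D\<close>, and a member exists because \<open>TA\<close> for \<open>B\<close>
        produces one.\<close>
      case (1 x)
      have "\<one>\<^bsub>B\<^esub> \<in> positives B"
        using B.one B.adj_unit[OF B.is_unit_one[OF B(4)]] by (auto simp: positives_def intro!: exI[of _ "\<one>\<^bsub>B\<^esub>"])
      moreover have "\<one>\<^bsub>B\<^esub> \<noteq> \<zero>\<^bsub>B\<^esub>"
      proof
        assume "\<one>\<^bsub>B\<^esub> = \<zero>\<^bsub>B\<^esub>"
        then have "y = \<zero>\<^bsub>B\<^esub>" if "y \<in> carrier B" for y using B.one(2)[OF that] B.zero_mult[OF that] by simp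
        then have "carrier B = {\<zero>\<^bsub>B\<^esub>}" using B.zero_closed by blast
        then show False using B(3) unfolding simple_def by blast
      qed
      ultimately have "finite {} \<and> {} \<subseteq> carrier B \<and> (0::real) < 1 \<and> \<one>\<^bsub>B\<^esub> \<in> positives B \<and> \<one>\<^bsub>B\<^esub> \<noteq> \<zero>\<^bsub>B\<^esub>" by simp
      then obtain S where "in_class \<C> (restrict_to B S)" using TA_B unfolding TA_def by metis
      then obtain D where D: "D \<in> \<C>" by (auto simp: in_class_def)
      have zh: "cstar_hom D A (\<lambda>_. \<zero>\<^bsub>A\<^esub>)"
        unfolding cstar_hom_def by (simp add: A.zero_closed A.add_zero A.scale_zero A.zero_mult A.adj_zero)
      have D0: "\<zero>\<^bsub>D\<^esub> \<in> carrier D" using CU D by (auto intro: cstar_algebra.zero_closed ucstarD)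
      show ?thesis
      proof (rule TA_witness[OF CU D AU quotients[rule_format, OF D] zh F \<epsilon> a(1), of "x \<otimes>\<^bsub>A\<^esub> a"])
        show "x \<otimes>\<^bsub>A\<^esub> a \<in> carrier A" by (simp add: A.closed 1(1) ap)
        have e: "a \<otimes>\<^bsub>A\<^esub> (x \<otimes>\<^bsub>A\<^esub> a) = \<one>\<^bsub>A\<^esub>" by (simp add: 1 A.mult_assoc ap)
        have "(\<one>\<^bsub>A\<^esub> \<ominus>\<^bsub>A\<^esub> \<zero>\<^bsub>A\<^esub>) \<ominus>\<^bsub>A\<^esub> \<one>\<^bsub>A\<^esub> = \<zero>\<^bsub>A\<^esub>" by (rule A.eqI) (simp_all add: A.closed A.emb_simps)
        then show "nrm A ((\<one>\<^bsub>A\<^esub> \<ominus>\<^bsub>A\<^esub> \<zero>\<^bsub>A\<^esub>) \<ominus>\<^bsub>A\<^esub> adj A (a \<otimes>\<^bsub>A\<^esub> (x \<otimes>\<^bsub>A\<^esub> a)) \<otimes>\<^bsub>A\<^esub> (a \<otimes>\<^bsub>A\<^esub> (x \<otimes>\<^bsub>A\<^esub> a))) < 1"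
          unfolding e by (simp add: A.adj_unit[OF A.is_unit_one[OF A(4)]] A.one A.nrm_zero)
        fix y assume "y \<in> F"
        then have y: "y \<in> carrier A" using F by auto
        have "\<zero>\<^bsub>A\<^esub> \<otimes>\<^bsub>A\<^esub> y \<ominus>\<^bsub>A\<^esub> y \<otimes>\<^bsub>A\<^esub> \<zero>\<^bsub>A\<^esub> = \<zero>\<^bsub>A\<^esub>" "\<zero>\<^bsub>A\<^esub> \<otimes>\<^bsub>A\<^esub> y \<otimes>\<^bsub>A\<^esub> \<zero>\<^bsub>A\<^esub> \<ominus>\<^bsub>A\<^esub> \<zero>\<^bsub>A\<^esub> = \<zero>\<^bsub>A\<^esub>"
          by (rule A.eqI; simp add: A.closed A.emb_simps y)+
        then show "nrm A (\<zero>\<^bsub>A\<^esub> \<otimes>\<^bsub>A\<^esub> y \<ominus>\<^bsub>A\<^esub> y \<otimes>\<^bsub>A\<^esub> \<zero>\<^bsub>A\<^esub>) \<le> \<epsilon>"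
          "\<exists>d\<in>carrier D. nrm A (\<zero>\<^bsub>A\<^esub> \<otimes>\<^bsub>A\<^esub> y \<otimes>\<^bsub>A\<^esub> \<zero>\<^bsub>A\<^esub> \<ominus>\<^bsub>A\<^esub> \<zero>\<^bsub>A\<^esub>) < \<epsilon> / 2"
          using \<epsilon> D0 by (auto simp: A.nrm_zero)
      qed
    next
      case (2 \<psi> g b)
      note ps = cstar_homD[OF 2(1)] and G = E.projectionD[OF 2(2)] and bp = A.positives_emb[OF 2(6)]
      define K where "K x = E.\<alpha> (seq_const A x)" for x
      define h where "h y = E.\<alpha> (\<psi> (ev B y))" for y
      have h: "star_hom h" unfolding h_def by (rule star_hom_lift[OF BU EU 2(1)])
      have hemb: "h (B.\<alpha> y) = E.\<alpha> (\<psi> y)" if "y \<in> carrier B" for y by (simp add: h_def ev_emb[OF BU that])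
      have gK: "E.\<alpha> g * K x = K x * E.\<alpha> g" if "x \<in> carrier A" for x
      proof -
        have "g \<otimes>\<^bsub>?E\<^esub> seq_const A x = seq_const A x \<otimes>\<^bsub>?E\<^esub> g" using 2(3) that by (simp add: central_sequences_def)
        from arg_cong[OF this, of E.\<alpha>] show ?thesis by (simp add: K_def E.emb_simps k that G)
      qed
      have h\<phi>: "h (B.\<alpha> (\<phi> x)) = K x * E.\<alpha> g" if "x \<in> carrier A" for x
        by (simp add: hemb f that 2(5) E.emb_simps k G K_def)
      have b1: "\<phi> b \<in> positives B"
      proof -
        obtain y where "y \<in> carrier A" "b = adj A y \<otimes>\<^bsub>A\<^esub> y" using 2(6) by (auto simp: positives_def)
        then have "\<phi> b = adj B (\<phi> y) \<otimes>\<^bsub>B\<^esub> \<phi> y" "\<phi> y \<in> carrier B" by (simp_all add: f A.closed)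
        then show ?thesis by (auto simp: positives_def)
      qed
      \<comment> \<open>If \<open>\<phi> b\<close> were zero, \<open>b\<close> would annihilate
        \<open>g\<close>, and simplicity of \<open>A\<close> would give \<open>g = 0\<close>; this
        is where \<open>g\<close> being nonzero enters.\<close>
      have b2: "\<phi> b \<noteq> \<zero>\<^bsub>B\<^esub>"
      proof
        assume "\<phi> b = \<zero>\<^bsub>B\<^esub>"
        then have "seq_const A b \<otimes>\<^bsub>?E\<^esub> g = \<zero>\<^bsub>?E\<^esub>"
          using 2(5)[OF bp(1)] cstar_hom_zero[OF B.cstar_algebra_axioms E.cstar_algebra_axioms 2(1)] by simp
        moreover have "g \<otimes>\<^bsub>?E\<^esub> seq_const A x = seq_const A x \<otimes>\<^bsub>?E\<^esub> g" if "x \<in> carrier A" for x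
          using 2(3) that by (simp add: central_sequences_def)
        ultimately have "seq_const A \<one>\<^bsub>A\<^esub> \<otimes>\<^bsub>?E\<^esub> g = \<zero>\<^bsub>?E\<^esub>"
          by (intro simple_annihilator[OF AU A(3) EU kh G(1) _ bp(1) 2(7)])
        then show False using 2(4) E.one(2)[OF G(1)] by (simp add: seq_one[OF AU])
      qed
      obtain M where M: "1 \<le> M" "\<And>x. x \<in> F \<Longrightarrow> nrm A x \<le> M" using finite_norm_bound[OF F(1)] by metis
      \<comment> \<open>The errors to be absorbed are \<open>3 \<eta> M\<close> against
        \<open>\<epsilon>\<close> for commutators, \<open>2 \<eta> M\<close> against
        \<open>\<epsilon> / 2\<close> for distances, and \<open>2 \<eta>\<close> against
        \<open>1\<close> for the complement.\<close>
      define \<eta> where "\<eta> = min (1 / 4) (\<epsilon> / (8 * M))"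
      have \<eta>: "0 < \<eta>" "4 * \<eta> \<le> 1" "8 * (\<eta> * M) \<le> \<epsilon>"
      proof -
        show "0 < \<eta>" "4 * \<eta> \<le> 1" using \<epsilon> M by (auto simp: \<eta>_def)
        have "\<eta> \<le> \<epsilon> / (8 * M)" by (simp add: \<eta>_def)
        then show "8 * (\<eta> * M) \<le> \<epsilon>" using M by (simp add: field_simps)
      qed
      have \<eta>M: "\<eta> \<le> \<eta> * M" using \<eta>(1) M(1) by simp
      have qF: "\<phi> \<one>\<^bsub>A\<^esub> \<otimes>\<^bsub>B\<^esub> x = x \<and> x \<otimes>\<^bsub>B\<^esub> \<phi> \<one>\<^bsub>A\<^esub> = x" if "x \<in> \<phi> ` F" for x
      proof -
        obtain y where y: "y \<in> F" "x = \<phi> y" using \<open>x \<in> \<phi> ` F\<close> by blast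
        then have "y \<in> carrier A" using F by auto
        then show ?thesis using A.one by (simp add: y flip: f(4))
      qed
      have F': "finite (\<phi> ` F)" "\<phi> ` F \<subseteq> carrier B" using F f(1) by auto
      obtain D \<theta> where D: "D \<in> \<C>" and \<theta>: "cstar_hom D B \<theta>"
        and t1: "norm (B.\<alpha> (\<theta> \<one>\<^bsub>D\<^esub>) * B.\<alpha> (\<phi> \<one>\<^bsub>A\<^esub>) - B.\<alpha> (\<theta> \<one>\<^bsub>D\<^esub>)) \<le> \<eta>"
        and t2: "norm (B.\<alpha> (\<phi> \<one>\<^bsub>A\<^esub>) * B.\<alpha> (\<theta> \<one>\<^bsub>D\<^esub>) - B.\<alpha> (\<theta> \<one>\<^bsub>D\<^esub>)) \<le> \<eta>"
        and t3: "\<And>x. x \<in> \<phi> ` F \<Longrightarrow> norm (B.\<alpha> (\<theta> \<one>\<^bsub>D\<^esub>) * B.\<alpha> x - B.\<alpha> x * B.\<alpha> (\<theta> \<one>\<^bsub>D\<^esub>)) \<le> \<eta>"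
        and t4: "\<And>x. x \<in> \<phi> ` F \<Longrightarrow> \<exists>d\<in>carrier D. norm (B.\<alpha> (\<theta> \<one>\<^bsub>D\<^esub>) * B.\<alpha> x * B.\<alpha> (\<theta> \<one>\<^bsub>D\<^esub>) - B.\<alpha> (\<theta> d)) \<le> \<eta>"
        and t5: "\<exists>c\<in>carrier B. norm (B.\<alpha> (\<phi> \<one>\<^bsub>A\<^esub>) - B.\<alpha> (\<theta> \<one>\<^bsub>D\<^esub>) - star (B.\<alpha> (\<phi> b) * B.\<alpha> c) * (B.\<alpha> (\<phi> b) * B.\<alpha> c)) \<le> \<eta>"
        using TA_corner[OF CU hered TA_B BU qp F' qF b1 b2 \<eta>(1)] by metis
      have DU: "D \<in> ucstar" using CU D by blast
      interpret D: ucalg D by unfold_locales (rule DU)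
      note th = cstar_homD[OF \<theta>]
      have \<Psi>: "cstar_hom D ?E (\<lambda>d. \<psi> (\<theta> d))" by (rule cstar_hom_comp[OF \<theta> 2(1)])
      note P = cstar_homD[OF \<Psi>]
      define T where "T = B.\<alpha> (\<theta> \<one>\<^bsub>D\<^esub>)"
      define S where "S = E.\<alpha> (\<psi> (\<theta> \<one>\<^bsub>D\<^esub>))"
      have hT: "h T = S" by (simp add: T_def S_def hemb th D.one)
      \<comment> \<open>This identity carries estimates relative to \<open>q\<close> over to
        estimates relative to \<open>g\<close>.\<close>
      have hQ: "h (B.\<alpha> (\<phi> \<one>\<^bsub>A\<^esub>)) = E.\<alpha> g"
        using E.one(2)[OF G(1)] by (simp add: hemb f A.one 2(5) seq_one[OF AU])
      have contr: "norm y \<le> r \<Longrightarrow> norm (h y) \<le> r" for y r using star_hom_contractive[OF h, of y] by simp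
      note hs = star_homD(2,3,7)[OF h]
      have s1: "norm (S * E.\<alpha> g - S) \<le> \<eta>" using contr[OF t1[folded T_def]] by (simp add: hs hT hQ)
      have s2: "norm (E.\<alpha> g * S - S) \<le> \<eta>" using contr[OF t2[folded T_def]] by (simp add: hs hT hQ)
      have "S * S = S"
        using P(4)[OF D.one(1) D.one(1)] D.one by (simp add: S_def P flip: E.emb_simps)
      moreover have "star S = S"
        using P(5)[OF D.one(1)] D.adj_unit[OF D.is_unit_one[OF ucstarD(2)[OF DU]]] D.one by (simp add: S_def P flip: E.emb_simps)
      ultimately have nS: "norm S \<le> 1" by (rule norm_projection[rotated])
      have nK: "norm (K x) \<le> M" if "x \<in> F" for x
      proof -
        have xc: "x \<in> carrier A" using that F by auto
        have "norm (K x) = nrm ?E (seq_const A x)" by (simp add: K_def E.nrm_eq k xc)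
        also have "\<dots> \<le> nrm A x" by (rule cstar_hom_contractive[OF AU EU kh xc])
        finally show ?thesis using M(2)[OF that] by simp
      qed
      obtain c where c: "c \<in> carrier B"
        "norm (B.\<alpha> (\<phi> \<one>\<^bsub>A\<^esub>) - T - star (B.\<alpha> (\<phi> b) * B.\<alpha> c) * (B.\<alpha> (\<phi> b) * B.\<alpha> c)) \<le> \<eta>"
        using t5 unfolding T_def by blast
      \<comment> \<open>Image of \<open>\<phi> b * c\<close> under \<open>\<psi>\<close>; the factor
        \<open>g\<close> produced by \<open>\<psi> (\<phi> b)\<close> is absorbed into the element
        \<open>d\<close> for which the reserve property of \<open>b\<close> is invoked.\<close>
      define W where "W = K b * E.\<alpha> g * E.\<alpha> (\<psi> c)"
      have s5: "norm (E.\<alpha> g - S - star W * W) \<le> \<eta>"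
        using contr[OF c(2)] by (simp add: hs hT hQ h\<phi> bp hemb c W_def)
      have dc: "g \<otimes>\<^bsub>?E\<^esub> \<psi> c \<in> carrier ?E" by (simp add: E.closed G ps c)
      obtain c' where c': "c' \<in> carrier ?E"
        "norm (E.\<alpha> \<one>\<^bsub>?E\<^esub> - E.\<alpha> g + star W * W - star (K a * E.\<alpha> c') * (K a * E.\<alpha> c')) < \<eta>"
      proof -
        have "K b * E.\<alpha> (g \<otimes>\<^bsub>?E\<^esub> \<psi> c) = W" by (simp add: W_def E.emb_simps G ps c mult.assoc)
        then show ?thesis using 2(8)[OF \<eta>(1) dc] that unfolding K_def by auto
      qed
      show ?thesis
      proof (rule coordinate_witness[OF CU D AU A(2) _ quotients[rule_format, OF D] \<Psi> F \<epsilon> a(1) c'(1)])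
        show "semiprojective D \<or> weakly_semiprojective D" using \<C> D by blast
        \<comment> \<open>The two defects \<open>1 - g\<close> and \<open>g - S\<close> add up to
          \<open>1 - S\<close>, and the terms in \<open>W\<close> cancel.\<close>
        have "norm (E.\<alpha> \<one>\<^bsub>?E\<^esub> - S - star (K a * E.\<alpha> c') * (K a * E.\<alpha> c'))
          = norm ((E.\<alpha> \<one>\<^bsub>?E\<^esub> - E.\<alpha> g + star W * W - star (K a * E.\<alpha> c') * (K a * E.\<alpha> c')) + (E.\<alpha> g - S - star W * W))"
          by (rule arg_cong[of _ _ norm]) (simp add: algebra_simps)
        also have "\<dots> < 1"
          using norm_triangle_ineq[of "E.\<alpha> \<one>\<^bsub>?E\<^esub> - E.\<alpha> g + star W * W - star (K a * E.\<alpha> c') * (K a * E.\<alpha> c')" "E.\<alpha> g - S - star W * W"] c'(2) s5 \<eta>(2) by linarith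
        finally show "nrm ?E ((\<one>\<^bsub>?E\<^esub> \<ominus>\<^bsub>?E\<^esub> \<psi> (\<theta> \<one>\<^bsub>D\<^esub>))
            \<ominus>\<^bsub>?E\<^esub> adj ?E (seq_const A a \<otimes>\<^bsub>?E\<^esub> c') \<otimes>\<^bsub>?E\<^esub> (seq_const A a \<otimes>\<^bsub>?E\<^esub> c')) < 1"
          by (simp add: E.nrm_eq E.closed E.emb_simps P D.one k ap c' S_def K_def)
        fix x assume x: "x \<in> F"
        have xc: "x \<in> carrier A" using x F by auto
        note nKx = nK[OF x]
        have "norm (S * (K x * E.\<alpha> g) - K x * E.\<alpha> g * S) \<le> \<eta>"
          using contr[OF t3[OF imageI[OF x], folded T_def]] by (simp add: hs hT h\<phi> xc)
        \<comment> \<open>The estimate in \<open>B\<close> concerns \<open>\<phi> x\<close>, whose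
          image is \<open>K x * g\<close>. Moving the central \<open>g\<close> next to
          \<open>S\<close>, which almost absorbs it, leaves a commutator with \<open>K x\<close>
          itself.\<close>
        moreover have "S * (K x * E.\<alpha> g) = S * E.\<alpha> g * K x"
          unfolding gK[OF xc, symmetric] by (rule mult.assoc[symmetric])
        ultimately have s3: "norm (S * E.\<alpha> g * K x - K x * E.\<alpha> g * S) \<le> \<eta>" by simp
        have "norm (S * K x - K x * S)
          = norm ((S * E.\<alpha> g * K x - K x * E.\<alpha> g * S) + (K x * (E.\<alpha> g * S - S) - (S * E.\<alpha> g - S) * K x))"
          by (rule arg_cong[of _ _ norm]) (simp add: left_diff_distrib right_diff_distrib mult.assoc)
        moreover have "norm (K x * (E.\<alpha> g * S - S)) \<le> M * \<eta>" "norm ((S * E.\<alpha> g - S) * K x) \<le> \<eta> * M"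
          by (rule norm_mult_le[OF nKx s2], rule norm_mult_le[OF s1 nKx])
        ultimately have "norm (S * K x - K x * S) \<le> \<eta> + (M * \<eta> + \<eta> * M)"
          using s3 norm_triangle_ineq[of "S * E.\<alpha> g * K x - K x * E.\<alpha> g * S" "K x * (E.\<alpha> g * S - S) - (S * E.\<alpha> g - S) * K x"]
            norm_triangle_ineq4[of "K x * (E.\<alpha> g * S - S)" "(S * E.\<alpha> g - S) * K x"] by linarith
        also have "\<dots> < \<epsilon>" using \<eta> \<eta>M unfolding mult.commute[of M \<eta>] by linarith
        finally show "nrm ?E (\<psi> (\<theta> \<one>\<^bsub>D\<^esub>) \<otimes>\<^bsub>?E\<^esub> seq_const A x \<ominus>\<^bsub>?E\<^esub> seq_const A x \<otimes>\<^bsub>?E\<^esub> \<psi> (\<theta> \<one>\<^bsub>D\<^esub>)) < \<epsilon>"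
          by (simp add: E.nrm_eq E.closed E.emb_simps P D.one k xc S_def K_def)
        obtain d where d: "d \<in> carrier D" "norm (T * B.\<alpha> (\<phi> x) * T - B.\<alpha> (\<theta> d)) \<le> \<eta>"
          using t4[OF imageI[OF x]] unfolding T_def by blast
        have s4: "norm (S * (K x * E.\<alpha> g) * S - E.\<alpha> (\<psi> (\<theta> d))) \<le> \<eta>"
          using contr[OF d(2)] by (simp add: hs hT h\<phi> xc hemb th d)
        have "norm (S * K x * S - E.\<alpha> (\<psi> (\<theta> d)))
          = norm ((S * (K x * E.\<alpha> g) * S - E.\<alpha> (\<psi> (\<theta> d))) - S * K x * (E.\<alpha> g * S - S))"
          by (rule arg_cong[of _ _ norm]) (simp add: left_diff_distrib right_diff_distrib mult.assoc)
        moreover have "norm (S * K x * (E.\<alpha> g * S - S)) \<le> 1 * M * \<eta>"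
          by (rule norm_mult_le[OF norm_mult_le[OF nS nKx] s2])
        ultimately have "norm (S * K x * S - E.\<alpha> (\<psi> (\<theta> d))) \<le> \<eta> + M * \<eta>"
          using s4 norm_triangle_ineq4[of "S * (K x * E.\<alpha> g) * S - E.\<alpha> (\<psi> (\<theta> d))" "S * K x * (E.\<alpha> g * S - S)"] by simp
        also have "\<dots> < \<epsilon> / 2" using \<eta> \<eta>M unfolding mult.commute[of M \<eta>] by linarith
        finally have "nrm ?E (\<psi> (\<theta> \<one>\<^bsub>D\<^esub>) \<otimes>\<^bsub>?E\<^esub> seq_const A x \<otimes>\<^bsub>?E\<^esub> \<psi> (\<theta> \<one>\<^bsub>D\<^esub>) \<ominus>\<^bsub>?E\<^esub> \<psi> (\<theta> d)) < \<epsilon> / 2"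
          by (simp add: E.nrm_eq E.closed E.emb_simps P d D.one k xc S_def K_def)
        then show "\<exists>d\<in>carrier D. nrm ?E (\<psi> (\<theta> \<one>\<^bsub>D\<^esub>) \<otimes>\<^bsub>?E\<^esub> seq_const A x \<otimes>\<^bsub>?E\<^esub> \<psi> (\<theta> \<one>\<^bsub>D\<^esub>) \<ominus>\<^bsub>?E\<^esub> \<psi> (\<theta> d)) < \<epsilon> / 2"
          using d(1) by blast
      qed
    qed
  qed
qed

end
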